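(* Let $d\ge3$. For any finite non-empty $K\subset\mathbb Z^d$ and $u>0$: (a) $\mathcal F^{\mathrm{in}}_{K,u}$ and $\mathcal F^{\mathrm{out}}_{K,u}$ are conditionally independent, given $\mathcal F^{AB}_{K,u}$. (b) For any choice of integers $n\ge1$ and (for $1\le i\le n$) $m_i\ge1$, sets $\mathcal U_i\in\mathcal B([0,u])$, $\mathcal A_i,\mathcal B_i\in\mathcal W_+$, points $x_{i,j},y_{i,j}\in\partial_{\mathrm{int}}K$ ($1\le j\le m_i$), finite nearest-neighbor trajectories $\tau^{\mathrm{in}}_{i,j}$ from $x_{i,j}$ to $y_{i,j}$ in $K$ ($1\le j\le m_i$), and finite nearest-neighbor trajectories $\tau^{\mathrm{out}}_{i,j'}$ from $y_{i,j'}$ to $x_{i,j'+1}$ outside $K$ except for the start and end points ($1\le j'\le m_i-1$), the events $$\mathcal E^{AB}_{K,u}=\Big\{N_{K,u}=n,\ u_i\in\mathcal U_i,\ M_i=m_i,\ X_i(A_{i,j})=x_{i,j},\ X_i(B_{i,j})=y_{i,j}\ \text{for all }1\le i\le n,\ 1\le j\le m_i\Big\},$$ $$\mathcal E^{\mathrm{in}}_{K,u}=\mathcal E^{AB}_{K,u}\cap\Big\{X^{\mathrm{in}}_{i,j}=\tau^{\mathrm{in}}_{i,j}\ \text{for all }1\le i\le n,\ 1\le j\le m_i\Big\},$$ $$\mathcal E^{\mathrm{out}}_{K,u}=\mathcal E^{AB}_{K,u}\cap\Big\{X^{\mathrm{out}}_{i,j'}=\tau^{\mathrm{out}}_{i,j'},\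 X^-_i\in\mathcal A_i,\ X^+_i\in\mathcal B_i\ \text{for all }1\le i\le n,\ 1\le j'\le m_i-1\Big\}$$ satisfy $$\mathbb P\big[\mathcal E^{\mathrm{in}}_{K,u}\cap\mathcal E^{\mathrm{out}}_{K,u}\big]=\mathbb P\big[\mathcal E^{AB}_{K,u}\big]\cdot\mathbb P\big[\mathcal E^{\mathrm{in}}_{K,u}\,|\,\mathcal E^{AB}_{K,u}\big]\cdot\mathbb P\big[\mathcal E^{\mathrm{out}}_{K,u}\,|\,\mathcal E^{AB}_{K,u}\big]$$ and $$\mathbb P[\mathcal E^{AB}_{K,u}]=\mathbb P[N_{K,u}=n]\cdot\mathbb P[u_i\in\mathcal U_i:1\le i\le n]\cdot\prod_{i=1}^n\widetilde e_K(x_{i,1})\cdot P_{x_{i,1}}\left[\begin{array}{c}M(X)=m_i,\ X(R_j)=x_{i,j},\ X(D_j-1)=y_{i,j}\\ \text{for all }1\le j\le m_i\end{array}\right],$$ $$\mathbb P[\mathcal E^{\mathrm{in}}_{K,u}\,|\,\mathcal E^{AB}_{K,u}]=\prod_{i=1}^n\prod_{j=1}^{m_i}\frac{P_{x_{i,j}}[(X(t):0\le t\le T_K-1)=\tau^{\mathrm{in}}_{i,j}]}{P_{x_{i,j}}[X(T_K-1)=y_{i,j}]},$$ $$\mathbb P[\mathcal E^{\mathrm{out}}_{K,u}\,|\,\mathcal E^{AB}_{K,u}]=\prod_{i=1}^nP^K_{x_{i,1}}[\mathcal A_i]\cdot P^K_{y_{i,m_i}}[\mathcal B_i]\cdot\prod_{j'=1}^{m_i-1}\frac{P_{y_{i,j'}}[(X(t):0\le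 t\le\widetilde H_K)=\tau^{\mathrm{out}}_{i,j'},\ \widetilde H_K<\infty]}{P_{y_{i,j'}}[X(\widetilde H_K)=x_{i,j'+1},\ \widetilde H_K<\infty]}.$$
   Context: Random walk. Write $x\sim y$ if $|x-y|_1=1$. $W_+$ is the set of trajectories $w:\mathbb N\to\mathbb Z^d$ ($\mathbb N=\{0,1,\dots\}$) with $w(n)\sim w(n+1)$ and $|w(n)|\to\infty$; $W$ is the set of $w:\mathbb Z\to\mathbb Z^d$ with $w(n)\sim w(n+1)$ and $|w(n)|\to\infty$ as $n\to\pm\infty$. $\mathcal W_+$, $\mathcal W$ are the $\sigma$-algebras generated by the coordinate maps. $P_x$ is the law on $W_+$ of simple random walk $X$ on $\mathbb Z^d$ ($d\ge3$) started at $x$. For finite $K\subset\mathbb Z^d$: $H_K=\inf\{n\ge0:X(n)\in K\}$, $\widetilde H_K=\inf\{n\ge1:X(n)\in K\}$, $T_K=\inf\{n\ge0:X(n)\notin K\}$; $e_K(x)=P_x[\widetilde H_K=\infty]$ for $x\in K$, $e_K(x)=0$ otherwise; $\mathrm{cap}(K)=\sum_xe_K(x)$, $\widetilde e_K=e_K/\mathrm{cap}(K)$; $P^K_x=P_x[\,\cdot\,|\widetilde H_K=\infty]$. $\partial_{\mathrm{int}}K$ is the set of vertices of $K$ having a nearest neighbor outside $K$. Interlacement process. $W^*$ is $W$ modulo time shift, $\pi^*:W\to W^*$ the projection, $\mathcal W^*=\{A\subset W^*:(\pi^* )^{-1}(A)\in\mathcal W\}$, and $W^*_K$ the image under $\pi^*$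 of the trajectories that hit $K$. $Q_K$ is the measure on $W$ given by $Q_K[(X_{-n})_{n\ge0}\in A,X_0=x,(X_n)_{n\ge0}\in B]=P_x[A|\widetilde H_K=\infty]\,e_K(x)\,P_x[B]$, and $\nu$ is the unique $\sigma$-finite measure on $W^*$ with $\nu(E)=Q_K[(\pi^* )^{-1}(E)]$ for all finite $K$ and $E\in\mathcal W^*$, $E\subseteq W_K^*$. $\omega=\sum_i\delta_{(w_i^*,u_i)}$ is a Poisson point process on $W^*\times\mathbb R_+$ with intensity $\nu(\mathrm dw^* )\,\mathrm du$, under $\mathbb P$. $\omega_{K,u}$ is the restriction of $\omega$ to pairs with $w_i^*\in W_K^*$ and $u_i\le u$, and $\omega-\omega_{K,u}$ is its complementary part. Write $\omega_{K,u}=\sum_{i=1}^{N_{K,u}}\delta_{(w_i^*,u_i)}$ with $u_1<\dots<u_{N_{K,u}}$ (a.s. distinct); $N_{K,u}$ is Poisson with parameter $u\,\mathrm{cap}(K)$. For each such $i$, $X_i\in W$ is the representative of $w_i^*$ with $X_i(0)\in K$ and $X_i(t)\notin K$ for $t<0$. Excursions. For a trajectory $w$ in $W$ or $W_+$: $R_1(w)=\inf\{n:w(n)\in K\}$, $D_k(w)=\inf\{n>R_k(w):w(n)\notin K\}$, $R_{k+1}(w)=\inf\{n>D_k(w):w(n)\in K\}$, $M(w)=\max\{k\ge1:R_k(w)<\infty\}$. Let $M_i=M(X_i)$, $A_{i,j}=R_j(X_i)$, $B_{i,j}=D_j(X_i)-1$ for $1\le j\le M_i$. Put $X^{\mathrm{in}}_{i,j}(t)=X_i(A_{i,j}+t)$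 for $0\le t\le B_{i,j}-A_{i,j}$; $X^{\mathrm{out}}_{i,j}(t)=X_i(B_{i,j}+t)$ for $0\le t\le A_{i,j+1}-B_{i,j}$, $1\le j\le M_i-1$; $X_i^-(t)=X_i(-t)$ and $X_i^+(t)=X_i(t+B_{i,M_i})$ for $t\ge0$. $\sigma$-algebras. $\mathcal F^{\mathrm{in}}_{K,u}$ is generated by $N_{K,u}$, $(u_i)$, $(M_i)$, $(X^{\mathrm{in}}_{i,j})_{1\le j\le M_i}$; $\mathcal F^{\mathrm{out}}_{K,u}$ by $\omega-\omega_{K,u}$, $N_{K,u}$, $(u_i)$, $(M_i)$, $(X_i^-)$, $(X^{\mathrm{out}}_{i,j})_{1\le j\le M_i-1}$, $(X_i^+)$; $\mathcal F^{AB}_{K,u}$ by $N_{K,u}$, $(u_i)$, $(M_i)$, $((X_i(A_{i,j}),X_i(B_{i,j})))_{1\le j\le M_i}$, with $1\le i\le N_{K,u}$ throughout. Conventions. $\mathbb P[u_i\in\mathcal U_i:1\le i\le n]$ is the probability given $N_{K,u}=n$, i.e. the probability that the increasing order statistics $u_1<\dots<u_n$ of $n$ independent uniform variables on $[0,u]$ satisfy $u_i\in\mathcal U_i$ for all $i$. Formulas with conditional probabilities given $\mathcal E^{AB}_{K,u}$ are understood when $\mathbb P[\mathcal E^{AB}_{K,u}]>0$ (otherwise both sides of the product formula are $0$).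
   Formalization: In the last formula the event X(1) ∉ K is added to numerator and denominator, since out-excursions leave K at their first step; the formula as printed is false if some y_{i,j'} is adjacent to x_{i,j'+1}, and is proved as printed when no such pair is adjacent. *)

theory Defs
  imports "HOL-Probability.Probability"
begin

section \<open>Nearest-neighbour trajectories on the integer lattice\<close>

type_synonym 'd site = "(int, 'd) vec"

definition norm1 :: "('d::finite) site \<Rightarrow> int" where
  "norm1 x = (\<Sum>i\<in>UNIV. \<bar>x $ i\<bar>)"

definition adj :: "('d::finite) site \<Rightarrow> 'd site \<Rightarrow> bool" where
  "adj x y \<longleftrightarrow> norm1 (x - y) = 1"

definition int_boundary :: "('d::finite) site set \<Rightarrow> 'd site set" where
  "int_boundary K = {x \<in> K. \<exists>y. adj x y \<and> y \<notin> K}"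

definition half_trajs :: "(nat \<Rightarrow> ('d::finite) site) set" where
  "half_trajs = {w. (\<forall>n. adj (w n) (w (Suc n))) \<and> filterlim (\<lambda>n. norm1 (w n)) at_top at_top}"

definition full_trajs :: "(int \<Rightarrow> ('d::finite) site) set" where
  "full_trajs = {w. (\<forall>n. adj (w n) (w (n + 1))) \<and>
     filterlim (\<lambda>n. norm1 (w n)) at_top at_top \<and> filterlim (\<lambda>n. norm1 (w n)) at_top at_bot}"

text \<open>The following two measures, as well as the later ones built with \<^const>\<open>sigma\<close>, only serve as
  carriers of a sigma-algebra.\<close>

definition half_space :: "(nat \<Rightarrow> ('d::finite) site) measure" where
  "half_space = restrict_space (\<Pi>\<^sub>M n\<in>UNIV. count_space UNIV) half_trajs"

definition full_space :: "(int \<Rightarrow> ('d::finite) site) measure" where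
  "full_space = restrict_space (\<Pi>\<^sub>M n\<in>UNIV. count_space UNIV) full_trajs"

text \<open>The law of simple random walk started at \<open>x\<close>, realised through i.i.d. uniform steps. In dimension
  at least 3 the walk is transient, so restricting its law to \<^const>\<open>half_trajs\<close> loses no mass.\<close>

definition srw :: "('d::finite) site \<Rightarrow> (nat \<Rightarrow> 'd site) measure" where
  "srw x = restrict_space
     (distr (\<Pi>\<^sub>M n\<in>(UNIV :: nat set). measure_pmf (pmf_of_set {e :: 'd site. norm1 e = 1}))
        (\<Pi>\<^sub>M n\<in>UNIV. count_space UNIV) (\<lambda>\<xi> n. x + (\<Sum>k<n. \<xi> k)))
     half_trajs"

definition path_inside :: "('d::finite) site set \<Rightarrow> 'd site \<Rightarrow> 'd site \<Rightarrow> 'd site list \<Rightarrow> bool" where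
  "path_inside K x y \<tau> \<longleftrightarrow> \<tau> \<noteq> [] \<and> successively adj \<tau> \<and> hd \<tau> = x \<and> last \<tau> = y \<and> set \<tau> \<subseteq> K"

definition path_outside :: "('d::finite) site set \<Rightarrow> 'd site \<Rightarrow> 'd site \<Rightarrow> 'd site list \<Rightarrow> bool" where
  "path_outside K y x \<tau> \<longleftrightarrow> \<tau> \<noteq> [] \<and> successively adj \<tau> \<and> hd \<tau> = y \<and> last \<tau> = x \<and>
     (\<forall>t. 0 < t \<and> t < length \<tau> - 1 \<longrightarrow> \<tau> ! t \<notin> K)"

section \<open>Hitting times and excursions\<close>

text \<open>The infimum of a set of times, with \<^const>\<open>None\<close> in the role of infinity. The time axis \<open>'t\<close> is
  \<^typ>\<open>nat\<close> or \<^typ>\<open>int\<close>; in the latter case the sets of times considered are bounded below.\<close>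

definition first :: "('t::linorder \<Rightarrow> bool) \<Rightarrow> 't option" where
  "first Q = (if \<exists>n. Q n then Some (LEAST n. Q n) else None)"

definition first_after :: "'t::linorder option \<Rightarrow> ('t \<Rightarrow> bool) \<Rightarrow> 't option" where
  "first_after r Q = (case r of None \<Rightarrow> None | Some m \<Rightarrow> first (\<lambda>n. m < n \<and> Q n))"

definition return_time :: "('d::finite) site set \<Rightarrow> (nat \<Rightarrow> 'd site) \<Rightarrow> nat option" where
  "return_time K w = first (\<lambda>n. 1 \<le> n \<and> w n \<in> K)"

definition exit_time :: "('d::finite) site set \<Rightarrow> (nat \<Rightarrow> 'd site) \<Rightarrow> nat option" where
  "exit_time K w = first (\<lambda>n. w n \<notin> K)"

text \<open>The times \<open>R_k\<close> and \<open>D_k\<close> are indexed from \<open>k = 1\<close>; the value at 0 is irrelevant.\<close>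

fun R_time :: "('d::finite) site set \<Rightarrow> ('t::linorder \<Rightarrow> 'd site) \<Rightarrow> nat \<Rightarrow> 't option" where
  "R_time K w 0 = None"
| "R_time K w (Suc 0) = first (\<lambda>n. w n \<in> K)"
| "R_time K w (Suc (Suc k)) =
     first_after (first_after (R_time K w (Suc k)) (\<lambda>n. w n \<notin> K)) (\<lambda>n. w n \<in> K)"

definition D_time :: "('d::finite) site set \<Rightarrow> ('t::linorder \<Rightarrow> 'd site) \<Rightarrow> nat \<Rightarrow> 't option" where
  "D_time K w k = first_after (R_time K w k) (\<lambda>n. w n \<notin> K)"

definition M_count :: "('d::finite) site set \<Rightarrow> ('t::linorder \<Rightarrow> 'd site) \<Rightarrow> nat" where
  "M_count K w = Max {k. 1 \<le> k \<and> R_time K w k \<noteq> None}"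

definition A_time :: "('d::finite) site set \<Rightarrow> ('t::linorder \<Rightarrow> 'd site) \<Rightarrow> nat \<Rightarrow> 't" where
  "A_time K w j = the (R_time K w j)"

definition B_time :: "('d::finite) site set \<Rightarrow> ('t::{linorder,minus,one} \<Rightarrow> 'd site) \<Rightarrow> nat \<Rightarrow> 't" where
  "B_time K w j = the (D_time K w j) - 1"

definition X_in :: "('d::finite) site set \<Rightarrow> (int \<Rightarrow> 'd site) \<Rightarrow> nat \<Rightarrow> 'd site list" where
  "X_in K w j = map w [A_time K w j .. B_time K w j]"

definition X_out :: "('d::finite) site set \<Rightarrow> (int \<Rightarrow> 'd site) \<Rightarrow> nat \<Rightarrow> 'd site list" where
  "X_out K w j = map w [B_time K w j .. A_time K w (Suc j)]"

text \<open>An out-excursion \<open>X_out K w j\<close> leaves \<open>K\<close> at its first step, whereas a walk started at a point \<open>y\<close>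
  of \<open>K\<close> can have return time 1 by stepping to a neighbour \<open>x \<in> K\<close> of \<open>y\<close>. So the out-excursions between
  \<open>y\<close> and \<open>x\<close> follow the law of the walk up to its return time with the additional condition
  \<open>w 1 \<notin> K\<close>, which is automatic when \<open>x\<close> and \<open>y\<close> are not adjacent.\<close>

definition X_minus :: "(int \<Rightarrow> ('d::finite) site) \<Rightarrow> nat \<Rightarrow> 'd site" where
  "X_minus w = (\<lambda>t. w (- int t))"

definition X_plus :: "('d::finite) site set \<Rightarrow> (int \<Rightarrow> 'd site) \<Rightarrow> nat \<Rightarrow> 'd site" where
  "X_plus K w = (\<lambda>t. w (int t + B_time K w (M_count K w)))"

section \<open>Equilibrium measure\<close>

definition eq_measure :: "('d::finite) site set \<Rightarrow> 'd site \<Rightarrow> real" where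
  "eq_measure K x = (if x \<in> K then \<P>(w in srw x. return_time K w = None) else 0)"

definition cap :: "('d::finite) site set \<Rightarrow> real" where
  "cap K = (\<Sum>x\<in>K. eq_measure K x)"

definition norm_eq_measure :: "('d::finite) site set \<Rightarrow> 'd site \<Rightarrow> real" where
  "norm_eq_measure K x = eq_measure K x / cap K"

definition srw_avoid :: "('d::finite) site set \<Rightarrow> 'd site \<Rightarrow> (nat \<Rightarrow> 'd site) set \<Rightarrow> real" where
  "srw_avoid K x A = \<P>(w in srw x. w \<in> A \<bar> return_time K w = None)"

section \<open>The intensity measure of random interlacements\<close>

definition shift_rel :: "((int \<Rightarrow> ('d::finite) site) \<times> (int \<Rightarrow> 'd site)) set" where
  "shift_rel = {(w, w'). w \<in> full_trajs \<and> w' \<in> full_trajs \<and> (\<exists>k. \<forall>n. w' n = w (n + k))}"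

definition proj_star :: "(int \<Rightarrow> ('d::finite) site) \<Rightarrow> (int \<Rightarrow> 'd site) set" where
  "proj_star w = shift_rel `` {w}"

definition star_space :: "(int \<Rightarrow> ('d::finite) site) set measure" where
  "star_space = sigma (full_trajs // shift_rel)
     {A. A \<subseteq> full_trajs // shift_rel \<and> {w \<in> full_trajs. proj_star w \<in> A} \<in> sets full_space}"

definition star_hit :: "('d::finite) site set \<Rightarrow> (int \<Rightarrow> 'd site) set set" where
  "star_hit K = proj_star ` {w \<in> full_trajs. \<exists>n. w n \<in> K}"

definition is_Q :: "('d::finite) site set \<Rightarrow> (int \<Rightarrow> 'd site) measure \<Rightarrow> bool" where
  "is_Q K Q \<longleftrightarrow> sets Q = sets full_space \<and>
     (\<forall>A\<in>sets half_space. \<forall>B\<in>sets half_space. \<forall>x.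
        emeasure Q {w \<in> full_trajs. (\<lambda>n. w (- int n)) \<in> A \<and> w 0 = x \<and> (\<lambda>n. w (int n)) \<in> B}
          = ennreal (srw_avoid K x A * eq_measure K x * measure (srw x) B))"

text \<open>The formula in \<^const>\<open>is_Q\<close> determines \<open>Q\<close>, as it prescribes the values on a generating
  pi-system, and the conditions below determine \<open>\<nu>\<close>.\<close>

definition interlacement_intensity :: "(int \<Rightarrow> ('d::finite) site) set measure \<Rightarrow> bool" where
  "interlacement_intensity \<nu> \<longleftrightarrow> sets \<nu> = sets star_space \<and> sigma_finite_measure \<nu> \<and>
     (\<forall>K. finite K \<longrightarrow> (\<exists>Q. is_Q K Q \<and>
        (\<forall>E\<in>sets star_space. E \<subseteq> star_hit K \<longrightarrow>
           emeasure \<nu> E = emeasure Q {w \<in> full_trajs. proj_star w \<in> E})))"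

section \<open>Poisson point processes\<close>

text \<open>The image of counting measure on \<open>J\<close> under \<open>p\<close> is the sum of the Dirac masses at \<open>p i\<close>
  for \<open>i \<in> J\<close>.\<close>

definition poisson_point_process ::
  "'o measure \<Rightarrow> 's measure \<Rightarrow> ('o \<Rightarrow> 's measure) \<Rightarrow> bool" where
  "poisson_point_process P I \<omega> \<longleftrightarrow>
     prob_space P \<and>
     (\<forall>\<xi>\<in>space P. \<exists>(J::nat set) p. p \<in> J \<rightarrow> space I \<and> \<omega> \<xi> = distr (count_space J) I p) \<and>
     (\<forall>E\<in>sets I. (\<lambda>\<xi>. emeasure (\<omega> \<xi>) E) \<in> borel_measurable P) \<and>
     (\<forall>E\<in>sets I. emeasure I E < \<infinity> \<longrightarrow>
        (\<forall>k::nat. \<P>(\<xi> in P. emeasure (\<omega> \<xi>) E = of_nat k)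
           = measure I E ^ k / fact k * exp (- measure I E))) \<and>
     (\<forall>(n::nat) E. (\<forall>i<n. E i \<in> sets I) \<and> disjoint_family_on E {..<n} \<longrightarrow>
        prob_space.indep_vars P (\<lambda>_. borel) (\<lambda>i \<xi>. emeasure (\<omega> \<xi>) (E i)) {..<n})"

section \<open>The trajectories hitting a set up to a given level\<close>

type_synonym 'd config = "((int \<Rightarrow> 'd site) set \<times> real) measure"

definition marked_space :: "('d::finite) config" where
  "marked_space = star_space \<Otimes>\<^sub>M restrict_space borel {0..}"

definition hit_region :: "('d::finite) site set \<Rightarrow> real \<Rightarrow> ((int \<Rightarrow> 'd site) set \<times> real) set" where
  "hit_region K u = star_hit K \<times> {0..u}"

definition inner_part :: "('d::finite) site set \<Rightarrow> real \<Rightarrow> 'd config \<Rightarrow> 'd config" where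
  "inner_part K u \<mu> = density \<mu> (indicator (hit_region K u))"

definition outer_part :: "('d::finite) site set \<Rightarrow> real \<Rightarrow> 'd config \<Rightarrow> 'd config" where
  "outer_part K u \<mu> = density \<mu> (indicator (space \<mu> - hit_region K u))"

definition is_enumeration ::
  "('d::finite) site set \<Rightarrow> real \<Rightarrow> 'd config \<Rightarrow> ((int \<Rightarrow> 'd site) set \<times> real) list \<Rightarrow> bool" where
  "is_enumeration K u \<mu> ps \<longleftrightarrow>
     sorted_wrt (\<lambda>p q. snd p < snd q) ps \<and> set ps \<subseteq> hit_region K u \<and>
     inner_part K u \<mu> = distr (count_space {..<length ps}) marked_space (\<lambda>i. ps ! i)"

text \<open>An enumeration exists almost surely and is then unique. The empty list is used on the exceptional
  null event where there are infinitely many points or coinciding labels.\<close>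

definition enumeration ::
  "('d::finite) site set \<Rightarrow> real \<Rightarrow> 'd config \<Rightarrow> ((int \<Rightarrow> 'd site) set \<times> real) list" where
  "enumeration K u \<mu> =
     (if \<exists>ps. is_enumeration K u \<mu> ps then THE ps. is_enumeration K u \<mu> ps else [])"

definition N_count :: "('d::finite) site set \<Rightarrow> real \<Rightarrow> 'd config \<Rightarrow> nat" where
  "N_count K u \<mu> = length (enumeration K u \<mu>)"

definition label :: "('d::finite) site set \<Rightarrow> real \<Rightarrow> 'd config \<Rightarrow> nat \<Rightarrow> real" where
  "label K u \<mu> i = snd (enumeration K u \<mu> ! (i - 1))"

definition X_traj :: "('d::finite) site set \<Rightarrow> real \<Rightarrow> 'd config \<Rightarrow> nat \<Rightarrow> int \<Rightarrow> 'd site" where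
  "X_traj K u \<mu> i =
     (THE w. w \<in> fst (enumeration K u \<mu> ! (i - 1)) \<and> w 0 \<in> K \<and> (\<forall>t<0. w t \<notin> K))"

section \<open>The sigma-algebras\<close>

text \<open>A family indexed by a random range generates the sigma-algebra of all events that the index lies in
  the range and the corresponding variable lies in a given measurable set. Finite trajectories form a
  countable set, so their singletons suffice.\<close>

definition common_events ::
  "'o measure \<Rightarrow> ('o \<Rightarrow> ('d::finite) config) \<Rightarrow> 'd site set \<Rightarrow> real \<Rightarrow> 'o set set" where
  "common_events P \<omega> K u =
     {{\<xi> \<in> space P. N_count K u (\<omega> \<xi>) = n} | n. True} \<union>
     {{\<xi> \<in> space P. i \<le> N_count K u (\<omega> \<xi>) \<and> label K u (\<omega> \<xi>) i \<in> U} | i U.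
        1 \<le> i \<and> U \<in> sets borel} \<union>
     {{\<xi> \<in> space P. i \<le> N_count K u (\<omega> \<xi>) \<and> M_count K (X_traj K u (\<omega> \<xi>) i) = m} | i m. 1 \<le> i}"

definition F_AB ::
  "'o measure \<Rightarrow> ('o \<Rightarrow> ('d::finite) config) \<Rightarrow> 'd site set \<Rightarrow> real \<Rightarrow> 'o measure" where
  "F_AB P \<omega> K u = sigma (space P) (common_events P \<omega> K u \<union>
     {{\<xi> \<in> space P. i \<le> N_count K u (\<omega> \<xi>) \<and>
         (let X = X_traj K u (\<omega> \<xi>) i
          in j \<le> M_count K X \<and> (X (A_time K X j), X (B_time K X j)) = (x, y))} | i j x y.
        1 \<le> i \<and> 1 \<le> j})"

definition F_in ::
  "'o measure \<Rightarrow> ('o \<Rightarrow> ('d::finite) config) \<Rightarrow> 'd site set \<Rightarrow> real \<Rightarrow> 'o measure" where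
  "F_in P \<omega> K u = sigma (space P) (common_events P \<omega> K u \<union>
     {{\<xi> \<in> space P. i \<le> N_count K u (\<omega> \<xi>) \<and>
         (let X = X_traj K u (\<omega> \<xi>) i in j \<le> M_count K X \<and> X_in K X j = \<tau>)} | i j \<tau>.
        1 \<le> i \<and> 1 \<le> j})"

definition F_out ::
  "'o measure \<Rightarrow> ('o \<Rightarrow> ('d::finite) config) \<Rightarrow> 'd site set \<Rightarrow> real \<Rightarrow> 'o measure" where
  "F_out P \<omega> K u = sigma (space P) (common_events P \<omega> K u \<union>
     {{\<xi> \<in> space P. emeasure (outer_part K u (\<omega> \<xi>)) E \<in> C} | E C.
        E \<in> sets marked_space \<and> C \<in> sets borel} \<union>
     {{\<xi> \<in> space P. i \<le> N_count K u (\<omega> \<xi>) \<and> X_minus (X_traj K u (\<omega> \<xi>) i) \<in> A} | i A.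
        1 \<le> i \<and> A \<in> sets half_space} \<union>
     {{\<xi> \<in> space P. i \<le> N_count K u (\<omega> \<xi>) \<and>
         (let X = X_traj K u (\<omega> \<xi>) i in j \<le> M_count K X - 1 \<and> X_out K X j = \<tau>)} | i j \<tau>.
        1 \<le> i \<and> 1 \<le> j} \<union>
     {{\<xi> \<in> space P. i \<le> N_count K u (\<omega> \<xi>) \<and> X_plus K (X_traj K u (\<omega> \<xi>) i) \<in> B} | i B.
        1 \<le> i \<and> B \<in> sets half_space})"

definition cond_indep :: "'o measure \<Rightarrow> 'o measure \<Rightarrow> 'o measure \<Rightarrow> 'o measure \<Rightarrow> bool" where
  "cond_indep P F1 F2 G \<longleftrightarrow> subalgebra P F1 \<and> subalgebra P F2 \<and> subalgebra P G \<and>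
     (\<forall>E1\<in>sets F1. \<forall>E2\<in>sets F2. AE \<xi> in P.
        real_cond_exp P G (indicator (E1 \<inter> E2)) \<xi>
          = real_cond_exp P G (indicator E1) \<xi> * real_cond_exp P G (indicator E2) \<xi>)"

section \<open>The events\<close>

definition E_AB ::
  "'o measure \<Rightarrow> ('o \<Rightarrow> ('d::finite) config) \<Rightarrow> 'd site set \<Rightarrow> real \<Rightarrow> nat \<Rightarrow> (nat \<Rightarrow> nat) \<Rightarrow>
   (nat \<Rightarrow> real set) \<Rightarrow> (nat \<Rightarrow> nat \<Rightarrow> 'd site) \<Rightarrow> (nat \<Rightarrow> nat \<Rightarrow> 'd site) \<Rightarrow> 'o set" where
  "E_AB P \<omega> K u n m U x y = {\<xi> \<in> space P. N_count K u (\<omega> \<xi>) = n \<and>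
     (\<forall>i\<in>{1..n}. let X = X_traj K u (\<omega> \<xi>) i in
        label K u (\<omega> \<xi>) i \<in> U i \<and> M_count K X = m i \<and>
        (\<forall>j\<in>{1..m i}. X (A_time K X j) = x i j \<and> X (B_time K X j) = y i j))}"

definition E_in ::
  "'o measure \<Rightarrow> ('o \<Rightarrow> ('d::finite) config) \<Rightarrow> 'd site set \<Rightarrow> real \<Rightarrow> nat \<Rightarrow> (nat \<Rightarrow> nat) \<Rightarrow>
   (nat \<Rightarrow> real set) \<Rightarrow> (nat \<Rightarrow> nat \<Rightarrow> 'd site) \<Rightarrow> (nat \<Rightarrow> nat \<Rightarrow> 'd site) \<Rightarrow>
   (nat \<Rightarrow> nat \<Rightarrow> 'd site list) \<Rightarrow> 'o set" where
  "E_in P \<omega> K u n m U x y \<tau>in = {\<xi> \<in> E_AB P \<omega> K u n m U x y.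
     \<forall>i\<in>{1..n}. \<forall>j\<in>{1..m i}. X_in K (X_traj K u (\<omega> \<xi>) i) j = \<tau>in i j}"

definition E_out ::
  "'o measure \<Rightarrow> ('o \<Rightarrow> ('d::finite) config) \<Rightarrow> 'd site set \<Rightarrow> real \<Rightarrow> nat \<Rightarrow> (nat \<Rightarrow> nat) \<Rightarrow>
   (nat \<Rightarrow> real set) \<Rightarrow> (nat \<Rightarrow> nat \<Rightarrow> 'd site) \<Rightarrow> (nat \<Rightarrow> nat \<Rightarrow> 'd site) \<Rightarrow>
   (nat \<Rightarrow> nat \<Rightarrow> 'd site list) \<Rightarrow> (nat \<Rightarrow> (nat \<Rightarrow> 'd site) set) \<Rightarrow> (nat \<Rightarrow> (nat \<Rightarrow> 'd site) set) \<Rightarrow>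
   'o set" where
  "E_out P \<omega> K u n m U x y \<tau>out \<A> \<B> = {\<xi> \<in> E_AB P \<omega> K u n m U x y.
     \<forall>i\<in>{1..n}. let X = X_traj K u (\<omega> \<xi>) i in
        (\<forall>j\<in>{1..m i - 1}. X_out K X j = \<tau>out i j) \<and> X_minus X \<in> \<A> i \<and> X_plus K X \<in> \<B> i}"

definition order_stat_prob :: "nat \<Rightarrow> real \<Rightarrow> (nat \<Rightarrow> real set) \<Rightarrow> real" where
  "order_stat_prob n u U =
     \<P>(v in \<Pi>\<^sub>M i\<in>{1..n}. uniform_measure lborel {0..u}.
        \<forall>i\<in>{1..n}. sort (map v [1..<Suc n]) ! (i - 1) \<in> U i)"

end

(* The trajectories of the process that hit K before level u, cut into their excursions inside and outside K,
   have weights that factorise: by the Markov property, a product over the excursions of weights of finite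
   paths, times an escape weight at either end, each factor depending on the end points only through one
   excursion. Hence, given the end points, inner and outer excursions are independent, and the conditional
   laws are quotients of such weights. Since the labels of the points are uniform order statistics independent
   of the trajectories and of the rest of the process, these formulas give the probabilities of a pi-system
   of events; cylinder events of this kind generate the sigma-algebras, which yields the conditional
   independence. *)
theory Submission imports Defs begin


text \<open>Transience is replaced by a zero-one law for the total mass of the restricted walk. The
  Poisson hypothesis speaks only of independent counts in disjoint sets, while the events speak of
  points listed by increasing label. The bridge is the ordered box: if the label sets lie one behind
  the other, the i-th listed point lies in the i-th box exactly when each box holds one point and
  the rest of the hit region none. Separating rationals extend the resulting product formula to
  arbitrary label sets, where it becomes the law of order statistics. For the conditional
  independence no regular conditional law is built. The inner excursions of a trajectory form a list
  of lists of sites, hence take countably many values; for each value the mass, intersected with any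
  outer event, is a constant multiple of that of the end-point event. So the conditional expectation
  of an elementary inner event is this multiple of an indicator, and uniqueness of measures is
  applied twice, first in the outer event and then in the inner one.\<close>

lemma norm1_nonneg: "0 \<le> norm1 x"
  by (simp add: norm1_def sum_nonneg)

lemma norm1_triangle: "norm1 (x + y) \<le> norm1 x + norm1 y"
  unfolding norm1_def sum.distrib[symmetric] by (intro sum_mono) (simp add: abs_triangle_ineq)

lemma norm1_minus: "norm1 (- x) = norm1 x"
  by (simp add: norm1_def)

lemma adj_commute: "adj x y \<longleftrightarrow> adj y x"
  using norm1_minus[of "x - y"] by (simp add: adj_def)

definition unit_steps :: "('d::finite) site set" where
  "unit_steps = {e. norm1 e = 1}"

lemma adj_iff_step: "adj x y \<longleftrightarrow> y - x \<in> unit_steps"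
  by (subst adj_commute) (simp add: adj_def unit_steps_def)

text \<open>A coordinate of a unit vector lies between -1 and 1, so \<open>unit_steps\<close> embeds
  into a finite function space. Finiteness and non-emptiness make \<open>pmf_of_set\<close> a
  genuine uniform law.\<close>

lemma finite_unit_steps: "finite (unit_steps :: ('d::finite) site set)"
proof -
  have "vec_nth ` (unit_steps :: 'd site set) \<subseteq> PiE UNIV (\<lambda>_. {-1..1})"
  proof safe
    fix e :: "'d site" and i assume "e \<in> unit_steps"
    then have "\<bar>e $ i\<bar> \<le> 1"
      using member_le_sum[of i UNIV "\<lambda>i. \<bar>e $ i\<bar>"] by (simp add: unit_steps_def norm1_def)
    then show "e $ i \<in> {-1..1}" by auto
  qed auto
  then have "finite (vec_nth ` (unit_steps :: 'd site set))"
    by (rule finite_subset) (auto intro: finite_PiE)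
  then show ?thesis
    by (rule finite_imageD) (auto simp: inj_on_def vec_nth_inject)
qed

lemma unit_steps_nonempty: "unit_steps \<noteq> ({} :: ('d::finite) site set)"
proof -
  have "axis undefined 1 \<in> (unit_steps :: 'd site set)"
    by (simp add: unit_steps_def norm1_def axis_def if_distrib[of abs] cong: if_cong)
  then show ?thesis by blast
qed

section \<open>Simple random walk and its Markov property\<close>

abbreviation coord_space :: "('i \<Rightarrow> 'a) measure" where
  "coord_space \<equiv> (\<Pi>\<^sub>M n\<in>UNIV. count_space UNIV)"

lemma space_coord_space [simp]: "space coord_space = UNIV"
  by (simp add: space_PiM)

lemma coord_measurable [measurable]: "(\<lambda>w. w i) \<in> coord_space \<rightarrow>\<^sub>M count_space UNIV"
  by (rule measurable_component_singleton) simp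

lemma space_half_space [simp]: "space half_space = half_trajs"
  by (simp add: half_space_def space_restrict_space)

lemma space_full_space [simp]: "space full_space = full_trajs"
  by (simp add: full_space_def space_restrict_space)

text \<open>The quantifiers run over countable types, so in this form the escape condition can be
  proved measurable.\<close>

lemma filterlim_norm1_iff:
  "filterlim (\<lambda>n::nat. norm1 (w n)) at_top at_top \<longleftrightarrow> (\<forall>Z::int. \<exists>N. \<forall>n\<ge>N. Z \<le> norm1 (w n))"
  by (simp add: filterlim_at_top eventually_sequentially)

lemma norm1_measurable [measurable]: "norm1 \<in> count_space UNIV \<rightarrow>\<^sub>M count_space UNIV"
  by simp

lemma half_trajs_sets [measurable]: "(half_trajs :: (nat \<Rightarrow> ('d::finite) site) set) \<in> sets coord_space"
proof -
  have "half_trajs = {w \<in> space coord_space. (\<forall>n. adj (w n) ((w :: nat \<Rightarrow> 'd site) (Suc n))) \<and>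
      (\<forall>Z::int. \<exists>N. \<forall>n\<ge>N. Z \<le> norm1 (w n))}"
    by (auto simp: half_trajs_def filterlim_norm1_iff)
  also have "\<dots> \<in> sets coord_space" by measurable
  finally show ?thesis .
qed

lemma sets_half_space_iff: "A \<in> sets half_space \<longleftrightarrow> A \<in> sets coord_space \<and> A \<subseteq> half_trajs"
  unfolding half_space_def by (subst sets_restrict_space_iff) auto

lemma half_coord_measurable [measurable]: "(\<lambda>w. w i) \<in> half_space \<rightarrow>\<^sub>M count_space UNIV"
  unfolding half_space_def by (rule measurable_restrict_space1) simp

text \<open>The step sequence and the partial sums hidden in \<open>srw\<close> get names, so that
  the product measure of the steps can be decomposed into a first step and the rest.\<close>

definition step_space :: "(nat \<Rightarrow> ('d::finite) site) measure" where
  "step_space = (\<Pi>\<^sub>M n\<in>(UNIV :: nat set). measure_pmf (pmf_of_set unit_steps))"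

definition walk :: "('d::finite) site \<Rightarrow> (nat \<Rightarrow> 'd site) \<Rightarrow> nat \<Rightarrow> 'd site" where
  "walk x \<xi> n = x + (\<Sum>k<n. \<xi> k)"

interpretation steps: sequence_space "measure_pmf (pmf_of_set (unit_steps :: ('d::finite) site set))"
  by unfold_locales

lemma sets_step_space [measurable_cong]: "sets step_space = sets coord_space"
  unfolding step_space_def by (rule sets_PiM_cong) auto

lemma space_step_space [simp]: "space step_space = UNIV"
  by (simp add: step_space_def space_PiM)

lemma prob_space_step_space: "prob_space step_space"
  unfolding step_space_def by unfold_locales

lemma walk_measurable [measurable]: "walk x \<in> step_space \<rightarrow>\<^sub>M coord_space"
proof -
  have *: "(\<lambda>\<xi>. x + (\<Sum>k<n. \<xi> k)) \<in> coord_space \<rightarrow>\<^sub>M count_space UNIV" for n :: nat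
  proof (induction n)
    case (Suc n)
    have "(\<lambda>\<xi>. (x + (\<Sum>k<n. \<xi> k)) + \<xi> n) \<in> coord_space \<rightarrow>\<^sub>M count_space UNIV"
      using Suc by measurable
    then show ?case by (simp add: add.assoc)
  qed simp
  have "walk x \<in> coord_space \<rightarrow>\<^sub>M coord_space"
    using * by (intro measurable_PiM_single') (auto simp: walk_def[abs_def])
  then show ?thesis
    by (simp cong: measurable_cong_sets add: sets_step_space)
qed

lemma srw_eq: "srw x = restrict_space (distr step_space coord_space (walk x)) half_trajs"
  by (simp add: srw_def step_space_def walk_def[abs_def] unit_steps_def)

lemma sets_srw [measurable_cong]: "sets (srw x) = sets half_space"
  unfolding srw_eq half_space_def by (rule sets_restrict_space_cong) simp

lemma space_srw [simp]: "space (srw x) = half_trajs"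
  using sets_eq_imp_space_eq[OF sets_srw] by simp

lemma emeasure_srw:
  assumes "A \<in> sets half_space"
  shows "emeasure (srw x) A = emeasure step_space {\<xi>. walk x \<xi> \<in> A}"
proof -
  have A: "A \<in> sets coord_space" "A \<subseteq> half_trajs"
    using assms by (auto simp: sets_half_space_iff)
  then show ?thesis
    unfolding srw_eq using half_trajs_sets
    by (subst emeasure_restrict_space) (auto simp: emeasure_distr vimage_def)
qed

text \<open>Mass 1 would amount to transience; finiteness is inherited from the probability measure
  of the steps.\<close>

lemma finite_measure_srw: "finite_measure (srw x)"
proof
  interpret prob_space "step_space :: (nat \<Rightarrow> 'a site) measure" by (rule prob_space_step_space)
  show "emeasure (srw x) (space (srw x)) \<noteq> \<infinity>"
    using sets.top[of "half_space :: (nat \<Rightarrow> 'a site) measure"] by (simp add: emeasure_srw)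
qed

lemma walk_0 [simp]: "walk x \<xi> 0 = x"
  by (simp add: walk_def)

lemma walk_Suc: "walk x (case_nat e \<xi>) (Suc n) = walk (x + e) \<xi> n"
  by (simp add: walk_def sum.lessThan_Suc_shift add.assoc del: sum.lessThan_Suc)

definition tshift :: "nat \<Rightarrow> (nat \<Rightarrow> 'a) \<Rightarrow> nat \<Rightarrow> 'a" where
  "tshift k f = (\<lambda>n. f (k + n))"

lemma tshift_apply [simp]: "tshift k f n = f (k + n)"
  by (simp add: tshift_def)

lemma tshift_shift [simp]: "tshift k (tshift l f) = tshift (l + k) f"
  by (simp add: tshift_def add.assoc)

lemma tshift_0 [simp]: "tshift 0 f = f"
  by (simp add: tshift_def)

lemma tshift_measurable_coord [measurable]: "tshift k \<in> coord_space \<rightarrow>\<^sub>M coord_space"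
  unfolding tshift_def by (rule measurable_PiM_single') auto

lemma norm1_tshift_iff:
  "filterlim (\<lambda>n. norm1 (tshift k w n)) at_top at_top \<longleftrightarrow> filterlim (\<lambda>n::nat. norm1 (w n)) at_top at_top"
proof -
  have "(\<exists>N. \<forall>n\<ge>N. Z \<le> norm1 (w (k + n))) \<longleftrightarrow> (\<exists>N. \<forall>n\<ge>N. Z \<le> norm1 (w n))" for Z
  proof
    assume "\<exists>N. \<forall>n\<ge>N. Z \<le> norm1 (w (k + n))"
    then obtain N where N: "\<And>n. n \<ge> N \<Longrightarrow> Z \<le> norm1 (w (k + n))" by blast
    have "Z \<le> norm1 (w n)" if "n \<ge> k + N" for n
      using N[of "n - k"] that by simp
    then show "\<exists>N. \<forall>n\<ge>N. Z \<le> norm1 (w n)" by blast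
  qed (meson trans_le_add2)
  then show ?thesis unfolding filterlim_norm1_iff by simp
qed

lemma tshift_half_trajs: "f \<in> half_trajs \<Longrightarrow> tshift k f \<in> half_trajs"
  using norm1_tshift_iff[of k f] by (auto simp: half_trajs_def)

lemma tshift_measurable [measurable]: "tshift k \<in> half_space \<rightarrow>\<^sub>M half_space"
  unfolding half_space_def
  by (rule measurable_restrict_space3) (auto intro: tshift_half_trajs)

text \<open>An admissible first step settles the first adjacency, and escape is insensitive to a
  shift of time.\<close>

lemma walk_case_nat_half:
  assumes "e \<in> unit_steps"
  shows "walk x (case_nat e \<xi>) \<in> half_trajs \<longleftrightarrow> walk (x + e) \<xi> \<in> half_trajs"
proof -
  let ?w = "walk x (case_nat e \<xi>)" and ?v = "walk (x + e) \<xi>"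
  have v: "tshift 1 ?w = ?v"
    by (rule ext) (simp add: walk_Suc)
  have "adj (?w 0) (?w 1)"
    using assms walk_Suc[of x e \<xi> 0] by (simp add: adj_iff_step)
  then have "(\<forall>n. adj (?w n) (?w (Suc n))) \<longleftrightarrow> (\<forall>n. adj (?v n) (?v (Suc n)))"
    by (metis One_nat_def not0_implies_Suc walk_Suc)
  then show ?thesis
    using norm1_tshift_iff[of 1 ?w] unfolding half_trajs_def v by simp
qed

definition step_weight :: "('d::finite) itself \<Rightarrow> ennreal" where
  "step_weight _ = ennreal (1 / card (unit_steps :: 'd site set))"

text \<open>One step of the Markov property: an i.i.d. sequence is distributed like an independent
  first entry followed by a fresh copy of itself (\<open>steps.PiM_iter\<close>), and the event
  becomes a rectangle in these two coordinates.\<close>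

lemma srw_step:
  fixes x y :: "('d::finite) site"
  assumes xy: "adj x y" and S: "S \<in> sets half_space"
  shows "emeasure (srw x) {f \<in> half_trajs. f 1 = y \<and> tshift 1 f \<in> S}
    = step_weight TYPE('d) * emeasure (srw y) S"
proof -
  let ?M = "measure_pmf (pmf_of_set (unit_steps :: 'd site set))"
  let ?T = "{f \<in> half_trajs. f 1 = y \<and> tshift 1 f \<in> S}"
  interpret prob_space "step_space :: (nat \<Rightarrow> 'd site) measure" by (rule prob_space_step_space)
  have Sc: "S \<in> sets coord_space" "S \<subseteq> half_trajs" using S by (auto simp: sets_half_space_iff)
  have T: "?T \<in> sets half_space"
  proof -
    have "(\<lambda>f. f 1) -` {y} \<inter> space half_space \<in> sets half_space"
      by (rule measurable_sets[of _ _ "count_space UNIV"]) auto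
    moreover have "tshift 1 -` S \<inter> space half_space \<in> sets half_space"
      by (rule measurable_sets[OF tshift_measurable S])
    ultimately have "((\<lambda>f. f 1) -` {y} \<inter> space half_space) \<inter> (tshift 1 -` S \<inter> space half_space) \<in> sets half_space"
      by (rule sets.Int)
    moreover have "((\<lambda>f. f 1) -` {y} \<inter> space half_space) \<inter> (tshift 1 -` S \<inter> space half_space) = ?T"
      by auto
    ultimately show ?thesis by simp
  qed
  have T': "{\<xi>. walk x \<xi> \<in> ?T} \<in> sets step_space"
    using measurable_sets[OF walk_measurable, of ?T x] T by (simp add: sets_half_space_iff vimage_def)
  have e: "y - x \<in> unit_steps" using xy by (simp add: adj_iff_step)
  have "emeasure (srw x) ?T = emeasure step_space {\<xi>. walk x \<xi> \<in> ?T}"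
    by (rule emeasure_srw[OF T])
  also have "\<dots> = emeasure (distr (?M \<Otimes>\<^sub>M step_space) step_space (\<lambda>(s, \<omega>). case_nat s \<omega>)) {\<xi>. walk x \<xi> \<in> ?T}"
    by (simp only: step_space_def steps.PiM_iter)
  also have "\<dots> = emeasure (?M \<Otimes>\<^sub>M step_space)
      ((\<lambda>(s, \<omega>). case_nat s \<omega>) -` {\<xi>. walk x \<xi> \<in> ?T} \<inter> space (?M \<Otimes>\<^sub>M step_space))"
    by (rule emeasure_distr[OF _ T']) (simp add: step_space_def measurable_case_nat' case_prod_unfold)
  \<comment> \<open>The site at time 1 fixes the first step as \<open>y - x\<close>; the remaining
    steps then drive a walk from \<open>y\<close>.\<close>
  also have "((\<lambda>(s, \<omega>). case_nat s \<omega>) -` {\<xi>. walk x \<xi> \<in> ?T} \<inter> space (?M \<Otimes>\<^sub>M step_space))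
      = {y - x} \<times> {\<xi>. walk y \<xi> \<in> S}"
  proof -
    have "walk x (case_nat s \<xi>) \<in> ?T \<longleftrightarrow> s = y - x \<and> walk y \<xi> \<in> S" for s \<xi>
    proof -
      have v: "tshift 1 (walk x (case_nat s \<xi>)) = walk (x + s) \<xi>"
        by (rule ext) (simp add: walk_Suc)
      have w1: "walk x (case_nat s \<xi>) 1 = x + s"
        using walk_Suc[of x s \<xi> 0] by simp
      show ?thesis
      proof (cases "s = y - x")
        case True
        then show ?thesis using walk_case_nat_half[OF e, of x \<xi>] Sc(2) v w1 by auto
      next
        case False
        then show ?thesis using w1 by auto
      qed
    qed
    then show ?thesis by (auto simp: space_pair_measure)
  qed
  also have "emeasure (?M \<Otimes>\<^sub>M step_space) \<dots> = emeasure ?M {y - x} * emeasure step_space {\<xi>. walk y \<xi> \<in> S}"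
    using measurable_sets[OF walk_measurable Sc(1), of y]
    by (intro emeasure_pair_measure_Times) (auto simp: vimage_def)
  also have "emeasure ?M {y - x} = step_weight TYPE('d)"
    using e finite_unit_steps[where 'd='d] unit_steps_nonempty[where 'd='d]
    by (simp add: emeasure_pmf_single step_weight_def)
  also have "emeasure step_space {\<xi>. walk y \<xi> \<in> S} = emeasure (srw y) S"
    by (rule emeasure_srw[OF S, symmetric])
  finally show ?thesis .
qed


section \<open>Cylinders and the Markov property along a finite path\<close>

definition lattice_path :: "('d::finite) site list \<Rightarrow> bool" where
  "lattice_path \<tau> \<longleftrightarrow> \<tau> \<noteq> [] \<and> successively adj \<tau>"

definition path_weight :: "('d::finite) site list \<Rightarrow> ennreal" where
  "path_weight \<tau> = step_weight TYPE('d) ^ (length \<tau> - 1)"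

text \<open>The shift by \<open>length \<tau> - 1\<close> makes the last site of
  \<open>\<tau>\<close> the site at time 0 of the continuation. Consecutive pieces of a trajectory
  thus share their common end point, and the exponent in \<open>path_weight\<close> counts
  steps.\<close>

definition cyl :: "('d::finite) site list \<Rightarrow> (nat \<Rightarrow> 'd site) set \<Rightarrow> (nat \<Rightarrow> 'd site) set" where
  "cyl \<tau> S = {f \<in> half_trajs. map f [0..<length \<tau>] = \<tau> \<and> tshift (length \<tau> - 1) f \<in> S}"

lemma map_upt_eq_iff: "map f [0..<length \<tau>] = \<tau> \<longleftrightarrow> (\<forall>k<length \<tau>. f k = \<tau> ! k)"
proof -
  have "map f [0..<length \<tau>] = map ((!) \<tau>) [0..<length \<tau>] \<longleftrightarrow> (\<forall>k<length \<tau>. f k = \<tau> ! k)"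
    by (auto simp only: map_eq_conv set_upt atLeastLessThan_iff)
  then show ?thesis by (simp only: map_nth)
qed

lemma cyl_sets [measurable]:
  fixes S :: "(nat \<Rightarrow> ('d::finite) site) set"
  assumes S: "S \<in> sets half_space"
  shows "cyl \<tau> S \<in> sets half_space"
proof -
  have "{f \<in> space (half_space :: (nat \<Rightarrow> 'd site) measure). \<forall>k\<in>{..<length \<tau>}. f k = \<tau> ! k} \<in> sets half_space"
    by (intro sets.sets_Collect_finite_All) (auto intro!: measurable_sets_Collect[OF half_coord_measurable, of "\<lambda>v. v = _", simplified])
  moreover have "tshift (length \<tau> - 1) -` S \<inter> space half_space \<in> sets half_space"
    by (rule measurable_sets[OF tshift_measurable S])
  moreover have "cyl \<tau> S = {f \<in> space half_space. \<forall>k\<in>{..<length \<tau>}. f k = \<tau> ! k} \<inter>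
      (tshift (length \<tau> - 1) -` S \<inter> space half_space)"
    unfolding cyl_def map_upt_eq_iff by auto
  ultimately show ?thesis by simp
qed

text \<open>Subtraction on the naturals truncates, so the two shifts add up only if the tail has a
  last site; hence the non-emptiness of \<open>\<sigma>\<close>.\<close>

lemma cyl_Cons:
  assumes "\<sigma> \<noteq> []"
  shows "f \<in> cyl (x # \<sigma>) S \<longleftrightarrow> f \<in> half_trajs \<and> f 0 = x \<and> tshift 1 f \<in> cyl \<sigma> S"
proof -
  have "(\<forall>k<length (x # \<sigma>). f k = (x # \<sigma>) ! k) \<longleftrightarrow> f 0 = x \<and> (\<forall>k<length \<sigma>. tshift 1 f k = \<sigma> ! k)"
    by (simp only: length_Cons All_less_Suc2) simp
  moreover have "tshift (length (x # \<sigma>) - 1) f = tshift (length \<sigma> - 1) (tshift 1 f)"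
    using assms by (cases \<sigma>) simp_all
  ultimately show ?thesis
    using tshift_half_trajs[of f 1] unfolding cyl_def map_upt_eq_iff mem_Collect_eq by metis
qed

lemma AE_srw_start: "AE f in srw x. f 0 = x"
proof (rule AE_I')
  let ?N = "{f \<in> half_trajs. f 0 \<noteq> x}"
  have "{f \<in> space half_space. f 0 \<noteq> x} \<in> sets half_space" by measurable
  then have N: "?N \<in> sets half_space" by simp
  then show "?N \<in> null_sets (srw x)"
    by (simp add: null_sets_def sets_srw emeasure_srw[OF N])
qed simp

text \<open>The start is almost surely \<open>x\<close>. This lets cylinders, which record the site
  at time 0, be compared with events that do not.\<close>

lemma emeasure_srw_start:
  assumes "A \<in> sets half_space"
  shows "emeasure (srw x) {f \<in> A. f 0 = x} = emeasure (srw x) A"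
proof (rule emeasure_eq_AE)
  have "(\<lambda>f. f 0) -` {x} \<inter> space half_space \<in> sets half_space"
    by (rule measurable_sets[of _ _ "count_space UNIV"]) auto
  moreover have "{f \<in> A. f 0 = x} = A \<inter> ((\<lambda>f. f 0) -` {x} \<inter> space half_space)"
    using sets.sets_into_space[OF assms] by auto
  ultimately show "{f \<in> A. f 0 = x} \<in> sets (srw x)"
    using assms by (simp add: sets_srw)
  show "A \<in> sets (srw x)" using assms by (simp only: sets_srw)
  show "AE f in srw x. f \<in> {f \<in> A. f 0 = x} \<longleftrightarrow> f \<in> A"
    using AE_srw_start[of x] by eventually_elim simp
qed

text \<open>Induction along the path, one application of \<open>srw_step\<close> per step; a single
  site contributes weight 1 because the walk starts there almost surely.\<close>

lemma srw_cyl: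
  fixes \<tau> :: "('d::finite) site list"
  assumes "lattice_path \<tau>" and S: "S \<in> sets half_space"
  shows "emeasure (srw (hd \<tau>)) (cyl \<tau> S) = path_weight \<tau> * emeasure (srw (last \<tau>)) S"
  using assms(1)
proof (induction \<tau> rule: induct_list012)
  case (2 x)
  have "cyl [x] S = {f \<in> S. f 0 = x}"
    using sets.sets_into_space[OF S] by (auto simp: cyl_def)
  then show ?case using emeasure_srw_start[OF S] by (simp add: path_weight_def)
next
  case (3 x y zs)
  let ?\<sigma> = "y # zs"
  have v: "adj x y" "lattice_path ?\<sigma>" using 3 by (auto simp: lattice_path_def)
  let ?T = "{f \<in> half_trajs. f 1 = y \<and> tshift 1 f \<in> cyl ?\<sigma> S}"
  have y: "f 1 = y" if "tshift 1 f \<in> cyl ?\<sigma> S" for f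
    using that unfolding cyl_def map_upt_eq_iff by fastforce
  then have "cyl (x # ?\<sigma>) S = {f \<in> ?T. f 0 = x}"
    by (auto simp: cyl_Cons)
  moreover have "?T = tshift 1 -` cyl ?\<sigma> S \<inter> space half_space"
    using y by auto
  then have "?T \<in> sets half_space"
    using measurable_sets[OF tshift_measurable cyl_sets[OF S]] by simp
  ultimately have "emeasure (srw x) (cyl (x # ?\<sigma>) S) = step_weight TYPE('d) * emeasure (srw y) (cyl ?\<sigma> S)"
    using srw_step[OF v(1) cyl_sets[OF S], of ?\<sigma>] emeasure_srw_start[of ?T x] by presburger
  then show ?case using 3 v by (simp add: path_weight_def mult.assoc)
qed (simp add: lattice_path_def)

section \<open>Escape to infinity and its zero-one law\<close>

lemma walk_translate_escape:
  "filterlim (\<lambda>n. norm1 (walk x \<xi> n)) at_top at_top \<longleftrightarrow> filterlim (\<lambda>n. norm1 (walk y \<xi> n)) at_top at_top"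
proof -
  have "filterlim (\<lambda>n. norm1 (walk y \<xi> n)) at_top at_top"
    if esc: "filterlim (\<lambda>n. norm1 (walk x \<xi> n)) at_top at_top" for x y :: "'a site"
    unfolding filterlim_norm1_iff
  proof
    fix Z :: int
    obtain N where N: "\<And>n. n \<ge> N \<Longrightarrow> Z + norm1 (x - y) \<le> norm1 (walk x \<xi> n)"
      using esc unfolding filterlim_norm1_iff by blast
    have "norm1 (walk x \<xi> n) \<le> norm1 (x - y) + norm1 (walk y \<xi> n)" for n
      using norm1_triangle[of "x - y" "walk y \<xi> n"] by (simp add: walk_def)
    then show "\<exists>N. \<forall>n\<ge>N. Z \<le> norm1 (walk y \<xi> n)"
      using N by (smt (verit, best))
  qed
  then show ?thesis by blast
qed

text \<open>Separates the condition on the steps, which holds almost surely, from the escape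
  condition, to which the zero-one law applies.\<close>

lemma walk_half_iff:
  "walk x \<xi> \<in> half_trajs \<longleftrightarrow>
    (\<forall>n. \<xi> n \<in> unit_steps) \<and> filterlim (\<lambda>n. norm1 (walk x \<xi> n)) at_top at_top"
  unfolding half_trajs_def by (simp add: adj_iff_step) (simp add: walk_def)

lemma walk_translate_half: "walk x \<xi> \<in> half_trajs \<longleftrightarrow> walk y \<xi> \<in> half_trajs"
  using walk_translate_escape by (auto simp: walk_half_iff)

definition escape_mass :: "('d::finite) itself \<Rightarrow> ennreal" where
  "escape_mass _ = emeasure (srw (0 :: 'd site)) half_trajs"

lemma half_trajs_in_half_space [simp, measurable]: "half_trajs \<in> sets half_space"
  using sets.top[of half_space] by simp

lemma emeasure_srw_half_trajs:
  "emeasure (srw (x :: ('d::finite) site)) half_trajs = escape_mass TYPE('d)"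
  unfolding escape_mass_def by (simp add: emeasure_srw walk_translate_half[of x _ 0])

text \<open>The event that the walk escapes does not depend on finitely many steps, hence is independent of
  every cylinder, hence of itself. In this way the transience of the walk is never needed: if the mass is 0,
  all the capacities vanish.\<close>

lemma escape_mass_zero_one: "escape_mass TYPE('d::finite) = 0 \<or> escape_mass TYPE('d) = 1"
proof -
  let ?X = "step_space :: (nat \<Rightarrow> 'd site) measure"
  let ?T = "{\<xi> :: nat \<Rightarrow> 'd site. filterlim (\<lambda>n. norm1 (walk 0 \<xi> n)) at_top at_top}"
  interpret X: prob_space ?X by (rule prob_space_step_space)
  have T: "?T \<in> sets ?X"
  proof -
    have [measurable]: "(\<lambda>\<xi>. walk 0 \<xi> n) \<in> ?X \<rightarrow>\<^sub>M count_space UNIV" for n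
      using measurable_compose[OF walk_measurable coord_measurable] by simp
    have "{\<xi> \<in> space ?X. \<forall>Z::int. \<exists>N. \<forall>n\<ge>N. Z \<le> norm1 (walk 0 \<xi> n)} \<in> sets ?X"
      by measurable
    then show ?thesis by (simp add: filterlim_norm1_iff)
  qed
  have comb: "comb_seq i \<omega> \<omega>' \<in> ?T \<longleftrightarrow> \<omega>' \<in> ?T" for i \<omega> \<omega>'
  proof -
    \<comment> \<open>Replacing the first \<open>i\<close> steps only displaces the point from which
      the later steps \<open>\<omega>'\<close> start, and a bounded displacement does not influence
      escape.\<close>
    have "walk 0 (comb_seq i \<omega> \<omega>') (i + n) = walk (\<Sum>k<i. \<omega> k) \<omega>' n" for n
    proof -
      have "(\<Sum>k<i + n. comb_seq i \<omega> \<omega>' k) = (\<Sum>k<i. comb_seq i \<omega> \<omega>' k) + (\<Sum>k\<in>{i..<i+n}. comb_seq i \<omega> \<omega>' k)"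
        by (subst sum.atLeastLessThan_concat[of 0 i "i+n", symmetric, unfolded atLeast0LessThan]) auto
      also have "(\<Sum>k<i. comb_seq i \<omega> \<omega>' k) = (\<Sum>k<i. \<omega> k)"
        by (intro sum.cong) (auto simp: comb_seq_def)
      also have "(\<Sum>k\<in>{i..<i+n}. comb_seq i \<omega> \<omega>' k) = (\<Sum>k<n. \<omega>' k)"
        by (rule sum.reindex_bij_witness[of _ "\<lambda>k. k + i" "\<lambda>k. k - i"]) (auto simp: comb_seq_def)
      finally show ?thesis by (simp add: walk_def)
    qed
    then have "tshift i (walk 0 (comb_seq i \<omega> \<omega>')) = walk (\<Sum>k<i. \<omega> k) \<omega>'" by auto
    then show ?thesis
      using norm1_tshift_iff[of i "walk 0 (comb_seq i \<omega> \<omega>')"] walk_translate_escape[of _ \<omega>'] by auto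
  qed
  let ?h = "emeasure ?X ?T"
  have "density ?X (indicator ?T) = scale_measure ?h ?X"
    unfolding step_space_def
  proof (rule measure_eqI_PiM_infinite, simp_all add: step_space_def[symmetric])
    show "finite_measure (density ?X (indicator ?T))"
      using T by (rule X.finite_measure_restricted)
    fix J :: "nat set" and A :: "nat \<Rightarrow> 'd site set"
    assume J: "finite J"
    let ?E = "steps.emb UNIV J (Pi\<^sub>E J A)"
    \<comment> \<open>A cut beyond all coordinates in \<open>J\<close>: in the recombined sequence
      the cylinder depends on the first factor only, and escape on the second only.\<close>
    obtain i where i: "\<And>j. j \<in> J \<Longrightarrow> j < i"
      using finite_nat_bounded[OF J] by auto
    have E: "?E \<in> sets ?X" unfolding step_space_def using J by (intro sets_PiM_I) auto
    have sub: "(\<lambda>(\<omega>, \<omega>'). comb_seq i \<omega> \<omega>') -` (?T \<inter> ?E) \<inter> space (?X \<Otimes>\<^sub>M ?X) = ?E \<times> ?T"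
      using comb i by (auto simp: space_pair_measure prod_emb_def PiE_iff comb_seq_def)
    have "emeasure ?X (?T \<inter> ?E) = emeasure (distr (?X \<Otimes>\<^sub>M ?X) ?X (\<lambda>(\<omega>, \<omega>'). comb_seq i \<omega> \<omega>')) (?T \<inter> ?E)"
      unfolding step_space_def by (simp add: steps.PiM_comb_seq)
    also have "\<dots> = emeasure (?X \<Otimes>\<^sub>M ?X) (?E \<times> ?T)"
      unfolding sub[symmetric] using E T
      by (intro emeasure_distr) (auto simp: step_space_def measurable_comb_seq)
    also have "\<dots> = ?h * emeasure ?X ?E"
      using E T by (simp add: X.emeasure_pair_measure_Times mult.commute)
    finally show "emeasure (density ?X (indicator ?T)) ?E = ?h * emeasure ?X ?E"
      using E T by (simp add: emeasure_restricted)
  qed (simp_all only: step_space_def)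
  then have "emeasure (density ?X (indicator ?T)) ?T = emeasure (scale_measure ?h ?X) ?T" by simp
  then have "?h = ?h * ?h" using T by (simp add: emeasure_restricted)
  moreover have "?h \<le> 1" by (rule X.measure_le_1)
  then have "?h \<noteq> \<infinity>" by auto
  ultimately have "?h = 0 \<or> ?h = 1"
    by (metis ennreal_mult_cancel_left mult.right_neutral infinity_ennreal_def)
  moreover have "escape_mass TYPE('d) = ?h"
    unfolding escape_mass_def emeasure_srw[OF half_trajs_in_half_space]
  proof (rule emeasure_eq_AE)
    have "AE \<xi> in ?X. \<xi> n \<in> unit_steps" for n
      unfolding step_space_def
      using finite_unit_steps[where 'd='d] unit_steps_nonempty[where 'd='d]
      by (intro steps.AE_component) (auto simp: AE_measure_pmf_iff)
    then have "AE \<xi> in ?X. \<forall>n. \<xi> n \<in> unit_steps" by (simp add: AE_all_countable)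
    then show "AE \<xi> in ?X. \<xi> \<in> {\<xi>. walk 0 \<xi> \<in> half_trajs} \<longleftrightarrow> \<xi> \<in> ?T"
      by (auto simp: walk_half_iff)
    show "{\<xi>. walk 0 \<xi> \<in> half_trajs} \<in> sets ?X"
      using measurable_sets[OF walk_measurable half_trajs_sets, of 0] by (simp add: vimage_def)
  qed (rule T)
  ultimately show ?thesis by simp
qed


section \<open>Excursions of a half-infinite trajectory\<close>

declare tshift_apply [simp del]

text \<open>With pointwise unfolding of shifts switched off, this is the rewrite that moves a shift
  from the trajectory to the time.\<close>

lemma tshift_mem_iff: "tshift r f n \<in> K \<longleftrightarrow> f (r + n) \<in> K"
  by (simp add: tshift_apply)

section \<open>Calculus of first times\<close>

lemma first_eq_None_iff: "first Q = None \<longleftrightarrow> (\<forall>n. \<not> Q n)"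
  by (auto simp: first_def)

lemma first_eq_Some_iff: "first Q = Some (n :: nat) \<longleftrightarrow> Q n \<and> (\<forall>k<n. \<not> Q k)"
proof
  assume "first Q = Some n"
  then have "\<exists>n. Q n" "n = (LEAST n. Q n)" by (auto simp: first_def split: if_splits)
  then show "Q n \<and> (\<forall>k<n. \<not> Q k)" using LeastI_ex[of Q] not_less_Least[of _ Q] by blast
next
  assume *: "Q n \<and> (\<forall>k<n. \<not> Q k)"
  then have "(LEAST n. Q n) = n" by (intro Least_equality) (auto simp: not_less[symmetric])
  then show "first Q = Some n" using * by (auto simp: first_def)
qed

lemma first_after_None [simp]: "first_after None Q = None"
  by (simp add: first_after_def)

lemma first_after_Some: "first_after (Some m) Q = first (\<lambda>n. m < n \<and> Q n)"
  by (simp add: first_after_def)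

lemma first_after_eq_Some_iff:
  "first_after (Some m) Q = Some (n :: nat) \<longleftrightarrow> m < n \<and> Q n \<and> (\<forall>k. m < k \<and> k < n \<longrightarrow> \<not> Q k)"
  by (auto simp: first_after_Some first_eq_Some_iff)

lemma first_after_eq_None_iff: "first_after (Some m) Q = None \<longleftrightarrow> (\<forall>n>m. \<not> Q n)"
  by (auto simp: first_after_Some first_eq_None_iff)

text \<open>Searching strictly after a time is compatible with moving the origin of time. This is
  what makes the visits of a shifted trajectory the later visits of the original one.\<close>

lemma first_after_shift:
  "first_after (map_option ((+) r) X) Q = map_option ((+) (r :: nat)) (first_after X (\<lambda>n. Q (r + n)))"
proof (cases X)
  case (Some m)
  show ?thesis
  proof (cases "first_after X (\<lambda>n. Q (r + n))")
    case None
    then have "\<not> Q k" if "k > r + m" for k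
      using that Some first_after_eq_None_iff[of m "\<lambda>n. Q (r + n)"]
      by (metis add.commute less_diff_conv le_add_diff_inverse less_imp_le_nat trans_less_add1 add_lessD1)
    then have "first_after (Some (r + m)) Q = None" by (simp add: first_after_eq_None_iff)
    then show ?thesis using None Some by simp
  next
    case (Some n)
    then have n: "m < n" "Q (r + n)" "\<And>k. m < k \<Longrightarrow> k < n \<Longrightarrow> \<not> Q (r + k)"
      using \<open>X = Some m\<close> by (auto simp: first_after_eq_Some_iff)
    have "\<not> Q k" if "r + m < k" "k < r + n" for k
      using n(3)[of "k - r"] that by auto
    then have "first_after (Some (r + m)) Q = Some (r + n)"
      using n by (auto simp: first_after_eq_Some_iff)
    then show ?thesis using Some \<open>X = Some m\<close> by simp
  qed
qed simp

lemma successively_map_upt: "f \<in> half_trajs \<Longrightarrow> successively adj (map f [a..<b])"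
  by (auto simp: half_trajs_def successively_conv_nth)

definition no_return :: "('d::finite) site set \<Rightarrow> (nat \<Rightarrow> 'd site) set" where
  "no_return K = {f \<in> half_trajs. return_time K f = None}"

lemma no_return_iff: "f \<in> no_return K \<longleftrightarrow> f \<in> half_trajs \<and> (\<forall>n\<ge>1. f n \<notin> K)"
  by (auto simp: no_return_def return_time_def first_eq_None_iff)

lemma return_time_eq_Some_iff:
  "return_time K f = Some r \<longleftrightarrow> 1 \<le> r \<and> f r \<in> K \<and> (\<forall>k. 1 \<le> k \<and> k < r \<longrightarrow> f k \<notin> K)"
  by (auto simp: return_time_def first_eq_Some_iff)

text \<open>The norm is bounded on a finite set, and the sum of all norms in \<open>K\<close> is a
  bound that also makes sense for empty \<open>K\<close>.\<close>

lemma finite_eventually_outside: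
  assumes "finite K" and "f \<in> half_trajs"
  obtains N where "\<And>n. n \<ge> N \<Longrightarrow> f n \<notin> K"
proof -
  obtain N where N: "\<And>n. n \<ge> N \<Longrightarrow> (\<Sum>x\<in>K. norm1 x) + 1 \<le> norm1 (f n)"
    using assms(2) unfolding half_trajs_def mem_Collect_eq filterlim_norm1_iff by meson
  have "f n \<notin> K" if "n \<ge> N" for n
  proof
    assume "f n \<in> K"
    then have "norm1 (f n) \<le> (\<Sum>x\<in>K. norm1 x)"
      using assms(1) by (intro member_le_sum) (auto simp: norm1_nonneg)
    with N[OF that] show False by simp
  qed
  then show thesis by (rule that)
qed

section \<open>Excursions on the half line as nested cylinder sets\<close>

definition in_exc :: "('d::finite) site set \<Rightarrow> (nat \<Rightarrow> 'd site) \<Rightarrow> nat \<Rightarrow> 'd site list" where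
  "in_exc K f j = map f [A_time K f j..<Suc (B_time K f j)]"

definition out_exc :: "('d::finite) site set \<Rightarrow> (nat \<Rightarrow> 'd site) \<Rightarrow> nat \<Rightarrow> 'd site list" where
  "out_exc K f j = map f [B_time K f j..<Suc (A_time K f (Suc j))]"

definition last_exit :: "('d::finite) site set \<Rightarrow> (nat \<Rightarrow> 'd site) \<Rightarrow> nat \<Rightarrow> 'd site" where
  "last_exit K f = tshift (B_time K f (M_count K f)) f"

definition in_paths :: "('d::finite) site set \<Rightarrow> 'd site \<Rightarrow> 'd site \<Rightarrow> 'd site list set" where
  "in_paths K x y = {\<tau>. path_inside K x y \<tau>}"

text \<open>At least three sites: with two, \<open>path_outside\<close> has no interior site to test
  and would admit a direct step between neighbours, which no outer excursion of a trajectory makes;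
  with one it would admit a standstill.\<close>

definition out_paths :: "('d::finite) site set \<Rightarrow> 'd site \<Rightarrow> 'd site \<Rightarrow> 'd site list set" where
  "out_paths K y x = {\<tau>. path_outside K y x \<tau> \<and> 3 \<le> length \<tau>}"

text \<open>Sites, hence finite paths, form a countable type, so this union stays measurable for
  every \<open>F\<close>.\<close>

definition Phi :: "('d::finite) site list set \<Rightarrow> (nat \<Rightarrow> 'd site) set \<Rightarrow> (nat \<Rightarrow> 'd site) set" where
  "Phi F S = (\<Union>\<tau>\<in>F. cyl \<tau> S)"

text \<open>The lists alternate between stages inside and outside \<open>K\<close>, and
  \<open>no_return K\<close> after the last stage inside forbids a further one. Lists of mismatched
  lengths end in the catch-all equation.\<close>

fun exc :: "('d::finite) site set \<Rightarrow> 'd site list set list \<Rightarrow> 'd site list set list \<Rightarrow>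
    (nat \<Rightarrow> 'd site) set \<Rightarrow> (nat \<Rightarrow> 'd site) set" where
  "exc K [F] [] B = Phi F (B \<inter> no_return K)"
| "exc K (F # Fs) (H # Hs) B = Phi F (Phi H (exc K Fs Hs B))"
| "exc K _ _ B = {}"

context
  fixes K :: "('d::finite) site set"
  assumes finK: "finite K"
begin

text \<open>Visit times increase strictly, so the bound \<open>k \<le> n\<close> turns a last time
  in \<open>K\<close> into a bound on the number of visits.\<close>

lemma R_time_Suc_SomeD:
  "R_time K f (Suc k) = Some n \<Longrightarrow> k \<le> n \<and> f (n :: nat) \<in> K"
proof (induction k arbitrary: n)
  case (Suc k)
  then obtain m d where "R_time K f (Suc k) = Some m" "first_after (Some m) (\<lambda>n. f n \<notin> K) = Some d"
    "first_after (Some d) (\<lambda>n. f n \<in> K) = Some n"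
    by (cases "R_time K f (Suc k)"; cases "first_after (R_time K f (Suc k)) (\<lambda>n. f n \<notin> K)") auto
  with Suc.IH[of m] show ?case by (auto simp: first_after_eq_Some_iff)
qed (auto simp: first_eq_Some_iff)

lemma R_time_Suc_None: "R_time K f k = None \<Longrightarrow> 1 \<le> k \<Longrightarrow> R_time K f (Suc k) = None"
  by (cases k) auto

lemma R_time_None_mono: "R_time K f k = None \<Longrightarrow> 1 \<le> k \<Longrightarrow> k \<le> l \<Longrightarrow> R_time K f l = None"
  by (induction l rule: nat_induct) (auto simp: le_Suc_eq R_time_Suc_None simp del: R_time.simps)

text \<open>\<open>M_count\<close> is a \<open>Max\<close>, which is meaningful only for a finite
  set; finiteness comes from the escape to infinity.\<close>

lemma finite_R_times:
  assumes "f \<in> half_trajs"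
  shows "finite {k. 1 \<le> k \<and> R_time K f k \<noteq> None}"
proof -
  obtain N where N: "\<And>n. n \<ge> N \<Longrightarrow> f n \<notin> K"
    using finite_eventually_outside[OF finK assms] by blast
  have "k \<le> Suc N" if "1 \<le> k" "R_time K f k = Some n" for k n
  proof -
    have "k - 1 \<le> n" "f n \<in> K" using that R_time_Suc_SomeD[of f "k - 1" n] by auto
    then show ?thesis using N[of n] by linarith
  qed
  then have "{k. 1 \<le> k \<and> R_time K f k \<noteq> None} \<subseteq> {..Suc N}" by blast
  then show ?thesis by (rule finite_subset) simp
qed

lemma D_time_SomeE:
  assumes "f \<in> half_trajs" "R_time K f k = Some a"
  obtains d where "D_time K f k = Some d" "a < d" "f d \<notin> K" "\<And>n. a < n \<Longrightarrow> n < d \<Longrightarrow> f n \<in> K"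
proof -
  obtain N where "\<And>n. n \<ge> N \<Longrightarrow> f n \<notin> K"
    using finite_eventually_outside[OF finK assms(1)] by blast
  then have "f (Suc (max N a)) \<notin> K" "Suc (max N a) > a" by auto
  then obtain d where "D_time K f k = Some d"
    using assms(2) first_after_eq_None_iff[of a "\<lambda>n. f n \<notin> K"] unfolding D_time_def
    by (cases "first_after (Some a) (\<lambda>n. f n \<notin> K)") auto
  then show thesis using that assms(2) unfolding D_time_def by (auto simp: first_after_eq_Some_iff)
qed

text \<open>Starting in \<open>K\<close> makes the set of visits non-empty, and a missing visit is
  never followed by another one, so the visits are exactly those with index up to the
  maximum.\<close>

lemma M_count_ge1:
  assumes "f \<in> half_trajs" "f 0 \<in> K"
  shows "1 \<le> M_count K f" and "R_time K f (M_count K f) \<noteq> None"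
    and "1 \<le> j \<Longrightarrow> R_time K f j \<noteq> None \<longleftrightarrow> j \<le> M_count K f"
proof -
  let ?S = "{k. 1 \<le> k \<and> R_time K f k \<noteq> None}"
  have fin: "finite ?S" by (rule finite_R_times[OF assms(1)])
  have "first (\<lambda>n. f n \<in> K) = Some 0" using assms(2) by (simp add: first_eq_Some_iff)
  then have "1 \<in> ?S" by simp
  then have "M_count K f \<in> ?S" unfolding M_count_def using fin Max_in by blast
  then show "1 \<le> M_count K f" "R_time K f (M_count K f) \<noteq> None" by auto
  then have M: "R_time K f (M_count K f) \<noteq> None" by blast
  show "R_time K f j \<noteq> None \<longleftrightarrow> j \<le> M_count K f" if j: "1 \<le> j"
  proof
    assume "R_time K f j \<noteq> None"
    with j have "j \<in> ?S" by simp
    then show "j \<le> M_count K f" unfolding M_count_def by (rule Max_ge[OF fin])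
  next
    assume "j \<le> M_count K f"
    then show "R_time K f j \<noteq> None" using M R_time_None_mono[of f j "M_count K f"] j by argo
  qed
qed

text \<open>Escape guarantees a departure after each visit, so none of the values under
  \<open>the\<close> in \<open>A_time\<close> and \<open>B_time\<close> is a default, and the
  subtraction of 1 does not truncate.\<close>

lemma excursion_times:
  assumes f: "f \<in> half_trajs" "f 0 \<in> K" and j: "1 \<le> j" "j \<le> M_count K f"
  shows "A_time K f j \<le> B_time K f j" and "\<And>n. A_time K f j \<le> n \<Longrightarrow> n \<le> B_time K f j \<Longrightarrow> f n \<in> K"
    and "f (Suc (B_time K f j)) \<notin> K" and "D_time K f j = Some (Suc (B_time K f j))"
    and "R_time K f j = Some (A_time K f j)"
proof -
  obtain a where a: "R_time K f j = Some a"
    using M_count_ge1(3)[OF f j(1)] j(2) by auto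
  obtain d where d: "D_time K f j = Some d" "a < d" "f d \<notin> K" "\<And>n. a < n \<Longrightarrow> n < d \<Longrightarrow> f n \<in> K"
    using D_time_SomeE[OF f(1) a] by blast
  have "f a \<in> K" using R_time_Suc_SomeD[of f "j - 1" a] a j(1) by simp
  moreover have A: "A_time K f j = a" "B_time K f j = d - 1"
    using a d(1) by (simp_all add: A_time_def B_time_def)
  ultimately show "A_time K f j \<le> B_time K f j" "f (Suc (B_time K f j)) \<notin> K"
    "D_time K f j = Some (Suc (B_time K f j))" "R_time K f j = Some (A_time K f j)"
    using a d by auto
  show "f n \<in> K" if "A_time K f j \<le> n" "n \<le> B_time K f j" for n
    using \<open>f a \<in> K\<close> d that unfolding A by (cases "n = a") auto
qed

text \<open>The site after a departure is off \<open>K\<close>, so the next visit comes at least two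
  steps after \<open>B_time\<close>; this is the origin of the length bound 3 in
  \<open>out_paths\<close>.\<close>

lemma out_excursion_times:
  assumes f: "f \<in> half_trajs" "f 0 \<in> K" and j: "1 \<le> j" "Suc j \<le> M_count K f"
  shows "Suc (B_time K f j) < A_time K f (Suc j)"
    and "\<And>n. B_time K f j < n \<Longrightarrow> n < A_time K f (Suc j) \<Longrightarrow> f n \<notin> K" and "f (A_time K f (Suc j)) \<in> K"
proof -
  have D: "D_time K f j = Some (Suc (B_time K f j))" and out: "f (Suc (B_time K f j)) \<notin> K"
    using excursion_times[OF f j(1)] j(2) by auto
  have "R_time K f (Suc j) = Some (A_time K f (Suc j))"
    using excursion_times(5)[OF f _ j(2)] by simp
  moreover have "R_time K f (Suc j) = first_after (D_time K f j) (\<lambda>n. f n \<in> K)"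
    using j(1) by (cases j) (auto simp: D_time_def)
  ultimately have *: "first_after (Some (Suc (B_time K f j))) (\<lambda>n. f n \<in> K) = Some (A_time K f (Suc j))"
    using D by simp
  then show "Suc (B_time K f j) < A_time K f (Suc j)" "f (A_time K f (Suc j)) \<in> K"
    by (auto simp: first_after_eq_Some_iff)
  show "f n \<notin> K" if "B_time K f j < n" "n < A_time K f (Suc j)" for n
    using * that out by (cases "n = Suc (B_time K f j)") (auto simp: first_after_eq_Some_iff)
qed

lemma in_exc_path:
  assumes f: "f \<in> half_trajs" "f 0 \<in> K" and j: "1 \<le> j" "j \<le> M_count K f"
  shows "in_exc K f j \<in> in_paths K (f (A_time K f j)) (f (B_time K f j))"
  using excursion_times[OF f j] successively_map_upt[OF f(1)]
  by (auto simp: in_paths_def path_inside_def in_exc_def hd_map last_map simp del: upt_Suc)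

lemma out_exc_path:
  assumes f: "f \<in> half_trajs" "f 0 \<in> K" and j: "1 \<le> j" "Suc j \<le> M_count K f"
  shows "out_exc K f j \<in> out_paths K (f (B_time K f j)) (f (A_time K f (Suc j)))"
proof -
  have "out_exc K f j ! t \<notin> K" if "0 < t" "t < length (out_exc K f j) - 1" for t
    using that out_excursion_times(2)[OF f j, of "B_time K f j + t"] unfolding out_exc_def
    by (subst nth_map) (auto simp del: upt_Suc)
  then show ?thesis
    using out_excursion_times[OF f j] successively_map_upt[OF f(1)]
    by (auto simp: out_paths_def path_outside_def out_exc_def hd_map last_map simp del: upt_Suc)
qed

lemma first_in_exc:
  assumes f: "f \<in> half_trajs" "f 0 \<in> K"
  shows "A_time K f 1 = 0"
    and "\<And>n. n \<le> B_time K f 1 \<Longrightarrow> f n \<in> K" and "f (Suc (B_time K f 1)) \<notin> K"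
    and "in_exc K f 1 = map f [0..<Suc (B_time K f 1)]"
proof -
  have "first (\<lambda>n. f n \<in> K) = Some 0" using f(2) by (simp add: first_eq_Some_iff)
  then show A: "A_time K f 1 = 0" by (simp add: A_time_def)
  show "f n \<in> K" if "n \<le> B_time K f 1" for n
    using excursion_times(2)[OF f _ M_count_ge1(1)[OF f], of n] that A by simp
  show "f (Suc (B_time K f 1)) \<notin> K"
    using excursion_times(3)[OF f _ M_count_ge1(1)[OF f]] by simp
  show "in_exc K f 1 = map f [0..<Suc (B_time K f 1)]" by (simp only: in_exc_def A)
qed

text \<open>The cut is forced: a path inside \<open>K\<close> followed by a step off
  \<open>K\<close> can only end at the last site before the first exit. The condition on
  \<open>S\<close> at time 1 excludes shorter paths.\<close>

lemma Phi_in_iff: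
  assumes F: "\<And>\<tau>. \<tau> \<in> F \<Longrightarrow> \<tau> \<noteq> [] \<and> set \<tau> \<subseteq> K" and S: "\<And>g. g \<in> S \<Longrightarrow> g 1 \<notin> K"
  shows "f \<in> Phi F S \<longleftrightarrow>
    f \<in> half_trajs \<and> f 0 \<in> K \<and> in_exc K f 1 \<in> F \<and> tshift (B_time K f 1) f \<in> S"
proof
  assume "f \<in> Phi F S"
  then obtain \<tau> where \<tau>: "\<tau> \<in> F" "f \<in> half_trajs" "map f [0..<length \<tau>] = \<tau>" "tshift (length \<tau> - 1) f \<in> S"
    by (auto simp: Phi_def cyl_def)
  have ne: "\<tau> \<noteq> []" and in_K: "\<And>k. k < length \<tau> \<Longrightarrow> f k \<in> K"
    using F[OF \<tau>(1)] \<tau>(3) by (auto simp: map_upt_eq_iff)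
  then have f0: "f 0 \<in> K" by simp
  have "f (length \<tau>) \<notin> K" using S[OF \<tau>(4)] ne by (simp add: tshift_apply)
  then have "\<not> length \<tau> \<le> B_time K f 1"
    using first_in_exc(2)[OF \<tau>(2) f0] by blast
  moreover have "\<not> Suc (B_time K f 1) < length \<tau>"
    using first_in_exc(3)[OF \<tau>(2) f0] in_K by blast
  ultimately have "length \<tau> = Suc (B_time K f 1)" by simp
  then show "f \<in> half_trajs \<and> f 0 \<in> K \<and> in_exc K f 1 \<in> F \<and> tshift (B_time K f 1) f \<in> S"
    using \<tau> f0 first_in_exc(4)[OF \<tau>(2) f0] by (metis diff_Suc_1)
next
  assume *: "f \<in> half_trajs \<and> f 0 \<in> K \<and> in_exc K f 1 \<in> F \<and> tshift (B_time K f 1) f \<in> S"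
  then have "in_exc K f 1 = map f [0..<Suc (B_time K f 1)]" using first_in_exc(4) by blast
  then have "f \<in> cyl (in_exc K f 1) S" using * by (simp add: cyl_def del: upt_Suc)
  then show "f \<in> Phi F S" using * by (auto simp: Phi_def)
qed

text \<open>Dual to the inner case: interior sites off \<open>K\<close> and a last site in
  \<open>K\<close> identify the end of the path with the first return, and length at least 3 makes
  site 1 an interior site.\<close>

lemma Phi_out_iff:
  assumes H: "\<And>\<tau>. \<tau> \<in> H \<Longrightarrow> 3 \<le> length \<tau> \<and> last \<tau> \<in> K \<and> (\<forall>t. 0 < t \<and> t < length \<tau> - 1 \<longrightarrow> \<tau> ! t \<notin> K)"
  shows "g \<in> Phi H S \<longleftrightarrow> g \<in> half_trajs \<and> g 1 \<notin> K \<and>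
    (\<exists>r. return_time K g = Some r \<and> map g [0..<Suc r] \<in> H \<and> tshift r g \<in> S)"
proof
  assume "g \<in> Phi H S"
  then obtain \<tau> where \<tau>: "\<tau> \<in> H" "g \<in> half_trajs" "map g [0..<length \<tau>] = \<tau>" "tshift (length \<tau> - 1) g \<in> S"
    by (auto simp: Phi_def cyl_def)
  have g: "\<And>k. k < length \<tau> \<Longrightarrow> g k = \<tau> ! k" using \<tau>(3) by (auto simp: map_upt_eq_iff)
  have len: "3 \<le> length \<tau>" and last: "g (length \<tau> - 1) \<in> K"
    and inner: "\<And>t. 0 < t \<Longrightarrow> t < length \<tau> - 1 \<Longrightarrow> g t \<notin> K"
    using H[OF \<tau>(1)] g last_conv_nth[of \<tau>] by auto (metis One_nat_def list.size(3) not_numeral_le_zero diff_less length_greater_0_conv zero_less_one)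
  have "return_time K g = Some (length \<tau> - 1)"
    using len last inner by (auto simp: return_time_eq_Some_iff)
  moreover have "map g [0..<Suc (length \<tau> - 1)] = \<tau>" 
  proof -
    have "Suc (length \<tau> - 1) = length \<tau>" using len by simp
    then show ?thesis by (simp only: \<tau>(3))
  qed
  ultimately show "g \<in> half_trajs \<and> g 1 \<notin> K \<and>
    (\<exists>r. return_time K g = Some r \<and> map g [0..<Suc r] \<in> H \<and> tshift r g \<in> S)"
    using \<tau> inner[of 1] len by auto
next
  assume "g \<in> half_trajs \<and> g 1 \<notin> K \<and>
    (\<exists>r. return_time K g = Some r \<and> map g [0..<Suc r] \<in> H \<and> tshift r g \<in> S)"
  then obtain r where "g \<in> half_trajs" "map g [0..<Suc r] \<in> H" "tshift r g \<in> S" by blast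
  then show "g \<in> Phi H S"
    unfolding Phi_def by (intro UN_I[of "map g [0..<Suc r]"]) (auto simp: cyl_def simp del: upt_Suc)
qed

text \<open>The site right after the excursion is off \<open>K\<close>, so the search for the next
  visit may begin at the last site of the excursion, where it becomes a return time.\<close>

lemma R_time_2:
  assumes f: "f \<in> half_trajs" "f 0 \<in> K"
  shows "R_time K f (Suc (Suc 0)) = map_option ((+) (B_time K f 1)) (return_time K (tshift (B_time K f 1) f))"
proof -
  let ?b = "B_time K f 1"
  have "D_time K f 1 = Some (Suc ?b)" and out: "f (Suc ?b) \<notin> K"
    using excursion_times[OF f _ M_count_ge1(1)[OF f]] by auto
  then have "R_time K f (Suc (Suc 0)) = first_after (Some (Suc ?b)) (\<lambda>n. f n \<in> K)"
    by (simp add: D_time_def)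
  also have "\<dots> = first_after (Some ?b) (\<lambda>n. f n \<in> K)"
    unfolding first_after_Some using out by (intro arg_cong[of _ _ first] ext) (metis Suc_lessI Suc_lessD)
  also have "\<dots> = map_option ((+) ?b) (first_after (Some 0) (\<lambda>n. f (?b + n) \<in> K))"
    using first_after_shift[of ?b "Some 0" "\<lambda>n. f n \<in> K"] by simp
  also have "first_after (Some 0) (\<lambda>n. f (?b + n) \<in> K) = return_time K (tshift ?b f)"
    by (simp add: return_time_def first_after_Some Suc_le_eq tshift_apply)
  finally show ?thesis .
qed

text \<open>Renewal at the second visit: the recursion for visit times only looks forward, so it
  commutes with restarting the clock there.\<close>

lemma R_time_tshift:
  assumes "R_time K f (Suc (Suc 0)) = Some r"
  shows "R_time K f (Suc (Suc k)) = map_option ((+) r) (R_time K (tshift r f) (Suc k))"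
proof (induction k)
  case 0
  have "f r \<in> K" using R_time_Suc_SomeD[OF assms] by simp
  then have "first (\<lambda>n. tshift r f n \<in> K) = Some 0" by (simp add: first_eq_Some_iff tshift_apply)
  then show ?case using assms by simp
next
  case (Suc k)
  have "R_time K f (Suc (Suc (Suc k)))
      = first_after (first_after (map_option ((+) r) (R_time K (tshift r f) (Suc k))) (\<lambda>n. f n \<notin> K)) (\<lambda>n. f n \<in> K)"
    by (simp only: R_time.simps(3)[of K f "Suc k"] Suc)
  then show ?case by (simp add: first_after_shift tshift_mem_iff)
qed

lemma M_count_no_second:
  assumes f: "f \<in> half_trajs" "f 0 \<in> K" and R: "R_time K f (Suc (Suc 0)) = None"
  shows "M_count K f = 1"
  using M_count_ge1(1)[OF f] M_count_ge1(3)[OF f, of "Suc (Suc 0)"] R by simp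

context
  fixes f r
  assumes f: "f \<in> half_trajs" "f 0 \<in> K" and R: "R_time K f (Suc (Suc 0)) = Some r"
begin

lemma second_start: "tshift r f \<in> half_trajs" "tshift r f 0 \<in> K"
  using f R_time_Suc_SomeD[OF R] by (auto simp: tshift_half_trajs tshift_apply)

text \<open>By \<open>R_time_tshift\<close> the visits after the first are those of the restarted
  trajectory; comparing the largest indices gives the increment.\<close>

lemma M_count_second: "M_count K f = Suc (M_count K (tshift r f))"
proof -
  note g = second_start
  have *: "j \<le> M_count K (tshift r f) \<longleftrightarrow> Suc j \<le> M_count K f" if "1 \<le> j" for j
    using M_count_ge1(3)[OF f, of "Suc j"] M_count_ge1(3)[where f="tshift r f" and j=j, OF g] that R_time_tshift[OF R, of "j - 1"]
    by simp
  have "M_count K f \<ge> 1" "M_count K (tshift r f) \<ge> 1"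
    using M_count_ge1(1)[OF f] M_count_ge1(1)[where f="tshift r f", OF g] by auto
  moreover have "Suc (M_count K (tshift r f)) \<le> M_count K f"
    using * calculation(2) by blast
  ultimately show ?thesis
    using *[of "M_count K f - 1"] by linarith
qed

lemma second_times:
  assumes "1 \<le> j" "j \<le> M_count K (tshift r f)"
  shows "A_time K f (Suc j) = r + A_time K (tshift r f) j"
    and "B_time K f (Suc j) = r + B_time K (tshift r f) j"
proof -
  note g = second_start
  obtain i where i: "j = Suc i" using assms(1) by (cases j) auto
  note t = excursion_times[where f="tshift r f", OF g assms]
  show "A_time K f (Suc j) = r + A_time K (tshift r f) j"
    unfolding A_time_def i R_time_tshift[OF R] using t(5) by (simp add: i)
  have "D_time K f (Suc j) = map_option ((+) r) (D_time K (tshift r f) j)"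
    unfolding D_time_def i R_time_tshift[OF R] by (simp add: first_after_shift tshift_mem_iff)
  then have "D_time K f (Suc j) = Some (r + Suc (B_time K (tshift r f) j))"
    unfolding t(4) by simp
  then show "B_time K f (Suc j) = r + B_time K (tshift r f) j"
    unfolding B_time_def[of K f] by simp
qed

lemma map_tshift_upt: "map (tshift r f) [a..<b] = map f [r + a..<r + b]"
  by (rule nth_equalityI) (auto simp: add.assoc tshift_apply)

lemma second_excursions:
  shows "1 \<le> j \<Longrightarrow> j \<le> M_count K (tshift r f) \<Longrightarrow> in_exc K f (Suc j) = in_exc K (tshift r f) j"
    and "1 \<le> j \<Longrightarrow> Suc j \<le> M_count K (tshift r f) \<Longrightarrow> out_exc K f (Suc j) = out_exc K (tshift r f) j"
    and "last_exit K f = last_exit K (tshift r f)"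
proof -
  show "in_exc K f (Suc j) = in_exc K (tshift r f) j" if j: "1 \<le> j" "j \<le> M_count K (tshift r f)"
    unfolding in_exc_def second_times[OF j] map_tshift_upt add_Suc_right ..
  show "out_exc K f (Suc j) = out_exc K (tshift r f) j" if j: "1 \<le> j" "Suc j \<le> M_count K (tshift r f)"
  proof -
    have "A_time K f (Suc (Suc j)) = r + A_time K (tshift r f) (Suc j)"
      "B_time K f (Suc j) = r + B_time K (tshift r f) j"
      using second_times[of "Suc j"] second_times[of j] j by auto
    then show ?thesis by (simp add: out_exc_def map_tshift_upt del: upt_Suc)
  qed
  show "last_exit K f = last_exit K (tshift r f)"
    using second_times(2)[of "M_count K (tshift r f)"] M_count_ge1(1)[where f="tshift r f", OF second_start]
    unfolding last_exit_def M_count_second by simp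
qed

text \<open>The bound on \<open>r\<close> rules out truncation in
  \<open>r - B_time K f 1\<close>.\<close>

lemma first_out_exc:
  "out_exc K f 1 = map (tshift (B_time K f 1) f) [0..<Suc (r - B_time K f 1)]" "B_time K f 1 \<le> r"
proof -
  have "Suc (Suc 0) \<le> M_count K f" using M_count_second M_count_ge1(1)[where f="tshift r f", OF second_start] by simp
  moreover have "A_time K f (Suc 1) = r" using R by (simp add: A_time_def)
  ultimately have b: "B_time K f 1 < r" using out_excursion_times(1)[OF f, of 1] by simp
  then show "B_time K f 1 \<le> r" by simp
  show "out_exc K f 1 = map (tshift (B_time K f 1) f) [0..<Suc (r - B_time K f 1)]"
    unfolding out_exc_def \<open>A_time K f (Suc 1) = r\<close> using b by (intro nth_equalityI) (auto simp: tshift_apply simp del: upt_Suc)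
qed

end

lemma Phi_avoid_1: "g \<in> Phi H S \<Longrightarrow> (\<And>\<tau>. \<tau> \<in> H \<Longrightarrow> 3 \<le> length \<tau> \<and> last \<tau> \<in> K \<and>
    (\<forall>t. 0 < t \<and> t < length \<tau> - 1 \<longrightarrow> \<tau> ! t \<notin> K)) \<Longrightarrow> g 1 \<notin> K"
  using Phi_out_iff[of H g S] by blast

text \<open>Each recursion step of \<open>exc\<close> strips one excursion inside and one outside
  \<open>K\<close>; what remains is the trajectory restarted at its second visit, to which the
  induction hypothesis applies. The path conditions make both cuts unique.\<close>

lemma exc_iff:
  assumes "length Fs = Suc (length Hs)"
    and "\<And>F \<tau>. F \<in> set Fs \<Longrightarrow> \<tau> \<in> F \<Longrightarrow> \<tau> \<noteq> [] \<and> set \<tau> \<subseteq> K"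
    and "\<And>H \<tau>. H \<in> set Hs \<Longrightarrow> \<tau> \<in> H \<Longrightarrow> 3 \<le> length \<tau> \<and> last \<tau> \<in> K \<and>
      (\<forall>t. 0 < t \<and> t < length \<tau> - 1 \<longrightarrow> \<tau> ! t \<notin> K)"
  shows "f \<in> exc K Fs Hs B \<longleftrightarrow> f \<in> half_trajs \<and> f 0 \<in> K \<and> M_count K f = length Fs \<and>
    (\<forall>j<length Fs. in_exc K f (Suc j) \<in> Fs ! j) \<and> (\<forall>j<length Hs. out_exc K f (Suc j) \<in> Hs ! j) \<and>
    last_exit K f \<in> B"
  using assms
proof (induction Hs arbitrary: Fs f)
  case Nil
  then obtain F where Fs: "Fs = [F]" by (cases Fs) auto
  let ?b = "B_time K f 1"
  have "f \<in> exc K Fs [] B \<longleftrightarrow> f \<in> half_trajs \<and> f 0 \<in> K \<and> in_exc K f 1 \<in> F \<and> tshift ?b f \<in> B \<inter> no_return K"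
    unfolding Fs exc.simps using Nil.prems(2) Fs by (intro Phi_in_iff) (auto simp: no_return_iff)
  \<comment> \<open>A return after the first excursion is the same as a second visit, so its absence
    leaves exactly one excursion.\<close>
  moreover have "tshift ?b f \<in> no_return K \<longleftrightarrow> M_count K f = 1" if f: "f \<in> half_trajs" "f 0 \<in> K"
  proof -
    have "tshift ?b f \<in> no_return K \<longleftrightarrow> R_time K f (Suc (Suc 0)) = None"
      unfolding R_time_2[OF f] no_return_def using f by (simp add: tshift_half_trajs)
    then show ?thesis using M_count_no_second[OF f] M_count_second[OF f] M_count_ge1(1)[OF second_start[OF f]]
      by (cases "R_time K f (Suc (Suc 0))") fastforce+
  qed
  ultimately show ?case unfolding Fs by (auto simp: last_exit_def)
next
  case (Cons H Hs)
  then obtain F Fs' where Fs: "Fs = F # Fs'" "length Fs' = Suc (length Hs)" by (cases Fs) auto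
  let ?b = "B_time K f 1"
  let ?S = "exc K Fs' Hs B"
  have IH: "g \<in> ?S \<longleftrightarrow> g \<in> half_trajs \<and> g 0 \<in> K \<and> M_count K g = length Fs' \<and>
    (\<forall>j<length Fs'. in_exc K g (Suc j) \<in> Fs' ! j) \<and> (\<forall>j<length Hs. out_exc K g (Suc j) \<in> Hs ! j) \<and>
    last_exit K g \<in> B" for g
  proof (rule Cons.IH[OF Fs(2)])
    show "\<tau> \<noteq> [] \<and> set \<tau> \<subseteq> K" if "F \<in> set Fs'" "\<tau> \<in> F" for F \<tau>
      using that Cons.prems(2)[of F \<tau>] Fs(1) by simp
    show "3 \<le> length \<tau> \<and> last \<tau> \<in> K \<and> (\<forall>t. 0 < t \<and> t < length \<tau> - 1 \<longrightarrow> \<tau> ! t \<notin> K)"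
      if "H \<in> set Hs" "\<tau> \<in> H" for H \<tau>
      using that by (intro Cons.prems(3)[of H \<tau>]) simp_all
  qed
  have H: "3 \<le> length \<tau> \<and> last \<tau> \<in> K \<and> (\<forall>t. 0 < t \<and> t < length \<tau> - 1 \<longrightarrow> \<tau> ! t \<notin> K)"
    if "\<tau> \<in> H" for \<tau> using Cons.prems(3)[of H \<tau>] that by simp
  have "f \<in> exc K Fs (H # Hs) B \<longleftrightarrow>
      f \<in> half_trajs \<and> f 0 \<in> K \<and> in_exc K f 1 \<in> F \<and> tshift ?b f \<in> Phi H ?S"
    unfolding Fs exc.simps
  proof (rule Phi_in_iff)
    show "\<tau> \<noteq> [] \<and> set \<tau> \<subseteq> K" if "\<tau> \<in> F" for \<tau> using Cons.prems(2)[of F] Fs that by simp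
    show "g 1 \<notin> K" if "g \<in> Phi H ?S" for g using that H by (rule Phi_avoid_1)
  qed
  moreover have "tshift ?b f \<in> Phi H ?S \<longleftrightarrow>
      M_count K f = length Fs \<and> (\<forall>j<length Fs'. in_exc K f (Suc (Suc j)) \<in> Fs' ! j) \<and>
      out_exc K f 1 \<in> H \<and> (\<forall>j<length Hs. out_exc K f (Suc (Suc j)) \<in> Hs ! j) \<and> last_exit K f \<in> B"
    if f: "f \<in> half_trajs" "f 0 \<in> K"
  proof -
    have out: "tshift ?b f 1 \<notin> K" using first_in_exc(3)[OF f] by (simp add: tshift_apply)
    \<comment> \<open>Here \<open>r\<close> changes from a return time, counted from the end of the
      first excursion, to the absolute time of the second visit.\<close>
    have "tshift ?b f \<in> Phi H ?S \<longleftrightarrow> (\<exists>r. R_time K f (Suc (Suc 0)) = Some r \<and> out_exc K f 1 \<in> H \<and> tshift r f \<in> ?S)"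
      (is "_ \<longleftrightarrow> ?R")
    proof -
      have "tshift ?b f \<in> Phi H ?S \<longleftrightarrow> (\<exists>r. return_time K (tshift ?b f) = Some r \<and>
          map (tshift ?b f) [0..<Suc r] \<in> H \<and> tshift (?b + r) f \<in> ?S)"
        using Phi_out_iff[where g="tshift ?b f" and S="?S", OF H] out f(1) tshift_half_trajs[OF f(1), of ?b]
        by (simp del: upt_Suc)
      also have "\<dots> \<longleftrightarrow> (\<exists>r\<ge>?b. R_time K f (Suc (Suc 0)) = Some r \<and>
          map (tshift ?b f) [0..<Suc (r - ?b)] \<in> H \<and> tshift r f \<in> ?S)"
        unfolding R_time_2[OF f] by (auto simp: ex_map_conv simp del: upt_Suc)
      also have "\<dots> \<longleftrightarrow> ?R"
        using first_out_exc[OF f] by metis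
      finally show ?thesis .
    qed
    also have "\<dots> \<longleftrightarrow> M_count K f = length Fs \<and> (\<forall>j<length Fs'. in_exc K f (Suc (Suc j)) \<in> Fs' ! j) \<and>
      out_exc K f 1 \<in> H \<and> (\<forall>j<length Hs. out_exc K f (Suc (Suc j)) \<in> Hs ! j) \<and> last_exit K f \<in> B"
    proof (cases "R_time K f (Suc (Suc 0))")
      case None
      then show ?thesis using M_count_no_second[OF f None] Fs by auto
    next
      case (Some r)
      have "tshift r f \<in> ?S \<longleftrightarrow> M_count K f = length Fs \<and> (\<forall>j<length Fs'. in_exc K f (Suc (Suc j)) \<in> Fs' ! j) \<and>
         (\<forall>j<length Hs. out_exc K f (Suc (Suc j)) \<in> Hs ! j) \<and> last_exit K f \<in> B"
        unfolding IH M_count_second[OF f Some] second_excursions(3)[OF f Some]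
        using second_start[OF f Some] second_excursions(1,2)[OF f Some] Fs by auto
      then show ?thesis using Some by auto
    qed
    finally show ?thesis .
  qed
  moreover have "(\<forall>j<length Fs. in_exc K f (Suc j) \<in> Fs ! j) \<longleftrightarrow>
      in_exc K f 1 \<in> F \<and> (\<forall>j<length Fs'. in_exc K f (Suc (Suc j)) \<in> Fs' ! j)"
    "(\<forall>j<length (H # Hs). out_exc K f (Suc j) \<in> (H # Hs) ! j) \<longleftrightarrow>
      out_exc K f 1 \<in> H \<and> (\<forall>j<length Hs. out_exc K f (Suc (Suc j)) \<in> Hs ! j)"
    unfolding Fs length_Cons All_less_Suc2 by simp_all
  ultimately show ?case by blast
qed

end


section \<open>The law of the excursions\<close>

text \<open>An integral against counting measure, so that infinite path sets raise no question of
  summability. For all paths inside \<open>K\<close> between two sites it is the Green function of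
  the walk killed on leaving \<open>K\<close>.\<close>

definition weight :: "('d::finite) site list set \<Rightarrow> ennreal" where
  "weight F = (\<integral>\<^sup>+\<tau>. path_weight \<tau> \<partial>count_space F)"

lemma weight_empty [simp]: "weight {} = 0"
  by (simp add: weight_def nn_integral_count_space)

lemma weight_singleton [simp]: "weight {\<tau>} = path_weight \<tau>"
  by (simp add: weight_def nn_integral_count_space_finite)

lemma Phi_sets [measurable]: "S \<in> sets half_space \<Longrightarrow> Phi F S \<in> sets half_space"
  unfolding Phi_def by (intro sets.countable_UN' cyl_sets) auto

text \<open>\<open>srw_cyl\<close> summed over disjoint cylinders: all paths share the same end
  points, so the continuation contributes one common factor.\<close>

lemma srw_Phi:
  assumes F: "\<And>\<tau>. \<tau> \<in> F \<Longrightarrow> lattice_path \<tau> \<and> hd \<tau> = x \<and> last \<tau> = y"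
    and disj: "disjoint_family_on (\<lambda>\<tau>. cyl \<tau> S) F" and S: "S \<in> sets half_space"
  shows "emeasure (srw x) (Phi F S) = weight F * emeasure (srw y) S"
proof -
  have "emeasure (srw x) (Phi F S) = (\<integral>\<^sup>+\<tau>. emeasure (srw x) (cyl \<tau> S) \<partial>count_space F)"
    unfolding Phi_def using disj S by (intro emeasure_UN_countable) (auto simp: sets_srw cyl_sets)
  also have "\<dots> = (\<integral>\<^sup>+\<tau>. path_weight \<tau> * emeasure (srw y) S \<partial>count_space F)"
  proof (rule nn_integral_cong)
    fix \<tau> assume "\<tau> \<in> space (count_space F)"
    then have "\<tau> \<in> F" by simp
    from F[OF this] have \<tau>: "lattice_path \<tau>" "hd \<tau> = x" "last \<tau> = y" by blast+
    show "emeasure (srw x) (cyl \<tau> S) = path_weight \<tau> * emeasure (srw y) S"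
      using srw_cyl[OF \<tau>(1) S] unfolding \<tau>(2,3) .
  qed
  finally show ?thesis by (simp add: weight_def nn_integral_multc)
qed

lemma cyl_Int_lengths:
  assumes "f \<in> cyl \<tau> S" "f \<in> cyl \<tau>' S'" "length \<tau> = length \<tau>'"
  shows "\<tau> = \<tau>'"
proof -
  have "map f [0..<length \<tau>] = \<tau>" "map f [0..<length \<tau>'] = \<tau>'"
    using assms(1,2) unfolding cyl_def by blast+
  then show ?thesis using assms(3) by argo
qed

lemma in_pathsD:
  assumes "\<tau> \<in> in_paths K x y"
  shows "\<tau> \<noteq> [] \<and> set \<tau> \<subseteq> K" and "lattice_path \<tau> \<and> hd \<tau> = x \<and> last \<tau> = y"
  using assms by (auto simp: in_paths_def path_inside_def lattice_path_def)

lemma out_pathsD: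
  assumes "\<tau> \<in> out_paths K y x" "x \<in> K"
  shows "3 \<le> length \<tau> \<and> last \<tau> \<in> K \<and> (\<forall>t. 0 < t \<and> t < length \<tau> - 1 \<longrightarrow> \<tau> ! t \<notin> K)"
    and "lattice_path \<tau> \<and> hd \<tau> = y \<and> last \<tau> = x"
  using assms by (auto simp: out_paths_def path_outside_def lattice_path_def)

text \<open>If two inner paths began the same trajectory, the shorter one would be followed by a
  step off \<open>K\<close> at a time when the longer one is still inside; hence the cylinders are
  disjoint.\<close>

lemma srw_Phi_in:
  assumes F: "F \<subseteq> in_paths K x y" and S: "S \<in> sets half_space" "\<And>g. g \<in> S \<Longrightarrow> g 1 \<notin> K"
  shows "emeasure (srw x) (Phi F S) = weight F * emeasure (srw y) S"
proof (rule srw_Phi[OF _ _ S(1)])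
  show "lattice_path \<tau> \<and> hd \<tau> = x \<and> last \<tau> = y" if "\<tau> \<in> F" for \<tau>
    using in_pathsD(2) that F by blast
  have len: "\<not> length \<tau> < length \<tau>'" if "\<tau> \<in> F" "\<tau>' \<in> F" "f \<in> cyl \<tau> S" "f \<in> cyl \<tau>' S" for \<tau> \<tau>' f
  proof
    assume l: "length \<tau> < length \<tau>'"
    have "f (length \<tau>) \<notin> K"
      using S(2)[of "tshift (length \<tau> - 1) f"] that(1,3) in_pathsD(1)[of \<tau> K x y] F
      by (auto simp: cyl_def tshift_apply)
    moreover have "f (length \<tau>) = \<tau>' ! length \<tau>"
      using that(4) l by (auto simp: cyl_def map_upt_eq_iff)
    ultimately show False
      using in_pathsD(1)[of \<tau>' K x y] that(2) F nth_mem[OF l] by (metis subsetD)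
  qed
  then show "disjoint_family_on (\<lambda>\<tau>. cyl \<tau> S) F"
    unfolding disjoint_family_on_def using cyl_Int_lengths
    by (metis (no_types, opaque_lifting) disjoint_iff nat_neq_iff)
qed

text \<open>If two outer paths began the same trajectory, the shorter one would end in
  \<open>K\<close> at an interior time of the longer one; hence the cylinders are disjoint.\<close>

lemma srw_Phi_out:
  assumes H: "H \<subseteq> out_paths K y x" and x: "x \<in> K" and S: "S \<in> sets half_space"
  shows "emeasure (srw y) (Phi H S) = weight H * emeasure (srw x) S"
proof (rule srw_Phi[OF _ _ S])
  show "lattice_path \<tau> \<and> hd \<tau> = y \<and> last \<tau> = x" if "\<tau> \<in> H" for \<tau>
    using out_pathsD(2)[OF _ x] that H by blast
  have len: "\<not> length \<tau> < length \<tau>'" if "\<tau> \<in> H" "\<tau>' \<in> H" "f \<in> cyl \<tau> S" "f \<in> cyl \<tau>' S" for \<tau> \<tau>' f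
  proof
    assume l: "length \<tau> < length \<tau>'"
    have t: "3 \<le> length \<tau>" "last \<tau> \<in> K" "\<forall>t. 0 < t \<and> t < length \<tau>' - 1 \<longrightarrow> \<tau>' ! t \<notin> K"
      using out_pathsD(1)[OF _ x] that(1,2) H by blast+
    then have "\<tau> \<noteq> []" by auto
    then have "f (length \<tau> - 1) \<in> K" using that(3) t(2) by (auto simp: cyl_def map_upt_eq_iff last_conv_nth)
    moreover have "f (length \<tau> - 1) = \<tau>' ! (length \<tau> - 1)"
      using that(4) l by (auto simp: cyl_def map_upt_eq_iff)
    ultimately show False using t l by auto
  qed
  then show "disjoint_family_on (\<lambda>\<tau>. cyl \<tau> S) H"
    unfolding disjoint_family_on_def using cyl_Int_lengths
    by (metis (no_types, opaque_lifting) disjoint_iff nat_neq_iff)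
qed

lemma no_return_sets [measurable]: "no_return (K :: ('d::finite) site set) \<in> sets half_space"
proof -
  have "no_return K = {f \<in> space half_space. \<forall>n\<in>{1..}. f n \<notin> K}"
    by (auto simp: no_return_iff)
  also have "\<dots> \<in> sets half_space"
    by (intro sets.sets_Collect_countable_Ball) (auto intro!: measurable_sets_Collect[OF half_coord_measurable])
  finally show ?thesis .
qed

lemma exc_sets: "B \<in> sets half_space \<Longrightarrow> exc K Fs Hs B \<in> sets half_space"
  by (induction K Fs Hs B rule: exc.induct) (auto intro!: Phi_sets sets.Int no_return_sets)

text \<open>The pairs in \<open>c\<close> are the end points of the successive excursions inside \<open>K\<close>.\<close>

definition compatible :: "('d::finite) site set \<Rightarrow> ('d site \<times> 'd site) list \<Rightarrow> 'd site list set list \<Rightarrow>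
    'd site list set list \<Rightarrow> bool" where
  "compatible K c Fs Hs \<longleftrightarrow> length Fs = length c \<and> Suc (length Hs) = length c \<and>
    set c \<subseteq> K \<times> K \<and> (\<forall>j<length c. Fs ! j \<subseteq> in_paths K (fst (c ! j)) (snd (c ! j))) \<and>
    (\<forall>j<length Hs. Hs ! j \<subseteq> out_paths K (snd (c ! j)) (fst (c ! Suc j)))"

text \<open>The Markov property at every end point of an excursion splits the probability into one
  weight per path set. Only the end points prescribed by \<open>c\<close> link neighbouring factors,
  and the last one is followed by escape without return.\<close>

lemma srw_exc:
  assumes "compatible K c Fs Hs" and B: "B \<in> sets half_space"
  shows "emeasure (srw (fst (hd c))) (exc K Fs Hs B) =
    prod_list (map weight Fs) * prod_list (map weight Hs) * emeasure (srw (snd (last c))) (B \<inter> no_return K)"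
  using assms(1)
proof (induction Hs arbitrary: c Fs)
  case Nil
  then obtain p F where c: "c = [p]" "Fs = [F]" "F \<subseteq> in_paths K (fst p) (snd p)"
    by (cases c; cases Fs) (auto simp: compatible_def)
  have "emeasure (srw (fst p)) (Phi F (B \<inter> no_return K)) =
      weight F * emeasure (srw (snd p)) (B \<inter> no_return K)"
    using c(3) B by (intro srw_Phi_in) (auto simp: no_return_iff no_return_sets)
  then show ?case by (simp add: c)
next
  case (Cons H Hs)
  obtain p c' F Fs' where c: "c = p # c'" "Fs = F # Fs'"
    using Cons.prems by (cases c; cases Fs) (auto simp: compatible_def)
  have ne: "c' \<noteq> []" and x: "fst (hd c') \<in> K"
    using Cons.prems by (cases c'; auto simp: compatible_def c)+
  have F: "F \<subseteq> in_paths K (fst p) (snd p)" and H: "H \<subseteq> out_paths K (snd p) (fst (hd c'))"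
    using Cons.prems ne unfolding compatible_def c by (force simp: hd_conv_nth)+
  have "compatible K c' Fs' Hs"
    using Cons.prems unfolding compatible_def c by (auto simp: All_less_Suc2)
  note IH = Cons.IH[OF this]
  let ?S = "exc K Fs' Hs B"
  have S: "?S \<in> sets half_space" by (rule exc_sets[OF B])
  \<comment> \<open>An outer path of at least three sites has site 1 off \<open>K\<close>; this is
    the condition under which the preceding inner path can be cut off uniquely.\<close>
  have out: "g 1 \<notin> K" if "g \<in> Phi H ?S" for g
  proof -
    obtain \<tau> where \<tau>: "\<tau> \<in> H" "g \<in> cyl \<tau> ?S" using \<open>g \<in> Phi H ?S\<close> by (auto simp: Phi_def)
    with out_pathsD(1)[OF subsetD[OF H \<tau>(1)] x] have "g 1 = \<tau> ! 1" "\<tau> ! 1 \<notin> K"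
      by (auto simp: cyl_def map_upt_eq_iff)
    then show ?thesis by simp
  qed
  have "emeasure (srw (fst p)) (Phi F (Phi H ?S)) = weight F * (weight H * emeasure (srw (fst (hd c'))) ?S)"
    unfolding srw_Phi_out[OF H x S, symmetric]
  proof (rule srw_Phi_in[OF F])
    show "Phi H ?S \<in> sets half_space" by (rule Phi_sets[OF S])
  qed (rule out)
  then show ?case using IH ne by (simp add: c mult_ac)
qed


section \<open>Doubly infinite trajectories\<close>

definition fwd :: "(int \<Rightarrow> 'a) \<Rightarrow> nat \<Rightarrow> 'a" where
  "fwd w = (\<lambda>n. w (int n))"

text \<open>The carrier of \<open>Q_K\<close> up to null sets, and the set from which
  \<open>X_traj\<close> takes its representatives.\<close>

definition canon :: "('d::finite) site set \<Rightarrow> (int \<Rightarrow> 'd site) set" where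
  "canon K = {w \<in> full_trajs. w 0 \<in> K \<and> (\<forall>t<0. w t \<notin> K)}"

lemma fwd_half: "w \<in> full_trajs \<Longrightarrow> fwd w \<in> half_trajs"
proof -
  assume w: "w \<in> full_trajs"
  have "filterlim (\<lambda>n. norm1 (w (int n))) at_top at_top"
    using w filterlim_compose[OF _ filterlim_int_sequentially] by (auto simp: full_trajs_def)
  moreover have "adj (w (int n)) (w (int (Suc n)))" for n
    using w unfolding full_trajs_def by (auto simp: add.commute)
  ultimately show ?thesis by (simp add: half_trajs_def fwd_def)
qed

lemma X_minus_half: "w \<in> full_trajs \<Longrightarrow> X_minus w \<in> half_trajs"
proof -
  assume w: "w \<in> full_trajs"
  have "filterlim (\<lambda>n. - int n) at_bot sequentially"
    unfolding filterlim_at_bot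
  proof
    fix Z :: int
    show "eventually (\<lambda>n. - int n \<le> Z) sequentially"
      using eventually_ge_at_top[of "nat (- Z)"] by eventually_elim linarith
  qed
  then have "filterlim (\<lambda>n. norm1 (w (- int n))) at_top at_top"
    using w filterlim_compose by (fastforce simp: full_trajs_def)
  moreover have "adj (w (- int n)) (w (- int (Suc n)))" for n
  proof -
    have "adj (w (- int (Suc n))) (w (- int (Suc n) + 1))" using w unfolding full_trajs_def by blast
    then show ?thesis by (subst adj_commute) simp
  qed
  ultimately show ?thesis by (simp add: half_trajs_def X_minus_def)
qed

lemma full_coord_measurable [measurable]: "(\<lambda>w. w i) \<in> full_space \<rightarrow>\<^sub>M count_space UNIV"
  unfolding full_space_def by (rule measurable_restrict_space1) simp

lemma full_coord_Collect: "{w \<in> full_trajs. R (w i)} \<in> sets full_space"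
  using measurable_sets_Collect[OF full_coord_measurable, of R i] by simp

lemma fwd_measurable [measurable]: "fwd \<in> full_space \<rightarrow>\<^sub>M half_space"
  unfolding half_space_def
proof (rule measurable_restrict_space2)
  show "fwd \<in> full_space \<rightarrow>\<^sub>M coord_space"
    unfolding fwd_def by (rule measurable_PiM_single') auto
qed (auto intro: fwd_half)

lemma X_minus_measurable [measurable]: "X_minus \<in> full_space \<rightarrow>\<^sub>M half_space"
  unfolding half_space_def
proof (rule measurable_restrict_space2)
  show "X_minus \<in> full_space \<rightarrow>\<^sub>M coord_space"
    unfolding X_minus_def by (rule measurable_PiM_single') auto
qed (auto intro: X_minus_half)

definition time_shift :: "int \<Rightarrow> (int \<Rightarrow> 'a) \<Rightarrow> int \<Rightarrow> 'a" where
  "time_shift k w = (\<lambda>n. w (n + k))"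

lemma time_shift_full: "w \<in> full_trajs \<Longrightarrow> time_shift k w \<in> full_trajs"
proof -
  assume w: "w \<in> full_trajs"
  have top: "filterlim (\<lambda>n. n + k) at_top (at_top :: int filter)"
    unfolding filterlim_at_top
  proof
    fix Z
    show "eventually (\<lambda>n. Z \<le> n + k) at_top"
      using eventually_ge_at_top[of "Z - k"] by eventually_elim linarith
  qed
  have bot: "filterlim (\<lambda>n. n + k) at_bot (at_bot :: int filter)"
    unfolding filterlim_at_bot
  proof
    fix Z
    show "eventually (\<lambda>n. n + k \<le> Z) at_bot"
      using eventually_le_at_bot[of "Z - k"] by eventually_elim linarith
  qed
  have "filterlim (\<lambda>n. norm1 (w (n + k))) at_top at_top" "filterlim (\<lambda>n. norm1 (w (n + k))) at_top at_bot"
    using w filterlim_compose[OF _ top] filterlim_compose[OF _ bot] by (auto simp: full_trajs_def)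
  moreover have "adj (w (n + k)) (w (n + 1 + k))" for n
    using w unfolding full_trajs_def by (auto simp: algebra_simps dest: spec[of _ "n + k"])
  ultimately show ?thesis by (simp add: full_trajs_def time_shift_def)
qed

lemma time_shift_measurable [measurable]: "time_shift k \<in> full_space \<rightarrow>\<^sub>M full_space"
proof -
  have "time_shift k \<in> full_space \<rightarrow>\<^sub>M restrict_space coord_space full_trajs"
  proof (rule measurable_restrict_space2)
    show "time_shift k \<in> full_space \<rightarrow>\<^sub>M coord_space"
      unfolding time_shift_def by (rule measurable_PiM_single') auto
  qed (auto intro: time_shift_full)
  then show ?thesis by (simp add: full_space_def)
qed

lemma canon_sets [measurable]: "canon (K :: ('d::finite) site set) \<in> sets full_space"
proof -
  have "{w \<in> space full_space. w 0 \<in> K} \<in> sets full_space"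
    using full_coord_Collect by simp
  moreover have "{w \<in> space full_space. \<forall>t\<in>{..<0}. w t \<notin> K} \<in> sets full_space"
    by (intro sets.sets_Collect_countable_Ball) (auto intro!: full_coord_Collect)
  moreover have "canon K = {w \<in> space full_space. w 0 \<in> K} \<inter> {w \<in> space full_space. \<forall>t\<in>{..<0}. w t \<notin> K}"
    by (auto simp: canon_def)
  ultimately show ?thesis by simp
qed

text \<open>\<open>LEAST\<close> on the integers is informative only for sets bounded below; a
  property failing at all negative times has the same first time on either axis.\<close>

lemma first_int:
  assumes "\<And>n. n < 0 \<Longrightarrow> \<not> Q n"
  shows "first Q = map_option int (first (\<lambda>n. Q (int n)))"
proof (cases "first (\<lambda>n. Q (int n))")
  case None
  then have "\<not> Q n" for n
    using assms[of n] by (cases n) (auto simp: first_eq_None_iff)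
  then have "first Q = None" unfolding first_eq_None_iff by blast
  then show ?thesis using None by simp
next
  case (Some m)
  then have m: "Q (int m)" "\<And>k. k < m \<Longrightarrow> \<not> Q (int k)" by (auto simp: first_eq_Some_iff)
  have "(LEAST n. Q n) = int m"
  proof (rule Least_equality)
    show "Q (int m)" by (rule m(1))
    fix n assume "Q n"
    then show "int m \<le> n"
      using assms[of n] m(2)[of "nat n"] by (cases "n < 0"; cases "nat n < m") (auto simp: nat_le_iff)
  qed
  then show ?thesis using Some m(1) by (auto simp: first_def)
qed

lemma first_after_int:
  "first_after (map_option int X) Q = map_option int (first_after X (\<lambda>n. Q (int n)))"
  by (cases X) (simp_all add: first_after_Some first_int)

lemma map_upto_int: "map w [int a..int b] = map (fwd w) [a..<Suc b]"
  by (rule nth_equalityI) (auto simp: fwd_def nth_append simp del: upt_Suc)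

context
  fixes K :: "('d::finite) site set"
  assumes finK: "finite K"
begin

lemma fwd_start:
  assumes "w \<in> canon K"
  shows "fwd w \<in> half_trajs" "fwd w 0 \<in> K"
  using assms fwd_half by (auto simp: canon_def fwd_def)

text \<open>A canonical trajectory has no visit before time 0, so nothing is lost by restricting it
  to the half line.\<close>

lemma R_time_fwd: "w \<in> canon K \<Longrightarrow> R_time K w j = map_option int (R_time K (fwd w) j)"
proof (induction K w j rule: R_time.induct)
  case (2 K w)
  then show ?case using first_int[of "\<lambda>n. w n \<in> K"] by (simp add: canon_def fwd_def)
qed (simp_all add: first_after_int fwd_def)

lemma M_count_fwd: "w \<in> canon K \<Longrightarrow> M_count K w = M_count K (fwd w)"
  by (simp add: M_count_def R_time_fwd)

text \<open>The departure time is a successor, so subtracting 1 gives the same result on the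
  naturals, where subtraction truncates, as on the integers.\<close>

lemma AB_time_fwd:
  assumes w: "w \<in> canon K" and j: "1 \<le> j" "j \<le> M_count K w"
  shows "A_time K w j = int (A_time K (fwd w) j)" and "B_time K w j = int (B_time K (fwd w) j)"
proof -
  note t = excursion_times[OF finK fwd_start[OF w] j(1), unfolded M_count_fwd[OF w, symmetric], OF j(2)]
  show "A_time K w j = int (A_time K (fwd w) j)"
    unfolding A_time_def[of K w] R_time_fwd[OF w] t(5) by simp
  have "D_time K w j = map_option int (D_time K (fwd w) j)"
    unfolding D_time_def R_time_fwd[OF w] by (simp add: first_after_int fwd_def)
  then show "B_time K w j = int (B_time K (fwd w) j)"
    unfolding B_time_def[of K w] t(4) by simp
qed

lemma excursions_fwd:
  assumes w: "w \<in> canon K"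
  shows "1 \<le> j \<Longrightarrow> j \<le> M_count K w \<Longrightarrow> X_in K w j = in_exc K (fwd w) j"
    and "1 \<le> j \<Longrightarrow> Suc j \<le> M_count K w \<Longrightarrow> X_out K w j = out_exc K (fwd w) j"
    and "X_plus K w = last_exit K (fwd w)"
proof -
  show "X_in K w j = in_exc K (fwd w) j" if "1 \<le> j" "j \<le> M_count K w"
    unfolding X_in_def in_exc_def AB_time_fwd[OF w that] map_upto_int ..
  show "X_out K w j = out_exc K (fwd w) j" if "1 \<le> j" "Suc j \<le> M_count K w"
  proof -
    have "A_time K w (Suc j) = int (A_time K (fwd w) (Suc j))"
      using that by (intro AB_time_fwd[OF w]) auto
    moreover have "B_time K w j = int (B_time K (fwd w) j)"
      using that by (intro AB_time_fwd[OF w]) auto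
    ultimately show ?thesis unfolding X_out_def out_exc_def by (simp only: map_upto_int)
  qed
  have "1 \<le> M_count K w"
    unfolding M_count_fwd[OF w] by (rule M_count_ge1(1)[OF finK fwd_start[OF w]])
  then show "X_plus K w = last_exit K (fwd w)"
    unfolding X_plus_def last_exit_def using AB_time_fwd(2)[OF w, of "M_count K w"] M_count_fwd[OF w]
    by (auto simp: tshift_def fwd_def add.commute)
qed

lemma M_count_canon_ge1: "w \<in> canon K \<Longrightarrow> 1 \<le> M_count K w"
  unfolding M_count_fwd using M_count_ge1(1)[OF finK fwd_start] .

end

section \<open>Excursion data and measurability\<close>

definition in_data :: "('d::finite) site set \<Rightarrow> (int \<Rightarrow> 'd site) \<Rightarrow> 'd site list list" where
  "in_data K w = map (X_in K w) [1..<Suc (M_count K w)]"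

definition out_data :: "('d::finite) site set \<Rightarrow> (int \<Rightarrow> 'd site) \<Rightarrow> 'd site list list" where
  "out_data K w = map (X_out K w) [1..<M_count K w]"

lemma map_upt1_eq_iff:
  "map g [1..<Suc m] = xs \<longleftrightarrow> m = length xs \<and> (\<forall>j<length xs. g (Suc j) = xs ! j)"
  by (auto simp: list_eq_iff_nth_eq simp del: upt_Suc)

lemma in_data_eq_iff:
  "in_data K w = a \<longleftrightarrow> M_count K w = length a \<and> (\<forall>j<length a. X_in K w (Suc j) = a ! j)"
  unfolding in_data_def by (rule map_upt1_eq_iff)

lemma out_data_eq_iff:
  "1 \<le> M_count K w \<Longrightarrow> out_data K w = b \<longleftrightarrow>
    M_count K w = Suc (length b) \<and> (\<forall>j<length b. X_out K w (Suc j) = b ! j)"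
  unfolding out_data_def using map_upt1_eq_iff[of "X_out K w" _ b] by (cases "M_count K w") (simp_all del: upt_Suc)

text \<open>\<open>c\<close> prescribes the end points of all the excursions inside \<open>K\<close>.\<close>

definition ends :: "('d::finite) site set \<Rightarrow> ('d site \<times> 'd site) list \<Rightarrow>
    ('t::{linorder,minus,one} \<Rightarrow> 'd site) \<Rightarrow> bool" where
  "ends K c w \<longleftrightarrow> M_count K w = length c \<and>
    (\<forall>j<length c. w (A_time K w (Suc j)) = fst (c ! j) \<and> w (B_time K w (Suc j)) = snd (c ! j))"

definition exc_event :: "('d::finite) site set \<Rightarrow> 'd site list set list \<Rightarrow> 'd site list set list \<Rightarrow>
    (nat \<Rightarrow> 'd site) set \<Rightarrow> (nat \<Rightarrow> 'd site) set \<Rightarrow> (int \<Rightarrow> 'd site) set" where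
  "exc_event K Fs Hs A B = {w. M_count K w = length Fs \<and> (\<forall>j<length Fs. X_in K w (Suc j) \<in> Fs ! j) \<and>
    (\<forall>j<length Hs. X_out K w (Suc j) \<in> Hs ! j) \<and> X_minus w \<in> A \<and> X_plus K w \<in> B}"

definition all_in :: "('d::finite) site set \<Rightarrow> ('d site \<times> 'd site) list \<Rightarrow> 'd site list set list" where
  "all_in K c = map (\<lambda>p. in_paths K (fst p) (snd p)) c"

definition all_out :: "('d::finite) site set \<Rightarrow> ('d site \<times> 'd site) list \<Rightarrow> 'd site list set list" where
  "all_out K c = map (\<lambda>j. out_paths K (snd (c ! j)) (fst (c ! Suc j))) [0..<length c - 1]"

lemma all_in_simps [simp]:
  "length (all_in K c) = length c"
  "j < length c \<Longrightarrow> all_in K c ! j = in_paths K (fst (c ! j)) (snd (c ! j))"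
  by (simp_all add: all_in_def)

lemma all_out_simps [simp]:
  "length (all_out K c) = length c - 1"
  "j < length c - 1 \<Longrightarrow> all_out K c ! j = out_paths K (snd (c ! j)) (fst (c ! Suc j))"
  by (simp_all add: all_out_def)

text \<open>A path determines its own end points, so prescribing end points amounts to prescribing a
  class of paths.\<close>

lemma in_paths_unique: "\<tau> \<in> in_paths K x y \<Longrightarrow> \<tau> \<in> in_paths K x' y' \<Longrightarrow> x = x' \<and> y = y'"
  by (auto simp: in_paths_def path_inside_def)

lemma compatible_all: "c \<noteq> [] \<Longrightarrow> set c \<subseteq> K \<times> K \<Longrightarrow> compatible K c (all_in K c) (all_out K c)"
  by (auto simp: compatible_def)

lemma compatible_exc_conditions:
  assumes "compatible K c Fs Hs"
  shows "length Fs = Suc (length Hs)"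
    and "F \<in> set Fs \<Longrightarrow> \<tau> \<in> F \<Longrightarrow> \<tau> \<noteq> [] \<and> set \<tau> \<subseteq> K"
    and "H \<in> set Hs \<Longrightarrow> \<tau> \<in> H \<Longrightarrow> 3 \<le> length \<tau> \<and> last \<tau> \<in> K \<and>
      (\<forall>t. 0 < t \<and> t < length \<tau> - 1 \<longrightarrow> \<tau> ! t \<notin> K)"
proof -
  show "length Fs = Suc (length Hs)" using assms by (simp add: compatible_def)
  show "\<tau> \<noteq> [] \<and> set \<tau> \<subseteq> K" if F: "F \<in> set Fs" "\<tau> \<in> F"
  proof -
    obtain j where "j < length Fs" "F = Fs ! j" using F(1) by (metis in_set_conv_nth)
    then have "\<tau> \<in> in_paths K (fst (c ! j)) (snd (c ! j))"
      using assms F(2) by (auto simp: compatible_def)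
    then show ?thesis by (rule in_pathsD(1))
  qed
  show "3 \<le> length \<tau> \<and> last \<tau> \<in> K \<and> (\<forall>t. 0 < t \<and> t < length \<tau> - 1 \<longrightarrow> \<tau> ! t \<notin> K)"
    if H: "H \<in> set Hs" "\<tau> \<in> H"
  proof -
    obtain j where j: "j < length Hs" "H = Hs ! j" using H(1) by (metis in_set_conv_nth)
    then have "\<tau> \<in> out_paths K (snd (c ! j)) (fst (c ! Suc j))"
      using assms H(2) by (auto simp: compatible_def)
    moreover have "c ! Suc j \<in> K \<times> K"
      using assms j(1) nth_mem[of "Suc j" c] by (auto simp: compatible_def)
    then have "fst (c ! Suc j) \<in> K" by auto
    ultimately show ?thesis by (rule out_pathsD(1))
  qed
qed

context
  fixes K :: "('d::finite) site set"
  assumes finK: "finite K"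
begin

text \<open>The end points of inner excursions are read off the paths themselves, and outer
  excursions run between consecutive inner ones. Hence the requirement on outer paths is automatic
  once the end points are right.\<close>

lemma ends_iff:
  assumes f: "f \<in> half_trajs" "f 0 \<in> K"
  shows "ends K c f \<longleftrightarrow> M_count K f = length c \<and> (\<forall>j<length c. in_exc K f (Suc j) \<in> all_in K c ! j) \<and>
    (\<forall>j<length (all_out K c). out_exc K f (Suc j) \<in> all_out K c ! j)"
proof (cases "M_count K f = length c")
  case True
  have "in_exc K f (Suc j) \<in> in_paths K (f (A_time K f (Suc j))) (f (B_time K f (Suc j)))" if "j < length c" for j
    using that True by (intro in_exc_path[OF finK f]) auto
  then have "f (A_time K f (Suc j)) = fst (c ! j) \<and> f (B_time K f (Suc j)) = snd (c ! j) \<longleftrightarrow>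
      in_exc K f (Suc j) \<in> all_in K c ! j" if "j < length c" for j
    using that in_paths_unique by (metis all_in_simps(2))
  moreover have "out_exc K f (Suc j) \<in> all_out K c ! j" if "j < length c - 1"
      "\<forall>j<length c. f (A_time K f (Suc j)) = fst (c ! j) \<and> f (B_time K f (Suc j)) = snd (c ! j)" for j
  proof -
    have "out_exc K f (Suc j) \<in> out_paths K (f (B_time K f (Suc j))) (f (A_time K f (Suc (Suc j))))"
      using that True by (intro out_exc_path[OF finK f]) auto
    then show ?thesis using that by simp
  qed
  ultimately show ?thesis using True by (auto simp: ends_def)
qed (simp add: ends_def)

lemma ends_fwd:
  assumes w: "w \<in> canon K"
  shows "ends K c w \<longleftrightarrow> ends K c (fwd w)"
proof (cases "M_count K w = length c")
  case True
  then have "A_time K w (Suc j) = int (A_time K (fwd w) (Suc j)) \<and> B_time K w (Suc j) = int (B_time K (fwd w) (Suc j))"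
    if "j < length c" for j
    using that AB_time_fwd[OF finK w, of "Suc j"] by simp
  then show ?thesis using M_count_fwd[OF finK w] by (simp add: ends_def fwd_def)
qed (use M_count_fwd[OF finK w] in \<open>simp add: ends_def\<close>)

lemma exc_event_iff:
  assumes w: "w \<in> canon K" and len: "length Fs = Suc (length Hs)"
    and "\<And>F \<tau>. F \<in> set Fs \<Longrightarrow> \<tau> \<in> F \<Longrightarrow> \<tau> \<noteq> [] \<and> set \<tau> \<subseteq> K"
    and "\<And>H \<tau>. H \<in> set Hs \<Longrightarrow> \<tau> \<in> H \<Longrightarrow> 3 \<le> length \<tau> \<and> last \<tau> \<in> K \<and>
      (\<forall>t. 0 < t \<and> t < length \<tau> - 1 \<longrightarrow> \<tau> ! t \<notin> K)"
  shows "w \<in> exc_event K Fs Hs A B \<longleftrightarrow> X_minus w \<in> A \<and> fwd w \<in> exc K Fs Hs B"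
proof -
  have E: "fwd w \<in> exc K Fs Hs B \<longleftrightarrow> fwd w \<in> half_trajs \<and> fwd w 0 \<in> K \<and> M_count K (fwd w) = length Fs \<and>
    (\<forall>j<length Fs. in_exc K (fwd w) (Suc j) \<in> Fs ! j) \<and> (\<forall>j<length Hs. out_exc K (fwd w) (Suc j) \<in> Hs ! j) \<and>
    last_exit K (fwd w) \<in> B"
    by (rule exc_iff[OF finK len assms(3,4)])
  show ?thesis
  proof (cases "M_count K w = length Fs")
  case True
  have "X_in K w (Suc j) = in_exc K (fwd w) (Suc j)" if "j < length Fs" for j
    using that True by (intro excursions_fwd(1)[OF finK w]) auto
  moreover have "X_out K w (Suc j) = out_exc K (fwd w) (Suc j)" if "j < length Hs" for j
    using that True len by (intro excursions_fwd(2)[OF finK w]) auto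
  ultimately show ?thesis
    unfolding E exc_event_def
    using fwd_start[OF finK w] excursions_fwd(3)[OF finK w] M_count_fwd[OF finK w] by auto
next
  case False
  then show ?thesis
    unfolding E exc_event_def using M_count_fwd[OF finK w] by auto
  qed
qed

lemma ends_exc_event:
  assumes w: "w \<in> canon K" and c: "c \<noteq> []"
  shows "ends K c w \<longleftrightarrow> w \<in> exc_event K (all_in K c) (all_out K c) half_trajs half_trajs"
proof (cases "M_count K w = length c")
  case True
  have "X_in K w (Suc j) = in_exc K (fwd w) (Suc j)" if "j < length c" for j
    using that True by (intro excursions_fwd(1)[OF finK w]) auto
  moreover have "X_out K w (Suc j) = out_exc K (fwd w) (Suc j)" if "j < length (all_out K c)" for j
    using that True by (intro excursions_fwd(2)[OF finK w]) auto
  moreover have "X_minus w \<in> half_trajs" "X_plus K w \<in> half_trajs"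
    using w X_minus_half fwd_start[OF finK w] unfolding excursions_fwd(3)[OF finK w] last_exit_def
    by (auto simp: canon_def intro: tshift_half_trajs)
  ultimately show ?thesis
    unfolding ends_fwd[OF w] ends_iff[OF fwd_start[OF finK w]] exc_event_def
    using M_count_fwd[OF finK w] by auto
next
  case False
  then show ?thesis
    unfolding ends_fwd[OF w] ends_def exc_event_def using M_count_fwd[OF finK w] by simp
qed

text \<open>Fixed lists turn the event into a condition on the past together with one on the future,
  and the latter has the form \<open>exc\<close>, whose measurability is known.\<close>

lemma in_out_data_event_sets:
  assumes A: "A \<in> sets half_space" and B: "B \<in> sets half_space"
  shows "{w \<in> canon K. in_data K w = a \<and> out_data K w = b \<and> X_minus w \<in> A \<and> X_plus K w \<in> B} \<in> sets full_space"
    (is "?L \<in> _")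
proof (cases "length a = Suc (length b)")
  case False
  have "?L = {}"
  proof (rule equals0I)
    fix w assume "w \<in> ?L"
    note * = CollectD[OF this]
    have w: "w \<in> canon K" "in_data K w = a" "out_data K w = b"
      by (rule *[THEN conjunct1], rule *[THEN conjunct2, THEN conjunct1],
          rule *[THEN conjunct2, THEN conjunct2, THEN conjunct1])
    have "M_count K w = length a" using w(2) unfolding in_data_eq_iff by (rule conjunct1)
    moreover have "M_count K w = Suc (length b)"
      using w(3) unfolding out_data_eq_iff[OF M_count_canon_ge1[OF finK w(1)]] by (rule conjunct1)
    ultimately show False using False by simp
  qed
  then show ?thesis by (simp only: sets.empty_sets)
next
  case True
  \<comment> \<open>Intersecting each singleton with the admissible paths makes the side conditions
    of \<open>exc_iff\<close> hold for arbitrary lists \<open>a\<close> and \<open>b\<close>. The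
    excursions of a trajectory are admissible anyway, so the event does not change.\<close>
  let ?Fs = "map (\<lambda>\<tau>. {\<tau>} \<inter> {\<tau>. \<tau> \<noteq> [] \<and> set \<tau> \<subseteq> K}) a"
  let ?Hs = "map (\<lambda>\<tau>. {\<tau>} \<inter> {\<tau>. 3 \<le> length \<tau> \<and> last \<tau> \<in> K \<and>
      (\<forall>t. 0 < t \<and> t < length \<tau> - 1 \<longrightarrow> \<tau> ! t \<notin> K)}) b"
  have eq: "w \<in> ?L \<longleftrightarrow> X_minus w \<in> A \<and> fwd w \<in> exc K ?Fs ?Hs B" if w: "w \<in> canon K" for w
  proof -
    have inK: "X_in K w (Suc j) \<in> {\<tau>. \<tau> \<noteq> [] \<and> set \<tau> \<subseteq> K}" if "j < M_count K w" for j
    proof -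
      have eq: "X_in K w (Suc j) = in_exc K (fwd w) (Suc j)"
        using that by (intro excursions_fwd(1)[OF finK w]) auto
      have "in_exc K (fwd w) (Suc j) \<in> in_paths K (fwd w (A_time K (fwd w) (Suc j))) (fwd w (B_time K (fwd w) (Suc j)))"
        using that M_count_fwd[OF finK w] by (intro in_exc_path[OF finK fwd_start[OF finK w]]) auto
      from in_pathsD(1)[OF this] show ?thesis unfolding eq mem_Collect_eq .
    qed
    have outK: "3 \<le> length (X_out K w (Suc j)) \<and> last (X_out K w (Suc j)) \<in> K \<and>
      (\<forall>t. 0 < t \<and> t < length (X_out K w (Suc j)) - 1 \<longrightarrow> X_out K w (Suc j) ! t \<notin> K)" if "Suc j < M_count K w" for j
    proof -
      have eq: "X_out K w (Suc j) = out_exc K (fwd w) (Suc j)"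
        using that by (intro excursions_fwd(2)[OF finK w]) auto
      have "out_exc K (fwd w) (Suc j) \<in> out_paths K (fwd w (B_time K (fwd w) (Suc j))) (fwd w (A_time K (fwd w) (Suc (Suc j))))"
        using that M_count_fwd[OF finK w] by (intro out_exc_path[OF finK fwd_start[OF finK w]]) auto
      moreover have "fwd w (A_time K (fwd w) (Suc (Suc j))) \<in> K"
        using that M_count_fwd[OF finK w] by (intro out_excursion_times(3)[OF finK fwd_start[OF finK w]]) auto
      ultimately show ?thesis unfolding eq by (rule out_pathsD(1))
    qed
    have L: "w \<in> ?L \<longleftrightarrow> (M_count K w = length a \<and> (\<forall>j<length a. X_in K w (Suc j) = a ! j)) \<and>
        (M_count K w = Suc (length b) \<and> (\<forall>j<length b. X_out K w (Suc j) = b ! j)) \<and> X_minus w \<in> A \<and> X_plus K w \<in> B"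
      unfolding mem_Collect_eq in_data_eq_iff out_data_eq_iff[OF M_count_canon_ge1[OF finK w]] using w by (simp only: simp_thms)
    have "w \<in> ?L \<longleftrightarrow> w \<in> exc_event K ?Fs ?Hs A B"
    proof (cases "M_count K w = length a")
      case M: True
      have 1: "(\<forall>j<length a. X_in K w (Suc j) = a ! j) \<longleftrightarrow> (\<forall>j<length a. X_in K w (Suc j) \<in> ?Fs ! j)"
      proof (rule all_cong)
        fix j assume j: "j < length a"
        then have "j < M_count K w" using M by simp
        from inK[OF this] show "X_in K w (Suc j) = a ! j \<longleftrightarrow> X_in K w (Suc j) \<in> ?Fs ! j"
          unfolding nth_map[OF j] Int_iff singleton_iff by blast
      qed
      have 2: "(\<forall>j<length b. X_out K w (Suc j) = b ! j) \<longleftrightarrow> (\<forall>j<length b. X_out K w (Suc j) \<in> ?Hs ! j)"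
      proof (rule all_cong)
        fix j assume j: "j < length b"
        then have "Suc j < M_count K w" using M True by simp
        from outK[OF this] show "X_out K w (Suc j) = b ! j \<longleftrightarrow> X_out K w (Suc j) \<in> ?Hs ! j"
          unfolding nth_map[OF j] Int_iff singleton_iff mem_Collect_eq by blast
      qed
      have "M_count K w = Suc (length b)" using M True by simp
      then show ?thesis unfolding L unfolding exc_event_def mem_Collect_eq length_map 1 2 by blast
    next
      case False
      then show ?thesis unfolding L unfolding exc_event_def mem_Collect_eq length_map by blast
    qed
    also have "\<dots> \<longleftrightarrow> X_minus w \<in> A \<and> fwd w \<in> exc K ?Fs ?Hs B"
      using True by (intro exc_event_iff[OF w]) auto
    finally show ?thesis .
  qed
  have "?L = canon K \<inter> (X_minus -` A \<inter> space full_space) \<inter> (fwd -` exc K ?Fs ?Hs B \<inter> space full_space)"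
    using eq by (auto simp: canon_def)
  then show ?thesis
    using measurable_sets[OF X_minus_measurable A] measurable_sets[OF fwd_measurable exc_sets[OF B]] canon_sets[of K]
    by simp
qed

text \<open>Pairs of lists of paths form a countable type, so an arbitrary relation \<open>R\<close>
  between inner and outer data only gives a countable union.\<close>

lemma canon_data_sets:
  assumes A: "A \<in> sets half_space" and B: "B \<in> sets half_space"
  shows "{w \<in> canon K. R (in_data K w) (out_data K w) \<and> X_minus w \<in> A \<and> X_plus K w \<in> B} \<in> sets full_space"
proof -
  have "{w \<in> canon K. R (in_data K w) (out_data K w) \<and> X_minus w \<in> A \<and> X_plus K w \<in> B} =
    (\<Union>p\<in>{p. R (fst p) (snd p)}. {w \<in> canon K. in_data K w = fst p \<and> out_data K w = snd p \<and>
      X_minus w \<in> A \<and> X_plus K w \<in> B})" (is "?U = (\<Union>p\<in>_. ?V p)")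
  proof (intro equalityI subsetI)
    fix w assume "w \<in> ?U"
    then show "w \<in> (\<Union>p\<in>{p. R (fst p) (snd p)}. ?V p)"
      by (intro UN_I[of "(in_data K w, out_data K w)"]) simp_all
  qed (elim UN_E, simp)
  also have "\<dots> \<in> sets full_space"
    by (rule sets.countable_UN''[OF countableI_type in_out_data_event_sets[OF A B]])
  finally show ?thesis .
qed

lemma X_plus_half: "w \<in> canon K \<Longrightarrow> X_plus K w \<in> half_trajs"
  using excursions_fwd(3)[OF finK] fwd_start(1)[OF finK] by (simp add: last_exit_def tshift_half_trajs)

end


section \<open>Trajectories modulo time shift\<close>

lemma shift_rel_iff:
  "(w, w') \<in> shift_rel \<longleftrightarrow> w \<in> full_trajs \<and> (\<exists>k. w' = time_shift k w)"
  using time_shift_full[of w] by (auto simp: shift_rel_def time_shift_def fun_eq_iff[symmetric])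

lemma time_shift_time_shift [simp]: "time_shift k (time_shift l w) = time_shift (k + l) w"
  by (simp add: time_shift_def add.assoc)

lemma time_shift_0 [simp]: "time_shift 0 w = w"
  by (simp add: time_shift_def)

lemma proj_star_eq: "w \<in> full_trajs \<Longrightarrow> proj_star w = range (\<lambda>k. time_shift k w)"
  by (auto simp: proj_star_def shift_rel_iff)

lemma proj_star_time_shift:
  assumes "w \<in> full_trajs"
  shows "proj_star (time_shift k w) = proj_star w"
proof -
  have *: "time_shift l w = time_shift (l - k) (time_shift k w)" for l by simp
  have "range (\<lambda>l. time_shift l w) = range (\<lambda>l. time_shift l (time_shift k w))"
  proof (intro equalityI subsetI)
    fix v assume "v \<in> range (\<lambda>l. time_shift l w)"
    then obtain l where "v = time_shift l w" by blast
    then have "v = time_shift (l - k) (time_shift k w)" using *[of l] by (rule trans)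
    then show "v \<in> range (\<lambda>l. time_shift l (time_shift k w))" by blast
  qed auto
  then show ?thesis using assms by (simp only: proj_star_eq time_shift_full)
qed

lemma proj_star_mem: "w \<in> full_trajs \<Longrightarrow> w \<in> proj_star w"
  unfolding proj_star_eq by (rule range_eqI[of _ _ 0]) simp

lemma star_quotient: "full_trajs // shift_rel = proj_star ` full_trajs"
  by (auto simp: quotient_def proj_star_def)

lemma space_star_space [simp]: "space star_space = proj_star ` full_trajs"
  unfolding star_space_def star_quotient by (subst space_measure_of) auto

text \<open>The sets with measurable preimage are already closed under complements and countable
  unions, so the sigma-algebra generated by them contains nothing else.\<close>

lemma sets_star_space_iff:
  "E \<in> sets star_space \<longleftrightarrow> E \<subseteq> proj_star ` full_trajs \<and> {w \<in> full_trajs. proj_star w \<in> E} \<in> sets full_space"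
proof
  let ?C = "{E. E \<subseteq> proj_star ` full_trajs \<and> {w \<in> full_trajs. proj_star w \<in> E} \<in> sets full_space}"
  have sets: "sets star_space = sigma_sets (proj_star ` full_trajs) ?C"
    unfolding star_space_def star_quotient by (subst sets_measure_of) auto
  show "E \<in> sets star_space" if "E \<subseteq> proj_star ` full_trajs \<and> {w \<in> full_trajs. proj_star w \<in> E} \<in> sets full_space"
    unfolding sets using that by blast
  assume "E \<in> sets star_space"
  then have "E \<in> sigma_sets (proj_star ` full_trajs) ?C" by (simp only: sets)
  then show "E \<subseteq> proj_star ` full_trajs \<and> {w \<in> full_trajs. proj_star w \<in> E} \<in> sets full_space"
  proof induction
    case (Compl E)
    have "{w \<in> full_trajs. proj_star w \<in> proj_star ` full_trajs - E} = space full_space - {w \<in> full_trajs. proj_star w \<in> E}"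
      by auto
    then show ?case using Compl sets.compl_sets[of _ full_space] by auto
  next
    case (Union E)
    have "{w \<in> full_trajs. proj_star w \<in> \<Union> (range E)} = (\<Union>i. {w \<in> full_trajs. proj_star w \<in> E i})" by auto
    moreover have "(\<Union>i. {w \<in> full_trajs. proj_star w \<in> E i}) \<in> sets full_space"
      using Union.IH by (intro sets.countable_UN) blast
    moreover have "\<Union> (range E) \<subseteq> proj_star ` full_trajs" using Union.IH by blast
    ultimately show ?case by (simp only: simp_thms)
  qed auto
qed

lemma full_singleton_sets: "w \<in> full_trajs \<Longrightarrow> {w} \<in> sets full_space"
proof -
  assume "w \<in> full_trajs"
  then have "{w} = {w' \<in> space full_space. \<forall>n\<in>UNIV. w' n = w n}" by (auto simp: fun_eq_iff)
  also have "\<dots> \<in> sets full_space"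
    by (intro sets.sets_Collect_countable_Ball) (auto intro!: full_coord_Collect)
  finally show ?thesis .
qed

text \<open>A class consists of the countably many time shifts of one trajectory, each of which is a
  measurable singleton. Measurable points allow the atoms of a configuration to be recognised by
  their mass.\<close>

lemma star_singleton_sets: "ws \<in> space star_space \<Longrightarrow> {ws} \<in> sets star_space"
proof -
  assume "ws \<in> space star_space"
  then obtain w where w: "w \<in> full_trajs" "ws = proj_star w" by auto
  have "{w' \<in> full_trajs. proj_star w' \<in> {ws}} = proj_star w"
  proof (intro equalityI subsetI)
    fix w' assume "w' \<in> {w' \<in> full_trajs. proj_star w' \<in> {ws}}"
    then show "w' \<in> proj_star w" using w proj_star_mem[of w'] by simp
  next
    fix w' assume "w' \<in> proj_star w"
    then obtain k where "w' = time_shift k w" unfolding proj_star_eq[OF w(1)] by blast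
    then show "w' \<in> {w' \<in> full_trajs. proj_star w' \<in> {ws}}"
      using w time_shift_full[OF w(1)] proj_star_time_shift[OF w(1)] by simp
  qed
  also have "\<dots> = (\<Union>k. {time_shift k w})" unfolding proj_star_eq[OF w(1)] by blast
  also have "\<dots> \<in> sets full_space"
    by (intro sets.countable_UN'') (auto intro: full_singleton_sets time_shift_full[OF w(1)])
  finally show ?thesis using w by (simp add: sets_star_space_iff)
qed

definition rep :: "('d::finite) site set \<Rightarrow> (int \<Rightarrow> 'd site) set \<Rightarrow> int \<Rightarrow> 'd site" where
  "rep K ws = (THE w. w \<in> ws \<and> w 0 \<in> K \<and> (\<forall>t<0. w t \<notin> K))"

definition star_event :: "('d::finite) site set \<Rightarrow> (int \<Rightarrow> 'd site) set \<Rightarrow> (int \<Rightarrow> 'd site) set set" where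
  "star_event K G = {ws \<in> star_hit K. rep K ws \<in> G}"

text \<open>A nonzero shift carries the visit at time 0 of one of the two trajectories to a negative
  time of the other.\<close>

lemma canon_shift_unique:
  assumes "w \<in> canon K" "time_shift k w \<in> canon K"
  shows "k = 0"
proof (rule ccontr)
  assume "k \<noteq> 0"
  then consider "k < 0" | "- k < 0" by linarith
  then show False
  proof cases
    case 1 then show False using assms by (auto simp: canon_def time_shift_def)
  next
    case 2
    have "time_shift k w (- k) \<in> K" using assms(1) by (simp add: canon_def time_shift_def)
    then show False using assms(2) 2 unfolding canon_def by blast
  qed
qed

lemma rep_proj_star:
  assumes w: "w \<in> canon K"
  shows "rep K (proj_star w) = w"
  unfolding rep_def
proof (rule the_equality)
  have f: "w \<in> full_trajs" using w by (simp add: canon_def)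
  show "w \<in> proj_star w \<and> w 0 \<in> K \<and> (\<forall>t<0. w t \<notin> K)"
    using w proj_star_mem by (auto simp: canon_def)
  fix v assume v: "v \<in> proj_star w \<and> v 0 \<in> K \<and> (\<forall>t<0. v t \<notin> K)"
  then obtain k where k: "v = time_shift k w" by (auto simp: proj_star_eq[OF f])
  then have "time_shift k w \<in> canon K" using v time_shift_full[OF f] by (simp add: canon_def)
  from canon_shift_unique[OF w this] show "v = w" using k by simp
qed

context
  fixes K :: "('d::finite) site set"
  assumes finK: "finite K"
begin

text \<open>Escape in the past bounds the visits from below by some \<open>N\<close>, so the first
  visit exists as a least natural offset from \<open>N\<close>.\<close>

lemma first_hit:
  assumes w: "w \<in> full_trajs" and hit: "w n \<in> K"
  obtains k where "time_shift k w \<in> canon K"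
proof -
  have "eventually (\<lambda>n. (\<Sum>x\<in>K. norm1 x) + 1 \<le> norm1 (w n)) at_bot"
    using w unfolding full_trajs_def filterlim_at_top by blast
  then obtain N where N: "\<And>n. n \<le> N \<Longrightarrow> (\<Sum>x\<in>K. norm1 x) + 1 \<le> norm1 (w n)"
    unfolding eventually_at_bot_linorder by blast
  have out: "w n \<notin> K" if "n \<le> N" for n
  proof
    assume "w n \<in> K"
    then have "norm1 (w n) \<le> (\<Sum>x\<in>K. norm1 x)"
      using finK by (intro member_le_sum) (auto simp: norm1_nonneg)
    with N[OF that] show False by simp
  qed
  define S where "S = {k. w (N + int k) \<in> K}"
  have "nat (n - N) \<in> S" using hit out[of n] by (cases "n \<le> N") (auto simp: S_def)
  then have "(LEAST k. k \<in> S) \<in> S" and least: "\<And>k. k < (LEAST k. k \<in> S) \<Longrightarrow> k \<notin> S"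
    by (auto intro: LeastI dest: not_less_Least)
  define k where "k = N + int (LEAST k. k \<in> S)"
  have "w k \<in> K" using \<open>(LEAST k. k \<in> S) \<in> S\<close> by (simp add: S_def k_def)
  moreover have "w (t + k) \<notin> K" if "t < 0" for t
  proof (cases "t + k \<le> N")
    case False
    then have "nat (t + k - N) \<notin> S" using that by (intro least) (auto simp: k_def)
    then show ?thesis using False by (simp add: S_def)
  qed (rule out)
  ultimately have "time_shift k w \<in> canon K"
    using time_shift_full[OF w] by (simp add: canon_def) (simp add: time_shift_def)
  then show thesis by (rule that)
qed

lemma star_hit_eq: "star_hit K = proj_star ` canon K"
proof
  show "proj_star ` canon K \<subseteq> star_hit K"
    by (auto simp: star_hit_def canon_def)
  show "star_hit K \<subseteq> proj_star ` canon K"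
  proof
    fix ws assume "ws \<in> star_hit K"
    then obtain w n where w: "w \<in> full_trajs" "w n \<in> K" "ws = proj_star w" by (auto simp: star_hit_def)
    obtain k where "time_shift k w \<in> canon K" using first_hit[OF w(1,2)] .
    then show "ws \<in> proj_star ` canon K" using proj_star_time_shift[OF w(1), of k] w(3) by (metis imageI)
  qed
qed

lemma rep_canon: "ws \<in> star_hit K \<Longrightarrow> rep K ws \<in> canon K"
  by (auto simp: star_hit_eq rep_proj_star)

lemma star_event_eq: "star_event K G = proj_star ` (G \<inter> canon K)"
  by (auto simp: star_event_def star_hit_eq rep_proj_star image_iff)

text \<open>Classes are orbits under integer time shifts; writing the preimage as a countable union
  of shifted sets makes it measurable.\<close>

lemma star_event_preimage:
  "{w \<in> full_trajs. proj_star w \<in> star_event K G} =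
    (\<Union>k. time_shift k -` (G \<inter> canon K) \<inter> space full_space)"
proof (intro equalityI subsetI)
  fix w assume "w \<in> {w \<in> full_trajs. proj_star w \<in> star_event K G}"
  then obtain v where w: "w \<in> full_trajs" and v: "v \<in> G \<inter> canon K" "proj_star w = proj_star v"
    by (auto simp: star_event_eq)
  have "v \<in> full_trajs" using v(1) by (simp add: canon_def)
  from proj_star_mem[OF this] have "v \<in> proj_star w" using v(2) by simp
  then obtain k where "v = time_shift k w" unfolding proj_star_eq[OF w] by blast
  then show "w \<in> (\<Union>k. time_shift k -` (G \<inter> canon K) \<inter> space full_space)"
    using w v(1) by auto
next
  fix w assume "w \<in> (\<Union>k. time_shift k -` (G \<inter> canon K) \<inter> space full_space)"
  then obtain k where "w \<in> full_trajs" "time_shift k w \<in> G \<inter> canon K" by auto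
  then show "w \<in> {w \<in> full_trajs. proj_star w \<in> star_event K G}"
    using proj_star_time_shift[of w k] unfolding star_event_eq by (metis (mono_tags, lifting) imageI mem_Collect_eq)
qed

lemma star_event_sets:
  assumes "G \<inter> canon K \<in> sets full_space"
  shows "star_event K G \<in> sets star_space"
  unfolding sets_star_space_iff star_event_preimage
proof
  show "star_event K G \<subseteq> proj_star ` full_trajs" by (auto simp: star_event_eq canon_def)
  show "(\<Union>k. time_shift k -` (G \<inter> canon K) \<inter> space full_space) \<in> sets full_space"
    by (intro sets.countable_UN'' countableI_type measurable_sets[OF time_shift_measurable assms])
qed

lemma star_hit_event: "star_hit K = star_event K UNIV"
  by (simp add: star_event_def)

lemma star_hit_sets: "star_hit K \<in> sets star_space"
  unfolding star_hit_event by (rule star_event_sets) simp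

end

section \<open>The intensity of trajectories with prescribed excursions\<close>

lemma measure_srw_eq: "ennreal (measure (srw x) A) = emeasure (srw x) A"
  using finite_measure.emeasure_eq_measure[OF finite_measure_srw] by metis

lemma no_return_Collect: "{w \<in> space (srw x). return_time K w = None} = no_return K"
  by (auto simp: no_return_def)

lemma eq_measure_eq: "x \<in> K \<Longrightarrow> eq_measure K x = measure (srw x) (no_return K)"
  by (simp add: eq_measure_def no_return_Collect[simplified])

lemma eq_measure_nonneg: "0 \<le> eq_measure K x"
  by (simp add: eq_measure_def)

lemma srw_avoid_eq:
  assumes "A \<in> sets half_space"
  shows "srw_avoid K x A = measure (srw x) (A \<inter> no_return K) / measure (srw x) (no_return K)"
proof -
  have "{w \<in> half_trajs. w \<in> A \<and> return_time K w = None} = A \<inter> no_return K"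
    using sets.sets_into_space[OF assms] by (auto simp: no_return_def)
  then show ?thesis
    by (simp add: srw_avoid_def cond_prob_def no_return_def)
qed

lemma srw_avoid_nonneg: "0 \<le> srw_avoid K x A"
  by (simp add: srw_avoid_def cond_prob_def)

text \<open>Holds also when the conditioning event is null: the conditional probability is then 0 by
  division by zero, and the left side vanishes by monotonicity.\<close>

lemma srw_Int_no_return:
  assumes A: "A \<in> sets half_space" and x: "x \<in> K"
  shows "emeasure (srw x) (A \<inter> no_return K) = ennreal (eq_measure K x * srw_avoid K x A)"
proof -
  interpret finite_measure "srw x" by (rule finite_measure_srw)
  have "measure (srw x) (A \<inter> no_return K) \<le> measure (srw x) (no_return K)"
    by (intro finite_measure_mono) (auto simp: sets_srw no_return_sets)
  then show ?thesis
    using eq_measure_eq[OF x] by (auto simp: emeasure_eq_measure srw_avoid_eq[OF A] measure_le_0_iff)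
qed

text \<open>A nonzero escape probability from \<open>K\<close> forces a positive escape mass, which
  the zero-one law raises to 1; otherwise both sides vanish.\<close>

lemma eq_measure_avoid_half:
  "srw_avoid K x half_trajs * eq_measure K x * measure (srw x) half_trajs = eq_measure K (x :: ('d::finite) site)"
proof (cases "eq_measure K x = 0")
  case False
  then have x: "x \<in> K" unfolding eq_measure_def by presburger
  interpret finite_measure "srw x" by (rule finite_measure_srw)
  have nr: "half_trajs \<inter> no_return K = no_return K" by (auto simp: no_return_def)
  have "srw_avoid K x half_trajs = 1"
    using False eq_measure_eq[OF x] by (simp add: srw_avoid_eq nr)
  moreover have "eq_measure K x \<le> measure (srw x) half_trajs"
    unfolding eq_measure_eq[OF x] by (intro finite_measure_mono) (auto simp: sets_srw no_return_def)
  then have "measure (srw x) half_trajs \<noteq> 0" using False eq_measure_nonneg[of K x] by linarith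
  then have "emeasure (srw x) half_trajs \<noteq> 0" by (simp add: emeasure_eq_measure)
  then have "emeasure (srw x) half_trajs = 1"
    using escape_mass_zero_one[where 'd='d] unfolding emeasure_srw_half_trajs by blast
  then have "measure (srw x) half_trajs = 1" by (simp add: measure_def)
  ultimately show ?thesis by simp
qed simp

context
  fixes K :: "('d::finite) site set" and Q
  assumes finK: "finite K" and Q: "is_Q K Q"
begin

lemma sets_Q: "sets Q = sets full_space"
  using Q by (simp add: is_Q_def)

lemma Q_formula:
  assumes "A \<in> sets half_space" "B \<in> sets half_space"
  shows "emeasure Q {w \<in> full_trajs. X_minus w \<in> A \<and> w 0 = x \<and> fwd w \<in> B} =
    ennreal (srw_avoid K x A * eq_measure K x * measure (srw x) B)"
  using Q assms unfolding is_Q_def X_minus_def fwd_def by blast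

lemma Q_event_sets:
  assumes "A \<in> sets half_space" "B \<in> sets half_space"
  shows "{w \<in> full_trajs. X_minus w \<in> A \<and> w 0 = x \<and> fwd w \<in> B} \<in> sets Q"
proof -
  have "{w \<in> full_trajs. X_minus w \<in> A \<and> w 0 = x \<and> fwd w \<in> B} =
      {w \<in> full_trajs. w 0 = x} \<inter> (X_minus -` A \<inter> space full_space) \<inter> (fwd -` B \<inter> space full_space)"
    by auto
  also have "\<dots> \<in> sets full_space"
    by (intro sets.Int full_coord_Collect measurable_sets[OF X_minus_measurable]
        measurable_sets[OF fwd_measurable] assms)
  finally show ?thesis by (simp add: sets_Q)
qed

lemma AE_Q_canon: "AE w in Q. w \<in> canon K"
proof -
  \<comment> \<open>Two kinds of null sets: for a site off \<open>K\<close> the equilibrium measure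
    vanishes; for a site in \<open>K\<close> the conditioned past gives no mass to a return.\<close>
  let ?N = "\<lambda>x. {w \<in> full_trajs. X_minus w \<in> (if x \<in> K then half_trajs - no_return K else half_trajs) \<and> w 0 = x \<and> fwd w \<in> half_trajs}"
  have A: "(if x \<in> K then half_trajs - no_return K else half_trajs) \<in> sets half_space" for x :: "'d site"
    using no_return_sets by auto
  have "emeasure Q (?N x) = 0" for x
  proof (cases "x \<in> K")
    case True
    have "srw_avoid K x (half_trajs - no_return K) = 0"
    proof -
      have "(half_trajs - no_return K) \<inter> no_return K = {}" by blast
      then show ?thesis using A[of x] True by (simp add: srw_avoid_eq)
    qed
    then show ?thesis using Q_formula[OF A[of x] half_trajs_in_half_space, of x] True by simp
  next
    case False
    then show ?thesis using Q_formula[OF A[of x] half_trajs_in_half_space, of x] by (simp add: eq_measure_def)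
  qed
  then have "?N x \<in> null_sets Q" for x
    using Q_event_sets[OF A[of x] half_trajs_in_half_space, of x] by (auto simp: null_sets_def)
  then have "(\<Union>x. ?N x) \<in> null_sets Q" by (rule null_sets_UN)
  moreover have "{w \<in> space Q. w \<notin> canon K} \<subseteq> (\<Union>x. ?N x)"
  proof
    fix w assume "w \<in> {w \<in> space Q. w \<notin> canon K}"
    then have w: "w \<in> full_trajs" "w \<notin> canon K" using sets_eq_imp_space_eq[OF sets_Q] by auto
    then have "X_minus w \<notin> no_return K" if w0: "w 0 \<in> K"
    proof -
      obtain t where t: "t < 0" "w t \<in> K" using w w0 unfolding canon_def by blast
      then have "1 \<le> nat (- t)" "X_minus w (nat (- t)) \<in> K" by (auto simp: X_minus_def)
      then show ?thesis unfolding no_return_iff by blast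
    qed
    then show "w \<in> (\<Union>x. ?N x)" using w X_minus_half fwd_half by auto
  qed
  ultimately show ?thesis by (rule AE_I')
qed

lemma emeasure_Q_canon:
  assumes "G \<in> sets full_space"
  shows "emeasure Q (G \<inter> canon K) = emeasure Q G"
  using AE_Q_canon assms by (intro emeasure_eq_AE) (auto simp: sets_Q)

text \<open>Almost every trajectory under \<open>Q\<close> is its own canonical representative, so
  membership of its class is membership of the trajectory.\<close>

lemma Q_star_event:
  assumes G: "G \<inter> canon K \<in> sets full_space"
  shows "emeasure Q {w \<in> full_trajs. proj_star w \<in> star_event K G} = emeasure Q (G \<inter> canon K)"
proof (rule emeasure_eq_AE)
  show "AE w in Q. w \<in> {w \<in> full_trajs. proj_star w \<in> star_event K G} \<longleftrightarrow> w \<in> G \<inter> canon K"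
    using AE_Q_canon
  proof eventually_elim
    case (elim w)
    then have "proj_star w \<in> star_hit K" "w \<in> full_trajs" unfolding star_hit_eq[OF finK] by (auto simp: canon_def)
    then show ?case using elim rep_proj_star[OF elim] by (auto simp: star_event_def)
  qed
  show "{w \<in> full_trajs. proj_star w \<in> star_event K G} \<in> sets Q"
    using star_event_sets[OF finK G] by (simp add: sets_star_space_iff sets_Q)
qed (use G in \<open>simp add: sets_Q\<close>)

text \<open>\<open>Q\<close> makes past and future independent given the site at time 0. That site
  is the start of the first path, so a single instance of the defining formula applies, and the
  future factor is \<open>srw_exc\<close>.\<close>

lemma Q_exc_event:
  assumes c: "compatible K c Fs Hs" and A: "A \<in> sets half_space" and B: "B \<in> sets half_space"
  shows "emeasure Q (exc_event K Fs Hs A B \<inter> canon K) =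
    ennreal (srw_avoid K (fst (hd c)) A * eq_measure K (fst (hd c))) * (prod_list (map weight Fs) *
      prod_list (map weight Hs) * ennreal (eq_measure K (snd (last c)) * srw_avoid K (snd (last c)) B))"
    and "exc_event K Fs Hs A B \<inter> canon K \<in> sets full_space"
proof -
  let ?x = "fst (hd c)" and ?E = "exc K Fs Hs B"
  note cond = compatible_exc_conditions[OF c]
  have ne: "c \<noteq> []" and sub: "set c \<subseteq> K \<times> K" using c by (auto simp: compatible_def)
  then have "last c \<in> K \<times> K" using last_in_set[of c] by blast
  then have y: "snd (last c) \<in> K" by auto
  have start: "f 0 = ?x" if "f \<in> ?E" for f
  proof -
    have "f \<in> ?E \<longleftrightarrow> f \<in> half_trajs \<and> f 0 \<in> K \<and> M_count K f = length Fs \<and>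
      (\<forall>j<length Fs. in_exc K f (Suc j) \<in> Fs ! j) \<and> (\<forall>j<length Hs. out_exc K f (Suc j) \<in> Hs ! j) \<and>
      last_exit K f \<in> B"
      by (rule exc_iff[OF finK cond])
    then have f: "f \<in> half_trajs" "f 0 \<in> K" "in_exc K f (Suc 0) \<in> Fs ! 0"
      using that cond(1) by auto
    have "Fs ! 0 \<subseteq> in_paths K ?x (snd (hd c))" using c ne by (auto simp: compatible_def hd_conv_nth)
    from in_pathsD(2)[OF subsetD[OF this f(3)]] have "hd (in_exc K f 1) = ?x" by simp
    then show ?thesis unfolding first_in_exc(4)[OF finK f(1,2)] by (simp add: hd_map del: upt_Suc)
  qed
  let ?T = "{w \<in> full_trajs. X_minus w \<in> A \<and> w 0 = ?x \<and> fwd w \<in> ?E}"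
  have T: "?T \<in> sets full_space" using Q_event_sets[OF A exc_sets[OF B]] by (simp add: sets_Q)
  have "w \<in> exc_event K Fs Hs A B \<longleftrightarrow> X_minus w \<in> A \<and> fwd w \<in> ?E" if "w \<in> canon K" for w
    by (rule exc_event_iff[OF finK that cond])
  moreover have "w 0 = ?x" if "fwd w \<in> ?E" for w using start[OF that] by (simp add: fwd_def)
  ultimately have eq: "exc_event K Fs Hs A B \<inter> canon K = ?T \<inter> canon K"
    by (auto simp: canon_def)
  then show "exc_event K Fs Hs A B \<inter> canon K \<in> sets full_space" using T by auto
  have "emeasure Q (?T \<inter> canon K) = ennreal (srw_avoid K ?x A * eq_measure K ?x * measure (srw ?x) ?E)"
    unfolding emeasure_Q_canon[OF T] by (rule Q_formula[OF A exc_sets[OF B]])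
  also have "\<dots> = ennreal (srw_avoid K ?x A * eq_measure K ?x) * emeasure (srw ?x) ?E"
    by (simp add: ennreal_mult' srw_avoid_nonneg eq_measure_nonneg measure_srw_eq)
  also have "emeasure (srw ?x) ?E = prod_list (map weight Fs) *
      prod_list (map weight Hs) * ennreal (eq_measure K (snd (last c)) * srw_avoid K (snd (last c)) B)"
    by (simp only: srw_exc[OF c B] srw_Int_no_return[OF B y])
  finally show "emeasure Q (exc_event K Fs Hs A B \<inter> canon K) =
    ennreal (srw_avoid K ?x A * eq_measure K ?x) * (prod_list (map weight Fs) *
      prod_list (map weight Hs) * ennreal (eq_measure K (snd (last c)) * srw_avoid K (snd (last c)) B))"
    unfolding eq .
qed

text \<open>Sum over the finitely many sites at time 0 with unrestricted past and future;
  \<open>eq_measure_avoid_half\<close> collapses each term to the equilibrium mass.\<close>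

lemma Q_canon: "emeasure Q (canon K) = ennreal (cap K)"
proof -
  let ?T = "\<lambda>x. {w \<in> full_trajs. X_minus w \<in> half_trajs \<and> w 0 = x \<and> fwd w \<in> half_trajs}"
  have T: "?T x \<in> sets Q" for x by (rule Q_event_sets) simp_all
  have "canon K = (\<Union>x\<in>K. ?T x) \<inter> canon K"
    using X_minus_half fwd_half by (auto simp: canon_def)
  also have "emeasure Q \<dots> = emeasure Q (\<Union>x\<in>K. ?T x)"
    by (intro emeasure_Q_canon sets.finite_UN finK T[unfolded sets_Q])
  also have "\<dots> = (\<Sum>x\<in>K. emeasure Q (?T x))"
    using T finK by (intro sum_emeasure[symmetric]) (auto simp: disjoint_family_on_def)
  also have "\<dots> = (\<Sum>x\<in>K. ennreal (eq_measure K x))"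
    by (intro sum.cong refl) (simp add: Q_formula eq_measure_avoid_half)
  finally show ?thesis by (simp add: cap_def eq_measure_nonneg sum_nonneg)
qed

end


section \<open>Order statistics of uniform variables\<close>

text \<open>Boxes of this kind sort themselves: every tuple in them is strictly increasing, so no
  ordering condition has to be imposed separately.\<close>

definition ordered_family :: "nat \<Rightarrow> (nat \<Rightarrow> real set) \<Rightarrow> bool" where
  "ordered_family n V \<longleftrightarrow> (\<forall>i\<in>{1..n}. \<forall>j\<in>{1..n}. i < j \<longrightarrow> (\<forall>s\<in>V i. \<forall>t\<in>V j. s < t))"

definition borel_family :: "nat \<Rightarrow> real \<Rightarrow> (nat \<Rightarrow> real set) \<Rightarrow> bool" where
  "borel_family n u V \<longleftrightarrow> (\<forall>i\<in>{1..n}. V i \<in> sets borel \<and> V i \<subseteq> {0..u})"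

lemma ordered_family_disjoint:
  "ordered_family n V \<Longrightarrow> i \<in> {1..n} \<Longrightarrow> j \<in> {1..n} \<Longrightarrow> i \<noteq> j \<Longrightarrow> V i \<inter> V j = {}"
  unfolding ordered_family_def by (meson disjoint_iff linorder_neqE_nat less_irrefl)

lemma ordered_family_mono: "ordered_family n V \<Longrightarrow> (\<And>i. i \<in> {1..n} \<Longrightarrow> W i \<subseteq> V i) \<Longrightarrow> ordered_family n W"
  unfolding ordered_family_def by blast

text \<open>Separating rationals cut the simplex of increasing tuples into countably many ordered boxes.\<close>

definition slot :: "nat \<Rightarrow> real \<Rightarrow> rat list \<Rightarrow> nat \<Rightarrow> real set" where
  "slot n u qs i = {t \<in> {0..u}. (1 < i \<longrightarrow> of_rat (qs ! (i - 2)) < t) \<and> (i < n \<longrightarrow> t \<le> of_rat (qs ! (i - 1)))}"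

lemma slot_borel: "slot n u qs i \<in> sets borel"
  unfolding slot_def by measurable

lemma slot_ordered:
  assumes "sorted qs" "length qs = n"
  shows "ordered_family n (slot n u qs)"
  unfolding ordered_family_def
proof (intro ballI impI)
  fix i j s t assume i: "i \<in> {1..n}" and j: "j \<in> {1..n}" "i < j" and s: "s \<in> slot n u qs i" and t: "t \<in> slot n u qs j"
  have "s \<le> of_rat (qs ! (i - 1))" "of_rat (qs ! (j - 2)) < t" using i j s t by (auto simp: slot_def)
  moreover have "qs ! (i - 1) \<le> qs ! (j - 2)"
    using i j assms by (intro sorted_nth_mono) auto
  ultimately show "s < t" by (meson le_less_trans of_rat_less_eq order_trans)
qed

text \<open>A rational is placed between each pair of neighbours and one above the last value, so
  that the list has length \<open>n\<close>.\<close>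

lemma increasing_in_slots:
  assumes inc: "\<And>i j. i \<in> {1..n} \<Longrightarrow> j \<in> {1..n} \<Longrightarrow> i < j \<Longrightarrow> f i < (f j :: real)"
    and range: "\<And>i. i \<in> {1..n} \<Longrightarrow> f i \<in> {0..u}"
  obtains qs where "sorted qs" "length qs = n" "\<And>i. i \<in> {1..n} \<Longrightarrow> f i \<in> slot n u qs i"
proof -
  have "\<exists>q. f i < of_rat q \<and> (i < n \<longrightarrow> of_rat q < f (Suc i))" if "i \<in> {1..n}" for i
  proof (cases "i < n")
    case True
    then show ?thesis using of_rat_dense[OF inc[of i "Suc i"]] that by auto
  next
    case False
    then show ?thesis using of_rat_dense[of "f i" "f i + 1"] by auto
  qed
  then obtain q where q: "\<And>i. i \<in> {1..n} \<Longrightarrow> f i < of_rat (q i)"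
    "\<And>i. i \<in> {1..n} \<Longrightarrow> i < n \<Longrightarrow> of_rat (q i) < f (Suc i)" by metis
  let ?qs = "map (\<lambda>k. q (Suc k)) [0..<n]"
  have "q (Suc k) \<le> q (Suc (Suc k))" if "Suc k < n" for k
  proof -
    have "(of_rat (q (Suc k)) :: real) < of_rat (q (Suc (Suc k)))"
      using q(2)[of "Suc k"] q(1)[of "Suc (Suc k)"] that by simp
    then show ?thesis by (simp add: of_rat_less)
  qed
  then have "sorted ?qs" by (auto simp: sorted_iff_nth_Suc)
  moreover have "f i \<in> slot n u ?qs i" if i: "i \<in> {1..n}" for i
  proof -
    have "of_rat (?qs ! (i - 2)) < f i" if "1 < i"
    proof -
      define k where "k = i - 2"
      have "i = Suc (Suc k)" using that by (simp add: k_def)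
      then have "?qs ! (i - 2) = q (i - 1)" using i by simp
      then show ?thesis using q(2)[of "i - 1"] i that by simp
    qed
    moreover have "?qs ! (i - 1) = q i"
    proof -
      define k where "k = i - 1"
      have "i = Suc k" "k < n" using i by (auto simp: k_def)
      then show ?thesis by simp
    qed
    ultimately show ?thesis using range[OF i] q(1)[OF i] by (auto simp: slot_def)
  qed
  ultimately show thesis by (intro that[of ?qs]) auto
qed

text \<open>Ordered boxes are closed under intersection, and countably many of them cover the
  increasing tuples; hence they determine a finite measure there. This transfers a formula known for
  ordered boxes to all Borel boxes, although the latter need not be ordered.\<close>

lemma ordered_boxes_determine:
  fixes X :: "'a \<Rightarrow> nat \<Rightarrow> real" and Y :: "'b \<Rightarrow> nat \<Rightarrow> real"
  assumes S: "S \<in> sets M" "\<And>a. a \<in> S \<Longrightarrow> (\<forall>i\<in>{1..n}. X a i \<in> {0..u}) \<and> (\<forall>i\<in>{1..n}. \<forall>j\<in>{1..n}. i < j \<longrightarrow> X a i < X a j)"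
    and T: "T \<in> sets N" "\<And>b. b \<in> T \<Longrightarrow> (\<forall>i\<in>{1..n}. Y b i \<in> {0..u}) \<and> (\<forall>i\<in>{1..n}. \<forall>j\<in>{1..n}. i < j \<longrightarrow> Y b i < Y b j)"
    and X: "\<And>V. borel_family n u V \<Longrightarrow> ordered_family n V \<Longrightarrow> {a \<in> S. \<forall>i\<in>{1..n}. X a i \<in> V i} \<in> sets M"
    and Y: "\<And>V. borel_family n u V \<Longrightarrow> ordered_family n V \<Longrightarrow> {b \<in> T. \<forall>i\<in>{1..n}. Y b i \<in> V i} \<in> sets N"
    and fin: "emeasure M S \<noteq> \<infinity>"
    and eq: "\<And>V. borel_family n u V \<Longrightarrow> ordered_family n V \<Longrightarrow>
      emeasure M {a \<in> S. \<forall>i\<in>{1..n}. X a i \<in> V i} = emeasure N {b \<in> T. \<forall>i\<in>{1..n}. Y b i \<in> V i}"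
    and V: "borel_family n u V"
  shows "{a \<in> S. \<forall>i\<in>{1..n}. X a i \<in> V i} \<in> sets M"
    and "emeasure M {a \<in> S. \<forall>i\<in>{1..n}. X a i \<in> V i} = emeasure N {b \<in> T. \<forall>i\<in>{1..n}. Y b i \<in> V i}"
proof -
  define \<Omega> where "\<Omega> = {f \<in> PiE {1..n} (\<lambda>_. {0..u}). \<forall>i\<in>{1..n}. \<forall>j\<in>{1..n}. i < j \<longrightarrow> f i < f j}"
  define \<E> where "\<E> = {PiE {1..n} V |V. borel_family n u V \<and> ordered_family n V}"
  define A where "A = {PiE {1..n} (slot n u qs) |qs. sorted qs \<and> length qs = n}"
  have E_sub: "\<E> \<subseteq> Pow \<Omega>"
  proof
    fix B assume "B \<in> \<E>"
    then obtain V where V: "B = PiE {1..n} V" "borel_family n u V" "ordered_family n V" by (auto simp: \<E>_def)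
    have "f \<in> \<Omega>" if "f \<in> PiE {1..n} V" for f
    proof -
      have f: "f i \<in> V i" if "i \<in> {1..n}" for i using \<open>f \<in> PiE {1..n} V\<close> that by (rule PiE_mem)
      have "f \<in> PiE {1..n} (\<lambda>_. {0..u})"
        using \<open>f \<in> PiE {1..n} V\<close> V(2) unfolding PiE_iff borel_family_def by blast
      moreover have "\<forall>i\<in>{1..n}. \<forall>j\<in>{1..n}. i < j \<longrightarrow> f i < f j"
        using f V(3) unfolding ordered_family_def by blast
      ultimately show ?thesis by (simp add: \<Omega>_def)
    qed
    then show "B \<in> Pow \<Omega>" using V(1) by blast
  qed
  have slot_fam: "borel_family n u (slot n u qs)" for qs
    using slot_borel by (auto simp: borel_family_def slot_def)
  have A_E: "A \<subseteq> \<E>" unfolding A_def \<E>_def using slot_fam slot_ordered by blast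
  have "A = (\<lambda>qs. PiE {1..n} (slot n u qs)) ` {qs. sorted qs \<and> length qs = n}" by (auto simp: A_def)
  then have A_count: "countable A" by simp
  have cover: "PiE {1..n} V \<inter> \<Omega> = (\<Union>qs\<in>{qs. sorted qs \<and> length qs = n}. PiE {1..n} (\<lambda>i. V i \<inter> slot n u qs i))" for V
  proof (intro equalityI subsetI)
    fix f assume f: "f \<in> PiE {1..n} V \<inter> \<Omega>"
    then obtain qs where "sorted qs" "length qs = n" "\<And>i. i \<in> {1..n} \<Longrightarrow> f i \<in> slot n u qs i"
      using increasing_in_slots[of n f u] unfolding \<Omega>_def by (auto simp: PiE_iff)
    then show "f \<in> (\<Union>qs\<in>{qs. sorted qs \<and> length qs = n}. PiE {1..n} (\<lambda>i. V i \<inter> slot n u qs i))"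
      using f by (auto simp: PiE_iff)
  next
    fix f assume "f \<in> (\<Union>qs\<in>{qs. sorted qs \<and> length qs = n}. PiE {1..n} (\<lambda>i. V i \<inter> slot n u qs i))"
    then obtain qs where qs: "sorted qs" "length qs = n" "f \<in> PiE {1..n} (\<lambda>i. V i \<inter> slot n u qs i)" by blast
    have "PiE {1..n} (slot n u qs) \<in> \<E>"
      using slot_fam[of qs] slot_ordered[OF qs(1,2)] unfolding \<E>_def by blast
    moreover have "f \<in> PiE {1..n} (slot n u qs)" using qs(3) by (auto simp: PiE_iff)
    ultimately have "f \<in> \<Omega>" using E_sub by blast
    then show "f \<in> PiE {1..n} V \<inter> \<Omega>" using qs(3) by (auto simp: PiE_iff)
  qed
  have A_cover: "\<Union>A = \<Omega>"
  proof -
    have "\<Omega> = PiE {1..n} (\<lambda>_. {0..u}) \<inter> \<Omega>" by (auto simp: \<Omega>_def)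
    also have "\<dots> = (\<Union>qs\<in>{qs. sorted qs \<and> length qs = n}. PiE {1..n} (\<lambda>i. {0..u} \<inter> slot n u qs i))" by (rule cover)
    also have "\<dots> = \<Union>A"
    proof -
      have "{0..u} \<inter> slot n u qs i = slot n u qs i" for qs i by (auto simp: slot_def)
      then show ?thesis unfolding A_def by auto
    qed
    finally show ?thesis by simp
  qed
  have stable: "Int_stable \<E>"
  proof (rule Int_stableI)
    fix a b assume "a \<in> \<E>" "b \<in> \<E>"
    then obtain V W where "a = PiE {1..n} V" "b = PiE {1..n} W" "borel_family n u V" "borel_family n u W" "ordered_family n V"
      by (auto simp: \<E>_def)
    then have "a \<inter> b = PiE {1..n} (\<lambda>i. V i \<inter> W i)" "borel_family n u (\<lambda>i. V i \<inter> W i)" "ordered_family n (\<lambda>i. V i \<inter> W i)"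
      by (auto simp: PiE_Int borel_family_def intro: ordered_family_mono)
    then show "a \<inter> b \<in> \<E>" unfolding \<E>_def by blast
  qed
  have VE: "PiE {1..n} V \<inter> \<Omega> \<in> sigma_sets \<Omega> \<E>"
    unfolding cover
  proof (rule sigma_sets_UNION)
    show "countable ((\<lambda>qs. PiE {1..n} (\<lambda>i. V i \<inter> slot n u qs i)) ` {qs. sorted qs \<and> length qs = n})" by simp
    fix B assume "B \<in> (\<lambda>qs. PiE {1..n} (\<lambda>i. V i \<inter> slot n u qs i)) ` {qs. sorted qs \<and> length qs = n}"
    then obtain qs where qs: "sorted qs" "length qs = n" "B = PiE {1..n} (\<lambda>i. V i \<inter> slot n u qs i)" by blast
    have "ordered_family n (\<lambda>i. V i \<inter> slot n u qs i)" using slot_ordered[OF qs(1,2)] by (rule ordered_family_mono) auto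
    moreover have "borel_family n u (\<lambda>i. V i \<inter> slot n u qs i)" using V slot_borel by (auto simp: borel_family_def)
    ultimately have "B \<in> \<E>" unfolding \<E>_def qs(3) by blast
    then show "B \<in> sigma_sets \<Omega> \<E>" by blast
  qed
  \<comment> \<open>Restriction to the index set makes both families maps into the extensional
    functions of \<open>\<Omega>\<close>, so that their image measures can be compared.\<close>
  let ?X = "\<lambda>a. restrict (X a) {1..n}" and ?Y = "\<lambda>b. restrict (Y b) {1..n}"
  have XV: "?X -` PiE {1..n} V \<inter> S = {a \<in> S. \<forall>i\<in>{1..n}. X a i \<in> V i}" for V by (auto simp: PiE_iff)
  have YV: "?Y -` PiE {1..n} V \<inter> T = {b \<in> T. \<forall>i\<in>{1..n}. Y b i \<in> V i}" for V by (auto simp: PiE_iff)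
  have XO: "?X a \<in> \<Omega>" if "a \<in> S" for a using S(2)[OF that] by (auto simp: \<Omega>_def)
  have YO: "?Y b \<in> \<Omega>" if "b \<in> T" for b using T(2)[OF that] by (auto simp: \<Omega>_def)
  have spM: "space (restrict_space M S) = S" and spN: "space (restrict_space N T) = T"
    using sets.sets_into_space[OF S(1)] sets.sets_into_space[OF T(1)] by (auto simp: space_restrict_space)
  have mX: "?X \<in> restrict_space M S \<rightarrow>\<^sub>M sigma \<Omega> \<E>"
  proof (rule measurable_measure_of[OF E_sub])
    show "?X \<in> space (restrict_space M S) \<rightarrow> \<Omega>" using XO by (auto simp: spM)
    fix B assume "B \<in> \<E>"
    then show "?X -` B \<inter> space (restrict_space M S) \<in> sets (restrict_space M S)"
    proof -
      obtain V where V: "B = PiE {1..n} V" "borel_family n u V" "ordered_family n V" using \<open>B \<in> \<E>\<close> by (auto simp: \<E>_def)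
      have "?X -` B \<inter> S \<in> sets M" unfolding V(1) XV by (rule X[OF V(2,3)])
      then show ?thesis using S(1) unfolding spM by (subst sets_restrict_space_iff) auto
    qed
  qed
  have mY: "?Y \<in> restrict_space N T \<rightarrow>\<^sub>M sigma \<Omega> \<E>"
  proof (rule measurable_measure_of[OF E_sub])
    show "?Y \<in> space (restrict_space N T) \<rightarrow> \<Omega>" using YO by (auto simp: spN)
    fix B assume "B \<in> \<E>"
    then show "?Y -` B \<inter> space (restrict_space N T) \<in> sets (restrict_space N T)"
    proof -
      obtain V where V: "B = PiE {1..n} V" "borel_family n u V" "ordered_family n V" using \<open>B \<in> \<E>\<close> by (auto simp: \<E>_def)
      have "?Y -` B \<inter> T \<in> sets N" unfolding V(1) YV by (rule Y[OF V(2,3)])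
      then show ?thesis using T(1) unfolding spN by (subst sets_restrict_space_iff) auto
    qed
  qed
  have sE: "sets (sigma \<Omega> \<E>) = sigma_sets \<Omega> \<E>" using E_sub by (rule sets_measure_of)
  let ?DX = "distr (restrict_space M S) (sigma \<Omega> \<E>) ?X" and ?DY = "distr (restrict_space N T) (sigma \<Omega> \<E>) ?Y"
  have DX: "emeasure ?DX B = emeasure M (?X -` B \<inter> S)" if "B \<in> sigma_sets \<Omega> \<E>" for B
  proof -
    have "B \<in> sets (sigma \<Omega> \<E>)" using that unfolding sE .
    from emeasure_distr[OF mX this] show ?thesis
      unfolding spM using S(1) by (subst (asm) emeasure_restrict_space) auto
  qed
  have DY: "emeasure ?DY B = emeasure N (?Y -` B \<inter> T)" if "B \<in> sigma_sets \<Omega> \<E>" for B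
  proof -
    have "B \<in> sets (sigma \<Omega> \<E>)" using that unfolding sE .
    from emeasure_distr[OF mY this] show ?thesis
      unfolding spN using T(1) by (subst (asm) emeasure_restrict_space) auto
  qed
  have D: "?DX = ?DY"
  proof (rule measure_eqI_generator_eq_countable[OF stable E_sub])
    show "emeasure ?DX B = emeasure ?DY B" if "B \<in> \<E>" for B
    proof -
      obtain V where V: "B = PiE {1..n} V" "borel_family n u V" "ordered_family n V" using \<open>B \<in> \<E>\<close> by (auto simp: \<E>_def)
      have "B \<in> sigma_sets \<Omega> \<E>" using that by blast
      then show ?thesis using eq[OF V(2,3)] by (simp only: DX DY V(1) XV YV)
    qed
    show "emeasure ?DX a \<noteq> \<infinity>" if "a \<in> A" for a
    proof -
      have a: "a \<in> sigma_sets \<Omega> \<E>" using that A_E by blast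
      have "emeasure M (?X -` a \<inter> S) \<le> emeasure M S" using S(1) by (intro emeasure_mono) auto
      then show ?thesis using fin unfolding DX[OF a] by (metis infinity_ennreal_def neq_top_trans)
    qed
  qed (use A_E A_cover A_count sE in auto)
  have XV': "?X -` (PiE {1..n} V \<inter> \<Omega>) \<inter> S = {a \<in> S. \<forall>i\<in>{1..n}. X a i \<in> V i}"
    unfolding XV[symmetric] using XO by blast
  have YV': "?Y -` (PiE {1..n} V \<inter> \<Omega>) \<inter> T = {b \<in> T. \<forall>i\<in>{1..n}. Y b i \<in> V i}"
    unfolding YV[symmetric] using YO by blast
  show "{a \<in> S. \<forall>i\<in>{1..n}. X a i \<in> V i} \<in> sets M"
    using measurable_sets[OF mX, of "PiE {1..n} V \<inter> \<Omega>"] VE S(1) unfolding sE spM XV'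
    by (simp add: sets_restrict_space_iff)
  show "emeasure M {a \<in> S. \<forall>i\<in>{1..n}. X a i \<in> V i} = emeasure N {b \<in> T. \<forall>i\<in>{1..n}. Y b i \<in> V i}"
    using DX[OF VE] DY[OF VE] D unfolding XV' YV' by simp
qed

section \<open>Sorting, permutations and ties\<close>

definition order_stat :: "nat \<Rightarrow> (nat \<Rightarrow> real) \<Rightarrow> nat \<Rightarrow> real" where
  "order_stat n v i = sort (map v [1..<Suc n]) ! (i - 1)"

abbreviation uniform_vector :: "nat \<Rightarrow> real \<Rightarrow> (nat \<Rightarrow> real) measure" where
  "uniform_vector n u \<equiv> (\<Pi>\<^sub>M i\<in>{1..n}. uniform_measure lborel {0..u})"

text \<open>Sorting the indices by their values, rather than the values themselves, yields the
  permutation.\<close>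

lemma order_stat_permutation:
  "\<exists>\<pi>. \<pi> permutes {1..n} \<and> (\<forall>i\<in>{1..n}. order_stat n v i = v (\<pi> i))"
proof -
  define zs where "zs = sort_key v [1..<Suc n]"
  have zs: "distinct zs" "set zs = {1..n}" "length zs = n" by (auto simp: zs_def)
  have "sort (map v [1..<Suc n]) = map v zs"
    by (rule properties_for_sort) (auto simp: zs_def simp del: upt_Suc)
  then have os: "order_stat n v i = v (zs ! (i - 1))" if "i \<in> {1..n}" for i
  proof -
    have "i - 1 < length zs" using that zs(3) by auto
    then show ?thesis unfolding order_stat_def \<open>sort (map v [1..<Suc n]) = map v zs\<close> by (rule nth_map)
  qed
  define \<pi> where "\<pi> i = (if i \<in> {1..n} then zs ! (i - 1) else i)" for i
  have "bij_betw (\<lambda>i. i - 1) {1..n} {..<n}"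
    by (rule bij_betw_byWitness[where f' = Suc]) auto
  then have "bij_betw ((!) zs \<circ> (\<lambda>i. i - 1)) {1..n} {1..n}"
    using bij_betw_nth[OF zs(1) refl refl] unfolding zs(2,3) by (rule bij_betw_trans)
  moreover have "bij_betw \<pi> {1..n} {1..n} \<longleftrightarrow> bij_betw ((!) zs \<circ> (\<lambda>i. i - 1)) {1..n} {1..n}"
    by (rule bij_betw_cong) (simp add: \<pi>_def)
  ultimately have "bij_betw \<pi> {1..n} {1..n}" by blast
  then have "\<pi> permutes {1..n}" by (rule bij_imp_permutes) (auto simp: \<pi>_def)
  moreover have "\<forall>i\<in>{1..n}. order_stat n v i = v (\<pi> i)" using os by (simp add: \<pi>_def)
  ultimately show ?thesis by blast
qed

lemma order_stat_eqI:
  assumes \<pi>: "\<pi> permutes {1..n}" and mono: "\<And>i j. i \<in> {1..n} \<Longrightarrow> j \<in> {1..n} \<Longrightarrow> i \<le> j \<Longrightarrow> v (\<pi> i) \<le> v (\<pi> j)"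
    and i: "i \<in> {1..n}"
  shows "order_stat n v i = v (\<pi> i)"
proof -
  have m: "mset [1..<Suc n] = mset_set {1..n}"
    by (simp add: mset_upt atLeastLessThanSuc_atLeastAtMost del: upt_Suc)
  have "mset (map (\<lambda>i. v (\<pi> i)) [1..<Suc n]) = image_mset v (image_mset \<pi> (mset [1..<Suc n]))"
    by (simp add: multiset.map_comp comp_def del: upt_Suc)
  also have "\<dots> = mset (map v [1..<Suc n])"
    unfolding m permutes_image_mset[OF \<pi>] mset_map ..
  finally have "sort (map v [1..<Suc n]) = map (\<lambda>i. v (\<pi> i)) [1..<Suc n]"
    by (rule properties_for_sort) (auto simp: sorted_iff_nth_mono_less intro!: mono simp del: upt_Suc)
  moreover have "i - 1 < length [1..<Suc n]" "[1..<Suc n] ! (i - 1) = i" using i by (auto simp del: upt_Suc)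
  ultimately show ?thesis by (simp only: order_stat_def nth_map)
qed

lemma order_stat_mono: "1 \<le> i \<Longrightarrow> i \<le> j \<Longrightarrow> j \<le> n \<Longrightarrow> order_stat n v i \<le> order_stat n v j"
  unfolding order_stat_def by (intro sorted_nth_mono) auto

text \<open>Replaces sorting by a finite union of conditions on coordinates, which gives
  measurability and, on ordered boxes, a disjoint decomposition into rectangles.\<close>

lemma order_stat_Collect_eq:
  "{v \<in> S. \<forall>i\<in>{1..n}. order_stat n v i \<in> V i} = (\<Union>\<pi>\<in>{\<pi>. \<pi> permutes {1..n}}.
    {v \<in> S. (\<forall>i\<in>{1..n}. v (\<pi> i) \<in> V i) \<and> (\<forall>i\<in>{1..n}. \<forall>j\<in>{1..n}. i \<le> j \<longrightarrow> v (\<pi> i) \<le> v (\<pi> j))})" (is "?L = ?R")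
proof (intro equalityI subsetI)
  fix v assume v: "v \<in> ?L"
  obtain \<pi> where \<pi>: "\<pi> permutes {1..n}" "\<And>i. i \<in> {1..n} \<Longrightarrow> order_stat n v i = v (\<pi> i)"
    using order_stat_permutation[of n v] by blast
  then have "v (\<pi> i) \<le> v (\<pi> j)" if "i \<in> {1..n}" "j \<in> {1..n}" "i \<le> j" for i j
    using order_stat_mono[of i j n v] that by auto
  then show "v \<in> ?R" using \<pi> v by auto
next
  fix v assume "v \<in> ?R"
  then obtain \<pi> where \<pi>: "\<pi> permutes {1..n}" "v \<in> S" "\<forall>i\<in>{1..n}. v (\<pi> i) \<in> V i"
    "\<And>i j. i \<in> {1..n} \<Longrightarrow> j \<in> {1..n} \<Longrightarrow> i \<le> j \<Longrightarrow> v (\<pi> i) \<le> v (\<pi> j)" by blast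
  have "order_stat n v i = v (\<pi> i)" if "i \<in> {1..n}" for i
  proof (rule order_stat_eqI[OF \<pi>(1) _ that])
    show "v (\<pi> i) \<le> v (\<pi> j)" if "i \<in> {1..n}" "j \<in> {1..n}" "i \<le> j" for i j using that by (rule \<pi>(4))
  qed
  then show "v \<in> ?L" using \<pi>(2,3) by simp
qed

context
  fixes u :: real assumes u: "u > 0"
begin

lemma prob_space_uniform: "prob_space (uniform_measure lborel {0..u})"
  using u by (intro prob_space_uniform_measure) auto

lemma prob_space_uniform_vector: "prob_space (uniform_vector n u)"
  by (intro prob_space_PiM prob_space_uniform)

lemma emeasure_uniform:
  assumes "V \<in> sets borel" "V \<subseteq> {0..u}"
  shows "emeasure (uniform_measure lborel {0..u}) V = ennreal (measure lborel V / u)"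
proof -
  have "emeasure lborel V \<le> emeasure lborel {0..u}" using assms by (intro emeasure_mono) auto
  then have "emeasure lborel V \<noteq> \<infinity>" using u by (auto simp: top_unique)
  then have "emeasure lborel V = ennreal (measure lborel V)" by (simp add: emeasure_eq_ennreal_measure)
  moreover have "{0..u} \<inter> V = V" using assms(2) by auto
  ultimately show ?thesis using assms u by (simp add: divide_ennreal)
qed

lemma measurable_order_stat_Collect:
  assumes "\<And>i. i \<in> {1..n} \<Longrightarrow> V i \<in> sets borel"
  shows "{v \<in> space (uniform_vector n u). \<forall>i\<in>{1..n}. order_stat n v i \<in> V i} \<in> sets (uniform_vector n u)"
  unfolding order_stat_Collect_eq
proof (rule sets.finite_UN)
  show "finite {\<pi>. \<pi> permutes {1..n}}" by (simp add: finite_permutations)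
  fix \<pi> assume "\<pi> \<in> {\<pi>. \<pi> permutes {1..n}}"
  then have \<pi>: "\<pi> i \<in> {1..n}" if "i \<in> {1..n}" for i using that permutes_in_image by fastforce
  let ?M = "uniform_vector n u"
  have m: "(\<lambda>v. v (\<pi> i)) \<in> borel_measurable ?M" if "i \<in> {1..n}" for i
    using measurable_component_singleton[OF \<pi>[OF that], of "\<lambda>_. uniform_measure lborel {0..u}"]
    by (simp cong: measurable_cong_sets)
  have 1: "{v \<in> space ?M. \<forall>i\<in>{1..n}. v (\<pi> i) \<in> V i} \<in> sets ?M"
  proof (rule sets.sets_Collect_finite_All)
    fix i assume i: "i \<in> {1..n}"
    have "(\<lambda>v. v (\<pi> i)) -` V i \<inter> space ?M \<in> sets ?M" by (rule measurable_sets[OF m[OF i] assms[OF i]])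
    then show "{v \<in> space ?M. v (\<pi> i) \<in> V i} \<in> sets ?M" by (rule back_subst[where P="\<lambda>A. A \<in> sets ?M"]) blast
  qed simp
  have 2: "{v \<in> space ?M. i \<le> j \<longrightarrow> v (\<pi> i) \<le> v (\<pi> j)} \<in> sets ?M" if ij: "i \<in> {1..n}" "j \<in> {1..n}" for i j
  proof (cases "i \<le> j")
    case True
    then show ?thesis using borel_measurable_le[OF m[OF ij(1)] m[OF ij(2)]] by (simp only: simp_thms)
  next
    case False
    then show ?thesis using sets.top[of ?M] by (simp only: simp_thms Collect_mem_eq)
  qed
  have "{v \<in> space ?M. \<forall>i\<in>{1..n}. \<forall>j\<in>{1..n}. i \<le> j \<longrightarrow> v (\<pi> i) \<le> v (\<pi> j)} \<in> sets ?M"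
    by (intro sets.sets_Collect_finite_All finite_atLeastAtMost 2)
  from sets.sets_Collect_conj[OF this 1]
  show "{v \<in> space ?M. (\<forall>i\<in>{1..n}. v (\<pi> i) \<in> V i) \<and>
      (\<forall>i\<in>{1..n}. \<forall>j\<in>{1..n}. i \<le> j \<longrightarrow> v (\<pi> i) \<le> v (\<pi> j))} \<in> sets ?M" .
qed

text \<open>Each permutation contributes one rectangle of the same measure, the product of the
  lengths over \<open>u ^ n\<close>. The rectangles are disjoint because the boxes are, whence the
  factor \<open>fact n\<close>.\<close>

lemma emeasure_order_stat_ordered:
  assumes V: "borel_family n u V" "ordered_family n V"
  shows "emeasure (uniform_vector n u) {v \<in> space (uniform_vector n u). \<forall>i\<in>{1..n}. order_stat n v i \<in> V i} =
    ennreal (fact n / u ^ n * (\<Prod>i\<in>{1..n}. measure lborel (V i)))"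
proof -
  let ?M = "uniform_vector n u" and ?U = "uniform_measure lborel {0..u}"
  have Vs: "V i \<in> sets borel" "V i \<subseteq> {0..u}" if "i \<in> {1..n}" for i
    using V(1) that by (auto simp: borel_family_def)
  interpret product_sigma_finite "\<lambda>_::nat. ?U"
    by (rule product_sigma_finite.intro) (rule prob_space_imp_sigma_finite[OF prob_space_uniform])
  \<comment> \<open>Coordinate \<open>k\<close> takes rank \<open>inv \<pi> k\<close>, so it has to
    lie in the box with that number.\<close>
  define B where "B \<pi> = PiE {1..n} (\<lambda>k. V (inv \<pi> k))" for \<pi>
  have eq: "{v \<in> space ?M. (\<forall>i\<in>{1..n}. v (\<pi> i) \<in> V i) \<and>
      (\<forall>i\<in>{1..n}. \<forall>j\<in>{1..n}. i \<le> j \<longrightarrow> v (\<pi> i) \<le> v (\<pi> j))} = B \<pi>" if \<pi>: "\<pi> permutes {1..n}" for \<pi>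
  proof -
    have in1: "\<pi> i \<in> {1..n}" "inv \<pi> i \<in> {1..n}" if "i \<in> {1..n}" for i
      using that permutes_in_image[OF \<pi>] permutes_in_image[OF permutes_inv[OF \<pi>]] by blast+
    have inv: "\<pi> (inv \<pi> k) = k" "inv \<pi> (\<pi> k) = k" for k
      using permutes_inverses[OF \<pi>] by auto
    have "(\<forall>i\<in>{1..n}. v (\<pi> i) \<in> V i) \<longleftrightarrow> (\<forall>k\<in>{1..n}. v k \<in> V (inv \<pi> k))" for v :: "nat \<Rightarrow> real"
      using in1 inv by metis
    moreover have "v (\<pi> i) \<le> v (\<pi> j)" if "\<forall>i\<in>{1..n}. v (\<pi> i) \<in> V i" "i \<in> {1..n}" "j \<in> {1..n}" "i \<le> j" for v :: "nat \<Rightarrow> real" and i j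
    proof (cases "i = j")
      case False
      then have "i < j" using that(4) by simp
      then have "v (\<pi> i) < v (\<pi> j)" using that(1-3) V(2) unfolding ordered_family_def by blast
      then show ?thesis by simp
    qed simp
    moreover have "v \<in> space ?M \<longleftrightarrow> v \<in> extensional {1..n}" for v by (simp add: space_PiM PiE_def)
    ultimately show ?thesis unfolding B_def by (intro set_eqI) (unfold mem_Collect_eq PiE_iff, blast)
  qed
  have Bs: "B \<pi> \<in> sets ?M" and Bm: "emeasure ?M (B \<pi>) = ennreal ((\<Prod>i\<in>{1..n}. measure lborel (V i)) / u ^ n)"
    if \<pi>: "\<pi> permutes {1..n}" for \<pi>
  proof -
    have in2: "inv \<pi> k \<in> {1..n}" if "k \<in> {1..n}" for k
      using that permutes_in_image[OF permutes_inv[OF \<pi>]] by blast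
    have Vi: "V (inv \<pi> k) \<in> sets ?U" if "k \<in> {1..n}" for k using Vs(1)[OF in2[OF that]] by simp
    then show "B \<pi> \<in> sets ?M" unfolding B_def by (intro sets_PiM_I_finite) auto
    have "emeasure ?M (B \<pi>) = (\<Prod>k\<in>{1..n}. emeasure ?U (V (inv \<pi> k)))"
      unfolding B_def using Vi by (intro emeasure_PiM) auto
    also have "\<dots> = (\<Prod>k\<in>{1..n}. ennreal (measure lborel (V (inv \<pi> k)) / u))"
      using Vs in2 by (intro prod.cong refl emeasure_uniform) auto
    also have "\<dots> = ennreal (\<Prod>k\<in>{1..n}. measure lborel (V (inv \<pi> k)) / u)"
      using u by (intro prod_ennreal) auto
    also have "(\<Prod>k\<in>{1..n}. measure lborel (V (inv \<pi> k)) / u) = (\<Prod>i\<in>{1..n}. measure lborel (V i) / u)"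
      using prod.permute[OF permutes_inv[OF \<pi>], of "\<lambda>i. measure lborel (V i) / u"] by (simp add: comp_def)
    finally show "emeasure ?M (B \<pi>) = ennreal ((\<Prod>i\<in>{1..n}. measure lborel (V i)) / u ^ n)"
      by (simp add: prod_dividef)
  qed
  have disj: "disjoint_family_on B {\<pi>. \<pi> permutes {1..n}}"
    unfolding disjoint_family_on_def
  proof (intro ballI impI, rule ccontr)
    fix \<pi> \<rho> assume "\<pi> \<in> {\<pi>. \<pi> permutes {1..n}}" "\<rho> \<in> {\<pi>. \<pi> permutes {1..n}}" and ne: "\<pi> \<noteq> \<rho>" "B \<pi> \<inter> B \<rho> \<noteq> {}"
    then have p: "\<pi> permutes {1..n}" "\<rho> permutes {1..n}" by auto
    obtain v where v: "v \<in> B \<pi>" "v \<in> B \<rho>" using ne by blast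
    have "inv \<pi> k = inv \<rho> k" for k
    proof (cases "k \<in> {1..n}")
      case True
      then have "v k \<in> V (inv \<pi> k) \<inter> V (inv \<rho> k)" using v by (auto simp: B_def PiE_iff)
      moreover have "inv \<pi> k \<in> {1..n}" "inv \<rho> k \<in> {1..n}"
        using True permutes_in_image[OF permutes_inv[OF p(1)]] permutes_in_image[OF permutes_inv[OF p(2)]] by blast+
      ultimately show ?thesis using ordered_family_disjoint[OF V(2)] by blast
    next
      case False
      then show ?thesis using permutes_not_in[OF permutes_inv[OF p(1)]] permutes_not_in[OF permutes_inv[OF p(2)]] by metis
    qed
    then have "inv \<pi> = inv \<rho>" by auto
    then show False using ne(1) p by (metis permutes_inv_inv)
  qed
  have "{v \<in> space ?M. \<forall>i\<in>{1..n}. order_stat n v i \<in> V i} = (\<Union>\<pi>\<in>{\<pi>. \<pi> permutes {1..n}}. B \<pi>)"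
    unfolding order_stat_Collect_eq using eq by auto
  also have "emeasure ?M \<dots> = (\<Sum>\<pi>\<in>{\<pi>. \<pi> permutes {1..n}}. emeasure ?M (B \<pi>))"
    using Bs disj by (intro sum_emeasure[symmetric]) (auto simp: finite_permutations)
  also have "\<dots> = (\<Sum>\<pi>\<in>{\<pi>. \<pi> permutes {1..n}}. ennreal ((\<Prod>i\<in>{1..n}. measure lborel (V i)) / u ^ n))"
    using Bm by (intro sum.cong) auto
  also have "\<dots> = ennreal (\<Sum>\<pi>\<in>{\<pi>. \<pi> permutes {1..n}}. (\<Prod>i\<in>{1..n}. measure lborel (V i)) / u ^ n)"
    using u by (intro sum_ennreal) (auto intro!: divide_nonneg_nonneg prod_nonneg)
  also have "(\<Sum>\<pi>\<in>{\<pi>. \<pi> permutes {1..n}}. (\<Prod>i\<in>{1..n}. measure lborel (V i)) / u ^ n) =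
      fact n / u ^ n * (\<Prod>i\<in>{1..n}. measure lborel (V i))"
    by (simp add: card_permutations)
  finally show ?thesis .
qed

text \<open>The diagonal of the square is covered by \<open>L\<close> subsquares of probability
  \<open>1 / L * (1 / L)\<close> each, and \<open>L\<close> is arbitrary.\<close>

lemma uniform_tie_null:
  assumes ij: "i \<in> {1..n}" "j \<in> {1..n}" "i \<noteq> j"
  shows "{v \<in> space (uniform_vector n u). v i = v j \<and> v i \<in> {0..u}} \<in> null_sets (uniform_vector n u)" (is "?T \<in> _")
proof -
  let ?M = "uniform_vector n u" and ?U = "uniform_measure lborel {0..u}"
  interpret prob_space ?U by (rule prob_space_uniform)
  interpret M: prob_space ?M by (rule prob_space_uniform_vector)
  interpret product_sigma_finite "\<lambda>_::nat. ?U"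
    by (rule product_sigma_finite.intro) (rule prob_space_imp_sigma_finite[OF prob_space_uniform])
  have m: "(\<lambda>v. v k) \<in> ?M \<rightarrow>\<^sub>M borel" if "k \<in> {1..n}" for k
    using measurable_component_singleton[OF that, of "\<lambda>_. ?U"] by (simp cong: measurable_cong_sets)
  have T: "?T \<in> sets ?M"
  proof -
    have "(\<lambda>v. v i - v j) -` {0} \<inter> space ?M \<in> sets ?M" "(\<lambda>v. v i) -` {0..u} \<inter> space ?M \<in> sets ?M"
      using m[OF ij(1)] m[OF ij(2)] by (auto intro!: measurable_sets[of _ ?M borel] borel_measurable_diff)
    from sets.Int[OF this] show ?thesis by (rule back_subst[where P="\<lambda>A. A \<in> sets ?M"]) auto
  qed
  have bound: "measure ?M ?T \<le> 1 / real L" if L: "L > 0" for L :: nat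
  proof -
    define W where "W c = {real c * u / L .. real (Suc c) * u / L}" for c :: nat
    define B where "B c = PiE {1..n} (\<lambda>k. if k = i \<or> k = j then W c else UNIV)" for c
    have Bs: "B c \<in> sets ?M" for c unfolding B_def by (intro sets_PiM_I_finite) (auto simp: W_def)
    have "emeasure ?U (W c) = ennreal (1 / L)" if "c < L" for c
    proof -
      have "real (Suc c) * u / L \<le> u" using that u L by (simp add: divide_simps)
      then have "W c \<subseteq> {0..u}" using u by (auto simp: W_def intro: order_trans[OF _ _])
      then have "emeasure ?U (W c) = ennreal (measure lborel (W c) / u)" by (intro emeasure_uniform) (auto simp: W_def)
      also have "measure lborel (W c) = u / L"
        using u L by (subst W_def) (auto simp: divide_simps algebra_simps)
      finally show ?thesis using u by simp
    qed
    then have "emeasure ?M (B c) = ennreal (1 / L * (1 / L))" if "c < L" for c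
    proof -
      have "emeasure ?M (B c) = (\<Prod>k\<in>{1..n}. emeasure ?U (if k = i \<or> k = j then W c else UNIV))"
        unfolding B_def by (intro emeasure_PiM) (auto simp: W_def)
      also have "\<dots> = (\<Prod>k\<in>{i, j}. emeasure ?U (if k = i \<or> k = j then W c else UNIV))"
        using ij emeasure_space_1 by (intro prod.mono_neutral_right) auto
      also have "\<dots> = emeasure ?U (W c) * emeasure ?U (W c)" using ij(3) by simp
      also have "\<dots> = ennreal (1 / L) * ennreal (1 / L)"
        using \<open>\<And>c. c < L \<Longrightarrow> emeasure ?U (W c) = ennreal (1 / L)\<close>[OF that] by simp
      also have "\<dots> = ennreal (1 / L * (1 / L))" by (rule ennreal_mult'[symmetric]) simp
      finally show ?thesis .
    qed
    then have Bm: "measure ?M (B c) = 1 / L * (1 / L)" if "c < L" for c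
      using that by (simp add: measure_def)
    have "?T \<subseteq> (\<Union>c\<in>{..<L}. B c)"
    proof
      fix v assume v: "v \<in> ?T"
      \<comment> \<open>The minimum with \<open>L - 1\<close> takes care of the value
        \<open>u\<close>, whose floor would point beyond the last subinterval.\<close>
      define c where "c = min (L - 1) (nat \<lfloor>v i * L / u\<rfloor>)"
      have c: "c < L" using L by (auto simp: c_def)
      have r: "0 \<le> v i * L / u" "v i * L / u \<le> L" using v u L by (auto simp: divide_simps)
      have "real c \<le> v i * L / u"
      proof -
        have "real c \<le> real (nat \<lfloor>v i * L / u\<rfloor>)" unfolding c_def by simp
        also have "\<dots> \<le> v i * L / u" using r(1) by (rule of_nat_floor)
        finally show ?thesis .
      qed
      moreover have "v i * L / u \<le> real (Suc c)"
      proof (cases "nat \<lfloor>v i * L / u\<rfloor> \<le> L - 1")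
        case True
        then have "c = nat \<lfloor>v i * L / u\<rfloor>" by (simp add: c_def)
        then show ?thesis using r(1) by (simp add: ) linarith
      next
        case False
        then have "Suc c = L" using L by (simp add: c_def)
        then show ?thesis using r(2) by simp
      qed
      ultimately have "v i \<in> W c" using u L by (auto simp: W_def divide_simps mult.commute)
      then have "v \<in> B c" using v by (auto simp: B_def space_PiM PiE_iff)
      then show "v \<in> (\<Union>c\<in>{..<L}. B c)" using c by blast
    qed
    then have "measure ?M ?T \<le> measure ?M (\<Union>c\<in>{..<L}. B c)"
      using Bs by (intro M.finite_measure_mono) auto
    also have "\<dots> \<le> (\<Sum>c\<in>{..<L}. measure ?M (B c))"
      using Bs by (intro M.finite_measure_subadditive_finite) auto
    also have "\<dots> = (\<Sum>c\<in>{..<L}. 1 / L * (1 / L))" by (intro sum.cong refl Bm) auto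
    also have "\<dots> = 1 / L" using L by simp
    finally show ?thesis .
  qed
  have le: "measure ?M ?T \<le> inverse (real (Suc k))" for k
    using bound[OF zero_less_Suc[of k]] unfolding inverse_eq_divide .
  have "measure ?M ?T \<le> 0"
  proof (rule ccontr)
    assume "\<not> measure ?M ?T \<le> 0"
    then obtain k where "inverse (real (Suc k)) < measure ?M ?T" using reals_Archimedean[of "measure ?M ?T"] by auto
    then show False using le[of k] by linarith
  qed
  then have "measure ?M ?T = 0" by (simp add: measure_le_0_iff)
  then have "emeasure ?M ?T = 0" by (simp only: M.emeasure_eq_measure ennreal_0)
  then show ?thesis using T by (rule null_setsI)
qed

text \<open>A set of full probability on which the order statistics lie in the simplex without
  exception, as \<open>ordered_boxes_determine\<close> demands.\<close>

definition strict_order_stat :: "nat \<Rightarrow> (nat \<Rightarrow> real) set" where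
  "strict_order_stat n = {v \<in> space (uniform_vector n u). (\<forall>i\<in>{1..n}. order_stat n v i \<in> {0..u}) \<and>
    (\<forall>i\<in>{1..n}. \<forall>j\<in>{1..n}. i < j \<longrightarrow> order_stat n v i < order_stat n v j)}"

text \<open>Equal order statistics at different ranks come from two different coordinates, since
  ranks are matched to coordinates by a permutation.\<close>

lemma order_stat_ties_null:
  "{v \<in> space (uniform_vector n u). \<forall>i\<in>{1..n}. order_stat n v i \<in> {0..u}} - strict_order_stat n
    \<subseteq> (\<Union>(i, j)\<in>{(i, j). i \<in> {1..n} \<and> j \<in> {1..n} \<and> i \<noteq> j}. {v \<in> space (uniform_vector n u). v i = v j \<and> v i \<in> {0..u}})"
proof
  fix v assume "v \<in> {v \<in> space (uniform_vector n u). \<forall>i\<in>{1..n}. order_stat n v i \<in> {0..u}} - strict_order_stat n"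
  then obtain i j where v: "v \<in> space (uniform_vector n u)" "\<forall>i\<in>{1..n}. order_stat n v i \<in> {0..u}"
    and ij: "i \<in> {1..n}" "j \<in> {1..n}" "i < j" "\<not> order_stat n v i < order_stat n v j"
    by (auto simp: strict_order_stat_def)
  obtain \<pi> where \<pi>: "\<pi> permutes {1..n}" "\<And>i. i \<in> {1..n} \<Longrightarrow> order_stat n v i = v (\<pi> i)"
    using order_stat_permutation[of n v] by blast
  have "order_stat n v i = order_stat n v j" using ij order_stat_mono[of i j n v] by simp
  then have "v (\<pi> i) = v (\<pi> j)" "v (\<pi> i) \<in> {0..u}" using \<pi>(2) ij v(2) by metis+
  moreover have "\<pi> i \<noteq> \<pi> j" using permutes_inj[OF \<pi>(1)] ij(3) by (auto dest: injD)
  moreover have "\<pi> i \<in> {1..n}" "\<pi> j \<in> {1..n}" using ij permutes_in_image[OF \<pi>(1)] by blast+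
  ultimately show "v \<in> (\<Union>(i, j)\<in>{(i, j). i \<in> {1..n} \<and> j \<in> {1..n} \<and> i \<noteq> j}. {v \<in> space (uniform_vector n u). v i = v j \<and> v i \<in> {0..u}})"
    using v(1) by blast
qed

lemma emeasure_order_stat_strict:
  assumes V: "borel_family n u V"
  shows "{v \<in> strict_order_stat n. \<forall>i\<in>{1..n}. order_stat n v i \<in> V i} \<in> sets (uniform_vector n u)"
    and "emeasure (uniform_vector n u) {v \<in> strict_order_stat n. \<forall>i\<in>{1..n}. order_stat n v i \<in> V i} =
      ennreal (order_stat_prob n u V)"
proof -
  let ?M = "uniform_vector n u"
  interpret M: prob_space ?M by (rule prob_space_uniform_vector)
  let ?all = "\<lambda>V. {v \<in> space ?M. \<forall>i\<in>{1..n}. order_stat n v i \<in> V i}"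
  let ?ties = "\<Union>(i, j)\<in>{(i, j). i \<in> {1..n} \<and> j \<in> {1..n} \<and> i \<noteq> j}. {v \<in> space ?M. v i = v j \<and> v i \<in> {0..u}}"
  have all: "?all W \<in> sets ?M" if "borel_family n u W" for W
    using that by (intro measurable_order_stat_Collect) (auto simp: borel_family_def)
  have meas: "(\<lambda>v. order_stat n v i) \<in> ?M \<rightarrow>\<^sub>M borel" if i: "i \<in> {1..n}" for i
  proof (rule borel_measurableI_le)
    fix a
    have "{v \<in> space ?M. \<forall>k\<in>{1..n}. order_stat n v k \<in> (if k = i then {..a} else UNIV)} \<in> sets ?M"
      by (rule measurable_order_stat_Collect) auto
    also have "{v \<in> space ?M. \<forall>k\<in>{1..n}. order_stat n v k \<in> (if k = i then {..a} else UNIV)} =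
        {v \<in> space ?M. order_stat n v i \<le> a}" using i by auto
    finally show "{v \<in> space ?M. order_stat n v i \<le> a} \<in> sets ?M" .
  qed
  note [measurable] = meas
  have S: "strict_order_stat n \<in> sets ?M" unfolding strict_order_stat_def by measurable
  have eq: "{v \<in> strict_order_stat n. \<forall>i\<in>{1..n}. order_stat n v i \<in> V i} = strict_order_stat n \<inter> ?all V"
    by (auto simp: strict_order_stat_def)
  show "{v \<in> strict_order_stat n. \<forall>i\<in>{1..n}. order_stat n v i \<in> V i} \<in> sets ?M"
    unfolding eq using S all[OF V] by (rule sets.Int)
  have fin: "finite {(i, j). i \<in> {1..n} \<and> j \<in> {1..n} \<and> i \<noteq> j}"
    by (rule finite_subset[of _ "{1..n} \<times> {1..n}"]) auto
  have N: "?ties \<in> null_sets ?M"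
  proof (rule null_sets_UN'[OF countable_finite[OF fin]])
    fix p assume "p \<in> {(i, j). i \<in> {1..n} \<and> j \<in> {1..n} \<and> i \<noteq> j}"
    then obtain i j where p: "p = (i, j)" and ij: "i \<in> {1..n}" "j \<in> {1..n}" "i \<noteq> j" by blast
    show "(case p of (i, j) \<Rightarrow> {v \<in> space ?M. v i = v j \<and> v i \<in> {0..u}}) \<in> null_sets ?M"
      unfolding p prod.case by (rule uniform_tie_null[OF ij])
  qed
  have "?all V - strict_order_stat n \<subseteq> ?ties"
  proof -
    have "?all V \<subseteq> {v \<in> space ?M. \<forall>i\<in>{1..n}. order_stat n v i \<in> {0..u}}"
      using V unfolding borel_family_def by blast
    then have "?all V - strict_order_stat n \<subseteq> {v \<in> space ?M. \<forall>i\<in>{1..n}. order_stat n v i \<in> {0..u}} - strict_order_stat n"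
      by (rule Diff_mono) simp
    then show ?thesis using order_stat_ties_null[of n] by (rule order_trans)
  qed
  then have "AE v in ?M. v \<in> strict_order_stat n \<inter> ?all V \<longleftrightarrow> v \<in> ?all V"
    by (intro AE_I'[OF N]) auto
  then have "emeasure ?M (strict_order_stat n \<inter> ?all V) = emeasure ?M (?all V)"
    using S all[OF V] by (intro emeasure_eq_AE) auto
  then show "emeasure ?M {v \<in> strict_order_stat n. \<forall>i\<in>{1..n}. order_stat n v i \<in> V i} = ennreal (order_stat_prob n u V)"
    unfolding eq by (simp only: order_stat_prob_def order_stat_def M.emeasure_eq_measure)
qed

lemma strict_order_stat_sets: "strict_order_stat n \<in> sets (uniform_vector n u)"
proof -
  have "{v \<in> strict_order_stat n. \<forall>i\<in>{1..n}. order_stat n v i \<in> {0..u}} \<in> sets (uniform_vector n u)"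
    by (rule emeasure_order_stat_strict(1)) (simp add: borel_family_def)
  also have "{v \<in> strict_order_stat n. \<forall>i\<in>{1..n}. order_stat n v i \<in> {0..u}} = strict_order_stat n"
    by (auto simp: strict_order_stat_def)
  finally show ?thesis .
qed

text \<open>Values taken from an ordered family are strictly increasing by themselves, so discarding
  ties changes nothing.\<close>

lemma emeasure_strict_order_stat_ordered:
  assumes V: "borel_family n u V" "ordered_family n V"
  shows "emeasure (uniform_vector n u) {v \<in> strict_order_stat n. \<forall>i\<in>{1..n}. order_stat n v i \<in> V i} =
    ennreal (fact n / u ^ n * (\<Prod>i\<in>{1..n}. measure lborel (V i)))"
proof -
  have "{v \<in> strict_order_stat n. \<forall>i\<in>{1..n}. order_stat n v i \<in> V i} =
      {v \<in> space (uniform_vector n u). \<forall>i\<in>{1..n}. order_stat n v i \<in> V i}"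
    using V unfolding strict_order_stat_def borel_family_def ordered_family_def by blast
  then show ?thesis using emeasure_order_stat_ordered[OF V] by simp
qed

text \<open>The normalisation behind \<open>prob_N\<close>: up to a null set all the uniform
  variables, hence also their order statistics, take values in the interval.\<close>

lemma order_stat_prob_full: "order_stat_prob n u (\<lambda>_. {0..u}) = 1"
proof -
  let ?M = "uniform_vector n u" and ?U = "uniform_measure lborel {0..u}"
  interpret M: prob_space ?M by (rule prob_space_uniform_vector)
  interpret product_sigma_finite "\<lambda>_::nat. ?U"
    by (rule product_sigma_finite.intro) (rule prob_space_imp_sigma_finite[OF prob_space_uniform])
  let ?A = "{v \<in> space ?M. \<forall>i\<in>{1..n}. order_stat n v i \<in> {0..u}}"
  have "emeasure ?M (PiE {1..n} (\<lambda>_. {0..u})) = (\<Prod>i\<in>{1..n}. emeasure ?U {0..u})"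
    by (intro emeasure_PiM) auto
  also have "emeasure ?U {0..u} = 1" using u by (subst emeasure_uniform) auto
  finally have "measure ?M (PiE {1..n} (\<lambda>_. {0..u})) = 1" by (simp add: measure_def)
  moreover have "PiE {1..n} (\<lambda>_. {0..u}) \<subseteq> ?A"
  proof
    fix v assume v: "v \<in> PiE {1..n} (\<lambda>_. {0..u})"
    obtain \<pi> where \<pi>: "\<pi> permutes {1..n}" "\<forall>i\<in>{1..n}. order_stat n v i = v (\<pi> i)"
      using order_stat_permutation[of n v] by blast
    have "order_stat n v i \<in> {0..u}" if i: "i \<in> {1..n}" for i
    proof -
      have "\<pi> i \<in> {1..n}" using permutes_in_image[OF \<pi>(1)] i by blast
      then have "v (\<pi> i) \<in> {0..u}" using v by (rule PiE_mem[rotated])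
      then show ?thesis using \<pi>(2) i by metis
    qed
    moreover have "v \<in> space ?M" using v by (simp add: space_PiM PiE_iff)
    ultimately show "v \<in> ?A" by blast
  qed
  then have "measure ?M (PiE {1..n} (\<lambda>_. {0..u})) \<le> measure ?M ?A"
    by (intro M.finite_measure_mono measurable_order_stat_Collect) auto
  ultimately have "measure ?M ?A = 1" using M.prob_le_1[of ?A] by linarith
  then show ?thesis by (simp add: order_stat_prob_def order_stat_def del: upt_Suc)
qed

end

lemma order_stat_prob_cong:
  "(\<And>i. i \<in> {1..n} \<Longrightarrow> U i = V i) \<Longrightarrow> order_stat_prob n u U = order_stat_prob n u V"
  unfolding order_stat_prob_def by (intro arg_cong2[where f=measure] refl Collect_cong conj_cong ball_cong) auto


section \<open>The enumeration of the points of the process\<close>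

text \<open>Strict sorting makes the list of labels unique and the label an injective key, so the
  points themselves are determined.\<close>

lemma sorted_by_label_unique:
  fixes ps qs :: "('a \<times> real) list"
  assumes "sorted_wrt (\<lambda>p q. snd p < snd q) ps" "sorted_wrt (\<lambda>p q. snd p < snd q) qs" "set ps = set qs"
  shows "ps = qs"
proof -
  have ps: "sorted_wrt (<) (map snd ps)" and qs: "sorted_wrt (<) (map snd qs)"
    using assms(1,2) by (simp_all add: sorted_wrt_map)
  then have "map snd ps = map snd qs"
    using assms(3) by (intro strict_sorted_equal) auto
  moreover have "inj_on snd (set ps)"
    using ps by (metis distinct_map strict_sorted_iff)
  ultimately show ?thesis using assms(3) by (intro map_inj_on[of snd]) auto
qed

locale interlacement_process =
  fixes K :: "('d::finite) site set" and u :: real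
    and \<nu> :: "(int \<Rightarrow> 'd site) set measure" and P :: "'o measure" and \<omega> :: "'o \<Rightarrow> 'd config"
  assumes intensity: "interlacement_intensity \<nu>"
    and ppp: "poisson_point_process P (\<nu> \<Otimes>\<^sub>M restrict_space lborel {0..}) \<omega>"
    and finK: "finite K" and u: "u > 0"
begin

sublocale prob_space P
  using ppp by (simp add: poisson_point_process_def)

abbreviation I where "I \<equiv> \<nu> \<Otimes>\<^sub>M restrict_space lborel {0..}"

lemma sets_nu [measurable_cong]: "sets \<nu> = sets star_space"
  using intensity by (simp add: interlacement_intensity_def)

lemma sets_I: "sets I = sets marked_space"
  unfolding marked_space_def by (intro sets_pair_measure_cong sets_nu sets_restrict_space_cong) simp

lemma ex_Q: "\<exists>Q. is_Q K Q \<and> (\<forall>E\<in>sets star_space. E \<subseteq> star_hit K \<longrightarrow>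
    emeasure \<nu> E = emeasure Q {w \<in> full_trajs. proj_star w \<in> E})"
proof -
  have "\<forall>K. finite K \<longrightarrow> (\<exists>Q. is_Q K Q \<and> (\<forall>E\<in>sets star_space. E \<subseteq> star_hit K \<longrightarrow>
    emeasure \<nu> E = emeasure Q {w \<in> full_trajs. proj_star w \<in> E}))"
    using intensity unfolding interlacement_intensity_def by (elim conjE)
  then show ?thesis using finK by (elim allE[of _ K] mp)
qed

text \<open>Finite by \<open>nu_sub_finite\<close> whenever the event is measurable, so real values
  lose nothing; \<open>kappa G / cap K\<close> will be the law of a single trajectory.\<close>

definition kappa :: "(int \<Rightarrow> 'd site) set \<Rightarrow> real" where
  "kappa G = measure \<nu> (star_event K G)"

lemma nu_star_hit: "emeasure \<nu> (star_hit K) = ennreal (cap K)"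
proof -
  obtain Q where Q: "is_Q K Q" "\<And>E. E \<in> sets star_space \<Longrightarrow> E \<subseteq> star_hit K \<Longrightarrow>
    emeasure \<nu> E = emeasure Q {w \<in> full_trajs. proj_star w \<in> E}"
    using ex_Q by meson
  have "emeasure \<nu> (star_hit K) = emeasure Q {w \<in> full_trajs. proj_star w \<in> star_event K UNIV}"
    using Q(2)[OF star_hit_sets[OF finK]] by (simp add: star_hit_event[OF finK, symmetric])
  also have "\<dots> = emeasure Q (UNIV \<inter> canon K)"
    by (rule Q_star_event[OF finK Q(1)]) simp
  finally show ?thesis using Q_canon[OF finK Q(1)] by simp
qed

lemma nu_sub_finite:
  assumes "E \<in> sets star_space" "E \<subseteq> star_hit K"
  shows "emeasure \<nu> E = ennreal (measure \<nu> E)" and "measure \<nu> E \<le> cap K"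
proof -
  have le: "emeasure \<nu> E \<le> ennreal (cap K)"
    unfolding nu_star_hit[symmetric] using assms star_hit_sets[OF finK] by (intro emeasure_mono) (auto simp: sets_nu)
  then have "emeasure \<nu> E \<noteq> \<infinity>" by (metis ennreal_neq_top infinity_ennreal_def neq_top_trans)
  then show "emeasure \<nu> E = ennreal (measure \<nu> E)" by (simp add: emeasure_eq_ennreal_measure)
  moreover have "0 \<le> cap K" by (simp add: cap_def sum_nonneg eq_measure_nonneg)
  ultimately show "measure \<nu> E \<le> cap K" using le by (simp add: ennreal_le_iff)
qed

lemma star_event_sub: "star_event K G \<subseteq> star_hit K"
  by (auto simp: star_event_def)

lemma kappa_exc_event:
  assumes c: "compatible K c Fs Hs" and A: "A \<in> sets half_space" and B: "B \<in> sets half_space"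
  shows "ennreal (kappa (exc_event K Fs Hs A B)) =
    ennreal (srw_avoid K (fst (hd c)) A * eq_measure K (fst (hd c))) * (prod_list (map weight Fs) *
      prod_list (map weight Hs) * ennreal (eq_measure K (snd (last c)) * srw_avoid K (snd (last c)) B))"
proof -
  obtain Q where Q: "is_Q K Q" "\<And>E. E \<in> sets star_space \<Longrightarrow> E \<subseteq> star_hit K \<Longrightarrow>
    emeasure \<nu> E = emeasure Q {w \<in> full_trajs. proj_star w \<in> E}"
    using ex_Q by meson
  note T = Q_exc_event[OF finK Q(1) c A B]
  note S = star_event_sets[OF finK T(2)]
  have "ennreal (kappa (exc_event K Fs Hs A B)) = emeasure \<nu> (star_event K (exc_event K Fs Hs A B))"
    unfolding kappa_def using nu_sub_finite(1)[OF S star_event_sub] by simp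
  also have "\<dots> = emeasure Q (exc_event K Fs Hs A B \<inter> canon K)"
    unfolding Q(2)[OF S star_event_sub] by (rule Q_star_event[OF finK Q(1) T(2)])
  finally show ?thesis unfolding T(1) .
qed

text \<open>Representatives are canonical, so \<open>G\<close> matters only on
  \<open>canon K\<close>.\<close>

lemma kappa_cong:
  assumes "\<And>w. w \<in> canon K \<Longrightarrow> w \<in> G \<longleftrightarrow> w \<in> G'"
  shows "kappa G = kappa G'"
proof -
  have "star_event K G = star_event K G'"
    using assms rep_canon[OF finK] by (auto simp: star_event_def)
  then show ?thesis by (simp add: kappa_def)
qed

lemma hit_region_sets: "hit_region K u \<in> sets marked_space"
proof -
  have "{0..u} \<in> sets (restrict_space borel {0::real..})" by (auto simp: sets_restrict_space_iff)
  then show ?thesis unfolding hit_region_def marked_space_def using star_hit_sets[OF finK] by auto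
qed

lemma Times_sets:
  assumes "E \<in> sets star_space" "V \<in> sets borel" "V \<subseteq> {0..u}"
  shows "E \<times> V \<in> sets marked_space"
proof -
  have "V \<in> sets (restrict_space borel {0::real..})" using assms(2,3) by (auto simp: sets_restrict_space_iff)
  then show ?thesis unfolding marked_space_def using assms(1) by auto
qed

text \<open>Sigma-finiteness of Lebesgue measure on the half line makes the product measure
  multiplicative; both factors are finite, which allows real numbers on the right.\<close>

lemma emeasure_I_Times:
  assumes E: "E \<in> sets star_space" "E \<subseteq> star_hit K" and V: "V \<in> sets borel" "V \<subseteq> {0..u}"
  shows "emeasure I (E \<times> V) = ennreal (measure \<nu> E * measure lborel V)"
proof -
  have "0 \<le> x" if "x \<in> V" for x using V(2) that by auto
  then have V': "V \<in> sets (restrict_space lborel {0..})" using V(1) by (auto simp: sets_restrict_space_iff)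
  interpret L: sigma_finite_measure "restrict_space lborel {0::real..}"
    by (intro sigma_finite_measure_restrict_space lborel.sigma_finite_measure_axioms) auto
  have "emeasure I (E \<times> V) = emeasure \<nu> E * emeasure (restrict_space lborel {0..}) V"
    using E V' by (intro L.emeasure_pair_measure_Times) (auto simp: sets_nu)
  also have "emeasure (restrict_space lborel {0..}) V = emeasure lborel V"
    using V \<open>\<And>x. x \<in> V \<Longrightarrow> 0 \<le> x\<close> by (intro emeasure_restrict_space) auto
  also have "\<dots> = ennreal (measure lborel V)"
  proof -
    have "emeasure lborel V \<le> emeasure lborel {0..u}" using V by (intro emeasure_mono) auto
    then have "emeasure lborel V \<noteq> \<infinity>" using u by (auto simp: top_unique)
    then show ?thesis by (simp add: emeasure_eq_ennreal_measure)
  qed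
  finally show ?thesis by (simp add: nu_sub_finite(1)[OF E] ennreal_mult')
qed

lemma measure_I_region: "emeasure I (hit_region K u) = ennreal (cap K * u)"
proof -
  have "measure \<nu> (star_hit K) = cap K"
    using nu_star_hit by (simp add: measure_def cap_def sum_nonneg eq_measure_nonneg)
  then show ?thesis unfolding hit_region_def
    using emeasure_I_Times[OF star_hit_sets[OF finK] order_refl, of "{0..u}"] u by simp
qed

text \<open>A configuration is an image of counting measure, so masses of measurable sets are
  numbers of indices.\<close>

lemma omega_points:
  assumes "\<xi> \<in> space P"
  shows "\<exists>(J :: nat set) p. \<omega> \<xi> = distr (count_space J) I p \<and>
    (\<forall>E\<in>sets marked_space. emeasure (\<omega> \<xi>) E = emeasure (count_space J) {j \<in> J. p j \<in> E})"
proof -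
  obtain J :: "nat set" and p where p: "p \<in> J \<rightarrow> space I" "\<omega> \<xi> = distr (count_space J) I p"
    using ppp assms unfolding poisson_point_process_def by blast
  have "emeasure (\<omega> \<xi>) E = emeasure (count_space J) {j \<in> J. p j \<in> E}" if "E \<in> sets marked_space" for E
  proof -
    have "emeasure (\<omega> \<xi>) E = emeasure (count_space J) (p -` E \<inter> space (count_space J))"
      unfolding p(2) using p(1) that sets_I by (intro emeasure_distr) auto
    also have "p -` E \<inter> space (count_space J) = {j \<in> J. p j \<in> E}" by auto
    finally show ?thesis .
  qed
  then show ?thesis using p(2) by blast
qed

lemma sets_omega: "\<xi> \<in> space P \<Longrightarrow> sets (\<omega> \<xi>) = sets marked_space"
proof -
  assume "\<xi> \<in> space P"
  then obtain J :: "nat set" and p where "\<omega> \<xi> = distr (count_space J) I p"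
    using omega_points by blast
  then show ?thesis using sets_I by simp
qed

lemma space_omega: "\<xi> \<in> space P \<Longrightarrow> space (\<omega> \<xi>) = space marked_space"
  using sets_omega by (rule sets_eq_imp_space_eq)

lemma emeasure_inner:
  assumes "\<xi> \<in> space P" "E \<in> sets marked_space"
  shows "emeasure (inner_part K u (\<omega> \<xi>)) E = emeasure (\<omega> \<xi>) (hit_region K u \<inter> E)"
  unfolding inner_part_def using assms hit_region_sets by (intro emeasure_restricted) (auto simp: sets_omega)

lemma emeasure_outer:
  assumes "\<xi> \<in> space P" "E \<in> sets marked_space"
  shows "emeasure (outer_part K u (\<omega> \<xi>)) E = emeasure (\<omega> \<xi>) ((space marked_space - hit_region K u) \<inter> E)"
  unfolding outer_part_def space_omega[OF assms(1)]
  using assms hit_region_sets by (intro emeasure_restricted) (auto simp: sets_omega)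

lemma omega_measurable: "E \<in> sets marked_space \<Longrightarrow> (\<lambda>\<xi>. emeasure (\<omega> \<xi>) E) \<in> borel_measurable P"
  using ppp sets_I unfolding poisson_point_process_def by blast

lemma sets_inner: "\<xi> \<in> space P \<Longrightarrow> sets (inner_part K u (\<omega> \<xi>)) = sets marked_space"
  by (simp add: inner_part_def sets_omega)

lemma hit_region_sub: "hit_region K u \<subseteq> space marked_space"
  by (rule sets.sets_into_space[OF hit_region_sets])

text \<open>A configuration counts points with multiplicity, hence positions of the list are counted
  rather than its members.\<close>

lemma emeasure_enumeration:
  assumes \<xi>: "\<xi> \<in> space P" and ps: "is_enumeration K u (\<omega> \<xi>) ps" and E: "E \<in> sets marked_space" "E \<subseteq> hit_region K u"
  shows "emeasure (\<omega> \<xi>) E = of_nat (card {k. k < length ps \<and> ps ! k \<in> E})"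
proof -
  have sub: "set ps \<subseteq> hit_region K u" using ps by (simp add: is_enumeration_def)
  have m: "(\<lambda>i. ps ! i) \<in> count_space {..<length ps} \<rightarrow>\<^sub>M marked_space"
    using sub hit_region_sub by (auto simp: set_conv_nth)
  have "emeasure (\<omega> \<xi>) E = emeasure (inner_part K u (\<omega> \<xi>)) E"
    using E emeasure_inner[OF \<xi> E(1)] by (simp add: Int_absorb1)
  also have "\<dots> = emeasure (distr (count_space {..<length ps}) marked_space (\<lambda>i. ps ! i)) E"
    using ps by (simp add: is_enumeration_def)
  also have "\<dots> = emeasure (count_space {..<length ps}) {k. k < length ps \<and> ps ! k \<in> E}"
    unfolding emeasure_distr[OF m E(1)] by (intro arg_cong2[where f=emeasure]) auto
  also have "\<dots> = of_nat (card {k. k < length ps \<and> ps ! k \<in> E})"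
    by (intro emeasure_count_space_finite) auto
  finally show ?thesis .
qed

lemma marked_singleton:
  assumes "p \<in> hit_region K u"
  shows "{p} \<in> sets marked_space"
proof -
  obtain ws t where p: "p = (ws, t)" "ws \<in> star_hit K" "t \<in> {0..u}" using assms by (auto simp: hit_region_def)
  have "ws \<in> space star_space" using p(2) sets.sets_into_space[OF star_hit_sets[OF finK]] by blast
  then have "{ws} \<times> {t} \<in> sets marked_space" using p(3) by (intro Times_sets star_singleton_sets) auto
  then show ?thesis by (simp add: p(1))
qed

text \<open>The entries of an enumeration are the atoms of the configuration in the hit region,
  hence a set determined by it; the labels fix their order.\<close>

lemma enumeration_unique:
  assumes \<xi>: "\<xi> \<in> space P" and ps: "is_enumeration K u (\<omega> \<xi>) ps" and qs: "is_enumeration K u (\<omega> \<xi>) qs"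
  shows "ps = qs"
proof -
  have mem: "p \<in> set ps \<longleftrightarrow> p \<in> hit_region K u \<and> emeasure (\<omega> \<xi>) {p} \<noteq> 0" if ps: "is_enumeration K u (\<omega> \<xi>) ps" for ps p
  proof (cases "p \<in> hit_region K u")
    case True
    then have "emeasure (\<omega> \<xi>) {p} = of_nat (card {k. k < length ps \<and> ps ! k \<in> {p}})"
      using marked_singleton by (intro emeasure_enumeration[OF \<xi> ps]) auto
    then show ?thesis using True by (auto simp: in_set_conv_nth)
  next
    case False
    then show ?thesis using ps by (auto simp: is_enumeration_def)
  qed
  then have "set ps = set qs" using ps qs by blast
  then show ?thesis using ps qs unfolding is_enumeration_def by (intro sorted_by_label_unique) auto
qed

lemma enumeration_eqI: "\<xi> \<in> space P \<Longrightarrow> is_enumeration K u (\<omega> \<xi>) ps \<Longrightarrow> enumeration K u (\<omega> \<xi>) = ps"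
  unfolding enumeration_def using enumeration_unique by (auto intro!: the_equality)

text \<open>A positive count excludes the default empty list, which also stands for a missing
  enumeration. Events with \<open>n \<ge> 1\<close> therefore refer to true enumerations.\<close>

lemma is_enumeration_enumeration:
  assumes "\<xi> \<in> space P" "N_count K u (\<omega> \<xi>) \<noteq> 0"
  shows "is_enumeration K u (\<omega> \<xi>) (enumeration K u (\<omega> \<xi>))"
proof (cases "\<exists>ps. is_enumeration K u (\<omega> \<xi>) ps")
  case True
  then show ?thesis using enumeration_eqI[OF assms(1)] by metis
qed (use assms in \<open>simp add: N_count_def enumeration_def\<close>)

section \<open>Events on the enumeration expressed by counts in boxes\<close>

definition point_event :: "nat \<Rightarrow> (nat \<Rightarrow> (int \<Rightarrow> 'd site) set set) \<Rightarrow> (nat \<Rightarrow> real set) \<Rightarrow> 'o set" where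
  "point_event n E V = {\<xi> \<in> space P. N_count K u (\<omega> \<xi>) = n \<and>
    (\<forall>i\<in>{1..n}. fst (enumeration K u (\<omega> \<xi>) ! (i - 1)) \<in> E i \<and> label K u (\<omega> \<xi>) i \<in> V i)}"

definition star_family :: "nat \<Rightarrow> (nat \<Rightarrow> (int \<Rightarrow> 'd site) set set) \<Rightarrow> bool" where
  "star_family n E \<longleftrightarrow> (\<forall>i\<in>{1..n}. E i \<in> sets star_space \<and> E i \<subseteq> star_hit K)"

definition rest_region :: "nat \<Rightarrow> (nat \<Rightarrow> (int \<Rightarrow> 'd site) set set) \<Rightarrow> (nat \<Rightarrow> real set) \<Rightarrow>
    ((int \<Rightarrow> 'd site) set \<times> real) set" where
  "rest_region n E V = hit_region K u - (\<Union>i\<in>{1..n}. E i \<times> V i)"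

context
  fixes n :: nat and E V
  assumes n: "n \<ge> 1" and E: "star_family n E" and V: "borel_family n u V" "ordered_family n V"
begin

lemma cell_sets: "i \<in> {1..n} \<Longrightarrow> E i \<times> V i \<in> sets marked_space"
  using E V(1) by (intro Times_sets) (auto simp: star_family_def borel_family_def)

lemma cell_sub: "i \<in> {1..n} \<Longrightarrow> E i \<times> V i \<subseteq> hit_region K u"
  using E V(1) unfolding hit_region_def star_family_def borel_family_def by blast

lemma rest_sets: "rest_region n E V \<in> sets marked_space"
  unfolding rest_region_def using hit_region_sets cell_sets by (intro sets.Diff sets.finite_UN) auto

lemma cell_disjoint: "i \<in> {1..n} \<Longrightarrow> j \<in> {1..n} \<Longrightarrow> i \<noteq> j \<Longrightarrow> (E i \<times> V i) \<inter> (E j \<times> V j) = {}"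
  using ordered_family_disjoint[OF V(2)] by blast

text \<open>Since the label sets follow one another, one point per box and none elsewhere forces the
  order of the list. The passage from counts to the list builds the enumeration from the single
  point in each box, so its existence is obtained on the event itself.\<close>

lemma point_event_box:
  "point_event n E V = {\<xi> \<in> space P. (\<forall>i\<in>{1..n}. emeasure (\<omega> \<xi>) (E i \<times> V i) = 1) \<and>
    emeasure (\<omega> \<xi>) (rest_region n E V) = 0}" (is "_ = ?B")
proof (intro equalityI subsetI)
  fix \<xi> assume "\<xi> \<in> point_event n E V"
  then have \<xi>: "\<xi> \<in> space P" and N: "N_count K u (\<omega> \<xi>) = n"
    and pts: "\<And>i. i \<in> {1..n} \<Longrightarrow> enumeration K u (\<omega> \<xi>) ! (i - 1) \<in> E i \<times> V i"
    by (auto simp: point_event_def label_def mem_Times_iff)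
  let ?ps = "enumeration K u (\<omega> \<xi>)"
  have ps: "is_enumeration K u (\<omega> \<xi>) ?ps" and len: "length ?ps = n"
    using is_enumeration_enumeration[OF \<xi>] N n unfolding N_count_def by linarith+
  have pt: "?ps ! k \<in> E (Suc k) \<times> V (Suc k)" if "k < n" for k using pts[of "Suc k"] that by simp
  have "emeasure (\<omega> \<xi>) (E i \<times> V i) = 1" if i: "i \<in> {1..n}" for i
  proof -
    have "{k. k < length ?ps \<and> ?ps ! k \<in> E i \<times> V i} = {i - 1}"
    proof (intro equalityI subsetI)
      fix k assume k: "k \<in> {k. k < length ?ps \<and> ?ps ! k \<in> E i \<times> V i}"
      then have "k < n" "?ps ! k \<in> (E (Suc k) \<times> V (Suc k)) \<inter> (E i \<times> V i)" using pt len by auto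
      then have "Suc k = i" using cell_disjoint[of "Suc k" i] i by (cases "Suc k = i") auto
      then show "k \<in> {i - 1}" by auto
    next
      fix k assume "k \<in> {i - 1}"
      then have "k = i - 1" by simp
      moreover have "i - 1 < length ?ps" using i len by auto
      ultimately show "k \<in> {k. k < length ?ps \<and> ?ps ! k \<in> E i \<times> V i}" using pts[OF i] by blast
    qed
    then show ?thesis using emeasure_enumeration[OF \<xi> ps cell_sets[OF i] cell_sub[OF i]] by simp
  qed
  moreover have "emeasure (\<omega> \<xi>) (rest_region n E V) = 0"
  proof -
    have "?ps ! k \<notin> rest_region n E V" if "k < length ?ps" for k
      using pt[of k] that len unfolding rest_region_def by (auto intro!: bexI[of _ "Suc k"])
    then have "{k. k < length ?ps \<and> ?ps ! k \<in> rest_region n E V} = {}" by blast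
    then show ?thesis
      using emeasure_enumeration[OF \<xi> ps rest_sets] by (simp add: rest_region_def)
  qed
  ultimately show "\<xi> \<in> ?B" using \<xi> by blast
next
  fix \<xi> assume "\<xi> \<in> ?B"
  then have \<xi>: "\<xi> \<in> space P" and one: "\<And>i. i \<in> {1..n} \<Longrightarrow> emeasure (\<omega> \<xi>) (E i \<times> V i) = 1"
    and zero: "emeasure (\<omega> \<xi>) (rest_region n E V) = 0" by auto
  obtain J :: "nat set" and p where J0: "\<omega> \<xi> = distr (count_space J) I p \<and>
      (\<forall>B\<in>sets marked_space. emeasure (\<omega> \<xi>) B = emeasure (count_space J) {j \<in> J. p j \<in> B})"
    using omega_points[OF \<xi>] by (elim exE)
  have J: "emeasure (\<omega> \<xi>) B = emeasure (count_space J) {j \<in> J. p j \<in> B}" if "B \<in> sets marked_space" for B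
    by (rule bspec[OF conjunct2[OF J0] that])
  have single: "\<exists>k. {j \<in> J. p j \<in> E i \<times> V i} = {k}" if i: "i \<in> {1..n}" for i
  proof -
    let ?S = "{j \<in> J. p j \<in> E i \<times> V i}"
    have c: "emeasure (count_space J) ?S = 1" using one[OF i] J[OF cell_sets[OF i]] by simp
    have "finite ?S"
    proof (rule ccontr)
      assume "infinite ?S"
      then have "emeasure (count_space J) ?S = \<infinity>" by (intro emeasure_count_space_infinite) auto
      then show False using c by simp
    qed
    then have "emeasure (count_space J) ?S = of_nat (card ?S)"
      by (rule emeasure_count_space_finite[rotated]) blast
    from trans[OF this[symmetric] c] have "card ?S = 1" by (simp only: of_nat_eq_1_iff)
    then show ?thesis by (rule card_1_singletonE) (rule exI)
  qed
  have "\<exists>f. \<forall>i\<in>{1..n}. {j \<in> J. p j \<in> E i \<times> V i} = {f i}"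
    by (rule bchoice, rule ballI, rule single)
  then obtain f where f0: "\<forall>i\<in>{1..n}. {j \<in> J. p j \<in> E i \<times> V i} = {f i}" by (rule exE)
  have f: "{j \<in> J. p j \<in> E i \<times> V i} = {f i}" if "i \<in> {1..n}" for i by (rule bspec[OF f0 that])
  have fJ: "f i \<in> J" "p (f i) \<in> E i \<times> V i" if "i \<in> {1..n}" for i using f[OF that] by auto
  have none: "{j \<in> J. p j \<in> rest_region n E V} = {}"
  proof (rule ccontr)
    assume "{j \<in> J. p j \<in> rest_region n E V} \<noteq> {}"
    moreover have "emeasure (count_space J) {j \<in> J. p j \<in> rest_region n E V} = 0"
      using zero J[OF rest_sets] by simp
    ultimately show False by (subst (asm) emeasure_count_space_eq_0) auto
  qed
  \<comment> \<open>\<open>f (Suc k)\<close> is the index of the unique point in box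
    \<open>Suc k\<close>, and the boxes are numbered in the order of their labels.\<close>
  define ps where "ps = map (\<lambda>k. p (f (Suc k))) [0..<n]"
  have len: "length ps = n" and nth: "\<And>k. k < n \<Longrightarrow> ps ! k = p (f (Suc k))" by (auto simp: ps_def)
  have cell: "ps ! k \<in> E (Suc k) \<times> V (Suc k)" if "k < n" for k using fJ(2)[of "Suc k"] nth that by simp
  have sorted: "sorted_wrt (\<lambda>p q. snd p < snd q) ps"
    unfolding sorted_wrt_iff_nth_less
  proof (intro allI impI)
    fix i j assume ij: "i < j" "j < length ps"
    then have "snd (ps ! i) \<in> V (Suc i)" "snd (ps ! j) \<in> V (Suc j)" using cell[of i] cell[of j] len by auto
    moreover have "Suc i \<in> {1..n}" "Suc j \<in> {1..n}" "Suc i < Suc j" using ij len by auto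
    ultimately show "snd (ps ! i) < snd (ps ! j)" using V(2) unfolding ordered_family_def by blast
  qed
  have sub: "set ps \<subseteq> hit_region K u"
  proof
    fix q assume "q \<in> set ps"
    then obtain k where "k < n" "q = ps ! k" using len by (auto simp: in_set_conv_nth)
    then show "q \<in> hit_region K u" using cell[of k] cell_sub[of "Suc k"] by auto
  qed
  have "inner_part K u (\<omega> \<xi>) = distr (count_space {..<length ps}) marked_space (\<lambda>i. ps ! i)"
  proof (rule measure_eqI)
    show "sets (inner_part K u (\<omega> \<xi>)) = sets (distr (count_space {..<length ps}) marked_space (\<lambda>i. ps ! i))"
      by (simp add: sets_inner[OF \<xi>])
    fix B assume "B \<in> sets (inner_part K u (\<omega> \<xi>))"
    then have B: "B \<in> sets marked_space" by (simp add: sets_inner[OF \<xi>])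
    have inj: "inj_on (\<lambda>k. f (Suc k)) {..<n}"
    proof (rule inj_onI)
      fix k l assume kl: "k \<in> {..<n}" "l \<in> {..<n}" "f (Suc k) = f (Suc l)"
      then have "p (f (Suc k)) \<in> (E (Suc k) \<times> V (Suc k)) \<inter> (E (Suc l) \<times> V (Suc l))"
        using fJ(2)[of "Suc k"] fJ(2)[of "Suc l"] by auto
      then show "k = l" using cell_disjoint[of "Suc k" "Suc l"] kl by (cases "k = l") auto
    qed
    \<comment> \<open>The rest region holds no points, so the points of the hit region are exactly
      the chosen ones, and counting them is counting list positions.\<close>
    have im: "{j \<in> J. p j \<in> hit_region K u \<inter> B} = (\<lambda>k. f (Suc k)) ` {k. k < n \<and> ps ! k \<in> B}"
    proof (intro equalityI subsetI)
      fix j assume j: "j \<in> {j \<in> J. p j \<in> hit_region K u \<inter> B}"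
      then have jJ: "j \<in> J" and hit: "p j \<in> hit_region K u" by simp_all
      have "p j \<notin> rest_region n E V"
      proof
        assume "p j \<in> rest_region n E V"
        with jJ have "j \<in> {j \<in> J. p j \<in> rest_region n E V}" by (intro CollectI conjI)
        then show False unfolding none by (rule emptyE)
      qed
      then have "p j \<in> (\<Union>i\<in>{1..n}. E i \<times> V i)" using hit unfolding rest_region_def by simp
      then obtain i where i: "i \<in> {1..n}" "p j \<in> E i \<times> V i" by (rule UN_E)
      with jJ have "j \<in> {j \<in> J. p j \<in> E i \<times> V i}" by (intro CollectI conjI)
      then have "j = f i" unfolding f[OF i(1)] by (rule singletonD)
      then show "j \<in> (\<lambda>k. f (Suc k)) ` {k. k < n \<and> ps ! k \<in> B}"
        using i(1) j nth[of "i - 1"] by (intro image_eqI[of _ _ "i - 1"]) auto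
    next
      fix j assume "j \<in> (\<lambda>k. f (Suc k)) ` {k. k < n \<and> ps ! k \<in> B}"
      then obtain k where k: "k < n" "ps ! k \<in> B" "j = f (Suc k)" by blast
      then show "j \<in> {j \<in> J. p j \<in> hit_region K u \<inter> B}"
        using fJ[of "Suc k"] cell_sub[of "Suc k"] nth[OF k(1)] by auto
    qed
    have m: "(\<lambda>i. ps ! i) \<in> count_space {..<length ps} \<rightarrow>\<^sub>M marked_space"
      using sub hit_region_sub by (auto simp: set_conv_nth)
    have "emeasure (inner_part K u (\<omega> \<xi>)) B = emeasure (count_space J) ((\<lambda>k. f (Suc k)) ` {k. k < n \<and> ps ! k \<in> B})"
      unfolding emeasure_inner[OF \<xi> B] im[symmetric] using B hit_region_sets by (intro J) auto
    also have "\<dots> = of_nat (card ((\<lambda>k. f (Suc k)) ` {k. k < n \<and> ps ! k \<in> B}))"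
      using fJ(1) by (intro emeasure_count_space_finite) auto
    also have "card ((\<lambda>k. f (Suc k)) ` {k. k < n \<and> ps ! k \<in> B}) = card {k. k < n \<and> ps ! k \<in> B}"
      by (rule card_image) (rule inj_on_subset[OF inj], auto)
    also have "of_nat \<dots> = emeasure (count_space {..<length ps}) {k. k < n \<and> ps ! k \<in> B}"
      using len by (intro emeasure_count_space_finite[symmetric]) auto
    also have "\<dots> = emeasure (distr (count_space {..<length ps}) marked_space (\<lambda>i. ps ! i)) B"
      unfolding emeasure_distr[OF m B] using len by (intro arg_cong2[where f=emeasure]) auto
    finally show "emeasure (inner_part K u (\<omega> \<xi>)) B = emeasure (distr (count_space {..<length ps}) marked_space (\<lambda>i. ps ! i)) B" .
  qed
  then have "is_enumeration K u (\<omega> \<xi>) ps" using sorted sub by (simp add: is_enumeration_def)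
  from enumeration_eqI[OF \<xi> this] have en: "enumeration K u (\<omega> \<xi>) = ps" .
  have "fst (ps ! (i - 1)) \<in> E i \<and> snd (ps ! (i - 1)) \<in> V i" if "i \<in> {1..n}" for i
    using cell[of "i - 1"] that by (auto simp: mem_Times_iff)
  then show "\<xi> \<in> point_event n E V" using \<xi> len by (simp add: point_event_def N_count_def label_def en)
qed

lemma rest_sub: "rest_region n E V \<subseteq> hit_region K u"
  by (auto simp: rest_region_def)

text \<open>Outside the hit region the process is independent of the boxes: refining finitely many sets to the
  atoms of the algebra they generate, everything is a function of disjoint counts.\<close>

lemma prob_point_event_box:
  fixes l :: nat
  assumes D: "\<And>k. k < l \<Longrightarrow> D k \<in> sets marked_space" and C: "\<And>k. k < l \<Longrightarrow> C k \<in> sets (borel :: ennreal measure)"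
  defines "out \<equiv> {\<xi> \<in> space P. \<forall>k<l. emeasure (outer_part K u (\<omega> \<xi>)) (D k) \<in> C k}"
  shows "point_event n E V \<in> events" and "out \<in> events"
    and "prob (point_event n E V \<inter> out) =
      prob out * (exp (- (cap K * u)) * (\<Prod>i\<in>{1..n}. measure \<nu> (E i) * measure lborel (V i)))"
proof -
  obtain h where h: "bij_betw h {0..<card (Pow {..<l})} (Pow {..<l})"
    using ex_bij_betw_nat_finite[of "Pow {..<l}"] by auto
  define q where "q = card (Pow {..<l})"
  define atom where "atom S = (space marked_space - hit_region K u) \<inter> {x \<in> space marked_space. \<forall>k<l. x \<in> D k \<longleftrightarrow> k \<in> S}" for S
  \<comment> \<open>Index layout: the \<open>n\<close> boxes, then the rest of the hit region at
    \<open>n\<close>, then one atom for each subset of \<open>{..<l}\<close>.\<close>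
  define F where "F i = (if i < n then E (Suc i) \<times> V (Suc i) else if i = n then rest_region n E V
    else atom (h (i - Suc n)))" for i
  define A where "A = {..<Suc n}"
  define B where "B = {Suc n..<Suc n + q}"
  let ?X = "\<lambda>i \<xi>. emeasure (\<omega> \<xi>) (F i)"
  have atom_sets: "atom S \<in> sets marked_space" for S
  proof -
    have "{x \<in> space marked_space. x \<in> D k \<longleftrightarrow> k \<in> S} \<in> sets marked_space" if "k \<in> {..<l}" for k
    proof (cases "k \<in> S")
      case True
      then have "{x \<in> space marked_space. x \<in> D k \<longleftrightarrow> k \<in> S} = D k"
        using sets.sets_into_space[OF D[of k]] that by auto
      then show ?thesis using D[of k] that by simp
    next
      case False
      then have "{x \<in> space marked_space. x \<in> D k \<longleftrightarrow> k \<in> S} = space marked_space - D k" by auto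
      then show ?thesis using D[of k] that by simp
    qed
    then have "{x \<in> space marked_space. \<forall>k\<in>{..<l}. x \<in> D k \<longleftrightarrow> k \<in> S} \<in> sets marked_space"
      by (rule sets.sets_Collect_finite_All) simp_all
    then have "{x \<in> space marked_space. \<forall>k<l. x \<in> D k \<longleftrightarrow> k \<in> S} \<in> sets marked_space"
      by (simp only: Ball_def lessThan_iff)
    then show ?thesis unfolding atom_def by (rule sets.Int[OF sets.Diff[OF sets.top hit_region_sets]])
  qed
  have F_sets: "F i \<in> sets marked_space" for i
    unfolding F_def using cell_sets[of "Suc i"] rest_sets atom_sets by auto
  have F_in: "F i \<subseteq> hit_region K u" if "i \<in> A" for i
    using that cell_sub[of "Suc i"] rest_sub unfolding F_def A_def by (auto simp: less_Suc_eq)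
  have F_out: "F i = atom (h (i - Suc n))" if "i \<in> B" for i using that by (auto simp: F_def B_def)
  have h_inj: "h a = h b \<longleftrightarrow> a = b" if "a < q" "b < q" for a b
    using h that unfolding q_def bij_betw_def by (auto dest: inj_onD)
  have h_sub: "h a \<subseteq> {..<l}" if "a < q" for a
    using h that unfolding q_def bij_betw_def by (metis PowD atLeastLessThan_iff image_eqI zero_le)
  have atom_disj: "atom S \<inter> atom T = {}" if "S \<subseteq> {..<l}" "T \<subseteq> {..<l}" "S \<noteq> T" for S T
  proof (rule ccontr)
    assume "atom S \<inter> atom T \<noteq> {}"
    then obtain x where "\<forall>k<l. x \<in> D k \<longleftrightarrow> k \<in> S" "\<forall>k<l. x \<in> D k \<longleftrightarrow> k \<in> T" unfolding atom_def by blast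
    then have "k \<in> S \<longleftrightarrow> k \<in> T" if "k < l" for k using that by blast
    then show False using that by blast
  qed
  have AB: "{..<Suc n + q} = A \<union> B" "A \<inter> B = {}" by (auto simp: A_def B_def)
  have disjAA: "F i \<inter> F j = {}" if "i \<in> A" "j \<in> A" "i < j" for i j
  proof (cases "j = n")
    case True
    then have "i < n" using that by simp
    then have "Suc i \<in> {1..n}" by simp
    then show ?thesis using True \<open>i < n\<close> unfolding F_def rest_region_def by auto
  next
    case False
    then have "i < n" "j < n" using that by (auto simp: A_def)
    then show ?thesis using cell_disjoint[of "Suc i" "Suc j"] that by (simp add: F_def)
  qed
  have disjBB: "F i \<inter> F j = {}" if ij: "i \<in> B" "j \<in> B" "i \<noteq> j" for i j
  proof -
    have "i - Suc n < q" "j - Suc n < q" "i - Suc n \<noteq> j - Suc n" using ij by (auto simp: B_def)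
    then show ?thesis unfolding F_out[OF ij(1)] F_out[OF ij(2)] by (intro atom_disj h_sub) (auto simp: h_inj)
  qed
  have disjAB: "F i \<inter> F j = {}" if "i \<in> A" "j \<in> B" for i j
    using F_in[OF that(1)] unfolding F_out[OF that(2)] atom_def by blast
  have disj: "disjoint_family_on F {..<Suc n + q}"
    unfolding disjoint_family_on_def AB(1)
  proof (intro ballI impI)
    fix i j assume "i \<in> A \<union> B" "j \<in> A \<union> B" "i \<noteq> j"
    then consider "i \<in> A" "j \<in> A" "i < j" | "i \<in> A" "j \<in> A" "j < i" | "i \<in> A" "j \<in> B" | "i \<in> B" "j \<in> A" | "i \<in> B" "j \<in> B"
      by fastforce
    then show "F i \<inter> F j = {}"
    proof cases
      case 1 then show ?thesis by (rule disjAA)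
    next
      case 2 then show ?thesis using disjAA[of j i] by (simp add: Int_commute)
    next
      case 3 then show ?thesis by (rule disjAB)
    next
      case 4 then show ?thesis using disjAB[of j i] by (simp add: Int_commute)
    next
      case 5 then show ?thesis using \<open>i \<noteq> j\<close> by (rule disjBB)
    qed
  qed
  have indep: "indep_vars (\<lambda>_. borel) ?X {..<Suc n + q}"
    using ppp F_sets disj sets_I unfolding poisson_point_process_def by blast
  have X_meas: "?X i \<in> borel_measurable P" for i by (rule omega_measurable[OF F_sets])
  \<comment> \<open>One point in every box and none in the rest, so all the factorials in the
    Poisson weights are 1.\<close>
  define T where "T i = (if i < n then {1} else {0 :: ennreal})" for i :: nat
  have T_sets: "T i \<in> sets borel" for i by (simp add: T_def)
  have box: "point_event n E V = {\<xi> \<in> space P. \<forall>i\<in>A. ?X i \<xi> \<in> T i}"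
  proof -
    have "(\<forall>i\<in>{1..n}. emeasure (\<omega> \<xi>) (E i \<times> V i) = 1) \<longleftrightarrow> (\<forall>i<n. ?X i \<xi> \<in> T i)" for \<xi>
    proof
      assume *: "\<forall>i<n. ?X i \<xi> \<in> T i"
      show "\<forall>i\<in>{1..n}. emeasure (\<omega> \<xi>) (E i \<times> V i) = 1"
      proof
        fix i assume i: "i \<in> {1..n}"
        then have "i - 1 < n" "Suc (i - 1) = i" by auto
        then show "emeasure (\<omega> \<xi>) (E i \<times> V i) = 1" using *[rule_format, of "i - 1"] by (simp add: F_def T_def)
      qed
    qed (simp add: F_def T_def)
    moreover have "emeasure (\<omega> \<xi>) (rest_region n E V) = 0 \<longleftrightarrow> ?X n \<xi> \<in> T n" for \<xi> by (simp add: F_def T_def)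
    ultimately show ?thesis unfolding point_event_box A_def by (simp add: Ball_def less_Suc_eq imp_disjL all_conj_distrib)
  qed
  have Ev: "{\<xi> \<in> space P. ?X i \<xi> \<in> T i} \<in> events" for i
    using measurable_sets[OF X_meas T_sets, of i] by (simp add: vimage_def Int_def conj_commute)
  show ev: "point_event n E V \<in> events"
    unfolding box by (intro sets.sets_Collect_finite_All Ev) (simp add: A_def)
  define Bk where "Bk k = {i \<in> B. k \<in> h (i - Suc n)}" for k
  have outer: "emeasure (outer_part K u (\<omega> \<xi>)) (D k) = (\<Sum>i\<in>Bk k. ?X i \<xi>)" if \<xi>: "\<xi> \<in> space P" and k: "k < l" for \<xi> k
  proof -
    have "(space marked_space - hit_region K u) \<inter> D k = (\<Union>i\<in>Bk k. F i)"
    proof (intro equalityI subsetI)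
      fix x assume x: "x \<in> (space marked_space - hit_region K u) \<inter> D k"
      let ?S = "{k. k < l \<and> x \<in> D k}"
      have "?S \<in> h ` {0..<card (Pow {..<l})}" using h unfolding bij_betw_def by auto
      then obtain a where a: "a < q" "h a = ?S" unfolding q_def by auto
      have "Suc n + a \<in> Bk k" using a k x unfolding Bk_def B_def by auto
      moreover have "x \<in> F (Suc n + a)" using a x by (auto simp: F_def atom_def)
      ultimately show "x \<in> (\<Union>i\<in>Bk k. F i)" by blast
    next
      fix x assume "x \<in> (\<Union>i\<in>Bk k. F i)"
      then obtain i where i: "i \<in> B" "k \<in> h (i - Suc n)" "x \<in> F i" by (auto simp: Bk_def)
      then show "x \<in> (space marked_space - hit_region K u) \<inter> D k"
        using k unfolding F_out[OF i(1)] atom_def by blast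
    qed
    moreover have "emeasure (\<omega> \<xi>) (\<Union>i\<in>Bk k. F i) = (\<Sum>i\<in>Bk k. ?X i \<xi>)"
    proof (rule sum_emeasure[symmetric])
      show "F ` Bk k \<subseteq> sets (\<omega> \<xi>)" using F_sets sets_omega[OF \<xi>] by auto
      show "disjoint_family_on F (Bk k)" using disjBB by (auto simp: disjoint_family_on_def Bk_def)
      show "finite (Bk k)" by (simp add: Bk_def B_def)
    qed
    ultimately show ?thesis using emeasure_outer[OF \<xi> D[OF k]] by simp
  qed
  \<comment> \<open>The outer counts become a measurable condition on the atom counts alone, which
    allows the inner and the outer block of independent variables to be separated.\<close>
  define G where "G = {y \<in> space (\<Pi>\<^sub>M i\<in>B. (borel :: ennreal measure)). \<forall>k\<in>{..<l}. (\<Sum>i\<in>Bk k. y i) \<in> C k}"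
  have G_sets: "G \<in> sets (\<Pi>\<^sub>M i\<in>B. borel)"
    unfolding G_def
  proof (rule sets.sets_Collect_finite_All)
    fix k assume k: "k \<in> {..<l}"
    have "(\<lambda>y. \<Sum>i\<in>Bk k. y i) \<in> borel_measurable (\<Pi>\<^sub>M i\<in>B. (borel :: ennreal measure))"
      by (intro borel_measurable_sum measurable_component_singleton) (auto simp: Bk_def)
    from measurable_sets[OF this C[of k]] k
    show "{y \<in> space (\<Pi>\<^sub>M i\<in>B. (borel :: ennreal measure)). (\<Sum>i\<in>Bk k. y i) \<in> C k} \<in> sets (\<Pi>\<^sub>M i\<in>B. borel)"
      by (simp add: vimage_def Int_def conj_commute)
  qed simp
  let ?XA = "\<lambda>\<xi>. restrict (\<lambda>i. ?X i \<xi>) A" and ?XB = "\<lambda>\<xi>. restrict (\<lambda>i. ?X i \<xi>) B"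
  have ind: "indep_var (\<Pi>\<^sub>M i\<in>A. borel) ?XA (\<Pi>\<^sub>M i\<in>B. borel) ?XB"
    by (rule indep_var_restrict[OF indep AB(2)]) (auto simp: A_def B_def)
  have PA: "?XA -` PiE A T \<inter> space P = point_event n E V" unfolding box by (auto simp: PiE_iff)
  have PB: "?XB -` G \<inter> space P = out"
  proof -
    have "(\<Sum>i\<in>Bk k. ?XB \<xi> i) = (\<Sum>i\<in>Bk k. ?X i \<xi>)" for k \<xi>
      by (intro sum.cong) (auto simp: Bk_def)
    then show ?thesis unfolding out_def G_def using outer by (auto simp: space_PiM)
  qed
  have mB: "?XB \<in> P \<rightarrow>\<^sub>M (\<Pi>\<^sub>M i\<in>B. borel)" by (intro measurable_restrict X_meas)
  show "out \<in> events" unfolding PB[symmetric] by (rule measurable_sets[OF mB G_sets])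
  have "prob ((\<lambda>x. (?XA x, ?XB x)) -` (PiE A T \<times> G) \<inter> space P) = prob (?XA -` PiE A T \<inter> space P) * prob (?XB -` G \<inter> space P)"
    by (rule indep_varD[OF ind _ G_sets]) (intro sets_PiM_I_finite, auto simp: A_def T_sets)
  moreover have "(\<lambda>x. (?XA x, ?XB x)) -` (PiE A T \<times> G) \<inter> space P = point_event n E V \<inter> out"
    unfolding PA[symmetric] PB[symmetric] by blast
  ultimately have split: "prob (point_event n E V \<inter> out) = prob (point_event n E V) * prob out"
    unfolding PA PB by simp
  have fin: "emeasure I (F i) \<noteq> \<infinity>" if "i \<in> A" for i
  proof -
    have "emeasure I (F i) \<le> emeasure I (hit_region K u)"
      using F_in[OF that] hit_region_sets by (intro emeasure_mono) (auto simp: sets_I)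
    then show ?thesis unfolding measure_I_region by (metis ennreal_neq_top infinity_ennreal_def neq_top_trans)
  qed
  have pois: "prob {\<xi> \<in> space P. ?X i \<xi> = of_nat k} = measure I (F i) ^ k / fact k * exp (- measure I (F i))" if "i \<in> A" for i k
    using ppp F_sets[of i] fin[OF that] unfolding poisson_point_process_def sets_I by (auto simp: top.not_eq_extremum)
  have "prob (point_event n E V) = prob (\<Inter>i\<in>A. ?X i -` T i \<inter> space P)"
    unfolding box by (intro arg_cong[where f=prob]) (auto simp: A_def)
  also have "\<dots> = (\<Prod>i\<in>A. prob (?X i -` T i \<inter> space P))"
    by (rule indep_varsD[OF indep]) (auto simp: A_def T_sets)
  also have "\<dots> = (\<Prod>i\<in>A. (if i < n then measure I (F i) else 1) * exp (- measure I (F i)))"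
  proof (rule prod.cong[OF refl])
    fix i assume i: "i \<in> A"
    show "prob (?X i -` T i \<inter> space P) = (if i < n then measure I (F i) else 1) * exp (- measure I (F i))"
    proof (cases "i < n")
      case True
      then have "?X i -` T i \<inter> space P = {\<xi> \<in> space P. ?X i \<xi> = of_nat 1}" by (auto simp: T_def)
      then show ?thesis using pois[OF i, of 1] True by simp
    next
      case False
      then have "?X i -` T i \<inter> space P = {\<xi> \<in> space P. ?X i \<xi> = of_nat 0}" by (auto simp: T_def)
      then show ?thesis using pois[OF i, of 0] False by simp
    qed
  qed
  also have "\<dots> = (\<Prod>i<n. measure I (F i)) * exp (- (\<Sum>i\<in>A. measure I (F i)))"
  proof -
    have "(\<Prod>i\<in>A. exp (- measure I (F i))) = exp (- (\<Sum>i\<in>A. measure I (F i)))"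
      unfolding sum_negf[symmetric] by (rule exp_sum[symmetric]) (simp add: A_def)
    moreover have "(\<Prod>i\<in>A. if i < n then measure I (F i) else 1) = (\<Prod>i<n. measure I (F i))"
      by (simp add: A_def lessThan_Suc)
    ultimately show ?thesis by (simp only: prod.distrib)
  qed
  \<comment> \<open>The exponents add up to the mass of the whole hit region, whatever the boxes
    are; hence the common factor \<open>exp (- (cap K * u))\<close>.\<close>
  also have "(\<Sum>i\<in>A. measure I (F i)) = measure I (\<Union>i\<in>A. F i)"
    using F_sets sets_I disj fin AB(1)
    by (intro measure_finite_Union[symmetric]) (auto simp: A_def intro: disjoint_family_on_mono[rotated])
  also have "(\<Union>i\<in>A. F i) = hit_region K u"
  proof
    show "(\<Union>i\<in>A. F i) \<subseteq> hit_region K u" using F_in by blast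
    show "hit_region K u \<subseteq> (\<Union>i\<in>A. F i)"
    proof
      fix x assume x: "x \<in> hit_region K u"
      show "x \<in> (\<Union>i\<in>A. F i)"
      proof (cases "x \<in> rest_region n E V")
        case True
        then show ?thesis by (intro UN_I[of n]) (auto simp: A_def F_def)
      next
        case False
        then obtain i where i: "i \<in> {1..n}" "x \<in> E i \<times> V i" using x unfolding rest_region_def by blast
        then show ?thesis by (intro UN_I[of "i - 1"]) (auto simp: A_def F_def)
      qed
    qed
  qed
  also have "measure I (hit_region K u) = cap K * u"
    using measure_I_region u by (simp add: measure_def cap_def sum_nonneg eq_measure_nonneg)
  also have "(\<Prod>i<n. measure I (F i)) = (\<Prod>i\<in>{1..n}. measure \<nu> (E i) * measure lborel (V i))"
  proof (rule prod.reindex_bij_witness[of _ "\<lambda>i. i - 1" Suc])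
    fix i assume i: "i \<in> {..<n}"
    then have "Suc i \<in> {1..n}" by simp
    then have "emeasure I (E (Suc i) \<times> V (Suc i)) = ennreal (measure \<nu> (E (Suc i)) * measure lborel (V (Suc i)))"
      using E V(1) unfolding star_family_def borel_family_def by (intro emeasure_I_Times) blast+
    then show "measure \<nu> (E (Suc i)) * measure lborel (V (Suc i)) = measure I (F i)"
      using i by (simp add: measure_def F_def)
  qed auto
  finally show "prob (point_event n E V \<inter> out) =
      prob out * (exp (- (cap K * u)) * (\<Prod>i\<in>{1..n}. measure \<nu> (E i) * measure lborel (V i)))"
    unfolding split by (simp add: mult_ac)
qed

end

definition outer_event :: "nat \<Rightarrow> (nat \<Rightarrow> ((int \<Rightarrow> 'd site) set \<times> real) set) \<Rightarrow> (nat \<Rightarrow> ennreal set) \<Rightarrow> 'o set" where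
  "outer_event l D C = {\<xi> \<in> space P. \<forall>k<l. emeasure (outer_part K u (\<omega> \<xi>)) (D k) \<in> C k}"

lemma outer_event_0 [simp]: "outer_event 0 D C = space P"
  by (simp add: outer_event_def)

definition outer_family :: "nat \<Rightarrow> (nat \<Rightarrow> ((int \<Rightarrow> 'd site) set \<times> real) set) \<Rightarrow> (nat \<Rightarrow> ennreal set) \<Rightarrow> bool" where
  "outer_family l D C \<longleftrightarrow> (\<forall>k<l. D k \<in> sets marked_space \<and> C k \<in> sets borel)"

text \<open>The labels of an enumeration increase strictly, so separating rationals exist; this
  splits the event into countably many ordered box events.\<close>

lemma point_event_slots:
  assumes "n \<ge> 1"
  shows "point_event n E V = (\<Union>qs\<in>{qs. sorted qs \<and> length qs = n}. point_event n E (\<lambda>i. V i \<inter> slot n u qs i))"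
proof (intro equalityI subsetI)
  fix \<xi> assume \<xi>: "\<xi> \<in> point_event n E V"
  have ps: "is_enumeration K u (\<omega> \<xi>) (enumeration K u (\<omega> \<xi>))" and len: "length (enumeration K u (\<omega> \<xi>)) = n"
  proof -
    have N: "\<xi> \<in> space P" "N_count K u (\<omega> \<xi>) = n" using \<xi> unfolding point_event_def by blast+
    then have "N_count K u (\<omega> \<xi>) \<noteq> 0" using assms by linarith
    then show "is_enumeration K u (\<omega> \<xi>) (enumeration K u (\<omega> \<xi>))" by (rule is_enumeration_enumeration[OF N(1)])
    show "length (enumeration K u (\<omega> \<xi>)) = n" using N(2) by (simp add: N_count_def)
  qed
  have "label K u (\<omega> \<xi>) i < label K u (\<omega> \<xi>) j" if "i \<in> {1..n}" "j \<in> {1..n}" "i < j" for i j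
    using ps len that unfolding is_enumeration_def label_def by (auto simp: sorted_wrt_iff_nth_less)
  moreover have "label K u (\<omega> \<xi>) i \<in> {0..u}" if "i \<in> {1..n}" for i
  proof -
    have "i - 1 < length (enumeration K u (\<omega> \<xi>))" using that len by auto
    then have "enumeration K u (\<omega> \<xi>) ! (i - 1) \<in> hit_region K u"
      using ps nth_mem unfolding is_enumeration_def by blast
    then show ?thesis unfolding label_def hit_region_def by (auto simp: mem_Times_iff)
  qed
  ultimately obtain qs where "sorted qs" "length qs = n" "\<And>i. i \<in> {1..n} \<Longrightarrow> label K u (\<omega> \<xi>) i \<in> slot n u qs i"
    using increasing_in_slots[of n "label K u (\<omega> \<xi>)" u] by blast
  then show "\<xi> \<in> (\<Union>qs\<in>{qs. sorted qs \<and> length qs = n}. point_event n E (\<lambda>i. V i \<inter> slot n u qs i))"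
    using \<xi> unfolding point_event_def by blast
qed (auto simp: point_event_def)

lemma slot_borel_family: "borel_family n u V \<Longrightarrow> borel_family n u (\<lambda>i. V i \<inter> slot n u qs i)"
  using slot_borel by (auto simp: borel_family_def)

lemma point_event_events:
  assumes "n \<ge> 1" "star_family n E" "borel_family n u V"
  shows "point_event n E V \<in> events"
proof (subst point_event_slots[OF assms(1)], rule sets.countable_UN'')
  fix qs assume "qs \<in> {qs :: rat list. sorted qs \<and> length qs = n}"
  then have qs: "sorted qs" "length qs = n" by auto
  have "ordered_family n (\<lambda>i. V i \<inter> slot n u qs i)"
    by (rule ordered_family_mono[OF slot_ordered[OF qs]]) auto
  then show "point_event n E (\<lambda>i. V i \<inter> slot n u qs i) \<in> events"
    using assms slot_borel_family
    by (intro prob_point_event_box(1)[where l=0 and D="\<lambda>_. {}" and C="\<lambda>_. {}"]) simp_all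
qed (rule countableI_type)

text \<open>The box lemma is instantiated with one empty cell, merely to extract the measurability
  of the outer event.\<close>

lemma outer_event_events:
  assumes "outer_family l D C"
  shows "outer_event l D C \<in> events"
  unfolding outer_event_def
proof (rule prob_point_event_box(2)[where n=1 and E="\<lambda>_. {}" and V="\<lambda>_. {}" and l=l and D=D and C=C])
qed (use assms in \<open>simp_all add: outer_family_def star_family_def borel_family_def ordered_family_def\<close>)

text \<open>On ordered boxes the labels of the process and the order statistics of uniform variables
  both give the product of the lengths up to a constant; \<open>ordered_boxes_determine\<close>
  carries the comparison over to all Borel label sets.\<close>

lemma prob_point_event:
  assumes n: "n \<ge> 1" and E: "star_family n E" and V: "borel_family n u V" and O: "outer_family l D C"
  shows "prob (point_event n E V \<inter> outer_event l D C) = prob (outer_event l D C) * exp (- (cap K * u)) *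
    (u ^ n / fact n) * order_stat_prob n u V * (\<Prod>i\<in>{1..n}. measure \<nu> (E i))"
proof -
  let ?O = "outer_event l D C" and ?N = "uniform_vector n u"
  \<comment> \<open>Chosen so that \<open>c\<close> times \<open>fact n / u ^ n\<close>, the
    constant of the order statistics, is the constant in the box formula.\<close>
  define c where "c = prob ?O * exp (- (cap K * u)) * (u ^ n / fact n) * (\<Prod>i\<in>{1..n}. measure \<nu> (E i))"
  have c: "c \<ge> 0" unfolding c_def using u by (intro mult_nonneg_nonneg divide_nonneg_nonneg prod_nonneg) auto
  have full: "borel_family n u (\<lambda>_. {0..u})" by (simp add: borel_family_def)
  let ?S = "point_event n E (\<lambda>_. {0..u}) \<inter> ?O"
  have O_ev: "?O \<in> events" by (rule outer_event_events[OF O])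
  have S: "?S \<in> events" using point_event_events[OF n E full] O_ev by (rule sets.Int)
  have SV: "{\<xi> \<in> ?S. \<forall>i\<in>{1..n}. label K u (\<omega> \<xi>) i \<in> V i} = point_event n E V \<inter> ?O" if "borel_family n u V" for V
    using that unfolding point_event_def borel_family_def by blast
  have box: "emeasure P (point_event n E V \<inter> ?O) = ennreal c * ennreal (fact n / u ^ n * (\<Prod>i\<in>{1..n}. measure lborel (V i)))"
    if V: "borel_family n u V" "ordered_family n V" for V
  proof -
    have "prob (point_event n E V \<inter> ?O) =
      prob ?O * (exp (- (cap K * u)) * (\<Prod>i\<in>{1..n}. measure \<nu> (E i) * measure lborel (V i)))"
      unfolding outer_event_def using O by (intro prob_point_event_box(3)[OF n E V]) (auto simp: outer_family_def)
    also have "\<dots> = c * (fact n / u ^ n * (\<Prod>i\<in>{1..n}. measure lborel (V i)))"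
      using u by (simp add: c_def prod.distrib)
    finally have e: "prob (point_event n E V \<inter> ?O) = c * (fact n / u ^ n * (\<Prod>i\<in>{1..n}. measure lborel (V i)))" .
    show ?thesis unfolding emeasure_eq_measure e by (rule ennreal_mult'[OF c])
  qed
  have "emeasure P {\<xi> \<in> ?S. \<forall>i\<in>{1..n}. label K u (\<omega> \<xi>) i \<in> V i} =
      emeasure (scale_measure (ennreal c) ?N) {v \<in> strict_order_stat u n. \<forall>i\<in>{1..n}. order_stat n v i \<in> V i}"
  proof (rule ordered_boxes_determine(2)[where M=P and N="scale_measure (ennreal c) ?N" and S="?S" and
        T="strict_order_stat u n" and X="\<lambda>\<xi>. label K u (\<omega> \<xi>)" and Y="order_stat n" and u=u and n=n and V=V])
    show "?S \<in> events" by (rule S)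
    show "borel_family n u V" by (rule V)
    show "emeasure P ?S \<noteq> \<infinity>" by simp
    show "strict_order_stat u n \<in> sets (scale_measure (ennreal c) ?N)"
      using strict_order_stat_sets[OF u] by simp
    fix \<xi> assume \<xi>: "\<xi> \<in> ?S"
    then obtain qs where qs: "sorted qs" "length qs = n" "\<xi> \<in> point_event n E (\<lambda>i. {0..u} \<inter> slot n u qs i)"
      using point_event_slots[OF n, of E "\<lambda>_. {0..u}"] by blast
    then show "(\<forall>i\<in>{1..n}. label K u (\<omega> \<xi>) i \<in> {0..u}) \<and>
      (\<forall>i\<in>{1..n}. \<forall>j\<in>{1..n}. i < j \<longrightarrow> label K u (\<omega> \<xi>) i < label K u (\<omega> \<xi>) j)"
      using slot_ordered[OF qs(1,2), of u] unfolding point_event_def ordered_family_def by blast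
  next
    fix v assume "v \<in> strict_order_stat u n"
    then show "(\<forall>i\<in>{1..n}. order_stat n v i \<in> {0..u}) \<and>
      (\<forall>i\<in>{1..n}. \<forall>j\<in>{1..n}. i < j \<longrightarrow> order_stat n v i < order_stat n v j)"
      unfolding strict_order_stat_def[OF u] by blast
  next
    fix V assume V: "borel_family n u V" "ordered_family n V"
    show "{\<xi> \<in> ?S. \<forall>i\<in>{1..n}. label K u (\<omega> \<xi>) i \<in> V i} \<in> events"
      unfolding SV[OF V(1)] by (intro sets.Int point_event_events[OF n E V(1)] O_ev)
    show "{v \<in> strict_order_stat u n. \<forall>i\<in>{1..n}. order_stat n v i \<in> V i} \<in> sets (scale_measure (ennreal c) ?N)"
      using emeasure_order_stat_strict(1)[OF u V(1)] by simp
    show "emeasure P {\<xi> \<in> ?S. \<forall>i\<in>{1..n}. label K u (\<omega> \<xi>) i \<in> V i} =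
      emeasure (scale_measure (ennreal c) ?N) {v \<in> strict_order_stat u n. \<forall>i\<in>{1..n}. order_stat n v i \<in> V i}"
      unfolding SV[OF V(1)] box[OF V] emeasure_scale_measure emeasure_strict_order_stat_ordered[OF u V] ..
  qed
  also have "\<dots> = ennreal (c * order_stat_prob n u V)"
    unfolding emeasure_scale_measure emeasure_order_stat_strict(2)[OF u V] by (rule ennreal_mult'[OF c, symmetric])
  finally have "prob (point_event n E V \<inter> ?O) = c * order_stat_prob n u V"
    unfolding SV[OF V] using c by (simp add: emeasure_eq_measure order_stat_prob_def)
  then show ?thesis by (simp add: c_def mult_ac)
qed

end


section \<open>Events of the marked trajectories\<close>

context interlacement_process
begin

definition traj_event :: "nat \<Rightarrow> (nat \<Rightarrow> real set) \<Rightarrow> (nat \<Rightarrow> (int \<Rightarrow> 'd site) set) \<Rightarrow> 'o set" where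
  "traj_event n U G = {\<xi> \<in> space P. N_count K u (\<omega> \<xi>) = n \<and>
    (\<forall>i\<in>{1..n}. label K u (\<omega> \<xi>) i \<in> U i \<and> X_traj K u (\<omega> \<xi>) i \<in> G i)}"

definition traj_set :: "(int \<Rightarrow> 'd site) set \<Rightarrow> bool" where
  "traj_set G \<longleftrightarrow> G \<inter> canon K \<in> sets full_space"

lemma enumeration_hit:
  assumes "\<xi> \<in> space P" "1 \<le> i" "i \<le> N_count K u (\<omega> \<xi>)"
  shows "fst (enumeration K u (\<omega> \<xi>) ! (i - 1)) \<in> star_hit K" and "label K u (\<omega> \<xi>) i \<in> {0..u}"
    and "X_traj K u (\<omega> \<xi>) i \<in> canon K"
proof -
  have "is_enumeration K u (\<omega> \<xi>) (enumeration K u (\<omega> \<xi>))"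
    using assms by (intro is_enumeration_enumeration) auto
  moreover have "i - 1 < length (enumeration K u (\<omega> \<xi>))" using assms by (simp add: N_count_def)
  ultimately have hit: "enumeration K u (\<omega> \<xi>) ! (i - 1) \<in> hit_region K u"
    using nth_mem unfolding is_enumeration_def by blast
  then show 1: "fst (enumeration K u (\<omega> \<xi>) ! (i - 1)) \<in> star_hit K" and "label K u (\<omega> \<xi>) i \<in> {0..u}"
    unfolding label_def hit_region_def by (simp_all add: mem_Times_iff)
  have "X_traj K u (\<omega> \<xi>) i = rep K (fst (enumeration K u (\<omega> \<xi>) ! (i - 1)))"
    by (simp add: X_traj_def rep_def)
  then show "X_traj K u (\<omega> \<xi>) i \<in> canon K" using rep_canon[OF finK 1] by simp
qed

text \<open>Labels of listed points lie in \<open>{0..u}\<close> anyway; the intersection supplies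
  the bound that \<open>borel_family\<close> requires.\<close>

lemma traj_event_point_event:
  "traj_event n U G = point_event n (\<lambda>i. star_event K (G i)) (\<lambda>i. U i \<inter> {0..u})"
proof -
  have X: "X_traj K u (\<omega> \<xi>) i = rep K (fst (enumeration K u (\<omega> \<xi>) ! (i - 1)))" for \<xi> i
    by (simp add: X_traj_def rep_def)
  have "label K u (\<omega> \<xi>) i \<in> U i \<and> X_traj K u (\<omega> \<xi>) i \<in> G i \<longleftrightarrow>
    fst (enumeration K u (\<omega> \<xi>) ! (i - 1)) \<in> star_event K (G i) \<and> label K u (\<omega> \<xi>) i \<in> U i \<inter> {0..u}"
    if "\<xi> \<in> space P" "N_count K u (\<omega> \<xi>) = n" "i \<in> {1..n}" for \<xi> i
    using enumeration_hit[of \<xi> i] that unfolding star_event_def X by auto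
  then show ?thesis unfolding traj_event_def point_event_def by blast
qed

lemma traj_star_family: "(\<And>i. i \<in> {1..n} \<Longrightarrow> traj_set (G i)) \<Longrightarrow> star_family n (\<lambda>i. star_event K (G i))"
  unfolding star_family_def traj_set_def using star_event_sets[OF finK] star_event_sub by blast

lemma traj_borel_family: "(\<And>i. i \<in> {1..n} \<Longrightarrow> U i \<in> sets borel) \<Longrightarrow> borel_family n u (\<lambda>i. U i \<inter> {0..u})"
  unfolding borel_family_def by auto

lemma N_event_eq: "traj_event n (\<lambda>_. UNIV) (\<lambda>_. UNIV) = {\<xi> \<in> space P. N_count K u (\<omega> \<xi>) = n}"
  by (simp add: traj_event_def)

text \<open>The count 0 also covers the exceptional event without an enumeration, so it is treated
  as the complement of the positive counts.\<close>

lemma N_event_events: "{\<xi> \<in> space P. N_count K u (\<omega> \<xi>) = n} \<in> events"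
proof -
  have pos: "{\<xi> \<in> space P. N_count K u (\<omega> \<xi>) = n} \<in> events" if "n \<ge> 1" for n
    unfolding N_event_eq[symmetric] traj_event_point_event
    by (rule point_event_events[OF that traj_star_family traj_borel_family]) (auto simp: traj_set_def)
  show ?thesis
  proof (cases "n \<ge> 1")
    case False
    then have "n = 0" by simp
    have "{\<xi> \<in> space P. N_count K u (\<omega> \<xi>) = 0} = space P - (\<Union>n\<in>{1..}. {\<xi> \<in> space P. N_count K u (\<omega> \<xi>) = n})"
      by auto
    also have "\<dots> \<in> events" using pos by (intro sets.Diff sets.top sets.countable_UN'') auto
    finally show ?thesis using \<open>n = 0\<close> by simp
  qed (rule pos)
qed

lemma traj_event_0: "traj_event 0 U G = {\<xi> \<in> space P. N_count K u (\<omega> \<xi>) = 0}"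
  by (simp add: traj_event_def)

lemma traj_event_events:
  assumes "\<And>i. i \<in> {1..n} \<Longrightarrow> U i \<in> sets borel" "\<And>i. i \<in> {1..n} \<Longrightarrow> traj_set (G i)"
  shows "traj_event n U G \<in> events"
proof (cases "n \<ge> 1")
  case True
  then show ?thesis unfolding traj_event_point_event
    using assms by (intro point_event_events traj_star_family traj_borel_family)
next
  case False
  then have "n = 0" by simp
  show ?thesis unfolding \<open>n = 0\<close> traj_event_0 by (rule N_event_events)
qed

text \<open>The Poisson law of the count, read off from the event that restricts neither labels nor
  trajectories, for which the order statistics have probability 1.\<close>

lemma prob_N:
  assumes "n \<ge> 1"
  shows "prob {\<xi> \<in> space P. N_count K u (\<omega> \<xi>) = n} = exp (- (cap K * u)) * (u ^ n / fact n) * cap K ^ n"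
proof -
  have fam: "star_family n (\<lambda>_. star_hit K)" using star_hit_sets[OF finK] by (simp add: star_family_def)
  have bor: "borel_family n u (\<lambda>_. {0..u})" by (simp add: borel_family_def)
  have "measure \<nu> (star_hit K) = cap K"
    using nu_star_hit by (simp add: measure_def cap_def sum_nonneg eq_measure_nonneg)
  moreover have "prob (point_event n (\<lambda>_. star_hit K) (\<lambda>_. {0..u}) \<inter> outer_event 0 (\<lambda>_. {}) (\<lambda>_. {})) =
      prob (outer_event 0 (\<lambda>_. {}) (\<lambda>_. {})) * exp (- (cap K * u)) *
    (u ^ n / fact n) * order_stat_prob n u (\<lambda>_. {0..u}) * (\<Prod>i\<in>{1..n}. measure \<nu> (star_hit K))"
    by (rule prob_point_event[OF assms fam bor]) (simp add: outer_family_def)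
  moreover have "point_event n (\<lambda>_. star_hit K) (\<lambda>_. {0..u}) = {\<xi> \<in> space P. N_count K u (\<omega> \<xi>) = n}"
    using traj_event_point_event[of n "\<lambda>_. UNIV" "\<lambda>_. UNIV"] N_event_eq[of n] by (simp add: star_hit_event[OF finK, symmetric])
  moreover have "{\<xi> \<in> space P. N_count K u (\<omega> \<xi>) = n} \<inter> space P = {\<xi> \<in> space P. N_count K u (\<omega> \<xi>) = n}" by blast
  ultimately show ?thesis by (simp add: prob_space order_stat_prob_full[OF u])
qed

lemma kappa_le: "traj_set G \<Longrightarrow> kappa G \<le> cap K"
  unfolding kappa_def traj_set_def using nu_sub_finite(2) star_event_sets[OF finK] star_event_sub by blast

lemma kappa_nonneg: "0 \<le> kappa G"
  by (simp add: kappa_def)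

text \<open>Dividing by \<open>cap K\<close> turns intensities into a law on trajectories. If the
  capacity is 0, so are all the intensities, and with division by zero both sides are 0.\<close>

lemma prob_traj_event:
  assumes n: "n \<ge> 1" and U: "\<And>i. i \<in> {1..n} \<Longrightarrow> U i \<in> sets borel" and G: "\<And>i. i \<in> {1..n} \<Longrightarrow> traj_set (G i)"
    and O: "outer_family l D C"
  shows "prob (traj_event n U G \<inter> outer_event l D C) = prob (outer_event l D C) *
    prob {\<xi> \<in> space P. N_count K u (\<omega> \<xi>) = n} * order_stat_prob n u (\<lambda>i. U i \<inter> {0..u}) *
    (\<Prod>i\<in>{1..n}. kappa (G i) / cap K)"
proof -
  have eq: "prob (traj_event n U G \<inter> outer_event l D C) = prob (outer_event l D C) * exp (- (cap K * u)) *
    (u ^ n / fact n) * order_stat_prob n u (\<lambda>i. U i \<inter> {0..u}) * (\<Prod>i\<in>{1..n}. kappa (G i))"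
    unfolding traj_event_point_event kappa_def
    by (rule prob_point_event[OF n traj_star_family[OF G] traj_borel_family[OF U] O])
  show ?thesis
  proof (cases "cap K = 0")
    case True
    have "kappa (G 1) = 0" using kappa_le[OF G[of 1]] kappa_nonneg[of "G 1"] n True by simp
    then have "(\<Prod>i\<in>{1..n}. kappa (G i)) = 0" using n by (intro prod_zero) auto
    moreover have "(\<Prod>i\<in>{1..n}. kappa (G i) / cap K) = 0" using n True by (intro prod_zero) auto
    ultimately show ?thesis using eq by (simp only: mult_zero_right)
  next
    case False
    have "(\<Prod>i\<in>{1..n}. kappa (G i) / cap K) = (\<Prod>i\<in>{1..n}. kappa (G i)) / cap K ^ n"
      by (simp add: prod_dividef)
    then show ?thesis unfolding eq prob_N[OF n] using False by simp
  qed
qed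

section \<open>Conditional independence\<close>

definition end_points :: "'d site list list \<Rightarrow> ('d site \<times> 'd site) list" where
  "end_points a = map (\<lambda>\<tau>. (hd \<tau>, last \<tau>)) a"

text \<open>Past and future range over uncountable spaces, so unlike the inner cells these sets
  carry events for them besides the list.\<close>

definition out_set :: "'d site list list \<Rightarrow> (nat \<Rightarrow> 'd site) set \<Rightarrow> (nat \<Rightarrow> 'd site) set \<Rightarrow> (int \<Rightarrow> 'd site) set" where
  "out_set b A B = {w \<in> canon K. out_data K w = b \<and> X_minus w \<in> A \<and> X_plus K w \<in> B}"

definition in_set :: "'d site list list \<Rightarrow> (int \<Rightarrow> 'd site) set" where
  "in_set a = {w \<in> canon K. in_data K w = a}"

definition ends_set :: "('d site \<times> 'd site) list \<Rightarrow> (int \<Rightarrow> 'd site) set" where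
  "ends_set c = {w \<in> canon K. ends K c w}"

lemma halves: "w \<in> canon K \<Longrightarrow> X_minus w \<in> half_trajs \<and> X_plus K w \<in> half_trajs"
  using X_minus_half X_plus_half[OF finK] by (auto simp: canon_def)

lemma in_exc_in_paths:
  assumes w: "w \<in> canon K" and j: "1 \<le> j" "j \<le> M_count K w"
  shows "X_in K w j \<in> in_paths K (w (A_time K w j)) (w (B_time K w j))"
proof -
  have "in_exc K (fwd w) j \<in> in_paths K (fwd w (A_time K (fwd w) j)) (fwd w (B_time K (fwd w) j))"
    using j M_count_fwd[OF finK w] by (intro in_exc_path[OF finK fwd_start[OF finK w]]) auto
  then show ?thesis using excursions_fwd(1)[OF finK w j] AB_time_fwd[OF finK w j] by (simp add: fwd_def)
qed

lemma out_exc_out_paths: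
  assumes w: "w \<in> canon K" and j: "1 \<le> j" "Suc j \<le> M_count K w"
  shows "X_out K w j \<in> out_paths K (w (B_time K w j)) (w (A_time K w (Suc j)))"
proof -
  have "out_exc K (fwd w) j \<in> out_paths K (fwd w (B_time K (fwd w) j)) (fwd w (A_time K (fwd w) (Suc j)))"
    using j M_count_fwd[OF finK w] by (intro out_exc_path[OF finK fwd_start[OF finK w]]) auto
  moreover have "A_time K w (Suc j) = int (A_time K (fwd w) (Suc j))" "B_time K w j = int (B_time K (fwd w) j)"
    using AB_time_fwd[OF finK w] j by auto
  ultimately show ?thesis using excursions_fwd(2)[OF finK w j] by (simp add: fwd_def)
qed

lemma in_paths_hd_last: "\<tau> \<in> in_paths K x y \<Longrightarrow> x = hd \<tau> \<and> y = last \<tau> \<and> x \<in> K \<and> y \<in> K"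
  by (auto simp: in_paths_def path_inside_def)

lemma ends_of_in_data:
  assumes w: "w \<in> canon K"
  shows "ends K (end_points (in_data K w)) w"
  unfolding ends_def
proof (intro conjI allI impI)
  show M: "M_count K w = length (end_points (in_data K w))" by (simp add: end_points_def in_data_def)
  fix j assume "j < length (end_points (in_data K w))"
  then have j: "j < M_count K w" using M by simp
  then have "end_points (in_data K w) ! j = (hd (X_in K w (Suc j)), last (X_in K w (Suc j)))"
    by (simp add: end_points_def in_data_def del: upt_Suc)
  moreover have "X_in K w (Suc j) \<in> in_paths K (w (A_time K w (Suc j))) (w (B_time K w (Suc j)))"
    using j by (intro in_exc_in_paths[OF w]) auto
  ultimately show "w (A_time K w (Suc j)) = fst (end_points (in_data K w) ! j)"
    "w (B_time K w (Suc j)) = snd (end_points (in_data K w) ! j)"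
    using in_paths_hd_last by auto
qed

lemma out_set_traj_set: "A \<in> sets half_space \<Longrightarrow> B \<in> sets half_space \<Longrightarrow> traj_set (out_set b A B)"
proof -
  assume "A \<in> sets half_space" "B \<in> sets half_space"
  from canon_data_sets[OF finK this, of "\<lambda>_ b'. b' = b"] have "out_set b A B \<in> sets full_space"
    unfolding out_set_def .
  then show ?thesis unfolding traj_set_def by (rule sets.Int) (rule canon_sets)
qed

lemma in_data_Collect_traj_set: "traj_set {w \<in> canon K. R (in_data K w) (out_data K w)}"
proof -
  have "{w \<in> canon K. R (in_data K w) (out_data K w)} \<inter> canon K =
    {w \<in> canon K. R (in_data K w) (out_data K w) \<and> X_minus w \<in> half_trajs \<and> X_plus K w \<in> half_trajs}"
  proof (intro equalityI subsetI)
    fix w assume "w \<in> {w \<in> canon K. R (in_data K w) (out_data K w)} \<inter> canon K"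
    then have w: "w \<in> canon K" "R (in_data K w) (out_data K w)" by simp_all
    show "w \<in> {w \<in> canon K. R (in_data K w) (out_data K w) \<and> X_minus w \<in> half_trajs \<and> X_plus K w \<in> half_trajs}"
      using w halves[OF w(1)] by (intro CollectI conjI) simp_all
  qed simp
  then show ?thesis unfolding traj_set_def
    using canon_data_sets[OF finK half_trajs_in_half_space half_trajs_in_half_space, of R] by (simp only:)
qed

lemma in_set_traj_set: "traj_set (in_set a)"
  unfolding in_set_def by (rule in_data_Collect_traj_set)

text \<open>The inner paths contain their end points, so \<open>ends\<close> is decided by the
  countable inner data and inherits their measurability.\<close>

lemma ends_iff_in_data:
  assumes w: "w \<in> canon K"
  shows "ends K c w \<longleftrightarrow> c = end_points (in_data K w)"
proof
  assume c: "ends K c w"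
  show "c = end_points (in_data K w)"
    using c ends_of_in_data[OF w] unfolding ends_def by (intro nth_equalityI) (auto simp: prod_eq_iff)
qed (use ends_of_in_data[OF w] in simp)

lemma ends_set_traj_set: "traj_set (ends_set c)"
proof -
  have "ends_set c = {w \<in> canon K. c = end_points (in_data K w)}"
    unfolding ends_set_def using ends_iff_in_data by blast
  then show ?thesis using in_data_Collect_traj_set by simp
qed

lemma traj_set_Int: "traj_set G \<Longrightarrow> traj_set G' \<Longrightarrow> traj_set (G \<inter> G')"
  unfolding traj_set_def by (metis Int_assoc Int_left_commute inf.idem sets.Int)

lemma kappa_empty: "(\<And>w. w \<in> canon K \<Longrightarrow> w \<notin> G) \<Longrightarrow> kappa G = 0"
  using kappa_cong[of G "{}"] by (auto simp: kappa_def star_event_def)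

lemma kappa_mono:
  assumes "traj_set G'" "\<And>w. w \<in> canon K \<Longrightarrow> w \<in> G \<Longrightarrow> w \<in> G'"
  shows "kappa G \<le> kappa G'"
proof -
  have sub: "star_event K G \<subseteq> star_event K G'" using assms(2) rep_canon[OF finK] by (auto simp: star_event_def)
  have S: "star_event K G' \<in> sets star_space" using assms(1) star_event_sets[OF finK] by (simp add: traj_set_def)
  show ?thesis
  proof (cases "star_event K G \<in> sets \<nu>")
    case True
    have "emeasure \<nu> (star_event K G') \<noteq> \<infinity>" using nu_sub_finite(1)[OF S star_event_sub] by simp
    then have "star_event K G' \<in> fmeasurable \<nu>" using S by (intro fmeasurableI) (auto simp: sets_nu top.not_eq_extremum)
    then show ?thesis unfolding kappa_def using sub True by (intro measure_mono_fmeasurable)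
  next
    case False
    \<comment> \<open>The measure of a set outside the sigma-algebra is 0 by convention.\<close>
    then show ?thesis using kappa_nonneg[of G'] by (simp add: kappa_def measure_notin_sets)
  qed
qed

section \<open>Factorised masses and the ratio of inner events to end-point events\<close>

definition rweight :: "'d site list set \<Rightarrow> real" where
  "rweight F = enn2real (weight F)"

definition paths_event :: "('d site \<times> 'd site) list \<Rightarrow> (nat \<Rightarrow> 'd site list set) \<Rightarrow> (nat \<Rightarrow> 'd site list set) \<Rightarrow>
    (nat \<Rightarrow> 'd site) set \<Rightarrow> (nat \<Rightarrow> 'd site) set \<Rightarrow> (int \<Rightarrow> 'd site) set" where
  "paths_event c fs hs A B = {w. ends K c w \<and> (\<forall>j<length c. X_in K w (Suc j) \<in> fs j) \<and>
    (\<forall>j<length c - 1. X_out K w (Suc j) \<in> hs j) \<and> X_minus w \<in> A \<and> X_plus K w \<in> B}"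

definition in_restr :: "('d site \<times> 'd site) list \<Rightarrow> (nat \<Rightarrow> 'd site list set) \<Rightarrow> nat \<Rightarrow> 'd site list set" where
  "in_restr c fs j = fs j \<inter> in_paths K (fst (c ! j)) (snd (c ! j))"

definition out_restr :: "('d site \<times> 'd site) list \<Rightarrow> (nat \<Rightarrow> 'd site list set) \<Rightarrow> nat \<Rightarrow> 'd site list set" where
  "out_restr c hs j = hs j \<inter> out_paths K (snd (c ! j)) (fst (c ! Suc j))"

text \<open>Paths inside \<open>K\<close> know their end points, so demanding the end points
  \<open>c\<close> is the same as shrinking each path set to the paths between them.\<close>

lemma paths_event_exc_event:
  assumes w: "w \<in> canon K" and c: "c \<noteq> []"
  shows "w \<in> paths_event c fs hs A B \<longleftrightarrow>
    w \<in> exc_event K (map (in_restr c fs) [0..<length c]) (map (out_restr c hs) [0..<length c - 1]) A B"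
proof (cases "M_count K w = length c")
  case M: True
  have X: "X_in K w (Suc j) \<in> in_paths K (w (A_time K w (Suc j))) (w (B_time K w (Suc j)))" if "j < length c" for j
    using M that by (intro in_exc_in_paths[OF w]) auto
  have Y: "X_out K w (Suc j) \<in> out_paths K (w (B_time K w (Suc j))) (w (A_time K w (Suc (Suc j))))" if "j < length c - 1" for j
    using M that by (intro out_exc_out_paths[OF w]) auto
  show ?thesis
  proof
    assume L: "w \<in> paths_event c fs hs A B"
    then have e: "ends K c w" by (simp add: paths_event_def)
    have "X_in K w (Suc j) \<in> in_restr c fs j" if "j < length c" for j
      using L X[OF that] e that unfolding paths_event_def in_restr_def ends_def by simp
    moreover have "X_out K w (Suc j) \<in> out_restr c hs j" if "j < length c - 1" for j
      using L Y[OF that] e that unfolding paths_event_def out_restr_def ends_def by simp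
    ultimately show "w \<in> exc_event K (map (in_restr c fs) [0..<length c]) (map (out_restr c hs) [0..<length c - 1]) A B"
      using L M unfolding exc_event_def paths_event_def by simp
  next
    assume R: "w \<in> exc_event K (map (in_restr c fs) [0..<length c]) (map (out_restr c hs) [0..<length c - 1]) A B"
    have inr: "X_in K w (Suc j) \<in> in_restr c fs j" if "j < length c" for j
      using R that unfolding exc_event_def by simp
    have outr: "X_out K w (Suc j) \<in> out_restr c hs j" if "j < length c - 1" for j
      using R that unfolding exc_event_def by simp
    have "w (A_time K w (Suc j)) = fst (c ! j) \<and> w (B_time K w (Suc j)) = snd (c ! j)" if "j < length c" for j
      using in_paths_unique[OF X[OF that]] inr[OF that] unfolding in_restr_def by blast
    then have "ends K c w" using M by (simp add: ends_def)
    then show "w \<in> paths_event c fs hs A B"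
      using R inr outr unfolding paths_event_def exc_event_def in_restr_def out_restr_def by simp
  qed
next
  case False
  then show ?thesis by (simp add: paths_event_def exc_event_def ends_def)
qed

lemma restr_compatible:
  assumes "c \<noteq> []" "set c \<subseteq> K \<times> K"
  shows "compatible K c (map (in_restr c fs) [0..<length c]) (map (out_restr c hs) [0..<length c - 1])"
  using assms by (auto simp: compatible_def in_restr_def out_restr_def)

text \<open>\<open>enn2real\<close> sends infinity to 0 and still respects products, so weights can
  be handled as reals before they are known to be finite.\<close>

lemma enn2real_prod_list: "enn2real (prod_list xs) = prod_list (map enn2real xs)"
  by (induction xs) (simp_all add: enn2real_mult)

lemma rweight_prod_list: "enn2real (prod_list (map weight (map g [0..<n]))) = (\<Prod>j<n. rweight (g j))"
proof -
  have "enn2real (prod_list (map weight (map g [0..<n]))) = prod_list (map (\<lambda>j. rweight (g j)) [0..<n])"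
    unfolding enn2real_prod_list by (simp add: rweight_def comp_def)
  also have "\<dots> = prod (\<lambda>j. rweight (g j)) (set [0..<n])"
    by (rule prod.distinct_set_conv_list[symmetric]) simp
  finally show ?thesis by (simp add: atLeast0LessThan)
qed

lemma kappa_paths_event:
  assumes c: "c \<noteq> []" "set c \<subseteq> K \<times> K" and A: "A \<in> sets half_space" and B: "B \<in> sets half_space"
  shows "kappa (paths_event c fs hs A B) = srw_avoid K (fst (hd c)) A * eq_measure K (fst (hd c)) *
    ((\<Prod>j<length c. rweight (in_restr c fs j)) * (\<Prod>j<length c - 1. rweight (out_restr c hs j)) *
      (eq_measure K (snd (last c)) * srw_avoid K (snd (last c)) B))"
proof -
  let ?E = "exc_event K (map (in_restr c fs) [0..<length c]) (map (out_restr c hs) [0..<length c - 1]) A B"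
  have "kappa (paths_event c fs hs A B) = kappa ?E"
    by (rule kappa_cong) (rule paths_event_exc_event[OF _ c(1)])
  also have "\<dots> = enn2real (ennreal (kappa ?E))" by (simp add: kappa_nonneg)
  finally show ?thesis
    unfolding kappa_exc_event[OF restr_compatible[OF c] A B]
    by (simp only: enn2real_mult rweight_prod_list enn2real_ennreal mult_nonneg_nonneg srw_avoid_nonneg eq_measure_nonneg)
qed

text \<open>The heart of the independence: in the factorised mass the inner paths enter through
  their weights only, and these factors are the same whatever the outer data are. The ratio for a
  value \<open>a\<close> therefore serves all outer events at once.\<close>

lemma kappa_in_ratio:
  "\<exists>r. \<forall>b. \<forall>A\<in>sets half_space. \<forall>B\<in>sets half_space.
    kappa (in_set a \<inter> out_set b A B) = r * kappa (ends_set (end_points a) \<inter> out_set b A B)"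
proof (cases "a \<noteq> [] \<and> (\<forall>\<tau>\<in>set a. \<tau> \<in> in_paths K (hd \<tau>) (last \<tau>))")
  case False
  have "w \<notin> in_set a" if w: "w \<in> canon K" for w
  proof
    assume "w \<in> in_set a"
    then have a: "in_data K w = a" by (simp add: in_set_def)
    then have M: "M_count K w = length a" "\<And>j. j < length a \<Longrightarrow> X_in K w (Suc j) = a ! j"
      unfolding in_data_eq_iff by auto
    have "a \<noteq> []" using M(1) M_count_canon_ge1[OF finK w] by auto
    moreover have "\<tau> \<in> in_paths K (hd \<tau>) (last \<tau>)" if mem: "\<tau> \<in> set a" for \<tau>
    proof -
      obtain j where j: "j < length a" "\<tau> = a ! j" using mem by (metis in_set_conv_nth)
      have "X_in K w (Suc j) \<in> in_paths K (w (A_time K w (Suc j))) (w (B_time K w (Suc j)))"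
        using j M(1) by (intro in_exc_in_paths[OF w]) auto
      then show ?thesis using in_paths_hd_last M(2)[OF j(1)] j(2) by metis
    qed
    ultimately show False using False by blast
  qed
  then have "kappa (in_set a \<inter> out_set b A B) = 0" for b A B by (intro kappa_empty) blast
  then show ?thesis by (intro exI[of _ 0]) simp
next
  case True
  let ?c = "end_points a"
  have nth: "?c ! j = (hd (a ! j), last (a ! j))" if "j < length a" for j using that by (simp add: end_points_def)
  have len: "length ?c = length a" by (simp add: end_points_def)
  have path: "a ! j \<in> in_paths K (fst (?c ! j)) (snd (?c ! j))" if "j < length a" for j
    using True that nth[OF that] by simp
  have c: "?c \<noteq> []" "set ?c \<subseteq> K \<times> K"
  proof -
    show "?c \<noteq> []" using True by (simp add: end_points_def)
    show "set ?c \<subseteq> K \<times> K"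
    proof
      fix p assume "p \<in> set ?c"
      then obtain \<tau> where "\<tau> \<in> set a" "p = (hd \<tau>, last \<tau>)" unfolding end_points_def by auto
      then show "p \<in> K \<times> K" using True in_paths_hd_last[of \<tau> "hd \<tau>" "last \<tau>"] by auto
    qed
  qed
  \<comment> \<open>\<open>p\<close> is the weight of the prescribed inner paths, \<open>q\<close>
    that of all inner paths with the same end points.\<close>
  define p where "p = (\<Prod>j<length a. rweight (in_restr ?c (\<lambda>j. {a ! j}) j))"
  define q where "q = (\<Prod>j<length a. rweight (in_restr ?c (\<lambda>j. UNIV) j))"
  show ?thesis
  proof (intro exI[of _ "p / q"] allI ballI)
    fix b and A B :: "(nat \<Rightarrow> 'd site) set"
    assume A: "A \<in> sets half_space" and B: "B \<in> sets half_space"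
    show "kappa (in_set a \<inter> out_set b A B) = p / q * kappa (ends_set ?c \<inter> out_set b A B)"
    proof (cases "Suc (length b) = length a")
      case False
      have "w \<notin> in_set a \<inter> out_set b A B" "w \<notin> ends_set ?c \<inter> out_set b A B" if w: "w \<in> canon K" for w
        using False w in_data_eq_iff[of K w a] out_data_eq_iff[OF M_count_canon_ge1[OF finK w], of b] len
        by (auto simp: in_set_def out_set_def ends_set_def ends_def)
      then have "kappa (in_set a \<inter> out_set b A B) = 0" "kappa (ends_set ?c \<inter> out_set b A B) = 0"
        by (intro kappa_empty; blast)+
      then show ?thesis by simp
    next
      case lb: True
      let ?hs = "\<lambda>j. {b ! j}"
      have out: "w \<in> out_set b A B \<longleftrightarrow> M_count K w = length a \<and> (\<forall>j<length ?c - 1. X_out K w (Suc j) \<in> ?hs j) \<and>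
          X_minus w \<in> A \<and> X_plus K w \<in> B" if w: "w \<in> canon K" for w
      proof -
        have "length ?c - 1 = length b" using lb len by simp
        then show ?thesis unfolding out_set_def mem_Collect_eq singleton_iff
          out_data_eq_iff[OF M_count_canon_ge1[OF finK w], of b] lb using w by (simp only: simp_thms conj_assoc)
      qed
      have 1: "kappa (in_set a \<inter> out_set b A B) = kappa (paths_event ?c (\<lambda>j. {a ! j}) ?hs A B)"
      proof (rule kappa_cong)
        fix w assume w: "w \<in> canon K"
        have "in_data K w = a \<longleftrightarrow> ends K ?c w \<and> (\<forall>j<length ?c. X_in K w (Suc j) \<in> {a ! j})"
        proof
          assume d: "in_data K w = a"
          show "ends K ?c w \<and> (\<forall>j<length ?c. X_in K w (Suc j) \<in> {a ! j})"
          proof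
            show "ends K ?c w" using ends_of_in_data[OF w] unfolding d .
            have "\<forall>j<length a. X_in K w (Suc j) = a ! j" using d unfolding in_data_eq_iff by (rule conjunct2)
            then show "\<forall>j<length ?c. X_in K w (Suc j) \<in> {a ! j}" by (simp only: len singleton_iff)
          qed
        next
          assume "ends K ?c w \<and> (\<forall>j<length ?c. X_in K w (Suc j) \<in> {a ! j})"
          then show "in_data K w = a" unfolding in_data_eq_iff by (simp add: ends_def len)
        qed
        then show "w \<in> in_set a \<inter> out_set b A B \<longleftrightarrow> w \<in> paths_event ?c (\<lambda>j. {a ! j}) ?hs A B"
          unfolding paths_event_def mem_Collect_eq Int_iff out[OF w] in_set_def using w len by (auto simp: ends_def)
      qed
      have 2: "kappa (ends_set ?c \<inter> out_set b A B) = kappa (paths_event ?c (\<lambda>j. UNIV) ?hs A B)"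
      proof (rule kappa_cong)
        fix w assume w: "w \<in> canon K"
        show "w \<in> ends_set ?c \<inter> out_set b A B \<longleftrightarrow> w \<in> paths_event ?c (\<lambda>j. UNIV) ?hs A B"
          unfolding paths_event_def mem_Collect_eq Int_iff out[OF w] ends_set_def using w len by (auto simp: ends_def)
      qed
      \<comment> \<open>For the case that \<open>q\<close> is 0: then \<open>p / q\<close> is 0 by
        convention, and monotonicity shows that the left side vanishes as well.\<close>
      have le: "kappa (in_set a \<inter> out_set b A B) \<le> kappa (ends_set ?c \<inter> out_set b A B)"
      proof (rule kappa_mono)
        show "traj_set (ends_set ?c \<inter> out_set b A B)"
          by (intro traj_set_Int ends_set_traj_set out_set_traj_set A B)
        fix w assume "w \<in> canon K" "w \<in> in_set a \<inter> out_set b A B"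
        then show "w \<in> ends_set ?c \<inter> out_set b A B"
          using ends_of_in_data[of w] by (auto simp: in_set_def ends_set_def)
      qed
      \<comment> \<open>The factor from past, outer paths and future, common to both masses.\<close>
      define Z where "Z = srw_avoid K (fst (hd ?c)) A * eq_measure K (fst (hd ?c)) *
        ((\<Prod>j<length ?c - 1. rweight (out_restr ?c ?hs j)) *
          (eq_measure K (snd (last ?c)) * srw_avoid K (snd (last ?c)) B))"
      have k1: "kappa (in_set a \<inter> out_set b A B) = p * Z" and k2: "kappa (ends_set ?c \<inter> out_set b A B) = q * Z"
        unfolding 1 2 kappa_paths_event[OF c A B] p_def q_def Z_def len by (simp_all only: mult_ac)
      show ?thesis
      proof (cases "q = 0")
        case True
        then show ?thesis using le k2 kappa_nonneg[of "in_set a \<inter> out_set b A B"] by simp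
      next
        case False
        then show ?thesis unfolding k1 k2 by simp
      qed
    qed
  qed
qed

end


section \<open>Generating pi-systems and their cells\<close>

context interlacement_process
begin

definition pi_sets :: "(int \<Rightarrow> 'd site) set set \<Rightarrow> bool \<Rightarrow> 'o set set" where
  "pi_sets \<B> o' = {traj_event n U G \<inter> outer_event l D C | n U G l D C.
    (\<forall>i\<in>{1..n}. U i \<in> sets borel \<and> G i \<in> \<B>) \<and> outer_family l D C \<and> (o' \<or> l = 0)}"

definition base :: "(int \<Rightarrow> 'd site) set set \<Rightarrow> bool" where
  "base \<B> \<longleftrightarrow> (\<forall>G\<in>\<B>. traj_set G) \<and> (\<forall>G\<in>\<B>. \<forall>G'\<in>\<B>. G \<inter> G' \<in> \<B>)"

text \<open>A countable cover of \<open>space P\<close> by members of \<open>pi_sets\<close>, with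
  one cell for each list of data; generation of events and uniqueness of measures both rest on
  it.\<close>

definition cells :: "('d site list list \<Rightarrow> (int \<Rightarrow> 'd site) set) \<Rightarrow> 'd site list list list \<Rightarrow> 'o set" where
  "cells cell L = traj_event (length L) (\<lambda>_. UNIV) (\<lambda>i. cell (L ! (i - 1)))"

lemma outer_family_0: "outer_family 0 D C"
  by (simp add: outer_family_def)

lemma traj_event_sub: "traj_event n U G \<subseteq> space P"
  by (auto simp: traj_event_def)

lemma traj_event_in_pi:
  assumes "\<And>i. i \<in> {1..n} \<Longrightarrow> U i \<in> sets borel" "\<And>i. i \<in> {1..n} \<Longrightarrow> G i \<in> \<B>"
  shows "traj_event n U G \<in> pi_sets \<B> o'"
proof -
  have "traj_event n U G = traj_event n U G \<inter> outer_event 0 (\<lambda>_. {}) (\<lambda>_. {})"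
    using traj_event_sub by simp blast
  then show ?thesis unfolding pi_sets_def using assms outer_family_0 by blast
qed

lemma traj_event_Int:
  "traj_event n U G \<inter> traj_event n U' G' = traj_event n (\<lambda>i. U i \<inter> U' i) (\<lambda>i. G i \<inter> G' i)"
  unfolding traj_event_def by blast

lemma traj_event_Int_empty: "n \<noteq> n' \<Longrightarrow> traj_event n U G \<inter> traj_event n' U' G' = {}"
  unfolding traj_event_def by blast

text \<open>The two finite families are concatenated, the second with its indices shifted by
  \<open>l\<close>.\<close>

lemma outer_event_Int:
  "outer_event l D C \<inter> outer_event l' D' C' = outer_event (l + l')
    (\<lambda>k. if k < l then D k else D' (k - l)) (\<lambda>k. if k < l then C k else C' (k - l))"
proof -
  have "(\<forall>k<l + l'. R (if k < l then D k else D' (k - l)) (if k < l then C k else C' (k - l))) \<longleftrightarrow>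
      (\<forall>k<l. R (D k) (C k)) \<and> (\<forall>k<l'. R (D' k) (C' k))" for R
  proof (intro iffI conjI allI impI)
    fix k assume *: "\<forall>k<l + l'. R (if k < l then D k else D' (k - l)) (if k < l then C k else C' (k - l))" and "k < l'"
    then show "R (D' k) (C' k)" using *[rule_format, of "l + k"] by simp
  next
    fix k assume *: "\<forall>k<l + l'. R (if k < l then D k else D' (k - l)) (if k < l then C k else C' (k - l))" and "k < l"
    then show "R (D k) (C k)" using *[rule_format, of k] by simp
  next
    fix k assume *: "(\<forall>k<l. R (D k) (C k)) \<and> (\<forall>k<l'. R (D' k) (C' k))" and k: "k < l + l'"
    show "R (if k < l then D k else D' (k - l)) (if k < l then C k else C' (k - l))"
    proof (cases "k < l")
      case False
      then have "k - l < l'" using k by simp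
      then show ?thesis using * False by simp
    qed (use * in simp)
  qed
  from this[of "\<lambda>d c. emeasure (outer_part K u (\<omega> _)) d \<in> c"] show ?thesis
    unfolding outer_event_def by blast
qed

lemma outer_family_append:
  "outer_family l D C \<Longrightarrow> outer_family l' D' C' \<Longrightarrow> outer_family (l + l')
    (\<lambda>k. if k < l then D k else D' (k - l)) (\<lambda>k. if k < l then C k else C' (k - l))"
  by (auto simp: outer_family_def)

lemma pi_sets_events:
  assumes "base \<B>"
  shows "pi_sets \<B> o' \<subseteq> events"
proof
  fix X assume "X \<in> pi_sets \<B> o'"
  then obtain n U G l D C where X: "X = traj_event n U G \<inter> outer_event l D C"
    "\<forall>i\<in>{1..n}. U i \<in> sets borel \<and> G i \<in> \<B>" "outer_family l D C" unfolding pi_sets_def by blast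
  have "traj_event n U G \<in> events" using X(2) assms by (intro traj_event_events) (auto simp: base_def)
  then show "X \<in> events" unfolding X(1) using outer_event_events[OF X(3)] by (rule sets.Int)
qed

lemma pi_sets_Pow: "base \<B> \<Longrightarrow> pi_sets \<B> o' \<subseteq> Pow (space P)"
  using pi_sets_events sets.sets_into_space by blast

lemma pi_sets_stable:
  assumes "base \<B>"
  shows "Int_stable (pi_sets \<B> o')"
proof (rule Int_stableI)
  fix X Y assume "X \<in> pi_sets \<B> o'" "Y \<in> pi_sets \<B> o'"
  then obtain n U G l D C n' U' G' l' D' C' where X: "X = traj_event n U G \<inter> outer_event l D C"
    "\<forall>i\<in>{1..n}. U i \<in> sets borel \<and> G i \<in> \<B>" "outer_family l D C" "o' \<or> l = 0"
    and Y: "Y = traj_event n' U' G' \<inter> outer_event l' D' C'"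
    "\<forall>i\<in>{1..n'}. U' i \<in> sets borel \<and> G' i \<in> \<B>" "outer_family l' D' C'" "o' \<or> l' = 0"
    unfolding pi_sets_def by blast
  show "X \<inter> Y \<in> pi_sets \<B> o'"
  proof (cases "n = n'")
    case True
    have "X \<inter> Y = (traj_event n U G \<inter> traj_event n U' G') \<inter> (outer_event l D C \<inter> outer_event l' D' C')"
      unfolding X(1) Y(1) True by blast
    also have "\<dots> \<in> pi_sets \<B> o'"
    proof -
      have "\<forall>i\<in>{1..n}. U i \<inter> U' i \<in> sets borel \<and> G i \<inter> G' i \<in> \<B>"
        using X(2) Y(2) assms True unfolding base_def by (meson sets.Int)
      moreover have "o' \<or> l + l' = 0" using X(4) Y(4) by (cases o') simp_all
      ultimately show ?thesis unfolding traj_event_Int outer_event_Int pi_sets_def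
        using outer_family_append[OF X(3) Y(3)] by blast
    qed
    finally show ?thesis .
  next
    case False
    then have e: "X \<inter> Y = {}" using traj_event_Int_empty[OF False] X(1) Y(1) by blast
    \<comment> \<open>The empty set is written as an event with empty label sets, which takes at
      least one trajectory; of two different counts one is positive.\<close>
    have mem: "{} \<in> pi_sets \<B> o'" if "n \<ge> 1" "\<forall>i\<in>{1..n}. G i \<in> \<B>" for n :: nat and G :: "nat \<Rightarrow> (int \<Rightarrow> 'd site) set"
    proof -
      have "traj_event n (\<lambda>_. {}) G = {}" using that(1) by (auto simp: traj_event_def)
      moreover have "traj_event n (\<lambda>_. {}) G \<in> pi_sets \<B> o'" using that(2) by (intro traj_event_in_pi) auto
      ultimately show ?thesis by simp
    qed
    show ?thesis unfolding e using False mem[of n G] mem[of n' G'] X(2) Y(2) by (cases "n = 0") auto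
  qed
qed

lemma cells_cover:
  assumes "canon K \<subseteq> (\<Union>b. cell b)"
  shows "\<xi> \<in> space P \<Longrightarrow> \<exists>L. \<xi> \<in> cells cell L"
proof -
  assume \<xi>: "\<xi> \<in> space P"
  define L where "L = map (\<lambda>i. SOME b. X_traj K u (\<omega> \<xi>) i \<in> cell b) [1..<Suc (N_count K u (\<omega> \<xi>))]"
  have len: "length L = N_count K u (\<omega> \<xi>)" by (simp add: L_def)
  have "X_traj K u (\<omega> \<xi>) i \<in> cell (L ! (i - 1))" if i: "i \<in> {1..length L}" for i
  proof -
    have "X_traj K u (\<omega> \<xi>) i \<in> canon K" using enumeration_hit(3)[OF \<xi>, of i] i len by simp
    then have "X_traj K u (\<omega> \<xi>) i \<in> cell (SOME b. X_traj K u (\<omega> \<xi>) i \<in> cell b)"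
      using assms by (intro someI_ex[of "\<lambda>b. _ \<in> cell b"]) blast
    moreover have "[1..<Suc (N_count K u (\<omega> \<xi>))] ! (i - 1) = i" "i - 1 < length [1..<Suc (N_count K u (\<omega> \<xi>))]"
      using i len by (auto simp del: upt_Suc)
    ultimately show ?thesis unfolding L_def by (simp only: nth_map)
  qed
  then have "\<xi> \<in> cells cell L" using \<xi> len unfolding cells_def traj_event_def by simp
  then show ?thesis by (rule exI)
qed

context
  fixes \<B> :: "(int \<Rightarrow> 'd site) set set" and o' :: bool and cell :: "'d site list list \<Rightarrow> (int \<Rightarrow> 'd site) set"
  assumes B: "base \<B>" and cell: "\<And>b. cell b \<in> \<B>" and cover: "canon K \<subseteq> (\<Union>b. cell b)"
begin

lemma cells_in_pi: "cells cell L \<in> pi_sets \<B> o'"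
  unfolding cells_def using cell by (intro traj_event_in_pi) auto

lemma sigma_sets_countable_union:
  assumes "\<And>L :: 'd site list list list. L \<in> S \<Longrightarrow> F L \<in> pi_sets \<B> o'"
  shows "(\<Union>L\<in>S. F L) \<in> sigma_sets (space P) (pi_sets \<B> o')"
  using assms by (intro sigma_sets_UNION countable_image countableI_type) auto

lemma gen_N: "{\<xi> \<in> space P. N_count K u (\<omega> \<xi>) = n} \<in> sigma_sets (space P) (pi_sets \<B> o')"
proof -
  have "{\<xi> \<in> space P. N_count K u (\<omega> \<xi>) = n} = (\<Union>L\<in>{L. length L = n}. cells cell L)"
  proof (intro equalityI subsetI)
    fix \<xi> assume \<xi>: "\<xi> \<in> {\<xi> \<in> space P. N_count K u (\<omega> \<xi>) = n}"
    then obtain L where "\<xi> \<in> cells cell L" using cells_cover[OF cover] by blast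
    then show "\<xi> \<in> (\<Union>L\<in>{L. length L = n}. cells cell L)" using \<xi> by (auto simp: cells_def traj_event_def)
  qed (auto simp: cells_def traj_event_def)
  then show ?thesis using sigma_sets_countable_union[of _ "cells cell"] cells_in_pi by simp
qed

text \<open>The condition concerns one index while the count is left open, so it is split over all
  data lists of sufficient length; in each piece only the factor with index \<open>i\<close> is
  restricted further.\<close>

lemma gen_traj:
  assumes U: "U \<in> sets borel" and i: "1 \<le> i" and G: "\<And>b. cell b \<inter> G \<in> \<B>"
  shows "{\<xi> \<in> space P. i \<le> N_count K u (\<omega> \<xi>) \<and> label K u (\<omega> \<xi>) i \<in> U \<and> X_traj K u (\<omega> \<xi>) i \<in> G}
    \<in> sigma_sets (space P) (pi_sets \<B> o')"
proof -
  let ?F = "\<lambda>L. traj_event (length L) (\<lambda>k. if k = i then U else UNIV)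
    (\<lambda>k. if k = i then cell (L ! (k - 1)) \<inter> G else cell (L ! (k - 1)))"
  have "{\<xi> \<in> space P. i \<le> N_count K u (\<omega> \<xi>) \<and> label K u (\<omega> \<xi>) i \<in> U \<and> X_traj K u (\<omega> \<xi>) i \<in> G} =
      (\<Union>L\<in>{L. i \<le> length L}. ?F L)"
  proof (intro equalityI subsetI)
    fix \<xi> assume \<xi>: "\<xi> \<in> {\<xi> \<in> space P. i \<le> N_count K u (\<omega> \<xi>) \<and> label K u (\<omega> \<xi>) i \<in> U \<and> X_traj K u (\<omega> \<xi>) i \<in> G}"
    then obtain L where L: "\<xi> \<in> cells cell L" using cells_cover[OF cover] by blast
    then have "length L = N_count K u (\<omega> \<xi>)" by (simp add: cells_def traj_event_def)
    moreover have "\<xi> \<in> ?F L" using L \<xi> unfolding cells_def traj_event_def by auto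
    moreover have "i \<le> N_count K u (\<omega> \<xi>)" using \<xi> by simp
    ultimately show "\<xi> \<in> (\<Union>L\<in>{L. i \<le> length L}. ?F L)" by (intro UN_I[of L]) simp_all
  next
    fix \<xi> assume "\<xi> \<in> (\<Union>L\<in>{L. i \<le> length L}. ?F L)"
    then obtain L where L: "i \<le> length L" "\<xi> \<in> ?F L" by blast
    then have "i \<in> {1..length L}" using i by simp
    then show "\<xi> \<in> {\<xi> \<in> space P. i \<le> N_count K u (\<omega> \<xi>) \<and> label K u (\<omega> \<xi>) i \<in> U \<and> X_traj K u (\<omega> \<xi>) i \<in> G}"
      using L unfolding traj_event_def by fastforce
  qed
  moreover have "(\<Union>L\<in>{L. i \<le> length L}. ?F L) \<in> sigma_sets (space P) (pi_sets \<B> o')"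
    using U G cell by (intro sigma_sets_countable_union traj_event_in_pi) auto
  ultimately show ?thesis by simp
qed

lemma gen_outer:
  assumes "o'" "outer_family l D C"
  shows "outer_event l D C \<in> sigma_sets (space P) (pi_sets \<B> o')"
proof -
  have "outer_event l D C = (\<Union>L\<in>UNIV. cells cell L \<inter> outer_event l D C)"
    using cells_cover[OF cover] by (auto simp: outer_event_def)
  moreover have "cells cell L \<inter> outer_event l D C \<in> pi_sets \<B> o'" for L
  proof -
    have "\<forall>i\<in>{1..length L}. UNIV \<in> sets (borel :: real measure) \<and> cell (L ! (i - 1)) \<in> \<B>" using cell by simp
    moreover have "o' \<or> l = 0" using assms(1) by (rule disjI1)
    ultimately show ?thesis unfolding pi_sets_def cells_def using assms(2) by blast
  qed
  ultimately show ?thesis using sigma_sets_countable_union[of UNIV "\<lambda>L. cells cell L \<inter> outer_event l D C"] by simp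
qed

text \<open>The measures live on \<open>events\<close>, agreement is only claimed on the
  sigma-algebra generated by \<open>pi_sets\<close>; so both are first pushed to it along the
  identity, and the cells provide the countable cover of finite mass.\<close>

lemma pi_sets_determine:
  assumes N1: "sets N1 = events" "\<And>X. X \<in> events \<Longrightarrow> emeasure N1 X \<noteq> \<infinity>" and N2: "sets N2 = events"
    and eq: "\<And>X. X \<in> pi_sets \<B> o' \<Longrightarrow> emeasure N1 X = emeasure N2 X"
    and X: "X \<in> sigma_sets (space P) (pi_sets \<B> o')"
  shows "emeasure N1 X = emeasure N2 X"
proof -
  let ?S = "sigma (space P) (pi_sets \<B> o')"
  have Pow: "pi_sets \<B> o' \<subseteq> Pow (space P)" by (rule pi_sets_Pow[OF B])
  have m: "(\<lambda>x. x) \<in> N \<rightarrow>\<^sub>M ?S" if N: "sets N = events" for N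
  proof (rule measurable_measure_of[OF Pow])
    show "(\<lambda>x. x) \<in> space N \<rightarrow> space P" using sets_eq_imp_space_eq[OF N] by simp
    fix Y assume "Y \<in> pi_sets \<B> o'"
    then have "Y \<in> events" using pi_sets_events[OF B] by blast
    then show "(\<lambda>x. x) -` Y \<inter> space N \<in> sets N"
      using sets.sets_into_space[of Y P] sets_eq_imp_space_eq[OF N] N by (simp add: Int_absorb2)
  qed
  have sS: "sets ?S = sigma_sets (space P) (pi_sets \<B> o')" using Pow by (rule sets_measure_of)
  have ev: "Y \<in> events" if "Y \<in> sets ?S" for Y
    using that sets.sigma_sets_subset[OF pi_sets_events[OF B, of o']] unfolding sS by blast
  have D: "emeasure (distr N ?S (\<lambda>x. x)) Y = emeasure N Y" if N: "sets N = events" and Y: "Y \<in> sets ?S" for N Y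
    using emeasure_distr[OF m[OF N] Y] sets.sets_into_space[OF ev[OF Y]] sets_eq_imp_space_eq[OF N] by (simp add: Int_absorb2)
  have "distr N1 ?S (\<lambda>x. x) = distr N2 ?S (\<lambda>x. x)"
  proof (rule measure_eqI_generator_eq_countable[OF pi_sets_stable[OF B] Pow, where A="range (cells cell)"])
    show "emeasure (distr N1 ?S (\<lambda>x. x)) Y = emeasure (distr N2 ?S (\<lambda>x. x)) Y" if "Y \<in> pi_sets \<B> o'" for Y
    proof -
      have "Y \<in> sets ?S" unfolding sS using that by blast
      then show ?thesis using D[OF N1(1)] D[OF N2] eq[OF that] by simp
    qed
    show "range (cells cell) \<subseteq> pi_sets \<B> o'" using cells_in_pi by blast
    have "cells cell L \<subseteq> space P" for L unfolding cells_def by (rule traj_event_sub)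
    then have "\<Union> (range (cells cell)) \<subseteq> space P" by (rule UN_least)
    moreover have "space P \<subseteq> \<Union> (range (cells cell))"
      by (rule subsetI, drule cells_cover[OF cover], erule exE, rule UN_I, rule UNIV_I)
    ultimately show "\<Union> (range (cells cell)) = space P" by (rule equalityI)
    fix a assume "a \<in> range (cells cell)"
    then have "a \<in> sets ?S" unfolding sS using cells_in_pi by blast
    then show "emeasure (distr N1 ?S (\<lambda>x. x)) a \<noteq> \<infinity>" using D[OF N1(1)] N1(2)[OF ev] by simp
  qed (simp_all add: sS)
  then show ?thesis using D[OF N1(1), of X] D[OF N2, of X] X unfolding sS by simp
qed

end

section \<open>The inner and the outer sigma-algebra\<close>

definition in_base :: "(int \<Rightarrow> 'd site) set set" where
  "in_base = insert {} (range in_set)"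

definition out_base :: "(int \<Rightarrow> 'd site) set set" where
  "out_base = {out_set b A B | b A B. A \<in> sets half_space \<and> B \<in> sets half_space}"

text \<open>Cells for different inner data are disjoint, which is why the empty set was put into
  \<open>in_base\<close>.\<close>

lemma base_in: "base in_base"
proof -
  have "in_set a \<inter> in_set a' \<in> in_base" for a a'
  proof (cases "a = a'")
    case False
    then have "in_set a \<inter> in_set a' = {}" by (auto simp: in_set_def)
    then show ?thesis by (simp add: in_base_def)
  qed (simp add: in_base_def)
  moreover have "traj_set {}" by (simp add: traj_set_def)
  ultimately show ?thesis unfolding base_def in_base_def using in_set_traj_set by auto
qed

lemma out_base_memI: "A \<in> sets half_space \<Longrightarrow> B \<in> sets half_space \<Longrightarrow> out_set b A B \<in> out_base"
  unfolding out_base_def by blast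

lemma out_base_empty: "{} \<in> out_base"
proof -
  have "out_set [] {} {} = {}" by (simp add: out_set_def)
  then show ?thesis using out_base_memI[of "{}" "{}" "[]"] by simp
qed

lemma base_out: "base out_base"
proof -
  have "out_set b A B \<inter> out_set b' A' B' \<in> out_base"
    if "A \<in> sets half_space" "B \<in> sets half_space" "A' \<in> sets half_space" "B' \<in> sets half_space" for b b' A B A' B'
  proof (cases "b = b'")
    case True
    then have "out_set b A B \<inter> out_set b' A' B' = out_set b (A \<inter> A') (B \<inter> B')" by (auto simp: out_set_def)
    then show ?thesis using out_base_memI[of "A \<inter> A'" "B \<inter> B'" b] that by simp
  next
    case False
    then have "out_set b A B \<inter> out_set b' A' B' = {}" by (auto simp: out_set_def)
    then show ?thesis using out_base_empty by simp
  qed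
  then show ?thesis unfolding base_def using out_set_traj_set by (auto simp: out_base_def)
qed

lemma in_cell: "in_set b \<in> in_base" and in_cover: "canon K \<subseteq> (\<Union>b. in_set b)"
  by (auto simp: in_base_def in_set_def)

definition out_cell :: "'d site list list \<Rightarrow> (int \<Rightarrow> 'd site) set" where
  "out_cell b = out_set b half_trajs half_trajs"

lemma out_cell: "out_cell b \<in> out_base"
  unfolding out_cell_def by (intro out_base_memI half_trajs_in_half_space)

lemma out_cover: "canon K \<subseteq> (\<Union>b. out_cell b)"
  unfolding out_cell_def out_set_def using halves by blast

abbreviation sig_in where "sig_in \<equiv> sigma_sets (space P) (pi_sets in_base False)"
abbreviation sig_out where "sig_out \<equiv> sigma_sets (space P) (pi_sets out_base True)"

lemmas in_gens = gen_N[OF base_in in_cell in_cover] gen_traj[OF base_in in_cell in_cover]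
lemmas out_gens = gen_N[OF base_out out_cell out_cover] gen_traj[OF base_out out_cell out_cover]
  gen_outer[OF base_out out_cell out_cover]

text \<open>A set that depends only on the inner data contains each inner cell or misses it.\<close>

lemma in_traj:
  assumes "1 \<le> i" "U \<in> sets borel" "\<And>w w'. w \<in> canon K \<Longrightarrow> w' \<in> canon K \<Longrightarrow> in_data K w = in_data K w' \<Longrightarrow> w \<in> G \<longleftrightarrow> w' \<in> G"
  shows "{\<xi> \<in> space P. i \<le> N_count K u (\<omega> \<xi>) \<and> label K u (\<omega> \<xi>) i \<in> U \<and> X_traj K u (\<omega> \<xi>) i \<in> G} \<in> sig_in"
proof (rule in_gens(2)[OF assms(2,1)])
  fix b
  show "in_set b \<inter> G \<in> in_base"
  proof (cases "in_set b \<inter> G = {}")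
    case False
    then obtain w where w: "w \<in> canon K" "in_data K w = b" "w \<in> G" unfolding in_set_def by blast
    have "in_set b \<subseteq> G"
    proof
      fix w' assume "w' \<in> in_set b"
      then have w': "w' \<in> canon K \<and> in_data K w' = b" unfolding in_set_def by (rule CollectD)
      have "in_data K w' = in_data K w" using w' w(2) by (simp only: simp_thms)
      then show "w' \<in> G" using assms(3)[OF conjunct1[OF w'] w(1)] w(3) by (simp only: simp_thms)
    qed
    then show ?thesis using in_cell[of b] by (simp add: Int_absorb2)
  qed (simp add: in_base_def)
qed

text \<open>For fixed outer data the event may still depend on past and future; it has to be a
  product condition on the two, since such conditions are closed under intersection.\<close>

lemma out_traj:
  assumes "1 \<le> i" "U \<in> sets borel"
    and G: "\<And>b. \<exists>A\<in>sets half_space. \<exists>B\<in>sets half_space. \<forall>w\<in>canon K. out_data K w = b \<longrightarrow>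
      (w \<in> G \<longleftrightarrow> X_minus w \<in> A \<and> X_plus K w \<in> B)"
  shows "{\<xi> \<in> space P. i \<le> N_count K u (\<omega> \<xi>) \<and> label K u (\<omega> \<xi>) i \<in> U \<and> X_traj K u (\<omega> \<xi>) i \<in> G} \<in> sig_out"
proof (rule out_gens(2)[OF assms(2,1)])
  fix b
  from G[of b] obtain A where A: "A \<in> sets half_space" and "\<exists>B\<in>sets half_space. \<forall>w\<in>canon K. out_data K w = b \<longrightarrow>
      (w \<in> G \<longleftrightarrow> X_minus w \<in> A \<and> X_plus K w \<in> B)" by (rule bexE)
  from this(2) obtain B where "B \<in> sets half_space" "\<forall>w\<in>canon K. out_data K w = b \<longrightarrow>
      (w \<in> G \<longleftrightarrow> X_minus w \<in> A \<and> X_plus K w \<in> B)" by (rule bexE)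
  note AB = A this
  have "out_cell b \<inter> G = out_set b A B"
    using AB(3) halves unfolding out_cell_def out_set_def by blast
  then show "out_cell b \<inter> G \<in> out_base" using out_base_memI[OF AB(1,2)] by simp
qed

lemma out_data_traj:
  assumes "1 \<le> i" "U \<in> sets borel" "\<And>w. w \<in> canon K \<Longrightarrow> w \<in> G \<longleftrightarrow> R (out_data K w)"
  shows "{\<xi> \<in> space P. i \<le> N_count K u (\<omega> \<xi>) \<and> label K u (\<omega> \<xi>) i \<in> U \<and> X_traj K u (\<omega> \<xi>) i \<in> G} \<in> sig_out"
proof (rule out_traj[OF assms(1,2)])
  fix b
  show "\<exists>A\<in>sets half_space. \<exists>B\<in>sets half_space. \<forall>w\<in>canon K. out_data K w = b \<longrightarrow>
      (w \<in> G \<longleftrightarrow> X_minus w \<in> A \<and> X_plus K w \<in> B)"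
  proof (cases "R b")
    case True
    then show ?thesis using assms(3) halves half_trajs_in_half_space by (intro bexI[of _ half_trajs]) auto
  next
    case False
    then show ?thesis using assms(3) by (intro bexI[of _ "{}"]) auto
  qed
qed

lemma M_in_data: "M_count K w = length (in_data K w)"
  by (simp add: in_data_def)

text \<open>There is one outer excursion fewer than inner ones, so the number of excursions is seen
  from either side, as the events common to both sigma-algebras require.\<close>

lemma M_out_data: "w \<in> canon K \<Longrightarrow> M_count K w = Suc (length (out_data K w))"
  using M_count_canon_ge1[OF finK, of w] by (simp add: out_data_def)

lemma X_in_data: "1 \<le> j \<Longrightarrow> j \<le> M_count K w \<Longrightarrow> X_in K w j = in_data K w ! (j - 1)"
  using in_data_eq_iff[of K w "in_data K w"] by (metis One_nat_def Suc_diff_1 Suc_le_eq less_le_trans)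

lemma X_out_data: "1 \<le> j \<Longrightarrow> j \<le> M_count K w - 1 \<Longrightarrow> X_out K w j = out_data K w ! (j - 1)"
  unfolding out_data_def by (subst nth_map) auto

lemma common_sub_in: "common_events P \<omega> K u \<subseteq> sig_in"
proof -
  have L: "{\<xi> \<in> space P. i \<le> N_count K u (\<omega> \<xi>) \<and> label K u (\<omega> \<xi>) i \<in> U} \<in> sig_in" if "1 \<le> i" "U \<in> sets borel" for i U
    using in_traj[OF that, of UNIV] by simp
  have M: "{\<xi> \<in> space P. i \<le> N_count K u (\<omega> \<xi>) \<and> M_count K (X_traj K u (\<omega> \<xi>) i) = m} \<in> sig_in" if "1 \<le> i" for i m
    using in_traj[OF that, of UNIV "{w. M_count K w = m}"] M_in_data by simp
  show ?thesis unfolding common_events_def using L M in_gens(1) by blast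
qed

lemma common_sub_out: "common_events P \<omega> K u \<subseteq> sig_out"
proof -
  have L: "{\<xi> \<in> space P. i \<le> N_count K u (\<omega> \<xi>) \<and> label K u (\<omega> \<xi>) i \<in> U} \<in> sig_out" if "1 \<le> i" "U \<in> sets borel" for i U
    using out_data_traj[OF that, of UNIV "\<lambda>_. True"] by simp
  have M: "{\<xi> \<in> space P. i \<le> N_count K u (\<omega> \<xi>) \<and> M_count K (X_traj K u (\<omega> \<xi>) i) = m} \<in> sig_out" if "1 \<le> i" for i m
    using out_data_traj[OF that, of UNIV "{w. M_count K w = m}" "\<lambda>b. Suc (length b) = m"] M_out_data by simp
  show ?thesis unfolding common_events_def using L M out_gens(1) by blast
qed

lemma common_Pow: "common_events P \<omega> K u \<subseteq> Pow (space P)"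
  unfolding common_events_def by blast

text \<open>One inclusion suffices, because independence proved for the larger sigma-algebra passes
  to the events of \<open>F_in\<close>.\<close>

lemma F_in_sub: "sets (F_in P \<omega> K u) \<subseteq> sig_in"
proof -
  have X: "{\<xi> \<in> space P. i \<le> N_count K u (\<omega> \<xi>) \<and> (let X = X_traj K u (\<omega> \<xi>) i in j \<le> M_count K X \<and> X_in K X j = \<tau>)} \<in> sig_in"
    if "1 \<le> i" "1 \<le> j" for i j \<tau>
  proof -
    have det: "w \<in> {w. j \<le> M_count K w \<and> X_in K w j = \<tau>} \<longleftrightarrow> w' \<in> {w. j \<le> M_count K w \<and> X_in K w j = \<tau>}"
      if "in_data K w = in_data K w'" for w w'
    proof -
      have M: "M_count K w = M_count K w'" unfolding M_in_data that ..
      have "X_in K w j = X_in K w' j" if "j \<le> M_count K w'"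
        unfolding X_in_data[OF \<open>1 \<le> j\<close> that] X_in_data[OF \<open>1 \<le> j\<close> that[folded M]] \<open>in_data K w = in_data K w'\<close> ..
      then show ?thesis unfolding mem_Collect_eq M by (intro conj_cong refl) (simp only:)
    qed
    have "{\<xi> \<in> space P. i \<le> N_count K u (\<omega> \<xi>) \<and> label K u (\<omega> \<xi>) i \<in> UNIV \<and>
        X_traj K u (\<omega> \<xi>) i \<in> {w. j \<le> M_count K w \<and> X_in K w j = \<tau>}} \<in> sig_in"
    proof (rule in_traj[OF that(1)])
      show "w \<in> {w. j \<le> M_count K w \<and> X_in K w j = \<tau>} \<longleftrightarrow> w' \<in> {w. j \<le> M_count K w \<and> X_in K w j = \<tau>}"
        if "in_data K w = in_data K w'" for w w' using that by (rule det)
    qed simp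
    then show ?thesis by (simp add: Let_def)
  qed
  let ?g = "common_events P \<omega> K u \<union>
     {{\<xi> \<in> space P. i \<le> N_count K u (\<omega> \<xi>) \<and>
         (let X = X_traj K u (\<omega> \<xi>) i in j \<le> M_count K X \<and> X_in K X j = \<tau>)} | i j \<tau>.
        1 \<le> i \<and> 1 \<le> j}"
  have Pow: "?g \<subseteq> Pow (space P)" using common_Pow by blast
  have "?g \<subseteq> sig_in" using common_sub_in X by blast
  then show ?thesis unfolding F_in_def sets_measure_of[OF Pow] by (rule sigma_sets_mono)
qed

lemma F_out_sub: "sets (F_out P \<omega> K u) \<subseteq> sig_out"
proof -
  have O: "{\<xi> \<in> space P. emeasure (outer_part K u (\<omega> \<xi>)) E \<in> C} \<in> sig_out"
    if "E \<in> sets marked_space" "C \<in> sets borel" for E C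
    using out_gens(3)[of True 1 "\<lambda>_. E" "\<lambda>_. C"] that by (simp add: outer_event_def outer_family_def)
  have Xm: "{\<xi> \<in> space P. i \<le> N_count K u (\<omega> \<xi>) \<and> X_minus (X_traj K u (\<omega> \<xi>) i) \<in> A} \<in> sig_out"
    if "1 \<le> i" "A \<in> sets half_space" for i A
  proof -
    have "{\<xi> \<in> space P. i \<le> N_count K u (\<omega> \<xi>) \<and> label K u (\<omega> \<xi>) i \<in> UNIV \<and> X_traj K u (\<omega> \<xi>) i \<in> {w. X_minus w \<in> A}} \<in> sig_out"
    proof (rule out_traj[OF that(1)])
      fix b
      show "\<exists>A'\<in>sets half_space. \<exists>B\<in>sets half_space. \<forall>w\<in>canon K. out_data K w = b \<longrightarrow>
          (w \<in> {w. X_minus w \<in> A} \<longleftrightarrow> X_minus w \<in> A' \<and> X_plus K w \<in> B)"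
        by (rule bexI[of _ A], rule bexI[of _ half_trajs]) (use that half_trajs_in_half_space halves in simp_all)
    qed simp
    then show ?thesis by simp
  qed
  have Xp: "{\<xi> \<in> space P. i \<le> N_count K u (\<omega> \<xi>) \<and> X_plus K (X_traj K u (\<omega> \<xi>) i) \<in> A} \<in> sig_out"
    if "1 \<le> i" "A \<in> sets half_space" for i A
  proof -
    have "{\<xi> \<in> space P. i \<le> N_count K u (\<omega> \<xi>) \<and> label K u (\<omega> \<xi>) i \<in> UNIV \<and> X_traj K u (\<omega> \<xi>) i \<in> {w. X_plus K w \<in> A}} \<in> sig_out"
    proof (rule out_traj[OF that(1)])
      fix b
      show "\<exists>A'\<in>sets half_space. \<exists>B\<in>sets half_space. \<forall>w\<in>canon K. out_data K w = b \<longrightarrow>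
          (w \<in> {w. X_plus K w \<in> A} \<longleftrightarrow> X_minus w \<in> A' \<and> X_plus K w \<in> B)"
        by (rule bexI[of _ half_trajs], rule bexI[of _ A]) (use that half_trajs_in_half_space halves in simp_all)
    qed simp
    then show ?thesis by simp
  qed
  have Xo: "{\<xi> \<in> space P. i \<le> N_count K u (\<omega> \<xi>) \<and> (let X = X_traj K u (\<omega> \<xi>) i in j \<le> M_count K X - 1 \<and> X_out K X j = \<tau>)} \<in> sig_out"
    if "1 \<le> i" "1 \<le> j" for i j \<tau>
  proof -
    have "w \<in> {w. j \<le> M_count K w - 1 \<and> X_out K w j = \<tau>} \<longleftrightarrow> j \<le> length (out_data K w) \<and> out_data K w ! (j - 1) = \<tau>"
      if "w \<in> canon K" for w
      using X_out_data[OF \<open>1 \<le> j\<close>, of w] M_out_data[OF that] by auto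
    from out_data_traj[OF that(1) _ this, of UNIV] show ?thesis by (simp add: Let_def)
  qed
  let ?g = "common_events P \<omega> K u \<union>
     {{\<xi> \<in> space P. emeasure (outer_part K u (\<omega> \<xi>)) E \<in> C} | E C.
        E \<in> sets marked_space \<and> C \<in> sets borel} \<union>
     {{\<xi> \<in> space P. i \<le> N_count K u (\<omega> \<xi>) \<and> X_minus (X_traj K u (\<omega> \<xi>) i) \<in> A} | i A.
        1 \<le> i \<and> A \<in> sets half_space} \<union>
     {{\<xi> \<in> space P. i \<le> N_count K u (\<omega> \<xi>) \<and>
         (let X = X_traj K u (\<omega> \<xi>) i in j \<le> M_count K X - 1 \<and> X_out K X j = \<tau>)} | i j \<tau>.
        1 \<le> i \<and> 1 \<le> j} \<union>
     {{\<xi> \<in> space P. i \<le> N_count K u (\<omega> \<xi>) \<and> X_plus K (X_traj K u (\<omega> \<xi>) i) \<in> B} | i B.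
        1 \<le> i \<and> B \<in> sets half_space}"
  have Pow: "?g \<subseteq> Pow (space P)" using common_Pow by blast
  have "?g \<subseteq> sig_out"
  proof (intro Un_least)
    show "common_events P \<omega> K u \<subseteq> sig_out" by (rule common_sub_out)
  qed (rule subsetI, elim CollectE exE conjE, hypsubst, rule O Xm Xp Xo, assumption, assumption)+
  then show ?thesis unfolding F_out_def sets_measure_of[OF Pow] by (rule sigma_sets_mono)
qed

abbreviation AB_gens where
  "AB_gens \<equiv> common_events P \<omega> K u \<union>
     {{\<xi> \<in> space P. i \<le> N_count K u (\<omega> \<xi>) \<and>
         (let X = X_traj K u (\<omega> \<xi>) i
          in j \<le> M_count K X \<and> (X (A_time K X j), X (B_time K X j)) = (x, y))} | i j x y.
        1 \<le> i \<and> 1 \<le> j}"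

lemma AB_gens_Pow: "AB_gens \<subseteq> Pow (space P)"
  using common_Pow by blast

lemma sets_F_AB: "sets (F_AB P \<omega> K u) = sigma_sets (space P) AB_gens"
  unfolding F_AB_def by (rule sets_measure_of[OF AB_gens_Pow])

lemma space_F_AB: "space (F_AB P \<omega> K u) = space P"
  unfolding F_AB_def by (rule space_measure_of[OF AB_gens_Pow])

text \<open>Each end point of an inner excursion is also an end point of a neighbouring outer
  excursion or, at the two extremes, of the past or the future. Hence the outer side knows all end
  points.\<close>

lemma start_of_in:
  assumes w: "w \<in> canon K" and j: "1 \<le> j" "j \<le> M_count K w"
  shows "w (A_time K w j) = (if j = 1 then X_minus w 0 else last (out_data K w ! (j - 2)))"
    and "w (B_time K w j) = (if j = M_count K w then X_plus K w 0 else hd (out_data K w ! (j - 1)))"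
proof -
  \<comment> \<open>Inner excursion \<open>j\<close> is entered by outer excursion
    \<open>j - 1\<close>, which sits at position \<open>j - 2\<close> of the list.\<close>
  show "w (A_time K w j) = (if j = 1 then X_minus w 0 else last (out_data K w ! (j - 2)))"
  proof (cases "j = 1")
    case True
    have "A_time K (fwd w) 1 = 0" using first_in_exc(1)[OF finK fwd_start[OF finK w]] .
    then have "A_time K w 1 = 0" using AB_time_fwd(1)[OF finK w, of 1] j True by simp
    then show ?thesis using True by (simp add: X_minus_def)
  next
    case False
    have "X_out K w (j - 1) \<in> out_paths K (w (B_time K w (j - 1))) (w (A_time K w (Suc (j - 1))))"
      using False j by (intro out_exc_out_paths[OF w]) auto
    moreover have "X_out K w (j - 1) = out_data K w ! (j - 1 - 1)"
      using False j by (intro X_out_data) auto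
    ultimately show ?thesis using False j by (auto simp: out_paths_def path_outside_def numeral_2_eq_2)
  qed
  show "w (B_time K w j) = (if j = M_count K w then X_plus K w 0 else hd (out_data K w ! (j - 1)))"
  proof (cases "j = M_count K w")
    case True
    then show ?thesis by (simp add: X_plus_def)
  next
    case False
    have "X_out K w j \<in> out_paths K (w (B_time K w j)) (w (A_time K w (Suc j)))"
      using False j by (intro out_exc_out_paths[OF w]) auto
    moreover have "X_out K w j = out_data K w ! (j - 1)"
      using False j by (intro X_out_data) auto
    ultimately show ?thesis using False by (auto simp: out_paths_def path_outside_def)
  qed
qed

lemma coord0_half: "{f \<in> half_trajs. f 0 = x} \<in> sets half_space"
  using measurable_sets_Collect[OF half_coord_measurable, of "\<lambda>v. v = x" 0] by simp

text \<open>Conditional expectations will be tested by intersecting with sets of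
  \<open>F_AB\<close>; this inclusion keeps such intersections outer events.\<close>

lemma F_AB_sub: "sets (F_AB P \<omega> K u) \<subseteq> sig_out"
proof -
  have X: "{\<xi> \<in> space P. i \<le> N_count K u (\<omega> \<xi>) \<and> (let X = X_traj K u (\<omega> \<xi>) i
      in j \<le> M_count K X \<and> (X (A_time K X j), X (B_time K X j)) = (x, y))} \<in> sig_out"
    if ij: "1 \<le> i" "1 \<le> j" for i j x y
  proof -
    let ?G = "{w. j \<le> M_count K w \<and> (w (A_time K w j), w (B_time K w j)) = (x, y)}"
    have "{\<xi> \<in> space P. i \<le> N_count K u (\<omega> \<xi>) \<and> label K u (\<omega> \<xi>) i \<in> UNIV \<and> X_traj K u (\<omega> \<xi>) i \<in> ?G} \<in> sig_out"
    proof (rule out_traj[OF ij(1)])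
      fix b :: "'d site list list"
      \<comment> \<open>An interior end point is decided by the outer data, while the entrance of
        the first excursion is a condition on the past and the exit from the last one a condition on
        the future.\<close>
      let ?A = "if j = 1 then {f \<in> half_trajs. f 0 = x} else if last (b ! (j - 2)) = x then half_trajs else {}"
      let ?B = "if j = Suc (length b) then {f \<in> half_trajs. f 0 = y}
        else if j \<le> length b \<and> hd (b ! (j - 1)) = y then half_trajs else {}"
      have Z: "w \<in> ?G \<longleftrightarrow> X_minus w \<in> ?A \<and> X_plus K w \<in> ?B" if w: "w \<in> canon K" "out_data K w = b" for w
        using start_of_in[OF w(1) ij(2)] M_out_data[OF w(1)] halves[OF w(1)] w(2) by (cases "j \<le> Suc (length b)") auto
      have A: "?A \<in> sets half_space" and B: "?B \<in> sets half_space"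
        using coord0_half half_trajs_in_half_space by auto
      show "\<exists>A\<in>sets half_space. \<exists>B\<in>sets half_space. \<forall>w\<in>canon K. out_data K w = b \<longrightarrow>
        (w \<in> ?G \<longleftrightarrow> X_minus w \<in> A \<and> X_plus K w \<in> B)"
        by (rule bexI[OF _ A], rule bexI[OF _ B], intro ballI impI, rule Z)
    qed simp
    then show ?thesis by (simp add: Let_def)
  qed
  have "AB_gens \<subseteq> sig_out" using common_sub_out X by blast
  then show ?thesis unfolding sets_F_AB by (rule sigma_sets_mono)
qed

text \<open>\<open>traj_event\<close> fixes the count, while the generators of \<open>F_AB\<close>
  carry a random index range; intersected with the event for the count the two descriptions
  agree.\<close>

lemma ends_event_F_AB:
  assumes U: "\<And>i. i \<in> {1..n} \<Longrightarrow> U i \<in> sets borel"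
  shows "traj_event n U (\<lambda>i. ends_set (c i)) \<in> sets (F_AB P \<omega> K u)"
proof -
  let ?F = "F_AB P \<omega> K u"
  have gen: "X \<in> sets ?F" if "X \<in> AB_gens" for X unfolding sets_F_AB using that by (rule sigma_sets.Basic)
  have N: "{\<xi> \<in> space P. N_count K u (\<omega> \<xi>) = n} \<in> sets ?F"
    by (intro gen UnI1) (auto simp: common_events_def)
  have L: "{\<xi> \<in> space P. i \<le> N_count K u (\<omega> \<xi>) \<and> label K u (\<omega> \<xi>) i \<in> U i} \<in> sets ?F" if "i \<in> {1..n}" for i
  proof -
    have "{\<xi> \<in> space P. i \<le> N_count K u (\<omega> \<xi>) \<and> label K u (\<omega> \<xi>) i \<in> U i} \<in> common_events P \<omega> K u"
      unfolding common_events_def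
      by (rule UnI1, rule UnI2, rule CollectI, rule exI[of _ i], rule exI[of _ "U i"]) (use U[OF that] that in simp)
    then show ?thesis by (intro gen UnI1)
  qed
  have M: "{\<xi> \<in> space P. i \<le> N_count K u (\<omega> \<xi>) \<and> M_count K (X_traj K u (\<omega> \<xi>) i) = length (c i)} \<in> sets ?F" if "i \<in> {1..n}" for i
  proof -
    have "{\<xi> \<in> space P. i \<le> N_count K u (\<omega> \<xi>) \<and> M_count K (X_traj K u (\<omega> \<xi>) i) = length (c i)} \<in> common_events P \<omega> K u"
      unfolding common_events_def
      by (rule UnI2, rule CollectI, rule exI[of _ i], rule exI[of _ "length (c i)"]) (use that in simp)
    then show ?thesis by (intro gen UnI1)
  qed
  let ?pt = "\<lambda>i j \<xi>. i \<le> N_count K u (\<omega> \<xi>) \<and> (let X = X_traj K u (\<omega> \<xi>) i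
      in j \<le> M_count K X \<and> (X (A_time K X j), X (B_time K X j)) = (fst (c i ! (j - 1)), snd (c i ! (j - 1))))"
  have X: "{\<xi> \<in> space P. ?pt i j \<xi>} \<in> sets ?F" if "i \<in> {1..n}" "j \<in> {1..length (c i)}" for i j
    by (rule gen, rule UnI2, rule CollectI, rule exI[of _ i], rule exI[of _ j], rule exI[of _ "fst (c i ! (j - 1))"],
      rule exI[of _ "snd (c i ! (j - 1))"]) (use that in simp)
  have all: "{\<xi> \<in> space P. \<forall>i\<in>{1..n}. ((i \<le> N_count K u (\<omega> \<xi>) \<and> label K u (\<omega> \<xi>) i \<in> U i) \<and>
      (i \<le> N_count K u (\<omega> \<xi>) \<and> M_count K (X_traj K u (\<omega> \<xi>) i) = length (c i))) \<and> (\<forall>j\<in>{1..length (c i)}. ?pt i j \<xi>)} \<in> sets ?F"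
  proof -
    have "{\<xi> \<in> space ?F. ((i \<le> N_count K u (\<omega> \<xi>) \<and> label K u (\<omega> \<xi>) i \<in> U i) \<and>
      (i \<le> N_count K u (\<omega> \<xi>) \<and> M_count K (X_traj K u (\<omega> \<xi>) i) = length (c i))) \<and> (\<forall>j\<in>{1..length (c i)}. ?pt i j \<xi>)} \<in> sets ?F"
      if i: "i \<in> {1..n}" for i
    proof -
      have l: "{\<xi> \<in> space ?F. i \<le> N_count K u (\<omega> \<xi>) \<and> label K u (\<omega> \<xi>) i \<in> U i} \<in> sets ?F"
        unfolding space_F_AB by (rule L[OF i])
      have m: "{\<xi> \<in> space ?F. i \<le> N_count K u (\<omega> \<xi>) \<and> M_count K (X_traj K u (\<omega> \<xi>) i) = length (c i)} \<in> sets ?F"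
        unfolding space_F_AB by (rule M[OF i])
      have "{\<xi> \<in> space ?F. \<forall>j\<in>{1..length (c i)}. ?pt i j \<xi>} \<in> sets ?F"
      proof (rule sets.sets_Collect_finite_All)
        fix j assume "j \<in> {1..length (c i)}"
        then show "{\<xi> \<in> space ?F. ?pt i j \<xi>} \<in> sets ?F" unfolding space_F_AB by (rule X[OF i])
      qed (rule finite_atLeastAtMost)
      from sets.sets_Collect_conj[OF this sets.sets_Collect_conj[OF m l]] show ?thesis .
    qed
    then have "{\<xi> \<in> space ?F. \<forall>i\<in>{1..n}. ((i \<le> N_count K u (\<omega> \<xi>) \<and> label K u (\<omega> \<xi>) i \<in> U i) \<and>
      (i \<le> N_count K u (\<omega> \<xi>) \<and> M_count K (X_traj K u (\<omega> \<xi>) i) = length (c i))) \<and> (\<forall>j\<in>{1..length (c i)}. ?pt i j \<xi>)} \<in> sets ?F"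
      by (intro sets.sets_Collect_finite_All[OF _ finite_atLeastAtMost])
    then show ?thesis unfolding space_F_AB .
  qed
  have ends: "ends K (c i) w \<longleftrightarrow> M_count K w = length (c i) \<and> (\<forall>j\<in>{1..length (c i)}. j \<le> M_count K w \<and>
      (w (A_time K w j), w (B_time K w j)) = (fst (c i ! (j - 1)), snd (c i ! (j - 1))))" for i and w :: "int \<Rightarrow> 'd site"
  proof -
    have shift: "(\<forall>j\<in>{1..length (c i)}. R j) \<longleftrightarrow> (\<forall>j<length (c i). R (Suc j))" for R
    proof (intro iffI allI ballI impI)
      fix j assume "\<forall>j<length (c i). R (Suc j)" "j \<in> {1..length (c i)}"
      then show "R j" by (cases j) auto
    qed simp
    show ?thesis unfolding ends_def
    proof (intro conj_cong refl)
      assume M: "M_count K w = length (c i)"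
      show "(\<forall>j<length (c i). w (A_time K w (Suc j)) = fst (c i ! j) \<and> w (B_time K w (Suc j)) = snd (c i ! j)) \<longleftrightarrow>
        (\<forall>j\<in>{1..length (c i)}. j \<le> M_count K w \<and>
        (w (A_time K w j), w (B_time K w j)) = (fst (c i ! (j - 1)), snd (c i ! (j - 1))))"
        unfolding shift diff_Suc_1 prod.inject M by (rule all_cong) (simp add: Suc_le_eq)
    qed
  qed
  have one: "label K u (\<omega> \<xi>) i \<in> U i \<and> X_traj K u (\<omega> \<xi>) i \<in> ends_set (c i) \<longleftrightarrow> ((i \<le> N_count K u (\<omega> \<xi>) \<and> label K u (\<omega> \<xi>) i \<in> U i) \<and>
      (i \<le> N_count K u (\<omega> \<xi>) \<and> M_count K (X_traj K u (\<omega> \<xi>) i) = length (c i))) \<and> (\<forall>j\<in>{1..length (c i)}. ?pt i j \<xi>)"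
    if \<xi>: "\<xi> \<in> space P" "N_count K u (\<omega> \<xi>) = n" and i: "i \<in> {1..n}" for \<xi> i
  proof -
    have le: "i \<le> N_count K u (\<omega> \<xi>)" using \<xi> i by simp
    have c: "X_traj K u (\<omega> \<xi>) i \<in> canon K" using \<xi> i le by (intro enumeration_hit(3)) auto
    show ?thesis unfolding ends_set_def mem_Collect_eq Let_def ends by (simp only: c le simp_thms conj_assoc)
  qed
  have "traj_event n U (\<lambda>i. ends_set (c i)) = {\<xi> \<in> space P. N_count K u (\<omega> \<xi>) = n} \<inter>
    {\<xi> \<in> space P. \<forall>i\<in>{1..n}. ((i \<le> N_count K u (\<omega> \<xi>) \<and> label K u (\<omega> \<xi>) i \<in> U i) \<and>
      (i \<le> N_count K u (\<omega> \<xi>) \<and> M_count K (X_traj K u (\<omega> \<xi>) i) = length (c i))) \<and> (\<forall>j\<in>{1..length (c i)}. ?pt i j \<xi>)}"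
  proof (intro set_eqI)
    fix \<xi>
    have "(\<forall>i\<in>{1..n}. label K u (\<omega> \<xi>) i \<in> U i \<and> X_traj K u (\<omega> \<xi>) i \<in> ends_set (c i)) \<longleftrightarrow>
      (\<forall>i\<in>{1..n}. ((i \<le> N_count K u (\<omega> \<xi>) \<and> label K u (\<omega> \<xi>) i \<in> U i) \<and>
      (i \<le> N_count K u (\<omega> \<xi>) \<and> M_count K (X_traj K u (\<omega> \<xi>) i) = length (c i))) \<and> (\<forall>j\<in>{1..length (c i)}. ?pt i j \<xi>))"
      if "\<xi> \<in> space P" "N_count K u (\<omega> \<xi>) = n" by (rule ball_cong[OF refl one[OF that]])
    then show "\<xi> \<in> traj_event n U (\<lambda>i. ends_set (c i)) \<longleftrightarrow> \<xi> \<in> {\<xi> \<in> space P. N_count K u (\<omega> \<xi>) = n} \<inter>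
        {\<xi> \<in> space P. \<forall>i\<in>{1..n}. ((i \<le> N_count K u (\<omega> \<xi>) \<and> label K u (\<omega> \<xi>) i \<in> U i) \<and>
      (i \<le> N_count K u (\<omega> \<xi>) \<and> M_count K (X_traj K u (\<omega> \<xi>) i) = length (c i))) \<and> (\<forall>j\<in>{1..length (c i)}. ?pt i j \<xi>)}"
      unfolding traj_event_def Int_iff mem_Collect_eq
      by (cases "\<xi> \<in> space P"; cases "N_count K u (\<omega> \<xi>) = n") (simp_all only: simp_thms)
  qed
  then show ?thesis using sets.Int[OF N all] by simp
qed

end


section \<open>From ratios to conditional independence\<close>

context interlacement_process
begin

lemma sig_in_events: "sig_in \<subseteq> events"
  by (rule sets.sigma_sets_subset[OF pi_sets_events[OF base_in]])

lemma sig_out_events: "sig_out \<subseteq> events"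
  by (rule sets.sigma_sets_subset[OF pi_sets_events[OF base_out]])

lemma subalgebra_F:
  "subalgebra P (F_in P \<omega> K u)" "subalgebra P (F_out P \<omega> K u)" "subalgebra P (F_AB P \<omega> K u)"
proof -
  show "subalgebra P (F_in P \<omega> K u)"
    using F_in_sub sig_in_events common_Pow unfolding subalgebra_def F_in_def
    by (subst space_measure_of) auto
  show "subalgebra P (F_out P \<omega> K u)"
    using F_out_sub sig_out_events common_Pow unfolding subalgebra_def F_out_def
    by (subst space_measure_of) auto
  show "subalgebra P (F_AB P \<omega> K u)"
    using F_AB_sub sig_out_events space_F_AB unfolding subalgebra_def by blast
qed

sublocale AB: finite_measure_subalgebra P "F_AB P \<omega> K u"
  by unfold_locales (rule subalgebra_F(3))

text \<open>By the product formula over trajectories, the ratio for the whole event is the product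
  of the single ratios of \<open>kappa_in_ratio\<close>; labels, count and complementary part
  contribute the same factors to both probabilities.\<close>

lemma in_event_ratio_pi:
  assumes "E1 \<in> pi_sets in_base False"
  shows "\<exists>r\<ge>0. \<exists>E0\<in>sets (F_AB P \<omega> K u). \<forall>E2\<in>pi_sets out_base True. prob (E1 \<inter> E2) = r * prob (E0 \<inter> E2)"
proof -
  have "\<exists>r. \<exists>E0\<in>sets (F_AB P \<omega> K u). \<forall>E2\<in>pi_sets out_base True. prob (E1 \<inter> E2) = r * prob (E0 \<inter> E2)"
  proof -
    obtain n U G D C where E1: "E1 = traj_event n U G \<inter> outer_event 0 D C"
      "\<forall>i\<in>{1..n}. U i \<in> sets borel \<and> G i \<in> in_base" using assms unfolding pi_sets_def by auto
    from E1(1) have E1': "E1 = traj_event n U G" unfolding outer_event_0 using traj_event_sub[of n U G] by blast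
    show ?thesis
    proof (cases "\<exists>i\<in>{1..n}. G i = {}")
      case True
      then have "E1 = {}" unfolding E1' traj_event_def by blast
      then show ?thesis by (intro exI[of _ 0] bexI[of _ "{}"]) simp_all
    next
      case False
      then have "\<forall>i\<in>{1..n}. \<exists>a. G i = in_set a" using E1(2) unfolding in_base_def by blast
      then obtain a where a: "\<forall>i\<in>{1..n}. G i = in_set (a i)" using bchoice by metis
      obtain \<rho> where \<rho>: "\<And>a b A B. A \<in> sets half_space \<Longrightarrow> B \<in> sets half_space \<Longrightarrow>
          kappa (in_set a \<inter> out_set b A B) = \<rho> a * kappa (ends_set (end_points a) \<inter> out_set b A B)"
        using kappa_in_ratio by metis
      let ?E0 = "traj_event n U (\<lambda>i. ends_set (end_points (a i)))"
      show ?thesis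
      proof (intro exI[of _ "\<Prod>i\<in>{1..n}. \<rho> (a i)"] bexI[of _ ?E0] ballI)
        show "?E0 \<in> sets (F_AB P \<omega> K u)" using E1(2) by (intro ends_event_F_AB) auto
        fix E2 assume "E2 \<in> pi_sets out_base True"
        then obtain n' U' G' l D C where E2: "E2 = traj_event n' U' G' \<inter> outer_event l D C"
          "\<forall>i\<in>{1..n'}. U' i \<in> sets borel \<and> G' i \<in> out_base" "outer_family l D C" unfolding pi_sets_def by blast
        show "prob (E1 \<inter> E2) = (\<Prod>i\<in>{1..n}. \<rho> (a i)) * prob (?E0 \<inter> E2)"
        proof (cases "n = n'")
          case False
          then have "E1 \<inter> E2 = {}" "?E0 \<inter> E2 = {}"
            using traj_event_Int_empty[OF False] unfolding E1' E2(1) by blast+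
          then show ?thesis by simp
        next
          case nn: True
          have G: "E1 = traj_event n U (\<lambda>i. in_set (a i))" using a unfolding E1' traj_event_def by blast
          show ?thesis
          proof (cases "n = 0")
            case True
            then show ?thesis unfolding G by (simp add: traj_event_0)
          next
            case False
            then have n: "n \<ge> 1" by simp
            have ts: "traj_set (G' i)" if "i \<in> {1..n}" for i
              using E2(2) that nn base_out unfolding base_def by blast
            have Ub: "U i \<inter> U' i \<in> sets borel" if "i \<in> {1..n}" for i using E1(2) E2(2) that nn by blast
            have 1: "E1 \<inter> E2 = traj_event n (\<lambda>i. U i \<inter> U' i) (\<lambda>i. in_set (a i) \<inter> G' i) \<inter> outer_event l D C"
              unfolding G E2(1) nn[symmetric] traj_event_Int[symmetric] by blast
            have 2: "?E0 \<inter> E2 = traj_event n (\<lambda>i. U i \<inter> U' i) (\<lambda>i. ends_set (end_points (a i)) \<inter> G' i) \<inter> outer_event l D C"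
              unfolding E2(1) nn[symmetric] traj_event_Int[symmetric] by blast
            have ratio: "(\<Prod>i\<in>{1..n}. kappa (in_set (a i) \<inter> G' i) / cap K) =
              (\<Prod>i\<in>{1..n}. \<rho> (a i) * (kappa (ends_set (end_points (a i)) \<inter> G' i) / cap K))"
            proof (rule prod.cong[OF refl])
              fix i assume "i \<in> {1..n}"
              then have "G' i \<in> out_base" using E2(2) nn by blast
              then obtain b A B where b: "G' i = out_set b A B" "A \<in> sets half_space" "B \<in> sets half_space"
                unfolding out_base_def by blast
              show "kappa (in_set (a i) \<inter> G' i) / cap K = \<rho> (a i) * (kappa (ends_set (end_points (a i)) \<inter> G' i) / cap K)"
                unfolding b(1) \<rho>[OF b(2,3)] by simp
            qed
            have p: "prob (traj_event n (\<lambda>i. U i \<inter> U' i) V \<inter> outer_event l D C) = prob (outer_event l D C) *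
                prob {\<xi> \<in> space P. N_count K u (\<omega> \<xi>) = n} * order_stat_prob n u (\<lambda>i. (U i \<inter> U' i) \<inter> {0..u}) *
                (\<Prod>i\<in>{1..n}. kappa (V i) / cap K)" if "\<forall>i\<in>{1..n}. traj_set (V i)" for V
              by (rule prob_traj_event[OF n _ _ E2(3)]) (rule Ub, assumption, rule bspec[OF that], assumption)
            have t1: "\<forall>i\<in>{1..n}. traj_set (in_set (a i) \<inter> G' i)"
              using traj_set_Int[OF in_set_traj_set ts] by blast
            have t2: "\<forall>i\<in>{1..n}. traj_set (ends_set (end_points (a i)) \<inter> G' i)"
              using traj_set_Int[OF ends_set_traj_set ts] by blast
            show ?thesis unfolding 1 2 p[OF t1] p[OF t2] ratio prod.distrib by (simp only: mult_ac)
          qed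
        qed
      qed
    qed
  qed
  then obtain r E0 where E0: "E0 \<in> sets (F_AB P \<omega> K u)"
    and eq: "\<And>E2. E2 \<in> pi_sets out_base True \<Longrightarrow> prob (E1 \<inter> E2) = r * prob (E0 \<inter> E2)" by blast
  show ?thesis
  \<comment> \<open>With a negative \<open>r\<close> all the probabilities on the left vanish, and 0
    serves as well; a nonnegative ratio is wanted for scaling a measure by it.\<close>
  proof (cases "r \<ge> 0")
    case True
    then show ?thesis using E0 eq by blast
  next
    case False
    have "prob (E1 \<inter> E2) = 0 * prob (E0 \<inter> E2)" if "E2 \<in> pi_sets out_base True" for E2
    proof -
      have "prob (E1 \<inter> E2) \<le> 0"
        unfolding eq[OF that] using False by (simp add: mult_nonpos_nonneg)
      then show ?thesis by (simp add: measure_le_0_iff)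
    qed
    then show ?thesis using E0 by blast
  qed
qed

text \<open>Both sides are finite measures in the outer event, so agreement on the pi-system extends
  to the generated sigma-algebra.\<close>

lemma in_event_ratio:
  assumes "E1 \<in> pi_sets in_base False"
  obtains r E0 where "r \<ge> 0" "E0 \<in> sets (F_AB P \<omega> K u)" "\<And>E2. E2 \<in> sig_out \<Longrightarrow> prob (E1 \<inter> E2) = r * prob (E0 \<inter> E2)"
proof -
  obtain r E0 where r: "r \<ge> 0" and E0: "E0 \<in> sets (F_AB P \<omega> K u)"
    and eq: "\<And>E2. E2 \<in> pi_sets out_base True \<Longrightarrow> prob (E1 \<inter> E2) = r * prob (E0 \<inter> E2)"
    using in_event_ratio_pi[OF assms] by blast
  have E1: "E1 \<in> events" using assms pi_sets_events[OF base_in] by blast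
  have E0': "E0 \<in> events" using E0 F_AB_sub sig_out_events by blast
  let ?N1 = "density P (indicator E1)" and ?N2 = "scale_measure (ennreal r) (density P (indicator E0))"
  have N1: "emeasure ?N1 X = ennreal (prob (E1 \<inter> X))" if "X \<in> events" for X
    using emeasure_restricted[OF E1 that] by (simp add: emeasure_eq_measure)
  have N2: "emeasure ?N2 X = ennreal (r * prob (E0 \<inter> X))" if "X \<in> events" for X
    using emeasure_restricted[OF E0' that] r by (simp add: emeasure_eq_measure ennreal_mult')
  have "prob (E1 \<inter> E2) = r * prob (E0 \<inter> E2)" if E2: "E2 \<in> sig_out" for E2
  proof -
    have "emeasure ?N1 E2 = emeasure ?N2 E2"
    proof (rule pi_sets_determine[OF base_out out_cell out_cover _ _ _ _ E2])
      show "emeasure ?N1 X \<noteq> \<infinity>" if "X \<in> events" for X using N1[OF that] by simp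
      fix X assume X: "X \<in> pi_sets out_base True"
      then have "X \<in> events" using pi_sets_events[OF base_out] by blast
      then show "emeasure ?N1 X = emeasure ?N2 X" using N1 N2 eq[OF X] by simp
    qed simp_all
    moreover have "E2 \<in> events" using E2 sig_out_events by blast
    ultimately have "ennreal (prob (E1 \<inter> E2)) = ennreal (r * prob (E0 \<inter> E2))" using N1 N2 by simp
    then show ?thesis using r by (subst (asm) ennreal_inj) auto
  qed
  then show thesis using that r E0 by blast
qed

abbreviation cexp where "cexp E \<equiv> real_cond_exp P (F_AB P \<omega> K u) (indicator E)"

lemma integrable_ind: "E \<in> events \<Longrightarrow> integrable P (indicator E :: 'o \<Rightarrow> real)"
  by (simp add: emeasure_eq_measure)

lemma integrable_cexp: "E \<in> events \<Longrightarrow> integrable P (cexp E)"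
  by (rule AB.real_cond_exp_int(1)[OF integrable_ind])

lemma set_integral_ind: "A \<in> events \<Longrightarrow> E \<in> events \<Longrightarrow> (\<integral>x\<in>A. indicator E x \<partial>P) = prob (A \<inter> E)"
proof -
  assume "A \<in> events" "E \<in> events"
  moreover have "(\<lambda>x. indicator A x *\<^sub>R (indicator E x :: real)) = indicator (A \<inter> E)"
    by (auto simp: indicator_def)
  ultimately show ?thesis unfolding set_lebesgue_integral_def by simp
qed

text \<open>Tested on sets of \<open>F_AB\<close>, which are outer events, the ratio identity says
  that the conditional expectation of \<open>E1\<close> is \<open>r\<close> times the indicator of
  \<open>E0\<close>; inserting this under the integral gives the formula.\<close>

lemma prob_in_out_pi:
  assumes E1: "E1 \<in> pi_sets in_base False" and E2: "E2 \<in> sig_out"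
  shows "prob (E1 \<inter> E2) = (\<integral>x. indicator E1 x * cexp E2 x \<partial>P)"
proof -
  obtain r E0 where r: "r \<ge> 0" and E0: "E0 \<in> sets (F_AB P \<omega> K u)"
    and eq: "\<And>E2. E2 \<in> sig_out \<Longrightarrow> prob (E1 \<inter> E2) = r * prob (E0 \<inter> E2)"
    by (rule in_event_ratio[OF E1]) blast
  have ev: "E1 \<in> events" "E2 \<in> events" "E0 \<in> events"
    using E1 pi_sets_events[OF base_in] E2 E0 F_AB_sub sig_out_events by blast+
  have "AE x in P. cexp E1 x = r * indicator E0 x"
  proof (rule AB.real_cond_exp_charact)
    show "integrable P (indicator E1 :: 'o \<Rightarrow> real)" by (rule integrable_ind[OF ev(1)])
    show "integrable P (\<lambda>x. r * indicator E0 x)" using integrable_ind[OF ev(3)] by simp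
    show "(\<lambda>x. r * indicator E0 x) \<in> borel_measurable (F_AB P \<omega> K u)" using E0 by measurable
    fix A assume A: "A \<in> sets (F_AB P \<omega> K u)"
    then have A': "A \<in> sig_out" "A \<in> events" using F_AB_sub sig_out_events by blast+
    have "(\<integral>x\<in>A. indicator E1 x \<partial>P) = r * prob (E0 \<inter> A)"
      using set_integral_ind[OF A'(2) ev(1)] eq[OF A'(1)] by (simp add: Int_commute)
    also have "\<dots> = r * (\<integral>x\<in>A. indicator E0 x \<partial>P)"
      using set_integral_ind[OF A'(2) ev(3)] by (simp add: Int_commute)
    also have "\<dots> = (\<integral>x\<in>A. r * indicator E0 x \<partial>P)" by simp
    finally show "(\<integral>x\<in>A. indicator E1 x \<partial>P) = (\<integral>x\<in>A. r * indicator E0 x \<partial>P)" .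
  qed
  then have "(\<integral>x. cexp E2 x * cexp E1 x \<partial>P) = (\<integral>x. cexp E2 x * (r * indicator E0 x) \<partial>P)"
    by (intro integral_cong_AE) (auto elim: AE_mp intro!: borel_measurable_times borel_measurable_indicator[OF ev(3)])
  moreover have "integrable P (\<lambda>x. cexp E2 x * indicator E1 x)"
    using integrable_mult_indicator[OF ev(1) integrable_cexp[OF ev(2)]] by (simp add: mult.commute)
  then have "(\<integral>x. cexp E2 x * cexp E1 x \<partial>P) = (\<integral>x. cexp E2 x * indicator E1 x \<partial>P)"
    by (rule AB.real_cond_exp_intg(2)) (auto intro!: borel_measurable_indicator[OF ev(1)])
  moreover have "(\<integral>x. cexp E2 x * (r * indicator E0 x) \<partial>P) = r * (\<integral>x\<in>E0. cexp E2 x \<partial>P)"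
    unfolding set_lebesgue_integral_def by (simp add: mult_ac flip: integral_mult_right_zero)
  moreover have "(\<integral>x\<in>E0. cexp E2 x \<partial>P) = prob (E0 \<inter> E2)"
    using AB.real_cond_exp_intA[OF integrable_ind[OF ev(2)] E0] set_integral_ind[OF ev(3,2)] by simp
  ultimately show ?thesis using eq[OF E2] by (simp add: mult.commute)
qed

text \<open>For fixed \<open>E2\<close> both sides are measures in the inner event, the right one
  with density \<open>cexp E2\<close>; so the identity extends from the pi-system.\<close>

lemma prob_in_out:
  assumes E1: "E1 \<in> sig_in" and E2: "E2 \<in> sig_out"
  shows "prob (E1 \<inter> E2) = (\<integral>x. indicator E1 x * cexp E2 x \<partial>P)"
proof -
  have ev2: "E2 \<in> events" using E2 sig_out_events by blast
  have pos: "AE x in P. 0 \<le> cexp E2 x" by (rule AB.real_cond_exp_pos) (auto intro: borel_measurable_indicator ev2)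
  have int: "integrable P (\<lambda>x. indicator X x * cexp E2 x)" if "X \<in> events" for X
    using integrable_mult_indicator[OF that integrable_cexp[OF ev2]] by simp
  let ?N1 = "density P (indicator E2)" and ?N2 = "density P (\<lambda>x. ennreal (cexp E2 x))"
  have N1: "emeasure ?N1 X = ennreal (prob (X \<inter> E2))" if "X \<in> events" for X
    using emeasure_restricted[OF ev2 that] by (simp add: emeasure_eq_measure Int_commute)
  have nn: "0 \<le> (\<integral>x. indicator X x * cexp E2 x \<partial>P)" for X
    using pos by (intro integral_nonneg_AE) (auto elim: AE_mp)
  have N2: "emeasure ?N2 X = ennreal (\<integral>x. indicator X x * cexp E2 x \<partial>P)" if X: "X \<in> events" for X
  proof -
    have "emeasure ?N2 X = (\<integral>\<^sup>+x. ennreal (cexp E2 x) * indicator X x \<partial>P)"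
      using X by (intro emeasure_density) auto
    also have "\<dots> = (\<integral>\<^sup>+x. ennreal (indicator X x * cexp E2 x) \<partial>P)"
      by (intro nn_integral_cong) (simp split: split_indicator)
    also have "\<dots> = ennreal (\<integral>x. indicator X x * cexp E2 x \<partial>P)"
      using int[OF X] pos by (intro nn_integral_eq_integral) (auto elim: AE_mp)
    finally show ?thesis .
  qed
  have "emeasure ?N1 E1 = emeasure ?N2 E1"
  proof (rule pi_sets_determine[OF base_in in_cell in_cover _ _ _ _ E1])
    show "emeasure ?N1 X \<noteq> \<infinity>" if "X \<in> events" for X using N1[OF that] by simp
    fix X assume X: "X \<in> pi_sets in_base False"
    then have "X \<in> events" using pi_sets_events[OF base_in] by blast
    then show "emeasure ?N1 X = emeasure ?N2 X" using N1 N2 prob_in_out_pi[OF X E2] by simp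
  qed simp_all
  moreover have "E1 \<in> events" using E1 sig_in_events by blast
  ultimately have "ennreal (prob (E1 \<inter> E2)) = ennreal (\<integral>x. indicator E1 x * cexp E2 x \<partial>P)" using N1 N2 by simp
  then show ?thesis using nn by (subst (asm) ennreal_inj) auto
qed

text \<open>A set \<open>A\<close> of \<open>F_AB\<close> can be absorbed into the outer event,
  where it factors out of the conditional expectation; \<open>prob_in_out\<close> for
  \<open>A \<inter> E2\<close> then becomes the characterising integral identity of the
  product.\<close>

lemma cond_indep_in_out: "cond_indep P (F_in P \<omega> K u) (F_out P \<omega> K u) (F_AB P \<omega> K u)"
  unfolding cond_indep_def
proof (intro conjI subalgebra_F ballI)
  fix E1 E2 assume "E1 \<in> sets (F_in P \<omega> K u)" "E2 \<in> sets (F_out P \<omega> K u)"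
  then have E1: "E1 \<in> sig_in" and E2: "E2 \<in> sig_out" using F_in_sub F_out_sub by blast+
  then have ev: "E1 \<in> events" "E2 \<in> events" using sig_in_events sig_out_events by blast+
  have int: "integrable P (\<lambda>x. cexp E2 x * indicator E1 x)"
    using integrable_mult_indicator[OF ev(1) integrable_cexp[OF ev(2)]] by (simp add: mult.commute)
  have int2: "integrable P (\<lambda>x. cexp E2 x * cexp E1 x)"
    using int by (rule AB.real_cond_exp_intg(1)) (auto intro!: borel_measurable_indicator[OF ev(1)])
  show "AE \<xi> in P. cexp (E1 \<inter> E2) \<xi> = cexp E1 \<xi> * cexp E2 \<xi>"
  proof (rule AB.real_cond_exp_charact)
    show "integrable P (indicator (E1 \<inter> E2) :: 'o \<Rightarrow> real)" using ev by (intro integrable_ind) auto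
    show "integrable P (\<lambda>x. cexp E1 x * cexp E2 x)" using int2 by (simp add: mult.commute)
    show "(\<lambda>x. cexp E1 x * cexp E2 x) \<in> borel_measurable (F_AB P \<omega> K u)" by measurable
    fix A assume A: "A \<in> sets (F_AB P \<omega> K u)"
    then have A': "A \<in> sig_out" "A \<in> events" using F_AB_sub sig_out_events by blast+
    have AE2: "A \<inter> E2 \<in> sig_out"
      using sets.Int[of A "sigma (space P) (pi_sets out_base True)" E2] A'(1) E2
      unfolding sets_measure_of[OF pi_sets_Pow[OF base_out]] by blast
    have eq: "(\<lambda>x. indicator A x * indicator E2 x) = (indicator (A \<inter> E2) :: 'o \<Rightarrow> real)"
      by (auto simp: indicator_def)
    have "AE x in P. real_cond_exp P (F_AB P \<omega> K u) (\<lambda>x. indicator A x * indicator E2 x) x = indicator A x * cexp E2 x"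
      using A A'(2) ev(2) unfolding eq
      by (intro AB.real_cond_exp_mult[where f="indicator A" and g="indicator E2", unfolded eq]) (auto intro!: integrable_ind)
    then have mult: "AE x in P. cexp (A \<inter> E2) x = indicator A x * cexp E2 x" unfolding eq .
    have "(\<integral>x\<in>A. indicator (E1 \<inter> E2) x \<partial>P) = prob (E1 \<inter> (A \<inter> E2))"
      using set_integral_ind[OF A'(2), of "E1 \<inter> E2"] ev by (simp add: Int_left_commute)
    also have "\<dots> = (\<integral>x. indicator E1 x * cexp (A \<inter> E2) x \<partial>P)" by (rule prob_in_out[OF E1 AE2])
    also have "\<dots> = (\<integral>x. (indicator A x * cexp E2 x) * indicator E1 x \<partial>P)"
      using mult by (intro integral_cong_AE) (auto elim!: AE_mp intro!: borel_measurable_times borel_measurable_indicator ev A'(2))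
    also have "\<dots> = (\<integral>x. (indicator A x * cexp E2 x) * cexp E1 x \<partial>P)"
    proof (rule AB.real_cond_exp_intg(2)[symmetric])
      show "integrable P (\<lambda>x. indicator A x * cexp E2 x * indicator E1 x)"
        using integrable_mult_indicator[OF A'(2) int] by (simp add: mult.assoc)
      show "(\<lambda>x. indicator A x * cexp E2 x) \<in> borel_measurable (F_AB P \<omega> K u)" using A by measurable
    qed (auto intro!: borel_measurable_indicator[OF ev(1)])
    also have "\<dots> = (\<integral>x\<in>A. cexp E1 x * cexp E2 x \<partial>P)"
      unfolding set_lebesgue_integral_def by (intro Bochner_Integration.integral_cong) (auto simp: mult_ac)
    finally show "(\<integral>x\<in>A. indicator (E1 \<inter> E2) x \<partial>P) = (\<integral>x\<in>A. cexp E1 x * cexp E2 x \<partial>P)" .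
  qed
qed

end


section \<open>Walks up to their exit and return times\<close>

lemma pred_coord_in [measurable]: "Measurable.pred half_space (\<lambda>f. f n \<in> K)"
  and pred_coord_eq [measurable]: "Measurable.pred half_space (\<lambda>f. f n = x)"
  by (rule measurable_compose[OF half_coord_measurable], simp)+

lemma pred_exit_time [measurable]: "Measurable.pred half_space (\<lambda>f. exit_time K f = Some n)"
  unfolding exit_time_def first_eq_Some_iff by measurable

lemma pred_return_time [measurable]: "Measurable.pred half_space (\<lambda>f. return_time K f = Some n)"
  unfolding return_time_eq_Some_iff by measurable

text \<open>Instead of a measurable space on an option type, each equation with a fixed value is
  treated as a predicate; the recursion becomes a countable existential quantifier over the
  preceding visit and departure.\<close>

lemma pred_R_time_Some [measurable]: "Measurable.pred half_space (\<lambda>f. R_time K f k = Some n)"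
proof (cases k)
  case (Suc l)
  have "Measurable.pred half_space (\<lambda>f. R_time K f (Suc l) = Some n)"
  proof (induction l arbitrary: n)
    case 0
    show ?case unfolding R_time.simps first_eq_Some_iff by measurable
  next
    case (Suc l)
    note Suc.IH [measurable]
    have "R_time K f (Suc (Suc l)) = Some n \<longleftrightarrow> (\<exists>m d. R_time K f (Suc l) = Some m \<and>
        (m < d \<and> f d \<notin> K \<and> (\<forall>k. m < k \<and> k < d \<longrightarrow> \<not> f k \<notin> K)) \<and>
        (d < n \<and> f n \<in> K \<and> (\<forall>k. d < k \<and> k < n \<longrightarrow> f k \<notin> K)))" for f
    proof (cases "R_time K f (Suc l)")
      case (Some m)
      show ?thesis unfolding R_time.simps Some
      proof (cases "first_after (Some m) (\<lambda>n. f n \<notin> K)")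
        case None
        then have n: "\<forall>n>m. \<not> f n \<notin> K" unfolding first_after_eq_None_iff .
        show "first_after (first_after (Some m) (\<lambda>n. f n \<notin> K)) (\<lambda>n. f n \<in> K) = Some n \<longleftrightarrow> (\<exists>m' d. Some m = Some m' \<and>
          (m' < d \<and> f d \<notin> K \<and> (\<forall>k. m' < k \<and> k < d \<longrightarrow> \<not> f k \<notin> K)) \<and>
          (d < n \<and> f n \<in> K \<and> (\<forall>k. d < k \<and> k < n \<longrightarrow> f k \<notin> K)))"
          unfolding None first_after_None using n by auto
      next
        case (Some d)
        then have d: "first_after (Some m) (\<lambda>n. f n \<notin> K) = Some d'
            \<longleftrightarrow> d' = d" for d' by auto
        show "first_after (first_after (Some m) (\<lambda>n. f n \<notin> K)) (\<lambda>n. f n \<in> K) = Some n \<longleftrightarrow> (\<exists>m' d. Some m = Some m' \<and>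
          (m' < d \<and> f d \<notin> K \<and> (\<forall>k. m' < k \<and> k < d \<longrightarrow> \<not> f k \<notin> K)) \<and>
          (d < n \<and> f n \<in> K \<and> (\<forall>k. d < k \<and> k < n \<longrightarrow> f k \<notin> K)))"
        proof -
          have gen: "B d \<longleftrightarrow> (\<exists>m' d. Some m = Some m' \<and> A m' d \<and> B d)" if "\<And>d'. A m d' \<longleftrightarrow> d' = d"
            for A :: "nat \<Rightarrow> nat \<Rightarrow> bool" and B using that by auto
          show ?thesis unfolding Some first_after_eq_Some_iff
            by (rule gen[where A="\<lambda>m' d. m' < d \<and> f d \<notin> K \<and> (\<forall>k. m' < k \<and> k < d \<longrightarrow> \<not> f k \<notin> K)"
              and B="\<lambda>d. d < n \<and> f n \<in> K \<and> (\<forall>k. d < k \<and> k < n \<longrightarrow> f k \<notin> K)", OF d[unfolded first_after_eq_Some_iff]])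
        qed
      qed
    qed simp
    note eq = this
    show ?case unfolding eq by measurable
  qed
  then show ?thesis unfolding Suc .
qed simp

lemma pred_R_time_None [measurable]: "Measurable.pred half_space (\<lambda>f. R_time K f k = (None :: nat option))"
proof -
  have "R_time K f k = None \<longleftrightarrow> (\<forall>n. \<not> R_time K f k = Some n)" for f :: "nat \<Rightarrow> 'a site" by auto
  note eq = this
  show ?thesis unfolding eq by measurable
qed

lemma pred_D_time_Some [measurable]: "Measurable.pred half_space (\<lambda>f. D_time K f k = Some (n :: nat))"
proof -
  have "D_time K f k = Some n \<longleftrightarrow> (\<exists>m. R_time K f k = Some m \<and>
      (m < n \<and> f n \<notin> K \<and> (\<forall>k. m < k \<and> k < n \<longrightarrow> \<not> f k \<notin> K)))" for f
    unfolding D_time_def by (cases "R_time K f k") (simp_all add: first_after_eq_Some_iff)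
  note eq = this
  show ?thesis unfolding eq by measurable
qed

lemma pred_D_time_None [measurable]: "Measurable.pred half_space (\<lambda>f. D_time K f k = (None :: nat option))"
proof -
  have "D_time K f k = None \<longleftrightarrow> (\<forall>n. \<not> D_time K f k = Some n)" for f :: "nat \<Rightarrow> 'a site" by auto
  note eq = this
  show ?thesis unfolding eq by measurable
qed

text \<open>Without a visit \<open>A_time\<close> is the fixed but unknown value
  \<open>the None\<close>, so that case has to be carried along.\<close>

lemma pred_at_A_time [measurable]: "Measurable.pred half_space (\<lambda>f. f (A_time K f j) = x)"
proof -
  have "f (A_time K f j) = x \<longleftrightarrow> (\<exists>n. R_time K f j = Some n \<and> f n = x) \<or> (R_time K f j = None \<and> f (the None) = x)"
    for f :: "nat \<Rightarrow> 'a site" unfolding A_time_def by (cases "R_time K f j") auto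
  note eq = this
  show ?thesis unfolding eq by measurable
qed

lemma pred_at_B_time [measurable]: "Measurable.pred half_space (\<lambda>f. f (B_time K f j) = x)"
proof -
  have "f (B_time K f j) = x \<longleftrightarrow> (\<exists>n. D_time K f j = Some n \<and> f (n - 1) = x) \<or> (D_time K f j = None \<and> f (the None - 1) = x)"
    for f :: "nat \<Rightarrow> 'a site" unfolding B_time_def by (cases "D_time K f j") auto
  note eq = this
  show ?thesis unfolding eq by measurable
qed

text \<open>The walk starts at \<open>x\<close> almost surely, so events may be compared on
  trajectories from \<open>x\<close> only.\<close>

lemma measure_srw_agree:
  assumes A: "A \<in> sets half_space" and B: "B \<in> sets half_space"
    and eq: "\<And>f. f \<in> half_trajs \<Longrightarrow> f 0 = x \<Longrightarrow> f \<in> A \<longleftrightarrow> f \<in> B"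
  shows "measure (srw x) A = measure (srw x) B"
proof -
  have "{f \<in> A. f 0 = x} = {f \<in> B. f 0 = x}"
    using eq sets.sets_into_space[OF A] sets.sets_into_space[OF B] by auto
  then show ?thesis using emeasure_srw_start[OF A, of x] emeasure_srw_start[OF B, of x] by (simp add: measure_def)
qed

section \<open>Exit and return laws of the walk\<close>

context
  fixes K :: "('d::finite) site set"
  assumes finK: "finite K"
begin

text \<open>A trajectory missing \<open>K\<close> has \<open>M_count\<close> equal to the
  unspecified \<open>Max {}\<close>; the first alternative records this, so that the equivalence
  holds on all of \<open>half_trajs\<close>.\<close>

lemma M_count_eq_iff:
  assumes "f \<in> half_trajs"
  shows "M_count K f = m \<longleftrightarrow> ((\<forall>k\<ge>1. R_time K f k = None) \<and> Max {} = m) \<or>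
    (1 \<le> m \<and> R_time K f m \<noteq> None \<and> (\<forall>k>m. R_time K f k = None))"
proof (cases "{k. 1 \<le> k \<and> R_time K f k \<noteq> None} = {}")
  case True
  then have n: "R_time K f k = None" if "1 \<le> k" for k using that by blast
  have "M_count K f = Max {}" unfolding M_count_def True ..
  then show ?thesis using n by auto
next
  case False
  have "M_count K f = m \<longleftrightarrow> (1 \<le> m \<and> R_time K f m \<noteq> None) \<and> (\<forall>k\<in>{k. 1 \<le> k \<and> R_time K f k \<noteq> None}. k \<le> m)"
    unfolding M_count_def using Max_eq_iff[OF finite_R_times[OF finK assms] False, of m] by simp
  also have "\<dots> \<longleftrightarrow> 1 \<le> m \<and> R_time K f m \<noteq> None \<and> (\<forall>k>m. R_time K f k = None)"
  proof (cases "1 \<le> m")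
    case True
    have "(\<forall>k\<in>{k. 1 \<le> k \<and> R_time K f k \<noteq> None}. k \<le> m) \<longleftrightarrow> (\<forall>k>m. R_time K f k = None)"
    proof (intro iffI allI impI ballI)
      fix k assume *: "\<forall>k\<in>{k. 1 \<le> k \<and> R_time K f k \<noteq> None}. k \<le> m" and k: "k > m"
      show "R_time K f k = None"
      proof (rule ccontr)
        assume "R_time K f k \<noteq> None"
        then have "k \<in> {k. 1 \<le> k \<and> R_time K f k \<noteq> None}" using k True by simp
        then show False using * k by (meson leD)
      qed
    next
      fix k assume *: "\<forall>k>m. R_time K f k = None" and "k \<in> {k. 1 \<le> k \<and> R_time K f k \<noteq> None}"
      then have R: "R_time K f k \<noteq> None" by (elim CollectE conjE)
      show "k \<le> m"
      proof (rule leI, rule notI)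
        assume "m < k"
        from R *[rule_format, OF this] show False by (rule notE)
      qed
    qed
    then show ?thesis unfolding conj_assoc by (rule arg_cong)
  qed (simp only: simp_thms)
  finally have eq: "M_count K f = m \<longleftrightarrow> 1 \<le> m \<and> R_time K f m \<noteq> None \<and> (\<forall>k>m. R_time K f k = None)" .
  have "\<not> (\<forall>k\<ge>1. R_time K f k = None)"
  proof
    assume none: "\<forall>k\<ge>1. R_time K f k = None"
    have "{k. 1 \<le> k \<and> R_time K f k \<noteq> None} = {}"
      by (rule equals0I, elim CollectE conjE, erule notE, rule none[rule_format], assumption)
    with False show False by (rule notE)
  qed
  then show ?thesis unfolding eq by (simp only: simp_thms)
qed

lemma ends_sets: "{f \<in> half_trajs. ends K c f} \<in> sets half_space"
proof -
  have "{f \<in> half_trajs. ends K c f} = {f \<in> space half_space.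
      (((\<forall>k\<ge>1. R_time K f k = None) \<and> Max {} = length c) \<or>
      (1 \<le> length c \<and> R_time K f (length c) \<noteq> None \<and> (\<forall>k>length c. R_time K f k = None))) \<and>
      (\<forall>j<length c. f (A_time K f (Suc j)) = fst (c ! j) \<and> f (B_time K f (Suc j)) = snd (c ! j))}"
  proof (intro Collect_cong)
    fix f :: "nat \<Rightarrow> 'd site"
    show "f \<in> half_trajs \<and> ends K c f \<longleftrightarrow> f \<in> space half_space \<and>
      (((\<forall>k\<ge>1. R_time K f k = None) \<and> Max {} = length c) \<or>
      (1 \<le> length c \<and> R_time K f (length c) \<noteq> None \<and> (\<forall>k>length c. R_time K f k = None))) \<and>
      (\<forall>j<length c. f (A_time K f (Suc j)) = fst (c ! j) \<and> f (B_time K f (Suc j)) = snd (c ! j))"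
    proof (cases "f \<in> half_trajs")
      case True
      show ?thesis unfolding ends_def M_count_eq_iff[OF True] by (simp only: space_half_space True)
    qed (simp only: space_half_space simp_thms)
  qed
  also have "\<dots> \<in> sets half_space" by measurable
  finally show ?thesis .
qed

lemma exit_eq:
  assumes f: "f \<in> half_trajs" "f 0 \<in> K"
  shows "exit_time K f = Some (Suc (B_time K f 1))"
  unfolding exit_time_def first_eq_Some_iff using first_in_exc(2,3)[OF finK f] by auto

text \<open>The stopped path is a list and takes countably many values, so the event is a countable
  union over exit times and paths.\<close>

lemma exit_sets:
  "{f \<in> half_trajs. R (the (exit_time K f)) (map f [0..<the (exit_time K f)])} \<in> sets half_space" if "countable {(n, \<tau>). R n \<tau>}"
proof -
  have ex: "\<exists>n. exit_time K f = Some n" if "f \<in> half_trajs" for f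
  proof -
    obtain N where "\<And>n. n \<ge> N \<Longrightarrow> f n \<notin> K" using finite_eventually_outside[OF finK \<open>f \<in> half_trajs\<close>] by blast
    then show ?thesis using first_eq_None_iff[of "\<lambda>n. f n \<notin> K"] unfolding exit_time_def by blast
  qed
  have "{f \<in> half_trajs. R (the (exit_time K f)) (map f [0..<the (exit_time K f)])} =
      {f \<in> space half_space. \<exists>n. exit_time K f = Some n \<and> (\<exists>\<tau>. (length \<tau> = n \<and> R n \<tau>) \<and> (\<forall>k<n. f k = \<tau> ! k))}"
  proof (intro equalityI subsetI)
    fix f assume f: "f \<in> {f \<in> half_trajs. R (the (exit_time K f)) (map f [0..<the (exit_time K f)])}"
    then obtain n where n: "exit_time K f = Some n" using ex by blast
    then have "R n (map f [0..<n])" using f by simp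
    then show "f \<in> {f \<in> space half_space. \<exists>n. exit_time K f = Some n \<and> (\<exists>\<tau>. (length \<tau> = n \<and> R n \<tau>) \<and> (\<forall>k<n. f k = \<tau> ! k))}"
      using f n by (intro CollectI conjI exI[of _ n] exI[of _ "map f [0..<n]"]) auto
  next
    fix f assume "f \<in> {f \<in> space half_space. \<exists>n. exit_time K f = Some n \<and> (\<exists>\<tau>. (length \<tau> = n \<and> R n \<tau>) \<and> (\<forall>k<n. f k = \<tau> ! k))}"
    then obtain n \<tau> where *: "f \<in> half_trajs" "exit_time K f = Some n" "length \<tau> = n" "R n \<tau>" "\<forall>k<n. f k = \<tau> ! k" by auto
    then have "map f [0..<n] = \<tau>" using map_upt_eq_iff[of f \<tau>] by simp
    then show "f \<in> {f \<in> half_trajs. R (the (exit_time K f)) (map f [0..<the (exit_time K f)])}" using * by simp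
  qed
  also have "\<dots> \<in> sets half_space" by measurable
  finally show ?thesis .
qed

lemma return_sets:
  "{f \<in> half_trajs. return_time K f \<noteq> None \<and> R (map f [0..<Suc (the (return_time K f))])} \<in> sets half_space"
proof -
  have "{f \<in> half_trajs. return_time K f \<noteq> None \<and> R (map f [0..<Suc (the (return_time K f))])} =
      {f \<in> space half_space. \<exists>n. return_time K f = Some n \<and> (\<exists>\<tau>. (length \<tau> = Suc n \<and> R \<tau>) \<and> (\<forall>k<Suc n. f k = \<tau> ! k))}"
  proof (intro equalityI subsetI)
    fix f assume f: "f \<in> {f \<in> half_trajs. return_time K f \<noteq> None \<and> R (map f [0..<Suc (the (return_time K f))])}"
    then obtain n where n: "return_time K f = Some n" by blast
    then have "R (map f [0..<Suc n])" using f by simp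
    then show "f \<in> {f \<in> space half_space. \<exists>n. return_time K f = Some n \<and> (\<exists>\<tau>. (length \<tau> = Suc n \<and> R \<tau>) \<and> (\<forall>k<Suc n. f k = \<tau> ! k))}"
      using f n by (intro CollectI conjI exI[of _ n] exI[of _ "map f [0..<Suc n]"]) (auto simp del: upt_Suc)
  next
    fix f assume "f \<in> {f \<in> space half_space. \<exists>n. return_time K f = Some n \<and> (\<exists>\<tau>. (length \<tau> = Suc n \<and> R \<tau>) \<and> (\<forall>k<Suc n. f k = \<tau> ! k))}"
    then obtain n \<tau> where *: "f \<in> half_trajs" "return_time K f = Some n" "length \<tau> = Suc n" "R \<tau>" "\<forall>k<Suc n. f k = \<tau> ! k" by auto
    then have "map f [0..<Suc n] = \<tau>" using map_upt_eq_iff[of f \<tau>] by simp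
    then show "f \<in> {f \<in> half_trajs. return_time K f \<noteq> None \<and> R (map f [0..<Suc (the (return_time K f))])}" using * by simp
  qed
  also have "\<dots> \<in> sets half_space" by measurable
  finally show ?thesis .
qed

lemma step_out_sets: "{f \<in> half_trajs. f 1 \<notin> K} \<in> sets half_space"
  using measurable_sets_Collect[OF half_coord_measurable, of "\<lambda>v. v \<notin> K" 1] by simp

text \<open>Stopping at the exit means an inner path followed by a step off \<open>K\<close>; the
  probability of that step from \<open>y\<close> is a factor independent of \<open>F\<close>, which
  will cancel in quotients.\<close>

lemma exit_measure:
  assumes x: "x \<in> K" and F: "F \<subseteq> in_paths K x y"
    and A: "A \<in> sets half_space"
    and iff: "\<And>f. f \<in> half_trajs \<Longrightarrow> f 0 = x \<Longrightarrow> f \<in> A \<longleftrightarrow> map f [0..<the (exit_time K f)] \<in> F"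
  shows "measure (srw x) A = enn2real (weight F) * measure (srw y) {f \<in> half_trajs. f 1 \<notin> K}"
proof -
  let ?S = "{f \<in> half_trajs. f 1 \<notin> K}"
  have "measure (srw x) A = measure (srw x) (Phi F ?S)"
  proof (rule measure_srw_agree[OF A Phi_sets[OF step_out_sets]])
    fix f assume f: "f \<in> half_trajs" "f 0 = x"
    have f0: "f 0 \<in> K" using f x by simp
    have "f \<in> Phi F ?S \<longleftrightarrow> f \<in> half_trajs \<and> f 0 \<in> K \<and> in_exc K f 1 \<in> F \<and> tshift (B_time K f 1) f \<in> ?S"
      using F in_pathsD(1) by (intro Phi_in_iff[OF finK]) blast+
    moreover have "tshift (B_time K f 1) f \<in> ?S"
      using first_in_exc(3)[OF finK f(1) f0] tshift_half_trajs[OF f(1)] by (simp add: tshift_apply)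
    moreover have "in_exc K f 1 = map f [0..<the (exit_time K f)]"
      using first_in_exc(4)[OF finK f(1) f0] exit_eq[OF f(1) f0] by simp
    ultimately show "f \<in> A \<longleftrightarrow> f \<in> Phi F ?S" using iff[OF f] f(1) f0 by simp
  qed
  also have "\<dots> = enn2real (weight F) * measure (srw y) ?S"
    unfolding measure_def using srw_Phi_in[OF F step_out_sets] by (simp add: enn2real_mult)
  finally show ?thesis .
qed

lemma exit_path_measure:
  assumes \<tau>: "\<tau> \<in> in_paths K x y"
  shows "measure (srw x) {f \<in> half_trajs. map f [0..<the (exit_time K f)] = \<tau>} =
    enn2real (weight {\<tau>}) * measure (srw y) {f \<in> half_trajs. f 1 \<notin> K}"
proof (rule exit_measure)
  show "x \<in> K" using \<tau> by (auto simp: in_paths_def path_inside_def)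
  show "{f \<in> half_trajs. map f [0..<the (exit_time K f)] = \<tau>} \<in> sets half_space"
    using exit_sets[of "\<lambda>_ \<tau>'. \<tau>' = \<tau>"] by simp
qed (use \<tau> in auto)

text \<open>The site before the exit is \<open>y\<close> exactly when the stopped path belongs to
  \<open>in_paths K x y\<close>, so the normalising constant is the weight of all these
  paths.\<close>

lemma exit_point_measure:
  assumes x: "x \<in> K"
  shows "measure (srw x) {f \<in> half_trajs. f (the (exit_time K f) - 1) = y} =
    enn2real (weight (in_paths K x y)) * measure (srw y) {f \<in> half_trajs. f 1 \<notin> K}"
proof -
  let ?A = "{f \<in> half_trajs. f (the (exit_time K f) - 1) = y}" and ?B = "{f \<in> half_trajs. map f [0..<the (exit_time K f)] \<in> in_paths K x y}"
  have B: "?B \<in> sets half_space" using exit_sets[of "\<lambda>_ \<tau>. \<tau> \<in> in_paths K x y"] by simp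
  have A: "?A \<in> sets half_space"
  proof -
    have ex: "exit_time K f \<noteq> None" if f: "f \<in> half_trajs" for f
    proof -
      obtain N where "\<And>n. n \<ge> N \<Longrightarrow> f n \<notin> K" using finite_eventually_outside[OF finK f] by blast
      then show ?thesis using first_eq_None_iff[of "\<lambda>n. f n \<notin> K"] unfolding exit_time_def by blast
    qed
    have "?A = {f \<in> space half_space. \<exists>n. exit_time K f = Some n \<and> f (n - 1) = y}" using ex by fastforce
    also have "\<dots> \<in> sets half_space" by measurable
    finally show ?thesis .
  qed
  have "f \<in> ?A \<longleftrightarrow> map f [0..<the (exit_time K f)] \<in> in_paths K x y" if f: "f \<in> half_trajs" "f 0 = x" for f
  proof -
    have f0: "f 0 \<in> K" using f x by simp
    have "in_exc K f 1 \<in> in_paths K (f (A_time K f 1)) (f (B_time K f 1))"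
      using M_count_ge1(1)[OF finK f(1) f0] by (intro in_exc_path[OF finK f(1) f0]) auto
    then have P: "map f [0..<Suc (B_time K f 1)] \<in> in_paths K x (f (B_time K f 1))"
      using first_in_exc(1,4)[OF finK f(1) f0] f(2) by simp
    have "f (B_time K f 1) = y \<longleftrightarrow> map f [0..<Suc (B_time K f 1)] \<in> in_paths K x y"
      using in_paths_unique[OF P] P by blast
    then show ?thesis unfolding mem_Collect_eq exit_eq[OF f(1) f0] option.sel diff_Suc_1 using f(1) by (simp only: simp_thms)
  qed
  then show ?thesis using A by (intro exit_measure[OF x]) auto
qed

text \<open>After the return nothing is required of the walk, so the continuation contributes the
  escape mass, which is 1 in the non-degenerate case.\<close>

lemma return_measure:
  assumes x: "x \<in> K" and H: "H \<subseteq> out_paths K y x"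
    and A: "A \<in> sets half_space"
    and iff: "\<And>f. f \<in> half_trajs \<Longrightarrow> f 0 = y \<Longrightarrow> f \<in> A \<longleftrightarrow>
      f 1 \<notin> K \<and> (\<exists>r. return_time K f = Some r \<and> map f [0..<Suc r] \<in> H)"
  shows "measure (srw y) A = enn2real (weight H) * measure (srw x) half_trajs"
proof -
  have "measure (srw y) A = measure (srw y) (Phi H half_trajs)"
  proof (rule measure_srw_agree[OF A Phi_sets[OF half_trajs_in_half_space]])
    fix f assume f: "f \<in> half_trajs" "f 0 = y"
    have "f \<in> Phi H half_trajs \<longleftrightarrow> f \<in> half_trajs \<and> f 1 \<notin> K \<and>
        (\<exists>r. return_time K f = Some r \<and> map f [0..<Suc r] \<in> H \<and> tshift r f \<in> half_trajs)"
      using H out_pathsD[OF _ x] by (intro Phi_out_iff[OF finK]) blast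
    then show "f \<in> A \<longleftrightarrow> f \<in> Phi H half_trajs" using iff[OF f] f(1) tshift_half_trajs[OF f(1)] by simp
  qed
  also have "\<dots> = enn2real (weight H) * measure (srw x) half_trajs"
    unfolding measure_def using srw_Phi_out[OF H x half_trajs_in_half_space] by (simp add: enn2real_mult)
  finally show ?thesis .
qed

lemma first_return_out_path:
  assumes f: "f \<in> half_trajs" and r: "return_time K f = Some r" and out: "f 1 \<notin> K"
  shows "map f [0..<Suc r] \<in> out_paths K (f 0) (f r)"
proof -
  have r': "1 \<le> r" "f r \<in> K" "\<forall>k. 1 \<le> k \<and> k < r \<longrightarrow> f k \<notin> K" using r return_time_eq_Some_iff by blast+
  have "r \<noteq> 1" using out r'(2) by blast
  then have r2: "2 \<le> r" using r'(1) by simp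
  have nth: "map f [0..<Suc r] ! t = f t" if "t < Suc r" for t using that by (simp del: upt_Suc)
  show ?thesis unfolding out_paths_def path_outside_def mem_Collect_eq
  proof (intro conjI allI impI)
    show "successively adj (map f [0..<Suc r])" by (rule successively_map_upt[OF f])
    show "hd (map f [0..<Suc r]) = f 0" by (simp add: hd_map del: upt_Suc)
    show "last (map f [0..<Suc r]) = f r" by (simp add: last_map)
    show "3 \<le> length (map f [0..<Suc r])" using r2 by simp
    fix t assume "0 < t \<and> t < length (map f [0..<Suc r]) - 1"
    then have "1 \<le> t" "t < r" by auto
    then show "map f [0..<Suc r] ! t \<notin> K" using nth[of t] r'(3) by simp
  qed simp
qed

lemma out_paths_last: "\<tau> \<in> out_paths K y x \<Longrightarrow> last \<tau> = x"
  by (auto simp: out_paths_def path_outside_def)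

lemma return_path_sets:
  "{f \<in> half_trajs. return_time K f \<noteq> None \<and> f 1 \<notin> K \<and> map f [0..<Suc (the (return_time K f))] = \<tau>} \<in> sets half_space"
proof -
  have "{f \<in> half_trajs. return_time K f \<noteq> None \<and> f 1 \<notin> K \<and> map f [0..<Suc (the (return_time K f))] = \<tau>} =
    {f \<in> half_trajs. return_time K f \<noteq> None \<and> map f [0..<Suc (the (return_time K f))] = \<tau>} \<inter> {f \<in> half_trajs. f 1 \<notin> K}" by blast
  then show ?thesis using sets.Int[OF return_sets[of "\<lambda>\<sigma>. \<sigma> = \<tau>"] step_out_sets] by (simp only:)
qed

lemma return_point_sets:
  "{f \<in> half_trajs. return_time K f \<noteq> None \<and> f (the (return_time K f)) = x} \<in> sets half_space"
proof -
  have "last (map f [0..<Suc r]) = f r" for f :: "nat \<Rightarrow> 'd site" and r by (simp add: last_map)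
  then show ?thesis using return_sets[of "\<lambda>\<sigma>. last \<sigma> = x"] by (simp only:)
qed

lemma return_point_out_sets:
  "{f \<in> half_trajs. return_time K f \<noteq> None \<and> f 1 \<notin> K \<and> f (the (return_time K f)) = x} \<in> sets half_space"
proof -
  have "{f \<in> half_trajs. return_time K f \<noteq> None \<and> f 1 \<notin> K \<and> f (the (return_time K f)) = x} =
    {f \<in> half_trajs. return_time K f \<noteq> None \<and> f (the (return_time K f)) = x} \<inter> {f \<in> half_trajs. f 1 \<notin> K}" by blast
  then show ?thesis using sets.Int[OF return_point_sets step_out_sets] by (simp only:)
qed

text \<open>The prescribed list may fail to be an outer path, for instance by being too short; then
  the intersection is empty and both sides are 0.\<close>

lemma return_path_measure:
  assumes x: "x \<in> K" and \<tau>: "last \<tau> = x"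
  shows "measure (srw y) {f \<in> half_trajs. return_time K f \<noteq> None \<and> f 1 \<notin> K \<and> map f [0..<Suc (the (return_time K f))] = \<tau>} =
    enn2real (weight ({\<tau>} \<inter> out_paths K y x)) * measure (srw x) half_trajs"
proof (rule return_measure[OF x _ return_path_sets])
  fix f :: "nat \<Rightarrow> 'd site" assume f: "f \<in> half_trajs" "f 0 = y"
  show "f \<in> {f \<in> half_trajs. return_time K f \<noteq> None \<and> f 1 \<notin> K \<and> map f [0..<Suc (the (return_time K f))] = \<tau>} \<longleftrightarrow>
      f 1 \<notin> K \<and> (\<exists>r. return_time K f = Some r \<and> map f [0..<Suc r] \<in> {\<tau>} \<inter> out_paths K y x)"
  proof (cases "return_time K f")
    case (Some r)
    have "map f [0..<Suc r] \<in> out_paths K y x" if "f 1 \<notin> K" "map f [0..<Suc r] = \<tau>"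
    proof -
      note P = first_return_out_path[OF f(1) Some that(1)]
      have "f r = x" using out_paths_last[OF P] \<tau> unfolding that(2) by simp
      then show ?thesis using P f(2) by (simp only:)
    qed
    then show ?thesis unfolding Some mem_Collect_eq option.sel using f(1) by blast
  qed simp
qed blast

lemma return_point_measure:
  assumes x: "x \<in> K"
  shows "measure (srw y) {f \<in> half_trajs. return_time K f \<noteq> None \<and> f 1 \<notin> K \<and> f (the (return_time K f)) = x} =
    enn2real (weight (out_paths K y x)) * measure (srw x) half_trajs"
proof (rule return_measure[OF x _ return_point_out_sets])
  fix f :: "nat \<Rightarrow> 'd site" assume f: "f \<in> half_trajs" "f 0 = y"
  show "f \<in> {f \<in> half_trajs. return_time K f \<noteq> None \<and> f 1 \<notin> K \<and> f (the (return_time K f)) = x} \<longleftrightarrow>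
      f 1 \<notin> K \<and> (\<exists>r. return_time K f = Some r \<and> map f [0..<Suc r] \<in> out_paths K y x)"
  proof (cases "return_time K f")
    case (Some r)
    have "f r = x \<longleftrightarrow> map f [0..<Suc r] \<in> out_paths K y x" if "f 1 \<notin> K"
    proof -
      note P = first_return_out_path[OF f(1) Some that, unfolded f(2)]
      show ?thesis using P out_paths_last[OF P] out_paths_last[of "map f [0..<Suc r]" y x] by metis
    qed
    then show ?thesis unfolding Some mem_Collect_eq option.sel using f(1) by blast
  qed simp
qed blast

text \<open>Being in \<open>K\<close> at time 1 would make 1 the return time, and the return would
  then be a step to a neighbour.\<close>

lemma return_not_adj:
  assumes "f \<in> half_trajs" "return_time K f = Some r" "\<not> adj (f 0) (f r)"
  shows "f 1 \<notin> K"
proof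
  assume "f 1 \<in> K"
  then have "\<not> 1 < r" "1 \<le> r" using assms(2) unfolding return_time_eq_Some_iff by blast+
  then have "r = Suc 0" by simp
  then show False using assms(1,3) by (simp add: half_trajs_def)
qed

lemma return_path_not_adj:
  assumes "\<not> adj y x" "last \<tau> = x"
  shows "measure (srw y) {f \<in> half_trajs. return_time K f \<noteq> None \<and> map f [0..<Suc (the (return_time K f))] = \<tau>} =
    measure (srw y) {f \<in> half_trajs. return_time K f \<noteq> None \<and> f 1 \<notin> K \<and> map f [0..<Suc (the (return_time K f))] = \<tau>}"
proof (rule measure_srw_agree[OF return_sets[of "\<lambda>\<sigma>. \<sigma> = \<tau>"] return_path_sets])
  fix f :: "nat \<Rightarrow> 'd site" assume f: "f \<in> half_trajs" "f 0 = y"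
  have "f 1 \<notin> K" if r: "return_time K f = Some r" "map f [0..<Suc r] = \<tau>" for r
  proof (rule return_not_adj[OF f(1) r(1)])
    have "last (map f [0..<Suc r]) = f r" by (simp add: last_map)
    then show "\<not> adj (f 0) (f r)" using assms f(2) unfolding r(2) by simp
  qed
  then show "f \<in> {f \<in> half_trajs. return_time K f \<noteq> None \<and> map f [0..<Suc (the (return_time K f))] = \<tau>} \<longleftrightarrow>
    f \<in> {f \<in> half_trajs. return_time K f \<noteq> None \<and> f 1 \<notin> K \<and> map f [0..<Suc (the (return_time K f))] = \<tau>}"
    unfolding mem_Collect_eq by (cases "return_time K f") (simp_all del: upt_Suc, blast)
qed

lemma return_point_not_adj:
  assumes "\<not> adj y x"
  shows "measure (srw y) {f \<in> half_trajs. return_time K f \<noteq> None \<and> f (the (return_time K f)) = x} =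
    measure (srw y) {f \<in> half_trajs. return_time K f \<noteq> None \<and> f 1 \<notin> K \<and> f (the (return_time K f)) = x}"
proof (rule measure_srw_agree[OF return_point_sets return_point_out_sets])
  fix f :: "nat \<Rightarrow> 'd site" assume f: "f \<in> half_trajs" "f 0 = y"
  have "f 1 \<notin> K" if r: "return_time K f = Some r" "f r = x" for r
    using assms f(2) r(2) by (intro return_not_adj[OF f(1) r(1)]) simp
  then show "f \<in> {f \<in> half_trajs. return_time K f \<noteq> None \<and> f (the (return_time K f)) = x} \<longleftrightarrow>
    f \<in> {f \<in> half_trajs. return_time K f \<noteq> None \<and> f 1 \<notin> K \<and> f (the (return_time K f)) = x}"
    unfolding mem_Collect_eq by (cases "return_time K f") (simp_all, blast)
qed

lemma srw_half_one: "escape_mass TYPE('d) = 1 \<Longrightarrow> measure (srw (x :: 'd site)) half_trajs = 1"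
  by (simp add: measure_def emeasure_srw_half_trajs)

text \<open>By the zero-one law the escape mass could otherwise only be 0, which would annihilate
  the equilibrium measure.\<close>

lemma escape_of_eq_measure:
  assumes "eq_measure K x \<noteq> 0"
  shows "escape_mass TYPE('d) = 1"
proof (rule ccontr)
  assume "escape_mass TYPE('d) \<noteq> 1"
  then have "escape_mass TYPE('d) = 0" using escape_mass_zero_one by blast
  then have "measure (srw x) half_trajs = 0" by (simp add: measure_def emeasure_srw_half_trajs)
  then show False using eq_measure_avoid_half[of K x] assms by simp
qed

lemma avoid_half_one: "eq_measure K x \<noteq> 0 \<Longrightarrow> srw_avoid K x half_trajs = 1"
  using eq_measure_avoid_half[of K x] srw_half_one[OF escape_of_eq_measure] by simp

text \<open>A site of the interior boundary has a neighbour off \<open>K\<close>, and after a step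
  there the walk still escapes. This makes the common factor of the exit quotients nonzero, so that
  it cancels.\<close>

lemma step_out_pos:
  assumes "escape_mass TYPE('d) = 1" "y \<in> int_boundary K"
  shows "measure (srw y) {f \<in> half_trajs. f 1 \<notin> K} > 0"
proof -
  obtain z where z: "adj y z" "z \<notin> K" using assms(2) by (auto simp: int_boundary_def)
  let ?T = "{f \<in> half_trajs. f 1 = z \<and> tshift 1 f \<in> half_trajs}"
  have "emeasure (srw y) ?T = step_weight TYPE('d)"
    using srw_step[OF z(1) half_trajs_in_half_space] assms(1) by (simp add: emeasure_srw_half_trajs)
  then have "measure (srw y) ?T = 1 / card (unit_steps :: 'd site set)"
    by (simp add: measure_def step_weight_def)
  moreover have "card (unit_steps :: 'd site set) > 0"
    using finite_unit_steps unit_steps_nonempty by (simp add: card_gt_0_iff)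
  moreover have "measure (srw y) ?T \<le> measure (srw y) {f \<in> half_trajs. f 1 \<notin> K}"
    using step_out_sets z(2) by (intro finite_measure.finite_measure_mono[OF finite_measure_srw]) (auto simp: sets_srw)
  ultimately show ?thesis by (smt (verit) divide_pos_pos of_nat_0_less_iff)
qed

end


section \<open>The probabilities of the excursion events\<close>

lemma all_Suc_iff: "(\<forall>j<m. R (Suc j)) \<longleftrightarrow> (\<forall>j\<in>{1..m}. R j)"
proof (intro iffI allI ballI impI)
  fix j assume "\<forall>j<m. R (Suc j)" "j \<in> {1..m}"
  then show "R j" by (cases j) auto
qed simp

lemma prod_Suc_eq: "(\<Prod>j<m. g (Suc j)) = (\<Prod>j=1..m. g j)"
  using prod.atLeast1_atMost_eq[of g m] by simp

text \<open>Excursions are numbered from 1 in the events and from 0 in lists.\<close>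

definition exc_points :: "nat \<Rightarrow> (nat \<Rightarrow> 'd site) \<Rightarrow> (nat \<Rightarrow> 'd site) \<Rightarrow> ('d site \<times> 'd site) list" where
  "exc_points m x y = map (\<lambda>j. (x (Suc j), y (Suc j))) [0..<m]"

lemma exc_points_simps [simp]:
  "length (exc_points m x y) = m" "j < m \<Longrightarrow> exc_points m x y ! j = (x (Suc j), y (Suc j))"
  by (simp_all add: exc_points_def)

lemma exc_points_ends:
  assumes "1 \<le> m"
  shows "exc_points m x y \<noteq> []" "hd (exc_points m x y) = (x 1, y 1)" "last (exc_points m x y) = (x m, y m)"
proof -
  show ne: "exc_points m x y \<noteq> []" using assms by (simp add: exc_points_def)
  show "hd (exc_points m x y) = (x 1, y 1)" using ne assms by (simp add: hd_conv_nth)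
  show "last (exc_points m x y) = (x m, y m)" using ne assms by (simp add: last_conv_nth)
qed

lemma exc_points_subset: "\<forall>j\<in>{1..m}. x j \<in> K \<and> y j \<in> K \<Longrightarrow> set (exc_points m x y) \<subseteq> K \<times> K"
  by (auto simp: exc_points_def)

lemma ends_exc_points: "ends K (exc_points m x y) w \<longleftrightarrow>
  M_count K w = m \<and> (\<forall>j\<in>{1..m}. w (A_time K w j) = x j \<and> w (B_time K w j) = y j)"
  unfolding ends_def all_Suc_iff[symmetric] by auto

context interlacement_process
begin

text \<open>One shape for all the events: the path sets \<open>UNIV\<close> and the end conditions
  \<open>half_trajs\<close> leave a component free, which yields the end-point, inner and outer
  events as special cases.\<close>

definition exc_set :: "nat \<Rightarrow> (nat \<Rightarrow> 'd site) \<Rightarrow> (nat \<Rightarrow> 'd site) \<Rightarrow> (nat \<Rightarrow> 'd site list set) \<Rightarrow>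
    (nat \<Rightarrow> 'd site list set) \<Rightarrow> (nat \<Rightarrow> 'd site) set \<Rightarrow> (nat \<Rightarrow> 'd site) set \<Rightarrow> (int \<Rightarrow> 'd site) set" where
  "exc_set m x y F H A B = paths_event (exc_points m x y) (\<lambda>j. F (Suc j)) (\<lambda>j. H (Suc j)) A B"

lemma exc_set_iff: "w \<in> exc_set m x y F H A B \<longleftrightarrow>
    (M_count K w = m \<and> (\<forall>j\<in>{1..m}. w (A_time K w j) = x j \<and> w (B_time K w j) = y j)) \<and>
    (\<forall>j\<in>{1..m}. X_in K w j \<in> F j) \<and> (\<forall>j\<in>{1..m - 1}. X_out K w j \<in> H j) \<and> X_minus w \<in> A \<and> X_plus K w \<in> B"
  unfolding exc_set_def paths_event_def mem_Collect_eq ends_exc_points exc_points_simps(1)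
    all_Suc_iff[of m "\<lambda>j. X_in K w j \<in> F j"] all_Suc_iff[of "m - 1" "\<lambda>j. X_out K w j \<in> H j"] ..

definition AB_set :: "nat \<Rightarrow> (nat \<Rightarrow> 'd site) \<Rightarrow> (nat \<Rightarrow> 'd site) \<Rightarrow> (int \<Rightarrow> 'd site) set" where
  "AB_set m x y = exc_set m x y (\<lambda>_. UNIV) (\<lambda>_. UNIV) half_trajs half_trajs"

definition I_prod :: "nat \<Rightarrow> (nat \<Rightarrow> 'd site) \<Rightarrow> (nat \<Rightarrow> 'd site) \<Rightarrow> real" where
  "I_prod m x y = (\<Prod>j=1..m. rweight (in_paths K (x j) (y j)))"

definition O_prod :: "nat \<Rightarrow> (nat \<Rightarrow> 'd site) \<Rightarrow> (nat \<Rightarrow> 'd site) \<Rightarrow> real" where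
  "O_prod m x y = (\<Prod>j=1..m - 1. rweight (out_paths K (y j) (x (j + 1))))"

context
  fixes m :: nat and x y :: "nat \<Rightarrow> 'd site"
  assumes m: "1 \<le> m" and xy: "\<forall>j\<in>{1..m}. x j \<in> K \<and> y j \<in> K"
begin

lemma exc_set_traj_set:
  assumes A: "A \<in> sets half_space" and B: "B \<in> sets half_space"
  shows "traj_set (exc_set m x y F H A B)"
proof -
  obtain Q where Q: "is_Q K Q" using ex_Q by blast
  let ?c = "exc_points m x y"
  let ?E = "exc_event K (map (in_restr ?c (\<lambda>j. F (Suc j))) [0..<length ?c]) (map (out_restr ?c (\<lambda>j. H (Suc j))) [0..<length ?c - 1]) A B"
  have "exc_set m x y F H A B \<inter> canon K = ?E \<inter> canon K"
    unfolding exc_set_def using paths_event_exc_event[OF _ exc_points_ends(1)[OF m]] by blast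
  then show ?thesis unfolding traj_set_def
    using Q_exc_event(2)[OF finK Q restr_compatible[OF exc_points_ends(1)[OF m] exc_points_subset[OF xy]] A B] by (simp only:)
qed

lemma restr_prods:
  "(\<Prod>j<m. rweight (in_restr (exc_points m x y) (\<lambda>j. F (Suc j)) j)) = (\<Prod>j=1..m. rweight (F j \<inter> in_paths K (x j) (y j)))"
  "(\<Prod>j<m - 1. rweight (out_restr (exc_points m x y) (\<lambda>j. H (Suc j)) j)) =
    (\<Prod>j=1..m - 1. rweight (H j \<inter> out_paths K (y j) (x (j + 1))))"
proof -
  show "(\<Prod>j<m. rweight (in_restr (exc_points m x y) (\<lambda>j. F (Suc j)) j)) = (\<Prod>j=1..m. rweight (F j \<inter> in_paths K (x j) (y j)))"
    unfolding prod_Suc_eq[symmetric] by (rule prod.cong) (simp_all add: in_restr_def)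
  show "(\<Prod>j<m - 1. rweight (out_restr (exc_points m x y) (\<lambda>j. H (Suc j)) j)) =
    (\<Prod>j=1..m - 1. rweight (H j \<inter> out_paths K (y j) (x (j + 1))))"
    unfolding prod_Suc_eq[symmetric] by (rule prod.cong) (simp_all add: out_restr_def)
qed

lemma kappa_exc_set:
  assumes A: "A \<in> sets half_space" and B: "B \<in> sets half_space"
  shows "kappa (exc_set m x y F H A B) = srw_avoid K (x 1) A * eq_measure K (x 1) *
    ((\<Prod>j=1..m. rweight (F j \<inter> in_paths K (x j) (y j))) * (\<Prod>j=1..m - 1. rweight (H j \<inter> out_paths K (y j) (x (j + 1)))) *
      (eq_measure K (y m) * srw_avoid K (y m) B))"
  using kappa_paths_event[where fs="\<lambda>j. F (Suc j)" and hs="\<lambda>j. H (Suc j)",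
      OF exc_points_ends(1)[OF m] exc_points_subset[OF xy] A B]
  unfolding exc_set_def exc_points_simps(1) restr_prods exc_points_ends(2,3)[OF m] fst_conv snd_conv .


lemma eq_avoid_half: "srw_avoid K z half_trajs * eq_measure K z = eq_measure K z"
  using avoid_half_one[OF finK, of z] by (cases "eq_measure K z = 0") simp_all

lemma eq_avoid_half': "eq_measure K z * srw_avoid K z half_trajs = eq_measure K z"
  using eq_avoid_half[of z] by (simp only: mult.commute)

lemma kappa_AB_set: "kappa (AB_set m x y) = eq_measure K (x 1) * (I_prod m x y * O_prod m x y * eq_measure K (y m))"
  unfolding AB_set_def kappa_exc_set[OF half_trajs_in_half_space half_trajs_in_half_space] Int_UNIV_left
    I_prod_def[symmetric] O_prod_def[symmetric] eq_avoid_half eq_avoid_half'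
  by (simp only: mult_ac)

lemma kappa_in:
  "kappa (exc_set m x y F (\<lambda>_. UNIV) half_trajs half_trajs) =
    eq_measure K (x 1) * ((\<Prod>j=1..m. rweight (F j \<inter> in_paths K (x j) (y j))) * O_prod m x y * eq_measure K (y m))"
  unfolding kappa_exc_set[OF half_trajs_in_half_space half_trajs_in_half_space] Int_UNIV_left
    O_prod_def[symmetric] eq_avoid_half eq_avoid_half'
  by (simp only: mult_ac)

text \<open>The inner and outer factors may be exchanged between two masses with the same end
  points; stated without division, the identity also covers vanishing masses.\<close>

lemma kappa_product:
  assumes A: "A \<in> sets half_space" and B: "B \<in> sets half_space"
  shows "kappa (exc_set m x y F H A B) * kappa (AB_set m x y) =
    kappa (exc_set m x y F (\<lambda>_. UNIV) half_trajs half_trajs) * kappa (exc_set m x y (\<lambda>_. UNIV) H A B)"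
  unfolding kappa_AB_set kappa_in kappa_exc_set[OF A B] Int_UNIV_left I_prod_def[symmetric] by (simp only: mult_ac)

text \<open>For the forward walk from the first site, prescribing all end points again gives the
  weights and a final escape; the equilibrium mass stands for the unrestricted past.\<close>

lemma srw_ends:
  "eq_measure K (x 1) * measure (srw (x 1)) {f \<in> half_trajs. M_count K f = m \<and>
    (\<forall>j\<in>{1..m}. f (A_time K f j) = x j \<and> f (B_time K f j) = y j)} = kappa (AB_set m x y)"
proof -
  let ?c = "exc_points m x y" and ?S = "\<lambda>_. UNIV :: 'd site list set"
  note ne = exc_points_ends[OF m, of x y] and sub = exc_points_subset[OF xy]
  note comp = compatible_all[OF ne(1) sub]
  have x1: "x 1 \<in> K" using bspec[OF xy, of 1] m by simp
  have in': "all_in K ?c = map (in_restr ?c ?S) [0..<length ?c]"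
    by (rule nth_equalityI) (simp_all add: in_restr_def)
  have out': "all_out K ?c = map (out_restr ?c ?S) [0..<length ?c - 1]"
    by (simp add: all_out_def out_restr_def)
  have "measure (srw (x 1)) {f \<in> half_trajs. ends K ?c f} = measure (srw (x 1)) (exc K (all_in K ?c) (all_out K ?c) half_trajs)"
  proof (rule measure_srw_agree[OF ends_sets[OF finK] exc_sets[OF half_trajs_in_half_space]])
    fix f :: "nat \<Rightarrow> 'd site" assume f: "f \<in> half_trajs" "f 0 = x 1"
    have f0: "f 0 \<in> K" using f x1 by simp
    have l: "last_exit K f \<in> half_trajs" unfolding last_exit_def by (rule tshift_half_trajs[OF f(1)])
    have "f \<in> exc K (all_in K ?c) (all_out K ?c) half_trajs \<longleftrightarrow> f \<in> half_trajs \<and> f 0 \<in> K \<and> M_count K f = length (all_in K ?c) \<and>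
        (\<forall>j<length (all_in K ?c). in_exc K f (Suc j) \<in> all_in K ?c ! j) \<and>
        (\<forall>j<length (all_out K ?c). out_exc K f (Suc j) \<in> all_out K ?c ! j) \<and> last_exit K f \<in> half_trajs"
      by (rule exc_iff[OF finK]) (use compatible_exc_conditions[OF comp] in blast)+
    then show "f \<in> {f \<in> half_trajs. ends K ?c f} \<longleftrightarrow> f \<in> exc K (all_in K ?c) (all_out K ?c) half_trajs"
      unfolding mem_Collect_eq ends_iff[OF finK f(1) f0] all_in_simps(1) by (simp only: f(1) f0 l simp_thms)
  qed
  moreover have "measure (srw (x 1)) (exc K (all_in K ?c) (all_out K ?c) half_trajs) = I_prod m x y * O_prod m x y * eq_measure K (y m)"
  proof -
    have ym: "y m \<in> K" using bspec[OF xy, of m] m by simp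
    have "half_trajs \<inter> no_return K = no_return K" by (auto simp: no_return_def)
    then have nr: "enn2real (emeasure (srw (y m)) (half_trajs \<inter> no_return K)) = eq_measure K (y m)"
      using eq_measure_eq[OF ym] by (simp add: measure_def)
    have "measure (srw (x 1)) (exc K (all_in K ?c) (all_out K ?c) half_trajs) =
        enn2real (prod_list (map weight (all_in K ?c))) * enn2real (prod_list (map weight (all_out K ?c))) * eq_measure K (y m)"
      using srw_exc[OF comp half_trajs_in_half_space] unfolding ne(2,3) fst_conv snd_conv measure_def
      by (simp only: enn2real_mult nr)
    also have "\<dots> = I_prod m x y * O_prod m x y * eq_measure K (y m)"
      unfolding in' out' rweight_prod_list
      unfolding exc_points_simps(1) restr_prods(1)[where F="?S"] restr_prods(2)[where H="?S"] Int_UNIV_left I_prod_def O_prod_def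
      by (rule refl)
    finally show ?thesis .
  qed
  ultimately show ?thesis unfolding kappa_AB_set ends_exc_points by (simp only: mult.assoc)
qed

lemma kappa_AB_set_nonzero:
  assumes "kappa (AB_set m x y) \<noteq> 0"
  shows "eq_measure K (x 1) \<noteq> 0" "I_prod m x y \<noteq> 0" "O_prod m x y \<noteq> 0" "eq_measure K (y m) \<noteq> 0"
  using assms unfolding kappa_AB_set by (metis mult_zero_left mult_zero_right)+

text \<open>In the quotient of masses only the inner weights survive. In each walk quotient the step
  off \<open>K\<close> cancels, its probability being positive at a boundary site.\<close>

lemma kappa_in_paths_ratio:
  assumes nz: "kappa (AB_set m x y) \<noteq> 0" and bd: "\<forall>j\<in>{1..m}. y j \<in> int_boundary K"
    and \<tau>: "\<forall>j\<in>{1..m}. \<tau> j \<in> in_paths K (x j) (y j)"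
  shows "kappa (exc_set m x y (\<lambda>j. {\<tau> j}) (\<lambda>_. UNIV) half_trajs half_trajs) / kappa (AB_set m x y) =
    (\<Prod>j=1..m. measure (srw (x j)) {f \<in> half_trajs. map f [0..<the (exit_time K f)] = \<tau> j} /
      measure (srw (x j)) {f \<in> half_trajs. f (the (exit_time K f) - 1) = y j})"
proof -
  note nz' = kappa_AB_set_nonzero[OF nz]
  note esc = escape_of_eq_measure[OF finK nz'(1)]
  have alg: "(a * (p * c * d)) / (a * (q * c * d)) = p / q" if "a \<noteq> 0" "c \<noteq> 0" "d \<noteq> 0" for a p c d q :: real
    using that by simp
  have "measure (srw (x j)) {f \<in> half_trajs. map f [0..<the (exit_time K f)] = \<tau> j} /
      measure (srw (x j)) {f \<in> half_trajs. f (the (exit_time K f) - 1) = y j} =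
      rweight ({\<tau> j} \<inter> in_paths K (x j) (y j)) / rweight (in_paths K (x j) (y j))" if j: "j \<in> {1..m}" for j
  proof -
    have q: "measure (srw (y j)) {f \<in> half_trajs. f 1 \<notin> K} \<noteq> 0" using step_out_pos[OF finK esc bspec[OF bd j]] by linarith
    have i: "{\<tau> j} \<inter> in_paths K (x j) (y j) = {\<tau> j}" using bspec[OF \<tau> j] by blast
    show ?thesis
      unfolding exit_path_measure[OF finK bspec[OF \<tau> j]] exit_point_measure[OF finK conjunct1[OF bspec[OF xy j]]] i rweight_def
      by (rule nonzero_mult_divide_mult_cancel_right[OF q])
  qed
  then have P: "(\<Prod>j=1..m. measure (srw (x j)) {f \<in> half_trajs. map f [0..<the (exit_time K f)] = \<tau> j} /
      measure (srw (x j)) {f \<in> half_trajs. f (the (exit_time K f) - 1) = y j}) =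
      (\<Prod>j=1..m. rweight ({\<tau> j} \<inter> in_paths K (x j) (y j)) / rweight (in_paths K (x j) (y j)))"
    by (rule prod.cong[OF refl])
  show ?thesis unfolding P unfolding prod_dividef kappa_AB_set kappa_in I_prod_def[symmetric] by (rule alg[OF nz'(1,3,4)])
qed

text \<open>Past and future leave their conditional probabilities, and the outer weights are return
  probabilities because the escape mass is 1.\<close>

lemma kappa_out_paths_ratio:
  assumes nz: "kappa (AB_set m x y) \<noteq> 0" and A: "A \<in> sets half_space" and B: "B \<in> sets half_space"
    and \<tau>: "\<forall>j\<in>{1..m - 1}. last (\<tau> j) = x (j + 1)"
  shows "kappa (exc_set m x y (\<lambda>_. UNIV) (\<lambda>j. {\<tau> j}) A B) / kappa (AB_set m x y) =
    srw_avoid K (x 1) A * srw_avoid K (y m) B * (\<Prod>j=1..m - 1. measure (srw (y j)) {f \<in> half_trajs. return_time K f \<noteq> None \<and> f 1 \<notin> K \<and> map f [0..<Suc (the (return_time K f))] = \<tau> j} /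
      measure (srw (y j)) {f \<in> half_trajs. return_time K f \<noteq> None \<and> f 1 \<notin> K \<and> f (the (return_time K f)) = x (j + 1)})"
proof -
  note nz' = kappa_AB_set_nonzero[OF nz]
  note esc = escape_of_eq_measure[OF finK nz'(1)]
  have alg: "(v * a * (i * p * (d * w))) / (a * (i * q * d)) = v * w * (p / q)" if "a \<noteq> 0" "i \<noteq> 0" "q \<noteq> 0" "d \<noteq> 0"
    for v a i p d w q :: real
    using that by (simp add: field_simps)
  have "measure (srw (y j)) {f \<in> half_trajs. return_time K f \<noteq> None \<and> f 1 \<notin> K \<and> map f [0..<Suc (the (return_time K f))] = \<tau> j} /
      measure (srw (y j)) {f \<in> half_trajs. return_time K f \<noteq> None \<and> f 1 \<notin> K \<and> f (the (return_time K f)) = x (j + 1)} =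
      rweight ({\<tau> j} \<inter> out_paths K (y j) (x (j + 1))) / rweight (out_paths K (y j) (x (j + 1)))" if j: "j \<in> {1..m - 1}" for j
  proof -
    have "j + 1 \<in> {1..m}" using j by auto
    then have x: "x (j + 1) \<in> K" using xy by blast
    show ?thesis
      unfolding return_path_measure[OF finK x bspec[OF \<tau> j]] return_point_measure[OF finK x] srw_half_one[OF finK esc] rweight_def mult_1_right
      by (rule refl)
  qed
  then have P: "(\<Prod>j=1..m - 1. measure (srw (y j)) {f \<in> half_trajs. return_time K f \<noteq> None \<and> f 1 \<notin> K \<and> map f [0..<Suc (the (return_time K f))] = \<tau> j} /
      measure (srw (y j)) {f \<in> half_trajs. return_time K f \<noteq> None \<and> f 1 \<notin> K \<and> f (the (return_time K f)) = x (j + 1)}) =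
      (\<Prod>j=1..m - 1. rweight ({\<tau> j} \<inter> out_paths K (y j) (x (j + 1))) / rweight (out_paths K (y j) (x (j + 1))))"
    by (rule prod.cong[OF refl])
  show ?thesis unfolding P unfolding prod_dividef kappa_AB_set kappa_exc_set[OF A B] Int_UNIV_left I_prod_def[symmetric] O_prod_def[symmetric]
    by (rule alg[OF nz'])
qed

end

text \<open>Between sites that are not adjacent a return cannot happen at time 1, so the restriction
  on the first step may be dropped in numerator and denominator.\<close>

lemma out_ratio_not_adj:
  assumes "\<forall>j\<in>{1..m - 1}. \<not> adj (y j) (x (j + 1))" "\<forall>j\<in>{1..m - 1}. last (\<tau> j) = x (j + 1)"
  shows "(\<Prod>j=1..m - 1. measure (srw (y j)) {f \<in> half_trajs. return_time K f \<noteq> None \<and> map f [0..<Suc (the (return_time K f))] = \<tau> j} /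
      measure (srw (y j)) {f \<in> half_trajs. return_time K f \<noteq> None \<and> f (the (return_time K f)) = x (j + 1)}) =
    (\<Prod>j=1..m - (1::nat). measure (srw (y j)) {f \<in> half_trajs. return_time K f \<noteq> None \<and> f 1 \<notin> K \<and> map f [0..<Suc (the (return_time K f))] = \<tau> j} /
      measure (srw (y j)) {f \<in> half_trajs. return_time K f \<noteq> None \<and> f 1 \<notin> K \<and> f (the (return_time K f)) = x (j + 1)})"
proof (rule prod.cong[OF refl])
  fix j assume j: "j \<in> {1..m - 1}"
  show "measure (srw (y j)) {f \<in> half_trajs. return_time K f \<noteq> None \<and> map f [0..<Suc (the (return_time K f))] = \<tau> j} /
      measure (srw (y j)) {f \<in> half_trajs. return_time K f \<noteq> None \<and> f (the (return_time K f)) = x (j + 1)} =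
    measure (srw (y j)) {f \<in> half_trajs. return_time K f \<noteq> None \<and> f 1 \<notin> K \<and> map f [0..<Suc (the (return_time K f))] = \<tau> j} /
      measure (srw (y j)) {f \<in> half_trajs. return_time K f \<noteq> None \<and> f 1 \<notin> K \<and> f (the (return_time K f)) = x (j + 1)}"
    unfolding return_path_not_adj[OF finK bspec[OF assms(1) j] bspec[OF assms(2) j]] return_point_not_adj[OF finK bspec[OF assms(1) j]]
    by (rule refl)
qed

text \<open>Lets the comparison of conditions assume that the index is within the count, where the
  listed trajectory is canonical.\<close>

lemma event_eq:
  assumes "\<And>\<xi> i. \<xi> \<in> space P \<Longrightarrow> N_count K u (\<omega> \<xi>) = n \<Longrightarrow> i \<in> {1..n} \<Longrightarrow>
    R \<xi> i \<longleftrightarrow> label K u (\<omega> \<xi>) i \<in> U i \<and> X_traj K u (\<omega> \<xi>) i \<in> G i"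
  shows "{\<xi> \<in> space P. N_count K u (\<omega> \<xi>) = n \<and> (\<forall>i\<in>{1..n}. R \<xi> i)} = traj_event n U G"
proof (intro set_eqI)
  fix \<xi>
  have "(\<forall>i\<in>{1..n}. R \<xi> i) \<longleftrightarrow> (\<forall>i\<in>{1..n}. label K u (\<omega> \<xi>) i \<in> U i \<and> X_traj K u (\<omega> \<xi>) i \<in> G i)"
    if "\<xi> \<in> space P" "N_count K u (\<omega> \<xi>) = n" by (rule ball_cong[OF refl assms[OF that]])
  then show "\<xi> \<in> {\<xi> \<in> space P. N_count K u (\<omega> \<xi>) = n \<and> (\<forall>i\<in>{1..n}. R \<xi> i)} \<longleftrightarrow> \<xi> \<in> traj_event n U G"
    unfolding traj_event_def mem_Collect_eq
    by (cases "\<xi> \<in> space P"; cases "N_count K u (\<omega> \<xi>) = n") (simp_all only: simp_thms)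
qed

lemma traj_halves:
  assumes "\<xi> \<in> space P" "N_count K u (\<omega> \<xi>) = n" "i \<in> {1..n}"
  shows "X_minus (X_traj K u (\<omega> \<xi>) i) \<in> half_trajs" "X_plus K (X_traj K u (\<omega> \<xi>) i) \<in> half_trajs"
proof -
  have "X_traj K u (\<omega> \<xi>) i \<in> canon K" using assms by (intro enumeration_hit(3)) auto
  then show "X_minus (X_traj K u (\<omega> \<xi>) i) \<in> half_trajs" "X_plus K (X_traj K u (\<omega> \<xi>) i) \<in> half_trajs"
    using halves by blast+
qed

lemma E_AB_eq: "E_AB P \<omega> K u n m U x y = traj_event n U (\<lambda>i. AB_set (m i) (x i) (y i))"
  unfolding E_AB_def Let_def
  by (rule event_eq, unfold AB_set_def exc_set_iff, simp only: traj_halves UNIV_I simp_thms ball_triv, blast?)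

lemma E_in_eq: "E_in P \<omega> K u n m U x y \<tau> =
  traj_event n U (\<lambda>i. exc_set (m i) (x i) (y i) (\<lambda>j. {\<tau> i j}) (\<lambda>_. UNIV) half_trajs half_trajs)"
proof -
  have "E_in P \<omega> K u n m U x y \<tau> = {\<xi> \<in> space P. N_count K u (\<omega> \<xi>) = n \<and> (\<forall>i\<in>{1..n}.
      (label K u (\<omega> \<xi>) i \<in> U i \<and> M_count K (X_traj K u (\<omega> \<xi>) i) = m i \<and>
      (\<forall>j\<in>{1..m i}. X_traj K u (\<omega> \<xi>) i (A_time K (X_traj K u (\<omega> \<xi>) i) j) = x i j \<and>
        X_traj K u (\<omega> \<xi>) i (B_time K (X_traj K u (\<omega> \<xi>) i) j) = y i j)) \<and>
      (\<forall>j\<in>{1..m i}. X_in K (X_traj K u (\<omega> \<xi>) i) j = \<tau> i j))}"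
    unfolding E_in_def E_AB_def Let_def by blast
  also have "\<dots> = traj_event n U (\<lambda>i. exc_set (m i) (x i) (y i) (\<lambda>j. {\<tau> i j}) (\<lambda>_. UNIV) half_trajs half_trajs)"
    by (rule event_eq, unfold exc_set_iff singleton_iff, simp only: traj_halves UNIV_I simp_thms ball_triv, blast?)
  finally show ?thesis .
qed

lemma E_out_eq: "E_out P \<omega> K u n m U x y \<tau> A B =
  traj_event n U (\<lambda>i. exc_set (m i) (x i) (y i) (\<lambda>_. UNIV) (\<lambda>j. {\<tau> i j}) (A i) (B i))"
proof -
  have "E_out P \<omega> K u n m U x y \<tau> A B = {\<xi> \<in> space P. N_count K u (\<omega> \<xi>) = n \<and> (\<forall>i\<in>{1..n}.
      (label K u (\<omega> \<xi>) i \<in> U i \<and> M_count K (X_traj K u (\<omega> \<xi>) i) = m i \<and>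
      (\<forall>j\<in>{1..m i}. X_traj K u (\<omega> \<xi>) i (A_time K (X_traj K u (\<omega> \<xi>) i) j) = x i j \<and>
        X_traj K u (\<omega> \<xi>) i (B_time K (X_traj K u (\<omega> \<xi>) i) j) = y i j)) \<and>
      ((\<forall>j\<in>{1..m i - 1}. X_out K (X_traj K u (\<omega> \<xi>) i) j = \<tau> i j) \<and>
        X_minus (X_traj K u (\<omega> \<xi>) i) \<in> A i \<and> X_plus K (X_traj K u (\<omega> \<xi>) i) \<in> B i))}"
    unfolding E_out_def E_AB_def Let_def by blast
  also have "\<dots> = traj_event n U (\<lambda>i. exc_set (m i) (x i) (y i) (\<lambda>_. UNIV) (\<lambda>j. {\<tau> i j}) (A i) (B i))"
    by (rule event_eq, unfold exc_set_iff singleton_iff, simp only: UNIV_I simp_thms ball_triv, blast?)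
  finally show ?thesis .
qed

lemma E_in_out_eq: "E_in P \<omega> K u n m U x y \<tau> \<inter> E_out P \<omega> K u n m U x y \<tau>' A B =
  traj_event n U (\<lambda>i. exc_set (m i) (x i) (y i) (\<lambda>j. {\<tau> i j}) (\<lambda>j. {\<tau>' i j}) (A i) (B i))"
proof -
  have "E_in P \<omega> K u n m U x y \<tau> \<inter> E_out P \<omega> K u n m U x y \<tau>' A B =
      {\<xi> \<in> space P. N_count K u (\<omega> \<xi>) = n \<and> (\<forall>i\<in>{1..n}.
      (label K u (\<omega> \<xi>) i \<in> U i \<and> X_traj K u (\<omega> \<xi>) i \<in> exc_set (m i) (x i) (y i) (\<lambda>j. {\<tau> i j}) (\<lambda>_. UNIV) half_trajs half_trajs) \<and>
      (label K u (\<omega> \<xi>) i \<in> U i \<and> X_traj K u (\<omega> \<xi>) i \<in> exc_set (m i) (x i) (y i) (\<lambda>_. UNIV) (\<lambda>j. {\<tau>' i j}) (A i) (B i)))}"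
    unfolding E_in_eq E_out_eq traj_event_def by blast
  also have "\<dots> = traj_event n U (\<lambda>i. exc_set (m i) (x i) (y i) (\<lambda>j. {\<tau> i j}) (\<lambda>j. {\<tau>' i j}) (A i) (B i))"
    by (rule event_eq, unfold exc_set_iff singleton_iff, simp only: traj_halves UNIV_I simp_thms ball_triv, blast?)
  finally show ?thesis .
qed

lemma prob_traj_event_0:
  assumes n: "n \<ge> 1" and U: "\<forall>i\<in>{1..n}. U i \<in> sets borel \<and> U i \<subseteq> {0..u}" and G: "\<forall>i\<in>{1..n}. traj_set (G i)"
  shows "prob (traj_event n U G) =
    prob {\<xi> \<in> space P. N_count K u (\<omega> \<xi>) = n} * order_stat_prob n u U * (\<Prod>i=1..n. kappa (G i) / cap K)"
proof -
  have o0: "outer_family 0 (\<lambda>_. {}) (\<lambda>_. {})" by (simp add: outer_family_def)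
  have "prob (traj_event n U G \<inter> outer_event 0 (\<lambda>_. {}) (\<lambda>_. {})) = prob (outer_event 0 (\<lambda>_. {}) (\<lambda>_. {})) *
      prob {\<xi> \<in> space P. N_count K u (\<omega> \<xi>) = n} * order_stat_prob n u (\<lambda>i. U i \<inter> {0..u}) * (\<Prod>i=1..n. kappa (G i) / cap K)"
    by (rule prob_traj_event[OF n _ _ o0]) (use U G in blast)+
  moreover have "traj_event n U G \<inter> space P = traj_event n U G" unfolding traj_event_def by blast
  moreover have "order_stat_prob n u (\<lambda>i. U i \<inter> {0..u}) = order_stat_prob n u U"
    using U by (intro order_stat_prob_cong) blast
  ultimately show ?thesis unfolding outer_event_0 prob_space by (simp only: mult_1)
qed

lemma cond_prob_subset:
  assumes "E \<subseteq> F" "F \<subseteq> space P"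
  shows "\<P>(\<xi> in P. \<xi> \<in> E \<bar> \<xi> \<in> F) = prob E / prob F"
proof -
  have "{\<xi> \<in> space P. \<xi> \<in> E \<and> \<xi> \<in> F} = E" "{\<xi> \<in> space P. \<xi> \<in> F} = F" using assms by blast+
  then show ?thesis unfolding cond_prob_def by (simp only:)
qed

section \<open>The probabilities for one choice of labels, end points and paths\<close>

context
  fixes n :: nat and m :: "nat \<Rightarrow> nat" and U :: "nat \<Rightarrow> real set" and A B :: "nat \<Rightarrow> (nat \<Rightarrow> 'd site) set"
    and x y :: "nat \<Rightarrow> nat \<Rightarrow> 'd site" and \<tau> \<tau>' :: "nat \<Rightarrow> nat \<Rightarrow> 'd site list"
  assumes n: "n \<ge> 1" and U: "\<forall>i\<in>{1..n}. U i \<in> sets borel \<and> U i \<subseteq> {0..u}"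
    and AB: "\<forall>i\<in>{1..n}. A i \<in> sets half_space \<and> B i \<in> sets half_space"
    and m: "\<forall>i\<in>{1..n}. 1 \<le> m i"
    and xy: "\<forall>i\<in>{1..n}. \<forall>j\<in>{1..m i}. x i j \<in> int_boundary K \<and> y i j \<in> int_boundary K"
    and \<tau>: "\<forall>i\<in>{1..n}. \<forall>j\<in>{1..m i}. path_inside K (x i j) (y i j) (\<tau> i j)"
    and \<tau>': "\<forall>i\<in>{1..n}. \<forall>j\<in>{1..m i - 1}. path_outside K (y i j) (x i (j + 1)) (\<tau>' i j)"
begin

abbreviation "EAB \<equiv> E_AB P \<omega> K u n m U x y"
abbreviation "Ein \<equiv> E_in P \<omega> K u n m U x y \<tau>"
abbreviation "Eout \<equiv> E_out P \<omega> K u n m U x y \<tau>' A B"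
abbreviation "kAB i \<equiv> kappa (AB_set (m i) (x i) (y i))"
abbreviation "kin i \<equiv> kappa (exc_set (m i) (x i) (y i) (\<lambda>j. {\<tau> i j}) (\<lambda>_. UNIV) half_trajs half_trajs)"
abbreviation "kout i \<equiv> kappa (exc_set (m i) (x i) (y i) (\<lambda>_. UNIV) (\<lambda>j. {\<tau>' i j}) (A i) (B i))"
abbreviation "kio i \<equiv> kappa (exc_set (m i) (x i) (y i) (\<lambda>j. {\<tau> i j}) (\<lambda>j. {\<tau>' i j}) (A i) (B i))"
abbreviation "const \<equiv> prob {\<xi> \<in> space P. N_count K u (\<omega> \<xi>) = n} * order_stat_prob n u U"

lemma in_K: "i \<in> {1..n} \<Longrightarrow> \<forall>j\<in>{1..m i}. x i j \<in> K \<and> y i j \<in> K"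
  using xy unfolding int_boundary_def by blast

lemma bnd: "i \<in> {1..n} \<Longrightarrow> \<forall>j\<in>{1..m i}. y i j \<in> int_boundary K"
  using xy by blast

lemma in_path: "i \<in> {1..n} \<Longrightarrow> \<forall>j\<in>{1..m i}. \<tau> i j \<in> in_paths K (x i j) (y i j)"
  using \<tau> unfolding in_paths_def by blast

lemma out_last: "i \<in> {1..n} \<Longrightarrow> \<forall>j\<in>{1..m i - 1}. last (\<tau>' i j) = x i (j + 1)"
  using \<tau>' unfolding path_outside_def by blast

lemma traj_sets:
  "\<forall>i\<in>{1..n}. traj_set (exc_set (m i) (x i) (y i) (F i) (H i) half_trajs half_trajs)"
  "\<forall>i\<in>{1..n}. traj_set (exc_set (m i) (x i) (y i) (F i) (H i) (A i) (B i))"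
  by (rule ballI, rule exc_set_traj_set, rule bspec[OF m], assumption, rule in_K, assumption, rule half_trajs_in_half_space, rule half_trajs_in_half_space,
    rule ballI, rule exc_set_traj_set, rule bspec[OF m], assumption, rule in_K, assumption,
    rule conjunct1[OF bspec[OF AB]], assumption, rule conjunct2[OF bspec[OF AB]], assumption)

lemma prob_EAB: "prob EAB = const * (\<Prod>i=1..n. kAB i / cap K)"
  unfolding E_AB_eq by (rule prob_traj_event_0[OF n U]) (unfold AB_set_def, rule traj_sets(1))

lemma prob_Ein: "prob Ein = const * (\<Prod>i=1..n. kin i / cap K)"
  unfolding E_in_eq by (rule prob_traj_event_0[OF n U]) (rule traj_sets(1))

lemma prob_Eout: "prob Eout = const * (\<Prod>i=1..n. kout i / cap K)"
  unfolding E_out_eq by (rule prob_traj_event_0[OF n U]) (rule traj_sets(2))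

lemma prob_Eio: "prob (Ein \<inter> Eout) = const * (\<Prod>i=1..n. kio i / cap K)"
  unfolding E_in_out_eq by (rule prob_traj_event_0[OF n U]) (rule traj_sets(2))

lemma EAB_events: "EAB \<in> events"
  unfolding E_AB_eq AB_set_def 
  by (rule traj_event_events) (rule conjunct1[OF bspec[OF U]], assumption, rule bspec[OF traj_sets(1)], assumption)

lemma EAB_sub: "EAB \<subseteq> space P" and Ein_sub: "Ein \<subseteq> EAB" and Eout_sub: "Eout \<subseteq> EAB"
  unfolding E_in_def E_out_def E_AB_def by blast+

lemma kappa_prods: "(\<Prod>i=1..n. kio i / cap K) * (\<Prod>i=1..n. kAB i / cap K) = (\<Prod>i=1..n. kin i / cap K) * (\<Prod>i=1..n. kout i / cap K)"
proof -
  have "kio i / cap K * (kAB i / cap K) = kin i / cap K * (kout i / cap K)" if i: "i \<in> {1..n}" for i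
  proof -
    have "kio i * kAB i = kin i * kout i"
      by (rule kappa_product[OF bspec[OF m i] in_K[OF i] conjunct1[OF bspec[OF AB i]] conjunct2[OF bspec[OF AB i]]])
    then show ?thesis by (simp only: times_divide_times_eq)
  qed
  then show ?thesis unfolding prod.distrib[symmetric] by (rule prod.cong[OF refl])
qed

text \<open>Cleared of denominators this is the exchange identity for the masses. If the end-point
  event is null, the left side is 0 by monotonicity and the right side contains the factor
  0.\<close>

lemma product_formula:
  "prob (Ein \<inter> Eout) = prob EAB * \<P>(\<xi> in P. \<xi> \<in> Ein \<bar> \<xi> \<in> EAB) * \<P>(\<xi> in P. \<xi> \<in> Eout \<bar> \<xi> \<in> EAB)"
proof (cases "prob EAB = 0")
  case True
  have "prob (Ein \<inter> Eout) \<le> prob EAB" using Ein_sub EAB_events by (intro finite_measure_mono) blast+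
  then have "prob (Ein \<inter> Eout) = 0" using True measure_nonneg[of P "Ein \<inter> Eout"] by linarith
  then show ?thesis using True by simp
next
  case False
  have alg: "a = b * (c / b) * (d / b)" if "a * b = c * d" "b \<noteq> 0" for a b c d :: real
    using that by (simp add: field_simps)
  have "prob (Ein \<inter> Eout) * prob EAB = prob Ein * prob Eout"
  proof -
    have mult4: "(p * a) * (p * b) = (p * c) * (p * d)" if "a * b = c * d" for p a b c d :: real
    proof -
      have "(p * a) * (p * b) = (p * p) * (a * b)" by (simp only: mult_ac)
      also have "\<dots> = (p * c) * (p * d)" unfolding that by (simp only: mult_ac)
      finally show ?thesis .
    qed
    show ?thesis unfolding prob_Eio prob_EAB prob_Ein prob_Eout
      by (rule mult4[OF kappa_prods])
  qed
  then show ?thesis unfolding cond_prob_subset[OF Ein_sub EAB_sub] cond_prob_subset[OF Eout_sub EAB_sub]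
    using False by (rule alg)
qed

lemma prob_EAB_formula:
  "prob EAB = const * (\<Prod>i=1..n. norm_eq_measure K (x i 1) * measure (srw (x i 1)) {f \<in> half_trajs. M_count K f = m i \<and>
    (\<forall>j\<in>{1..m i}. f (A_time K f j) = x i j \<and> f (B_time K f j) = y i j)})"
proof -
  have "kAB i / cap K = norm_eq_measure K (x i 1) * measure (srw (x i 1)) {f \<in> half_trajs. M_count K f = m i \<and>
    (\<forall>j\<in>{1..m i}. f (A_time K f j) = x i j \<and> f (B_time K f j) = y i j)}" if i: "i \<in> {1..n}" for i
    unfolding srw_ends[OF bspec[OF m i] in_K[OF i], symmetric] norm_eq_measure_def by (rule times_divide_eq_left[symmetric])
  then have "(\<Prod>i=1..n. kAB i / cap K) = (\<Prod>i=1..n. norm_eq_measure K (x i 1) * measure (srw (x i 1)) {f \<in> half_trajs. M_count K f = m i \<and>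
    (\<forall>j\<in>{1..m i}. f (A_time K f j) = x i j \<and> f (B_time K f j) = y i j)})" by (rule prod.cong[OF refl])
  then show ?thesis unfolding prob_EAB by (rule arg_cong)
qed

text \<open>Positive probability forces every \<open>kAB i\<close> and the capacity to be nonzero,
  so the common constants cancel and the quotient may be taken trajectory by trajectory.\<close>

lemma ratio_prod:
  assumes pos: "prob EAB > 0" and k: "\<And>i. i \<in> {1..n} \<Longrightarrow> kAB i \<noteq> 0 \<Longrightarrow> k i / kAB i = r i"
  shows "(const * (\<Prod>i=1..n. k i / cap K)) / prob EAB = (\<Prod>i=1..n. r i)"
proof -
  have nz: "const * (\<Prod>i=1..n. kAB i / cap K) \<noteq> 0" using pos unfolding prob_EAB by (rule less_imp_neq[symmetric])
  then have c: "const \<noteq> 0" and P: "(\<Prod>i=1..n. kAB i / cap K) \<noteq> 0" 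
  proof -
    show "const \<noteq> 0" using nz by (rule contrapos_nn) (simp only: mult_zero_left)
    show "(\<Prod>i=1..n. kAB i / cap K) \<noteq> 0" using nz by (rule contrapos_nn) (simp only: mult_zero_right)
  qed
  have alg: "(a / c) / (b / c) = a / b" if "c \<noteq> 0" for a b c :: real using that by simp
  have "(k i / cap K) / (kAB i / cap K) = r i" if i: "i \<in> {1..n}" for i
  proof -
    have q: "kAB i / cap K \<noteq> 0"
    proof
      assume "kAB i / cap K = 0"
      then have "(\<Prod>i=1..n. kAB i / cap K) = 0" by (intro prod_zero[OF finite_atLeastAtMost] bexI[OF _ i])
      with P show False by (rule notE)
    qed
    have k0: "kAB i \<noteq> 0" using q by (rule contrapos_nn) (simp only: div_0)
    have c0: "cap K \<noteq> 0" using q by (rule contrapos_nn) (simp only: div_by_0)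
    show ?thesis by (rule trans[OF alg[OF c0] k[OF i k0]])
  qed
  then have "(\<Prod>i=1..n. (k i / cap K) / (kAB i / cap K)) = (\<Prod>i=1..n. r i)" by (rule prod.cong[OF refl])
  then show ?thesis unfolding prob_EAB nonzero_mult_divide_mult_cancel_left[OF c] prod_dividef[symmetric] .
qed

lemma cond_Ein:
  assumes "prob EAB > 0"
  shows "\<P>(\<xi> in P. \<xi> \<in> Ein \<bar> \<xi> \<in> EAB) = (\<Prod>i=1..n. \<Prod>j=1..m i. measure (srw (x i j)) {f \<in> half_trajs. map f [0..<the (exit_time K f)] = \<tau> i j} /
      measure (srw (x i j)) {f \<in> half_trajs. f (the (exit_time K f) - 1) = y i j})"
  unfolding cond_prob_subset[OF Ein_sub EAB_sub] prob_Ein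
proof (rule ratio_prod[OF assms])
  fix i assume i: "i \<in> {1..n}" and nz: "kAB i \<noteq> 0"
  note R = kappa_in_paths_ratio[OF bspec[OF m i] in_K[OF i] nz bnd[OF i] in_path[OF i]]
  show "kin i / kAB i = (\<Prod>j=1..m i. measure (srw (x i j)) {f \<in> half_trajs. map f [0..<the (exit_time K f)] = \<tau> i j} /
      measure (srw (x i j)) {f \<in> half_trajs. f (the (exit_time K f) - 1) = y i j})" by (rule R)
qed

lemma cond_Eout:
  assumes "prob EAB > 0"
  shows "\<P>(\<xi> in P. \<xi> \<in> Eout \<bar> \<xi> \<in> EAB) = (\<Prod>i=1..n. srw_avoid K (x i 1) (A i) * srw_avoid K (y i (m i)) (B i) *
    (\<Prod>j=1..m i - 1. measure (srw (y i j)) {f \<in> half_trajs. return_time K f \<noteq> None \<and> f 1 \<notin> K \<and> map f [0..<Suc (the (return_time K f))] = \<tau>' i j} /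
      measure (srw (y i j)) {f \<in> half_trajs. return_time K f \<noteq> None \<and> f 1 \<notin> K \<and> f (the (return_time K f)) = x i (j + 1)}))"
  unfolding cond_prob_subset[OF Eout_sub EAB_sub] prob_Eout
proof (rule ratio_prod[OF assms])
  fix i assume i: "i \<in> {1..n}" and nz: "kAB i \<noteq> 0"
  note R = kappa_out_paths_ratio[OF bspec[OF m i] in_K[OF i] nz conjunct1[OF bspec[OF AB i]] conjunct2[OF bspec[OF AB i]] out_last[OF i]]
  show "kout i / kAB i = srw_avoid K (x i 1) (A i) * srw_avoid K (y i (m i)) (B i) * (\<Prod>j=1..m i - 1. measure (srw (y i j)) {f \<in> half_trajs. return_time K f \<noteq> None \<and> f 1 \<notin> K \<and> map f [0..<Suc (the (return_time K f))] = \<tau>' i j} /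
      measure (srw (y i j)) {f \<in> half_trajs. return_time K f \<noteq> None \<and> f 1 \<notin> K \<and> f (the (return_time K f)) = x i (j + 1)})" by (rule R)
qed

lemma cond_Eout_not_adj:
  assumes "prob EAB > 0" "\<forall>i\<in>{1..n}. \<forall>j\<in>{1..m i - 1}. \<not> adj (y i j) (x i (j + 1))"
  shows "\<P>(\<xi> in P. \<xi> \<in> Eout \<bar> \<xi> \<in> EAB) = (\<Prod>i=1..n. srw_avoid K (x i 1) (A i) * srw_avoid K (y i (m i)) (B i) *
    (\<Prod>j=1..m i - 1. measure (srw (y i j)) {f \<in> half_trajs. return_time K f \<noteq> None \<and> map f [0..<Suc (the (return_time K f))] = \<tau>' i j} /
      measure (srw (y i j)) {f \<in> half_trajs. return_time K f \<noteq> None \<and> f (the (return_time K f)) = x i (j + 1)}))"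
  unfolding cond_Eout[OF assms(1)]
proof (rule prod.cong[OF refl])
  fix i assume i: "i \<in> {1..n}"
  note R = out_ratio_not_adj[OF bspec[OF assms(2) i] out_last[OF i]]
  show "srw_avoid K (x i 1) (A i) * srw_avoid K (y i (m i)) (B i) * (\<Prod>j=1..m i - 1. measure (srw (y i j)) {f \<in> half_trajs. return_time K f \<noteq> None \<and> f 1 \<notin> K \<and> map f [0..<Suc (the (return_time K f))] = \<tau>' i j} /
      measure (srw (y i j)) {f \<in> half_trajs. return_time K f \<noteq> None \<and> f 1 \<notin> K \<and> f (the (return_time K f)) = x i (j + 1)}) =
    srw_avoid K (x i 1) (A i) * srw_avoid K (y i (m i)) (B i) * (\<Prod>j=1..m i - 1. measure (srw (y i j)) {f \<in> half_trajs. return_time K f \<noteq> None \<and> map f [0..<Suc (the (return_time K f))] = \<tau>' i j} /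
      measure (srw (y i j)) {f \<in> half_trajs. return_time K f \<noteq> None \<and> f (the (return_time K f)) = x i (j + 1)})"
    unfolding R by (rule refl)
qed

end

end

theorem lemma4p4:
  fixes K :: "('d::finite) site set"
    and u :: real
    and \<nu> :: "(int \<Rightarrow> 'd site) set measure"
    and P :: "'o measure"
    and \<omega> :: "'o \<Rightarrow> 'd config"
  assumes "CARD('d) \<ge> 3"
    and "interlacement_intensity \<nu>"
    and "poisson_point_process P (\<nu> \<Otimes>\<^sub>M restrict_space lborel {0..}) \<omega>"
    and "finite K" and "K \<noteq> {}" and "u > 0"
  shows "cond_indep P (F_in P \<omega> K u) (F_out P \<omega> K u) (F_AB P \<omega> K u) \<and>
   (\<forall>(n::nat) (m :: nat \<Rightarrow> nat) (U :: nat \<Rightarrow> real set)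
      (\<A> :: nat \<Rightarrow> (nat \<Rightarrow> 'd site) set) (\<B> :: nat \<Rightarrow> (nat \<Rightarrow> 'd site) set)
      (x :: nat \<Rightarrow> nat \<Rightarrow> 'd site) (y :: nat \<Rightarrow> nat \<Rightarrow> 'd site)
      (\<tau>in :: nat \<Rightarrow> nat \<Rightarrow> 'd site list) (\<tau>out :: nat \<Rightarrow> nat \<Rightarrow> 'd site list).
      n \<ge> 1 \<and>
      (\<forall>i\<in>{1..n}. m i \<ge> 1 \<and> U i \<in> sets borel \<and> U i \<subseteq> {0..u} \<and>
         \<A> i \<in> sets half_space \<and> \<B> i \<in> sets half_space \<and>
         (\<forall>j\<in>{1..m i}. x i j \<in> int_boundary K \<and> y i j \<in> int_boundary K \<and>
            path_inside K (x i j) (y i j) (\<tau>in i j)) \<and>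
         (\<forall>j\<in>{1..m i - 1}. path_outside K (y i j) (x i (j + 1)) (\<tau>out i j)))
      \<longrightarrow>
      (let EAB = E_AB P \<omega> K u n m U x y;
           Ein = E_in P \<omega> K u n m U x y \<tau>in;
           Eout = E_out P \<omega> K u n m U x y \<tau>out \<A> \<B>
       in
         measure P (Ein \<inter> Eout) =
           measure P EAB * \<P>(\<xi> in P. \<xi> \<in> Ein \<bar> \<xi> \<in> EAB) * \<P>(\<xi> in P. \<xi> \<in> Eout \<bar> \<xi> \<in> EAB) \<and>
         measure P EAB =
           \<P>(\<xi> in P. N_count K u (\<omega> \<xi>) = n) * order_stat_prob n u U *
           (\<Prod>i=1..n. norm_eq_measure K (x i 1) *
              \<P>(w in srw (x i 1). M_count K w = m i \<and>
                 (\<forall>j\<in>{1..m i}. w (A_time K w j) = x i j \<and> w (B_time K w j) = y i j))) \<and>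
         (measure P EAB > 0 \<longrightarrow>
           \<P>(\<xi> in P. \<xi> \<in> Ein \<bar> \<xi> \<in> EAB) =
             (\<Prod>i=1..n. \<Prod>j=1..m i.
                \<P>(w in srw (x i j). map w [0..<the (exit_time K w)] = \<tau>in i j) /
                \<P>(w in srw (x i j). w (the (exit_time K w) - 1) = y i j)) \<and>
           \<P>(\<xi> in P. \<xi> \<in> Eout \<bar> \<xi> \<in> EAB) =
             (\<Prod>i=1..n. srw_avoid K (x i 1) (\<A> i) * srw_avoid K (y i (m i)) (\<B> i) *
                (\<Prod>j=1..m i - 1.
                   \<P>(w in srw (y i j). return_time K w \<noteq> None \<and> w 1 \<notin> K \<and>
                      map w [0..<Suc (the (return_time K w))] = \<tau>out i j) /
                   \<P>(w in srw (y i j). return_time K w \<noteq> None \<and> w 1 \<notin> K \<and>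
                      w (the (return_time K w)) = x i (j + 1)))) \<and>
           ((\<forall>i\<in>{1..n}. \<forall>j\<in>{1..m i - 1}. \<not> adj (y i j) (x i (j + 1))) \<longrightarrow>
            \<P>(\<xi> in P. \<xi> \<in> Eout \<bar> \<xi> \<in> EAB) =
             (\<Prod>i=1..n. srw_avoid K (x i 1) (\<A> i) * srw_avoid K (y i (m i)) (\<B> i) *
                (\<Prod>j=1..m i - 1.
                   \<P>(w in srw (y i j). return_time K w \<noteq> None \<and>
                      map w [0..<Suc (the (return_time K w))] = \<tau>out i j) /
                   \<P>(w in srw (y i j). return_time K w \<noteq> None \<and>
                      w (the (return_time K w)) = x i (j + 1))))))))"
  proof -
  interpret interlacement_process K u \<nu> P \<omega>
    using assms(2,3,4,6) by (rule interlacement_process.intro)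
  show ?thesis
  proof (rule conjI, rule cond_indep_in_out, intro allI impI, elim conjE, unfold Let_def, goal_cases)
    case (1 n m U \<A> \<B> x y \<tau>in \<tau>out)
    have U: "\<forall>i\<in>{1..n}. U i \<in> sets borel \<and> U i \<subseteq> {0..u}"
      and AB: "\<forall>i\<in>{1..n}. \<A> i \<in> sets half_space \<and> \<B> i \<in> sets half_space"
      and m: "\<forall>i\<in>{1..n}. 1 \<le> m i"
      and xy: "\<forall>i\<in>{1..n}. \<forall>j\<in>{1..m i}. x i j \<in> int_boundary K \<and> y i j \<in> int_boundary K"
      and tin: "\<forall>i\<in>{1..n}. \<forall>j\<in>{1..m i}. path_inside K (x i j) (y i j) (\<tau>in i j)"
      and tout: "\<forall>i\<in>{1..n}. \<forall>j\<in>{1..m i - 1}. path_outside K (y i j) (x i (j + 1)) (\<tau>out i j)"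
      using 1(2) by blast+
    note hyps = 1(1) U AB m xy tin tout
    show ?case unfolding space_srw
      by (intro conjI impI product_formula[OF hyps] prob_EAB_formula[OF hyps] cond_Ein[OF hyps] cond_Eout[OF hyps]
        cond_Eout_not_adj[OF hyps])
  qed
qed

end
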